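(* Let $I$ be a set of indices and let $A=(A_{ij})_{i,j\in I}$ be a matrix with entries in $\{0,1\}$ and no identically zero rows. Let $\mathcal{G}=\{T_i\}_{i\in I}\,\dot\cup\,\{\mathbf{1}\}$. Let $\mathcal{R}_N$ be the set of norm relations expressing that $T_i$ is a partial isometry ($T_iT_i^*T_i=T_i$) for each $i\in I$ and that $\mathbf{1}$ is a unit (i.e. $\mathbf{1}=\mathbf{1}^*=\mathbf{1}^2$ and $\mathbf{1}T_i=T_i=T_i\mathbf{1}$ for all $i\in I$). Let $\mathcal{R}_S$ consist of the SOT relations $$\text{(CK1)}\quad \sum_{i\in I}T_iT_i^*=\mathbf{1};\qquad \text{(CK2)}\quad \text{for each } i\in I,\ \ T_i^*T_i=\sum_{j\in I}A_{ij}T_jT_j^*,$$ meaning respectively the net $\left(\mathbf{1}-\sum_{i\in X}T_iT_i^*\right)_{X}$ and, for each $i\in I$, the net $\left(T_i^*T_i-\sum_{j\in X}A_{ij}T_jT_j^*\right)_{X}$, where $X$ ranges over the finite subsets of $I$ directed by inclusion. Then the generating triple $(\mathcal{G},\mathcal{R}_N,\mathcal{R}_S)$ is admissible, and there is a unital *-isomorphism $\varphi:\widetilde{\mathcal{O}}_A\to C^*(\mathcal{G},\mathcal{R}_N,\mathcal{R}_S)$ such that $\varphi(S_i)=T_i$ for all $i\in I$ (where $T_i$ also denotes its image in $C^*(\mathcal{G},\mathcal{R}_N,\mathcal{R}_S)$).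
   Context: The unital Exel-Laca algebra $\widetilde{\mathcal{O}}_A$ is the universal C*-algebra generated by a family of partial isometries $\{S_i\}_{i\in I}$ and a unit $1$ satisfying: (EL1) $S_i^*S_iS_j^*S_j=S_j^*S_jS_i^*S_i$ for all $i,j\in I$; (EL2) $S_iS_i^*S_jS_j^*=0$ whenever $i\ne j$; (EL3) $S_i^*S_iS_jS_j^*=A_{ij}S_jS_j^*$ for all $i,j\in I$; (EL4) for all finite $X,Y\subseteq I$ such that $A(X,Y,j):=\prod_{x\in X}A_{xj}\prod_{y\in Y}(1-A_{yj})$ is zero for all but a finite number of $j$'s, $\prod_{x\in X}S_x^*S_x\prod_{y\in Y}(1-S_y^*S_y)=\sum_{j\in I}A(X,Y,j)S_jS_j^*$. Let $\mathcal{G}$ be a non-empty set and $\mathcal{G}^*=\{g^*: g\in\mathcal{G}\}$ a disjoint copy of it. $\mathcal{B}_{\mathcal{G}}=\mathbb{C}\langle\mathcal{G}\cup\mathcal{G}^*\rangle$ is the free (non-unital) complex *-algebra generated by $\mathcal{G}$, i.e. the free algebra on $\mathcal{G}\cup\mathcal{G}^*$ with its standard involution; any assignment of elements of a *-algebra to the elements of $\mathcal{G}$ extends uniquely to a *-homomorphism from $\mathcal{B}_{\mathcal{G}}$. A norm relation is a pair $(x,\eta)\in\mathcal{B}_{\mathcal{G}}\times\mathbb{R}_+$ (with $\mathbb{R}_+=[0,\infty)$). An equality $x=y$ with $x,y\in\mathcal{B}_{\mathcal{G}}$ is regarded as the norm relation $(x-y,0)$. A SOT relation is a net $(x_i)_{i\in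 I}$ in $\mathcal{B}_{\mathcal{G}}$. A generating triple is $(\mathcal{G},\mathcal{R}_N,\mathcal{R}_S)$ where $\mathcal{R}_N$ is a set of norm relations and $\mathcal{R}_S$ is a set of SOT relations. A representation of the triple on a Hilbert space $H$ is a *-homomorphism $\rho:\mathcal{B}_{\mathcal{G}}\to B(H)$ such that $\|\rho(x)\|\le\eta$ for all $(x,\eta)\in\mathcal{R}_N$ and $\lim_i\rho(x_i)=0$ in the strong operator topology for all $(x_i)_{i\in I}\in\mathcal{R}_S$. The triple is admissible if for every family $\{\rho_\alpha:\mathcal{B}_{\mathcal{G}}\to B(H_\alpha)\}_\alpha$ of representations of the triple, the map $\bigoplus_\alpha\rho_\alpha:\mathcal{B}_{\mathcal{G}}\to B(\bigoplus_\alpha H_\alpha)$, $x\mapsto\bigoplus_\alpha\rho_\alpha(x)$, is a well-defined representation of the triple. For an admissible triple, set $|||x|||=\sup\{\|\rho(x)\| : \rho \text{ a representation of the triple}\}$ for $x\in\mathcal{B}_{\mathcal{G}}$ (this is finite and is a C*-seminorm), and let $\mathcal{N}=\{x\in\mathcal{B}_{\mathcal{G}} : |||x|||=0\}$, a self-adjoint ideal. $C^*(\mathcal{G},\mathcal{R}_N,\mathcal{R}_S)$ is the completion of $\mathcal{B}_{\mathcal{G}}/\mathcal{N}$ in the norm $\|x+\mathcal{N}\|=\inf_{y\in\mathcal{N}}|||x+y|||$. *)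

theory Defs
  imports "HOL-Analysis.Analysis" "HOL-Library.FuncSet" "HOL-Library.Poly_Mapping"
begin

text \<open>
  The statement quantifies over Hilbert spaces and C*-algebras, so both are carrier-based records
  here, not type classes. HOL cannot quantify over types inside a formula: a definition that speaks
  of all Hilbert spaces or all C*-algebras takes an argument of type \<open>'u itself\<close> and lets the
  carriers range over all subsets of \<open>'u\<close>. Statements using such a definition have to require that
  \<open>'u\<close> is large enough. For generators in \<open>'g\<close> it suffices that \<open>'u\<close> has room for all sequences in
  the free *-algebra: a Hilbert space with a cyclic vector for a representation, and a C*-algebra
  topologically generated by the image of the free *-algebra, consist of limits of such sequences.
  So all of them occur, up to isomorphism, with carrier in \<open>'u\<close>.
\<close>

section \<open>Complex vector spaces and Hilbert spaces\<close>

record 'a cvs =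
  vcarrier :: "'a set"
  vzero :: 'a
  vadd :: "'a \<Rightarrow> 'a \<Rightarrow> 'a"
  vscale :: "complex \<Rightarrow> 'a \<Rightarrow> 'a"

record 'a hilbert = "'a cvs" +
  hinner :: "'a \<Rightarrow> 'a \<Rightarrow> complex"

definition vminus :: "('a, 'm) cvs_scheme \<Rightarrow> 'a \<Rightarrow> 'a \<Rightarrow> 'a" where
  "vminus V x y = vadd V x (vscale V (-1) y)"

definition vcauchy :: "('a, 'm) cvs_scheme \<Rightarrow> ('a \<Rightarrow> real) \<Rightarrow> (nat \<Rightarrow> 'a) \<Rightarrow> bool" where
  "vcauchy V nrm x \<longleftrightarrow> (\<forall>n. x n \<in> vcarrier V) \<and>
     (\<forall>e>0. \<exists>N. \<forall>m\<ge>N. \<forall>n\<ge>N. nrm (vminus V (x m) (x n)) < e)"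

definition vconverges :: "('a, 'm) cvs_scheme \<Rightarrow> ('a \<Rightarrow> real) \<Rightarrow> (nat \<Rightarrow> 'a) \<Rightarrow> 'a \<Rightarrow> bool" where
  "vconverges V nrm x l \<longleftrightarrow> (\<lambda>n. nrm (vminus V (x n) l)) \<longlonglongrightarrow> 0"

definition vcomplete :: "('a, 'm) cvs_scheme \<Rightarrow> ('a \<Rightarrow> real) \<Rightarrow> bool" where
  "vcomplete V nrm \<longleftrightarrow> (\<forall>x. vcauchy V nrm x \<longrightarrow> (\<exists>l\<in>vcarrier V. vconverges V nrm x l))"

locale complex_vector_space =
  fixes V :: "('a, 'm) cvs_scheme"
  assumes zero_closed: "vzero V \<in> vcarrier V"
    and add_closed: "\<lbrakk>x \<in> vcarrier V; y \<in> vcarrier V\<rbrakk> \<Longrightarrow> vadd V x y \<in> vcarrier V"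
    and scale_closed: "x \<in> vcarrier V \<Longrightarrow> vscale V c x \<in> vcarrier V"
    and add_assoc: "\<lbrakk>x \<in> vcarrier V; y \<in> vcarrier V; z \<in> vcarrier V\<rbrakk>
          \<Longrightarrow> vadd V (vadd V x y) z = vadd V x (vadd V y z)"
    and add_commute: "\<lbrakk>x \<in> vcarrier V; y \<in> vcarrier V\<rbrakk> \<Longrightarrow> vadd V x y = vadd V y x"
    and add_zero: "x \<in> vcarrier V \<Longrightarrow> vadd V x (vzero V) = x"
    and add_inverse: "x \<in> vcarrier V \<Longrightarrow> vadd V x (vscale V (-1) x) = vzero V"
    and scale_add_right: "\<lbrakk>x \<in> vcarrier V; y \<in> vcarrier V\<rbrakk>
          \<Longrightarrow> vscale V c (vadd V x y) = vadd V (vscale V c x) (vscale V c y)"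
    and scale_add_left: "x \<in> vcarrier V
          \<Longrightarrow> vscale V (c + d) x = vadd V (vscale V c x) (vscale V d x)"
    and scale_scale: "x \<in> vcarrier V \<Longrightarrow> vscale V c (vscale V d x) = vscale V (c * d) x"
    and scale_one: "x \<in> vcarrier V \<Longrightarrow> vscale V 1 x = x"

definition hnorm :: "('h, 'm) hilbert_scheme \<Rightarrow> 'h \<Rightarrow> real" where
  "hnorm H x = sqrt (Re (hinner H x x))"

text \<open>Inner products are linear in the first argument.\<close>

locale hilbert_space = complex_vector_space H for H :: "('h, 'm) hilbert_scheme" +
  assumes inner_add_left: "\<lbrakk>x \<in> vcarrier H; y \<in> vcarrier H; z \<in> vcarrier H\<rbrakk>
          \<Longrightarrow> hinner H (vadd H x y) z = hinner H x z + hinner H y z"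
    and inner_scale_left: "\<lbrakk>x \<in> vcarrier H; y \<in> vcarrier H\<rbrakk>
          \<Longrightarrow> hinner H (vscale H c x) y = c * hinner H x y"
    and inner_commute: "\<lbrakk>x \<in> vcarrier H; y \<in> vcarrier H\<rbrakk>
          \<Longrightarrow> hinner H x y = cnj (hinner H y x)"
    and inner_nonneg: "x \<in> vcarrier H \<Longrightarrow> 0 \<le> Re (hinner H x x)"
    and inner_definite: "\<lbrakk>x \<in> vcarrier H; hinner H x x = 0\<rbrakk> \<Longrightarrow> x = vzero H"
    and hilbert_complete: "vcomplete H (hnorm H)"


section \<open>*-algebras and C*-algebras (not necessarily unital)\<close>

record 'a star_alg = "'a cvs" +
  amult :: "'a \<Rightarrow> 'a \<Rightarrow> 'a"
  astar :: "'a \<Rightarrow> 'a"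

record 'a nstar_alg = "'a star_alg" +
  anorm :: "'a \<Rightarrow> real"

locale star_algebra = complex_vector_space A for A :: "('a, 'm) star_alg_scheme" +
  assumes mult_closed: "\<lbrakk>x \<in> vcarrier A; y \<in> vcarrier A\<rbrakk> \<Longrightarrow> amult A x y \<in> vcarrier A"
    and star_closed: "x \<in> vcarrier A \<Longrightarrow> astar A x \<in> vcarrier A"
    and mult_assoc: "\<lbrakk>x \<in> vcarrier A; y \<in> vcarrier A; z \<in> vcarrier A\<rbrakk>
          \<Longrightarrow> amult A (amult A x y) z = amult A x (amult A y z)"
    and mult_add_right: "\<lbrakk>x \<in> vcarrier A; y \<in> vcarrier A; z \<in> vcarrier A\<rbrakk>
          \<Longrightarrow> amult A x (vadd A y z) = vadd A (amult A x y) (amult A x z)"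
    and mult_add_left: "\<lbrakk>x \<in> vcarrier A; y \<in> vcarrier A; z \<in> vcarrier A\<rbrakk>
          \<Longrightarrow> amult A (vadd A x y) z = vadd A (amult A x z) (amult A y z)"
    and mult_scale_left: "\<lbrakk>x \<in> vcarrier A; y \<in> vcarrier A\<rbrakk>
          \<Longrightarrow> amult A (vscale A c x) y = vscale A c (amult A x y)"
    and mult_scale_right: "\<lbrakk>x \<in> vcarrier A; y \<in> vcarrier A\<rbrakk>
          \<Longrightarrow> amult A x (vscale A c y) = vscale A c (amult A x y)"
    and star_star: "x \<in> vcarrier A \<Longrightarrow> astar A (astar A x) = x"
    and star_add: "\<lbrakk>x \<in> vcarrier A; y \<in> vcarrier A\<rbrakk>
          \<Longrightarrow> astar A (vadd A x y) = vadd A (astar A x) (astar A y)"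
    and star_scale: "x \<in> vcarrier A \<Longrightarrow> astar A (vscale A c x) = vscale A (cnj c) (astar A x)"
    and star_mult: "\<lbrakk>x \<in> vcarrier A; y \<in> vcarrier A\<rbrakk>
          \<Longrightarrow> astar A (amult A x y) = amult A (astar A y) (astar A x)"

locale cstar_algebra = star_algebra A for A :: "('a, 'm) nstar_alg_scheme" +
  assumes norm_nonneg: "x \<in> vcarrier A \<Longrightarrow> 0 \<le> anorm A x"
    and norm_definite: "\<lbrakk>x \<in> vcarrier A; anorm A x = 0\<rbrakk> \<Longrightarrow> x = vzero A"
    and norm_scale: "x \<in> vcarrier A \<Longrightarrow> anorm A (vscale A c x) = cmod c * anorm A x"
    and norm_triangle: "\<lbrakk>x \<in> vcarrier A; y \<in> vcarrier A\<rbrakk>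
          \<Longrightarrow> anorm A (vadd A x y) \<le> anorm A x + anorm A y"
    and norm_mult: "\<lbrakk>x \<in> vcarrier A; y \<in> vcarrier A\<rbrakk>
          \<Longrightarrow> anorm A (amult A x y) \<le> anorm A x * anorm A y"
    and cstar_identity: "x \<in> vcarrier A \<Longrightarrow> anorm A (amult A (astar A x) x) = (anorm A x)\<^sup>2"
    and norm_complete: "vcomplete A (anorm A)"

definition is_unit :: "('a, 'm) star_alg_scheme \<Rightarrow> 'a \<Rightarrow> bool" where
  "is_unit A e \<longleftrightarrow> e \<in> vcarrier A \<and> (\<forall>x\<in>vcarrier A. amult A e x = x \<and> amult A x e = x)"

definition aunit :: "('a, 'm) star_alg_scheme \<Rightarrow> 'a" where
  "aunit A = (THE e. is_unit A e)"

definition unital_cstar_algebra :: "('a, 'm) nstar_alg_scheme \<Rightarrow> bool" where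
  "unital_cstar_algebra A \<longleftrightarrow> cstar_algebra A \<and> (\<exists>e. is_unit A e)"

definition star_hom ::
    "('a, 'm) star_alg_scheme \<Rightarrow> ('b, 'n) star_alg_scheme \<Rightarrow> ('a \<Rightarrow> 'b) \<Rightarrow> bool" where
  "star_hom A B f \<longleftrightarrow>
     f \<in> vcarrier A \<rightarrow> vcarrier B \<and>
     (\<forall>x\<in>vcarrier A. \<forall>y\<in>vcarrier A. f (vadd A x y) = vadd B (f x) (f y)) \<and>
     (\<forall>c. \<forall>x\<in>vcarrier A. f (vscale A c x) = vscale B c (f x)) \<and>
     (\<forall>x\<in>vcarrier A. \<forall>y\<in>vcarrier A. f (amult A x y) = amult B (f x) (f y)) \<and>
     (\<forall>x\<in>vcarrier A. f (astar A x) = astar B (f x))"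

definition unital_star_hom ::
    "('a, 'm) star_alg_scheme \<Rightarrow> ('b, 'n) star_alg_scheme \<Rightarrow> ('a \<Rightarrow> 'b) \<Rightarrow> bool" where
  "unital_star_hom A B f \<longleftrightarrow> star_hom A B f \<and> f (aunit A) = aunit B"

definition unital_star_iso ::
    "('a, 'm) star_alg_scheme \<Rightarrow> ('b, 'n) star_alg_scheme \<Rightarrow> ('a \<Rightarrow> 'b) \<Rightarrow> bool" where
  "unital_star_iso A B f \<longleftrightarrow> unital_star_hom A B f \<and> bij_betw f (vcarrier A) (vcarrier B)"

definition cstar_subalgebra :: "('a, 'm) nstar_alg_scheme \<Rightarrow> 'a set \<Rightarrow> bool" where
  "cstar_subalgebra A C \<longleftrightarrow> C \<subseteq> vcarrier A \<and> vzero A \<in> C \<and>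
     (\<forall>x\<in>C. \<forall>y\<in>C. vadd A x y \<in> C \<and> amult A x y \<in> C) \<and>
     (\<forall>x\<in>C. astar A x \<in> C \<and> (\<forall>c. vscale A c x \<in> C)) \<and>
     (\<forall>x l. (\<forall>n. x n \<in> C) \<and> l \<in> vcarrier A \<and> vconverges A (anorm A) x l \<longrightarrow> l \<in> C)"

definition generates :: "('a, 'm) nstar_alg_scheme \<Rightarrow> 'a set \<Rightarrow> bool" where
  "generates A X \<longleftrightarrow> X \<subseteq> vcarrier A \<and>
     (\<forall>C. cstar_subalgebra A C \<and> X \<subseteq> C \<longrightarrow> C = vcarrier A)"


section \<open>The bounded operators on a Hilbert space\<close>

definition bounded_op :: "('h, 'm) hilbert_scheme \<Rightarrow> ('h \<Rightarrow> 'h) \<Rightarrow> bool" where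
  "bounded_op H T \<longleftrightarrow> T \<in> vcarrier H \<rightarrow> vcarrier H \<and> T \<in> extensional (vcarrier H) \<and>
     (\<forall>x\<in>vcarrier H. \<forall>y\<in>vcarrier H. T (vadd H x y) = vadd H (T x) (T y)) \<and>
     (\<forall>c. \<forall>x\<in>vcarrier H. T (vscale H c x) = vscale H c (T x)) \<and>
     (\<exists>K. \<forall>x\<in>vcarrier H. hnorm H (T x) \<le> K * hnorm H x)"

definition opnorm :: "('h, 'm) hilbert_scheme \<Rightarrow> ('h \<Rightarrow> 'h) \<Rightarrow> real" where
  "opnorm H T = Sup {hnorm H (T x) | x. x \<in> vcarrier H \<and> hnorm H x \<le> 1}"

definition adjoint_op :: "('h, 'm) hilbert_scheme \<Rightarrow> ('h \<Rightarrow> 'h) \<Rightarrow> ('h \<Rightarrow> 'h)" where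
  "adjoint_op H T = (THE T'. bounded_op H T' \<and>
     (\<forall>x\<in>vcarrier H. \<forall>y\<in>vcarrier H. hinner H (T x) y = hinner H x (T' y)))"

definition bop_alg :: "('h, 'm) hilbert_scheme \<Rightarrow> ('h \<Rightarrow> 'h) nstar_alg" where
  "bop_alg H = \<lparr>
     vcarrier = {T. bounded_op H T},
     vzero = (\<lambda>x\<in>vcarrier H. vzero H),
     vadd = (\<lambda>S T. \<lambda>x\<in>vcarrier H. vadd H (S x) (T x)),
     vscale = (\<lambda>c T. \<lambda>x\<in>vcarrier H. vscale H c (T x)),
     amult = compose (vcarrier H),
     astar = adjoint_op H,
     anorm = opnorm H \<rparr>"

text \<open>Hilbert space direct sums over an index set \<open>\<Lambda>\<close>.\<close>

definition hsum :: "'k set \<Rightarrow> ('k \<Rightarrow> 'h hilbert) \<Rightarrow> ('k \<Rightarrow> 'h) hilbert" where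
  "hsum \<Lambda> H = \<lparr>
     vcarrier = {f \<in> \<Pi>\<^sub>E k\<in>\<Lambda>. vcarrier (H k). (\<lambda>k. (hnorm (H k) (f k))\<^sup>2) summable_on \<Lambda>},
     vzero = (\<lambda>k\<in>\<Lambda>. vzero (H k)),
     vadd = (\<lambda>f g. \<lambda>k\<in>\<Lambda>. vadd (H k) (f k) (g k)),
     vscale = (\<lambda>c f. \<lambda>k\<in>\<Lambda>. vscale (H k) c (f k)),
     hinner = (\<lambda>f g. \<Sum>\<^sub>\<infinity>k\<in>\<Lambda>. hinner (H k) (f k) (g k)) \<rparr>"

definition hsum_op :: "'k set \<Rightarrow> ('k \<Rightarrow> 'h hilbert) \<Rightarrow> ('k \<Rightarrow> 'h \<Rightarrow> 'h) \<Rightarrow> (('k \<Rightarrow> 'h) \<Rightarrow> ('k \<Rightarrow> 'h))" where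
  "hsum_op \<Lambda> H T = (\<lambda>f\<in>vcarrier (hsum \<Lambda> H). \<lambda>k\<in>\<Lambda>. T k (f k))"


section \<open>The free *-algebra\<close>

text \<open>
  Letters are \<open>Inl g\<close> (for \<open>g\<close>) and \<open>Inr g\<close> (for the formal adjoint of \<open>g\<close>). Words form a monoid,
  written additively because \<^typ>\<open>'a \<Rightarrow>\<^sub>0 'b\<close> multiplies by convolution over an additive monoid.
\<close>

datatype 'l word = Word (letters: "'l list")

instantiation word :: (type) monoid_add
begin

definition zero_word :: "'a word" where "0 = Word []"

definition plus_word :: "'a word \<Rightarrow> 'a word \<Rightarrow> 'a word" where
  "u + v = Word (letters u @ letters v)"

instance
  by standard (simp_all add: zero_word_def plus_word_def)

end

type_synonym 'g free_alg = "('g + 'g) word \<Rightarrow>\<^sub>0 complex"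

fun letter_star :: "'g + 'g \<Rightarrow> 'g + 'g" where
  "letter_star (Inl g) = Inr g"
| "letter_star (Inr g) = Inl g"

definition word_star :: "('g + 'g) word \<Rightarrow> ('g + 'g) word" where
  "word_star w = Word (rev (map letter_star (letters w)))"

definition fstar :: "'g free_alg \<Rightarrow> 'g free_alg" where
  "fstar x = Poly_Mapping.map cnj (Poly_Mapping.map_key word_star x)"

definition fscale :: "complex \<Rightarrow> 'g free_alg \<Rightarrow> 'g free_alg" where
  "fscale c x = Poly_Mapping.map ((*) c) x"

definition gen :: "'g \<Rightarrow> 'g free_alg" where
  "gen g = Poly_Mapping.single (Word [Inl g]) 1"

lemma word_star_word_star [simp]: "word_star (word_star w) = w"
proof -
  have "letter_star \<circ> letter_star = (id :: 'a + 'a \<Rightarrow> 'a + 'a)"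
    by (rule ext) (case_tac x; simp)
  then show ?thesis
    by (simp add: word_star_def rev_map)
qed

lemma inj_word_star: "inj word_star"
  by (metis injI word_star_word_star)

lemma lookup_fstar: "Poly_Mapping.lookup (fstar x) w = cnj (Poly_Mapping.lookup x (word_star w))"
  by (simp add: fstar_def Poly_Mapping.map.rep_eq Poly_Mapping.map_key.rep_eq inj_word_star when_def)

lemma lookup_fscale: "Poly_Mapping.lookup (fscale c x) w = c * Poly_Mapping.lookup x w"
  by (simp add: fscale_def Poly_Mapping.map.rep_eq when_def)

text \<open>
  The free non-unital *-algebra on a set \<open>G\<close>: the empty word, which is the unit of
  \<^typ>\<open>'g free_alg\<close>, is excluded.
\<close>

definition free_star :: "'g set \<Rightarrow> 'g free_alg star_alg" where
  "free_star G = \<lparr>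
     vcarrier = {x. \<forall>w\<in>Poly_Mapping.keys x. w \<noteq> 0 \<and> set (letters w) \<subseteq> G <+> G},
     vzero = 0, vadd = (+), vscale = fscale, amult = (*), astar = fstar \<rparr>"


section \<open>Generating triples\<close>

text \<open>A net is given by its index set, the order of the index set, and the family of values.\<close>

type_synonym ('k, 'x) net = "'k set \<times> ('k \<Rightarrow> 'k \<Rightarrow> bool) \<times> ('k \<Rightarrow> 'x)"

definition directed :: "'k set \<Rightarrow> ('k \<Rightarrow> 'k \<Rightarrow> bool) \<Rightarrow> bool" where
  "directed D le \<longleftrightarrow> D \<noteq> {} \<and> (\<forall>i\<in>D. le i i) \<and>
     (\<forall>i\<in>D. \<forall>j\<in>D. \<forall>k\<in>D. le i j \<and> le j k \<longrightarrow> le i k) \<and>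
     (\<forall>i\<in>D. \<forall>j\<in>D. \<exists>k\<in>D. le i k \<and> le j k)"

definition generating_triple ::
    "'g set \<Rightarrow> ('g free_alg \<times> real) set \<Rightarrow> ('k, 'g free_alg) net set \<Rightarrow> bool" where
  "generating_triple G RN RS \<longleftrightarrow> G \<noteq> {} \<and>
     (\<forall>(x, \<eta>)\<in>RN. x \<in> vcarrier (free_star G) \<and> 0 \<le> \<eta>) \<and>
     (\<forall>(D, le, x)\<in>RS. directed D le \<and> (\<forall>k\<in>D. x k \<in> vcarrier (free_star G)))"

definition representation ::
    "'g set \<Rightarrow> ('g free_alg \<times> real) set \<Rightarrow> ('k, 'g free_alg) net set
      \<Rightarrow> 'h hilbert \<Rightarrow> ('g free_alg \<Rightarrow> 'h \<Rightarrow> 'h) \<Rightarrow> bool" where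
  "representation G RN RS H \<rho> \<longleftrightarrow> hilbert_space H \<and> star_hom (free_star G) (bop_alg H) \<rho> \<and>
     (\<forall>(x, \<eta>)\<in>RN. opnorm H (\<rho> x) \<le> \<eta>) \<and>
     (\<forall>(D, le, x)\<in>RS. \<forall>\<xi>\<in>vcarrier H. \<forall>e>0. \<exists>d\<in>D. \<forall>k\<in>D. le d k \<longrightarrow> hnorm H (\<rho> (x k) \<xi>) < e)"

text \<open>Families of representations are indexed by arbitrary subsets of \<open>'a\<close>.\<close>

definition admissible ::
    "'a itself \<Rightarrow> 'u itself \<Rightarrow> 'g set \<Rightarrow> ('g free_alg \<times> real) set
      \<Rightarrow> ('k, 'g free_alg) net set \<Rightarrow> bool" where
  "admissible _ _ G RN RS \<longleftrightarrow> generating_triple G RN RS \<and>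
     (\<forall>(\<Lambda> :: 'a set) (H :: 'a \<Rightarrow> 'u hilbert) \<rho>.
        (\<forall>\<alpha>\<in>\<Lambda>. representation G RN RS (H \<alpha>) (\<rho> \<alpha>))
        \<longrightarrow> representation G RN RS (hsum \<Lambda> H) (\<lambda>x. hsum_op \<Lambda> H (\<lambda>\<alpha>. \<rho> \<alpha> x)))"

definition rep_norm ::
    "'u itself \<Rightarrow> 'g set \<Rightarrow> ('g free_alg \<times> real) set \<Rightarrow> ('k, 'g free_alg) net set
      \<Rightarrow> 'g free_alg \<Rightarrow> real" where
  "rep_norm _ G RN RS x =
     Sup {opnorm H (\<rho> x) | (H :: 'u hilbert) \<rho>. representation G RN RS H \<rho>}"

definition free_normed ::
    "'u itself \<Rightarrow> 'g set \<Rightarrow> ('g free_alg \<times> real) set \<Rightarrow> ('k, 'g free_alg) net set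
      \<Rightarrow> 'g free_alg nstar_alg" where
  "free_normed U G RN RS =
     star_alg.extend (free_star G) (nstar_alg.fields (rep_norm U G RN RS))"


section \<open>Quotient by the null space, completion\<close>

text \<open>
  For a seminormed *-algebra \<open>A\<close> with null space \<open>N\<close>, the classes of \<open>null_rel A\<close> are the cosets
  \<open>x + N\<close>, and \<open>separation A\<close> is \<open>A/N\<close> with the quotient seminorm (infimum over the coset).
\<close>

definition null_rel :: "('a, 'm) nstar_alg_scheme \<Rightarrow> ('a \<times> 'a) set" where
  "null_rel A = {(x, y). x \<in> vcarrier A \<and> y \<in> vcarrier A \<and> anorm A (vminus A x y) = 0}"

definition separation :: "('a, 'm) nstar_alg_scheme \<Rightarrow> 'a set nstar_alg" where
  "separation A = (let r = null_rel A in \<lparr>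
     vcarrier = vcarrier A // r,
     vzero = r `` {vzero A},
     vadd = (\<lambda>X Y. \<Union>x\<in>X. \<Union>y\<in>Y. r `` {vadd A x y}),
     vscale = (\<lambda>c X. \<Union>x\<in>X. r `` {vscale A c x}),
     amult = (\<lambda>X Y. \<Union>x\<in>X. \<Union>y\<in>Y. r `` {amult A x y}),
     astar = (\<lambda>X. \<Union>x\<in>X. r `` {astar A x}),
     anorm = (\<lambda>X. Inf (anorm A ` X)) \<rparr>)"

definition cauchy_alg :: "('a, 'm) nstar_alg_scheme \<Rightarrow> (nat \<Rightarrow> 'a) nstar_alg" where
  "cauchy_alg A = \<lparr>
     vcarrier = {x. vcauchy A (anorm A) x},
     vzero = (\<lambda>n. vzero A),
     vadd = (\<lambda>x y n. vadd A (x n) (y n)),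
     vscale = (\<lambda>c x n. vscale A c (x n)),
     amult = (\<lambda>x y n. amult A (x n) (y n)),
     astar = (\<lambda>x n. astar A (x n)),
     anorm = (\<lambda>x. lim (\<lambda>n. anorm A (x n))) \<rparr>"

definition completion :: "('a, 'm) nstar_alg_scheme \<Rightarrow> (nat \<Rightarrow> 'a) set nstar_alg" where
  "completion A = separation (cauchy_alg A)"

type_synonym 'g gen_cstar_elem = "(nat \<Rightarrow> 'g free_alg set) set"

definition gen_cstar ::
    "'u itself \<Rightarrow> 'g set \<Rightarrow> ('g free_alg \<times> real) set \<Rightarrow> ('k, 'g free_alg) net set
      \<Rightarrow> 'g gen_cstar_elem nstar_alg" where
  "gen_cstar U G RN RS = completion (separation (free_normed U G RN RS))"

definition gen_embed ::
    "'u itself \<Rightarrow> 'g set \<Rightarrow> ('g free_alg \<times> real) set \<Rightarrow> ('k, 'g free_alg) net set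
      \<Rightarrow> 'g free_alg \<Rightarrow> 'g gen_cstar_elem" where
  "gen_embed U G RN RS x =
     null_rel (cauchy_alg (separation (free_normed U G RN RS)))
       `` {\<lambda>n. null_rel (free_normed U G RN RS) `` {x}}"


section \<open>The unital Exel-Laca algebra\<close>

definition init_proj :: "('a, 'm) star_alg_scheme \<Rightarrow> 'a \<Rightarrow> 'a" where
  "init_proj B s = amult B (astar B s) s"

definition range_proj :: "('a, 'm) star_alg_scheme \<Rightarrow> 'a \<Rightarrow> 'a" where
  "range_proj B s = amult B s (astar B s)"

definition EL_coeff :: "('i \<Rightarrow> 'i \<Rightarrow> complex) \<Rightarrow> 'i set \<Rightarrow> 'i set \<Rightarrow> 'i \<Rightarrow> complex" where
  "EL_coeff A X Y j = (\<Prod>x\<in>X. A x j) * (\<Prod>y\<in>Y. 1 - A y j)"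

text \<open>
  In the last condition, finite products and sums in \<open>B\<close> are taken along duplicate-free lists that
  enumerate the finite index sets; the order does not matter because initial projections commute.
  Indices \<open>j\<close> with zero coefficient are left out of the sum.
\<close>

definition EL_family ::
    "'i set \<Rightarrow> ('i \<Rightarrow> 'i \<Rightarrow> complex) \<Rightarrow> ('b, 'm) nstar_alg_scheme \<Rightarrow> ('i \<Rightarrow> 'b) \<Rightarrow> bool" where
  "EL_family I A B S \<longleftrightarrow>
     (\<forall>i\<in>I. S i \<in> vcarrier B \<and> amult B (amult B (S i) (astar B (S i))) (S i) = S i) \<and>
     (\<forall>i\<in>I. \<forall>j\<in>I. amult B (init_proj B (S i)) (init_proj B (S j))
                  = amult B (init_proj B (S j)) (init_proj B (S i))) \<and>
     (\<forall>i\<in>I. \<forall>j\<in>I. i \<noteq> j \<longrightarrow> amult B (range_proj B (S i)) (range_proj B (S j)) = vzero B) \<and>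
     (\<forall>i\<in>I. \<forall>j\<in>I. amult B (init_proj B (S i)) (range_proj B (S j))
                  = vscale B (A i j) (range_proj B (S j))) \<and>
     (\<forall>xs ys js. distinct xs \<and> distinct ys \<and> distinct js \<and> set xs \<subseteq> I \<and> set ys \<subseteq> I \<and>
          set js = {j\<in>I. EL_coeff A (set xs) (set ys) j \<noteq> 0} \<longrightarrow>
        foldr (amult B)
          (map (\<lambda>x. init_proj B (S x)) xs @ map (\<lambda>y. vminus B (aunit B) (init_proj B (S y))) ys)
          (aunit B)
        = foldr (vadd B)
            (map (\<lambda>j. vscale B (EL_coeff A (set xs) (set ys) j) (range_proj B (S j))) js)
            (vzero B))"

text \<open>
  The universal property, tested against the unital C*-algebras with carrier in \<open>'u\<close>. The
  homomorphism is unique because \<open>OA\<close> is generated by the family and the unit.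
\<close>

definition universal_exel_laca ::
    "'u itself \<Rightarrow> 'i set \<Rightarrow> ('i \<Rightarrow> 'i \<Rightarrow> complex) \<Rightarrow> 'o nstar_alg \<Rightarrow> ('i \<Rightarrow> 'o) \<Rightarrow> bool" where
  "universal_exel_laca _ I A OA S \<longleftrightarrow>
     unital_cstar_algebra OA \<and> EL_family I A OA S \<and> generates OA (insert (aunit OA) (S ` I)) \<and>
     (\<forall>(B :: 'u nstar_alg) R. unital_cstar_algebra B \<and> EL_family I A B R \<longrightarrow>
        (\<exists>f. unital_star_hom OA B f \<and> (\<forall>i\<in>I. f (S i) = R i)))"


section \<open>The infinite Cuntz-Krieger relations\<close>

datatype 'i ck_gen = T 'i | One

definition ck_gens :: "'i set \<Rightarrow> 'i ck_gen set" where
  "ck_gens I = T ` I \<union> {One}"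

definition eq_rel :: "'g free_alg \<Rightarrow> 'g free_alg \<Rightarrow> 'g free_alg \<times> real" where
  "eq_rel x y = (x - y, 0)"

definition ck_RN :: "'i set \<Rightarrow> ('i ck_gen free_alg \<times> real) set" where
  "ck_RN I =
     {eq_rel (gen (T i) * fstar (gen (T i)) * gen (T i)) (gen (T i)) | i. i \<in> I} \<union>
     {eq_rel (gen One) (fstar (gen One)), eq_rel (gen One) (gen One * gen One)} \<union>
     {eq_rel (gen One * gen (T i)) (gen (T i)) | i. i \<in> I} \<union>
     {eq_rel (gen (T i)) (gen (T i) * gen One) | i. i \<in> I}"

definition fin_net :: "'i set \<Rightarrow> ('i set \<Rightarrow> 'x) \<Rightarrow> ('i set, 'x) net" where
  "fin_net I x = ({X. finite X \<and> X \<subseteq> I}, (\<subseteq>), x)"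

definition ck_RS ::
    "'i set \<Rightarrow> ('i \<Rightarrow> 'i \<Rightarrow> complex) \<Rightarrow> ('i set, 'i ck_gen free_alg) net set" where
  "ck_RS I A =
     {fin_net I (\<lambda>X. gen One - (\<Sum>i\<in>X. gen (T i) * fstar (gen (T i))))} \<union>
     {fin_net I (\<lambda>X. fstar (gen (T i)) * gen (T i)
                      - (\<Sum>j\<in>X. fscale (A i j) (gen (T j) * fstar (gen (T j))))) | i. i \<in> I}"

end

theory Submission
  imports Defs "HOL-Algebra.FiniteProduct"
begin

text \<open>
  On the free *-algebra compare two C*-seminorms: \<open>N\<close>, the supremum over the representations of the
  Cuntz-Krieger triple, and the pullback of the norm of the Exel-Laca algebra along \<open>T\<^bsub>i\<^esub> \<mapsto> S\<^bsub>i\<^esub>\<close>.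

  The relations bound the norms of all generators by 1, so strong operator convergence to zero passes
  to direct sums and the triple is admissible. Algebraically, (CK1) and (CK2) say that the range
  projections are orthogonal, how initial projections act on them, and that \<open>x = 0\<close> as soon as
  \<open>x T\<^bsub>j\<^esub> T\<^bsub>j\<^esub>* = 0\<close> for all \<open>j\<close>. Testing against the range projections proves the Exel-Laca
  relations for \<open>N\<close>, so the universal property yields a homomorphism \<open>\<phi>\<close>. It is contractive because
  \<open>a = b*b\<close> with \<open>\<parallel>b\<parallel> < 1\<close> can be written as \<open>2 y - y\<^sup>2\<close> with \<open>y\<close> self-adjoint, and \<open>2 \<sigma> - \<sigma>\<^sup>2 \<le> 1\<close> for every self-adjoint
  operator \<open>\<sigma>\<close>.

  For the reverse inequality, \<open>T\<^bsub>i\<^esub> \<mapsto> z T\<^bsub>i\<^esub>\<close> preserves \<open>N\<close>, so averaging over roots of unity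
  bounds the homogeneous components of an element. A component of degree \<open>d\<close> is controlled through
  \<open>x*x\<close>, which has degree zero and lies in one of the increasing subspaces spanned by
  \<open>T\<^bsub>\<mu>\<^esub> q T\<^bsub>\<nu>\<^esub>*\<close> with \<open>\<mu>\<close> and \<open>\<nu>\<close> of equal length and \<open>q\<close> a product of initial projections. On such a
  subspace the two seminorms are comparable with a constant, because no range projection is null and,
  by (EL4), the products of initial projections behave alike in both. Since the subspace is closed
  under multiplication, the C*-identity applied to the powers \<open>a^(2^k)\<close> improves the constant
  to 1. An arbitrary \<open>a = x*x\<close> has powers with linearly many homogeneous components, and the same
  argument applies once more.
\<close>

section \<open>Seminormed spaces\<close>

text \<open>The proof does without spectral theory and without a gauge action on the Exel-Laca
  algebra. The comparison is therefore carried out on the free *-algebra, where only the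
  C*-identity, elementary norm estimates and null elements occur, and equality in an algebra becomes
  congruence modulo null elements. Instead of identifying finite-dimensional subalgebras on which an
  injective homomorphism is isometric, the comparison on the degree-zero part is allowed any
  constant that is the same for all powers 2^k. For indices in a finite set F it comes from the
  2^|F| products of initial projections q_i and complements 1 - q_i, on which level-zero elements
  act as scalars, and from the |F|^2 compressions T_i* y T_j at each further level. Gauge invariance
  is asked only of the universal seminorm, whose defining representations can be twisted one by one.
  The injection \<open>emb\<close> serves twice: the l2-space must lie in the universe, so that the
  supremum is not over the empty set and no range projection is null, and the completed algebra must
  lie there too, as a test algebra for the universal property.\<close>

lemma vcauchy_closed: "vcauchy V nrm x \<Longrightarrow> x n \<in> vcarrier V"
  by (simp add: vcauchy_def)

lemma vcauchyE:
  assumes "vcauchy V nrm x" "e > 0"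
  obtains N where "\<And>m n. m \<ge> N \<Longrightarrow> n \<ge> N \<Longrightarrow> nrm (vminus V (x m) (x n)) < e"
proof -
  have "\<exists>N. \<forall>m\<ge>N. \<forall>n\<ge>N. nrm (vminus V (x m) (x n)) < e"
    using assms by (simp add: vcauchy_def)
  then show ?thesis using that by blast
qed

context complex_vector_space
begin

declare zero_closed [simp] add_closed [simp] scale_closed [simp] scale_one [simp] add_zero [simp]

lemma add_left_commute:
  "\<lbrakk>x \<in> vcarrier V; y \<in> vcarrier V; z \<in> vcarrier V\<rbrakk>
    \<Longrightarrow> vadd V x (vadd V y z) = vadd V y (vadd V x z)"
  by (metis add_assoc add_commute)

lemmas add_ac = add_assoc add_commute add_left_commute

lemma scale_zero_left [simp]: "x \<in> vcarrier V \<Longrightarrow> vscale V 0 x = vzero V"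
  using scale_add_left[of x 1 "-1"] add_inverse by simp

lemma scale_zero_right [simp]: "vscale V c (vzero V) = vzero V"
  by (metis mult_zero_right scale_scale scale_zero_left zero_closed)

lemma zero_add [simp]: "x \<in> vcarrier V \<Longrightarrow> vadd V (vzero V) x = x"
  by (metis add_commute add_zero zero_closed)

lemma minus_closed [simp]: "\<lbrakk>x \<in> vcarrier V; y \<in> vcarrier V\<rbrakk> \<Longrightarrow> vminus V x y \<in> vcarrier V"
  by (simp add: vminus_def)

lemma minus_self [simp]: "x \<in> vcarrier V \<Longrightarrow> vminus V x x = vzero V"
  by (simp add: vminus_def add_inverse)

lemma minus_zero [simp]: "x \<in> vcarrier V \<Longrightarrow> vminus V x (vzero V) = x"
  by (simp add: vminus_def)

lemma inverse_add_cancel: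
  "\<lbrakk>x \<in> vcarrier V; y \<in> vcarrier V\<rbrakk> \<Longrightarrow> vadd V x (vadd V (vscale V (-1) x) y) = y"
  by (simp add: add_assoc [symmetric] add_inverse)

lemma add_inverse_cancel:
  "\<lbrakk>x \<in> vcarrier V; y \<in> vcarrier V\<rbrakk> \<Longrightarrow> vadd V (vscale V (-1) x) (vadd V x y) = y"
  by (simp add: add_left_commute[of _ x] inverse_add_cancel)

lemma minus_add_cancel:
  "\<lbrakk>x \<in> vcarrier V; y \<in> vcarrier V\<rbrakk> \<Longrightarrow> vadd V (vminus V x y) y = x"
  by (simp add: vminus_def add_assoc add_commute[of "vscale V (-1) y" y] add_inverse)

lemma minus_eq_zero_iff:
  "\<lbrakk>x \<in> vcarrier V; y \<in> vcarrier V\<rbrakk> \<Longrightarrow> vminus V x y = vzero V \<longleftrightarrow> x = y"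
  by (metis minus_add_cancel minus_self zero_add)

lemma minus_add_add:
  "\<lbrakk>x \<in> vcarrier V; y \<in> vcarrier V; x' \<in> vcarrier V; y' \<in> vcarrier V\<rbrakk>
    \<Longrightarrow> vminus V (vadd V x y) (vadd V x' y') = vadd V (vminus V x x') (vminus V y y')"
  by (simp add: vminus_def scale_add_right add_ac)

lemma minus_trans:
  "\<lbrakk>x \<in> vcarrier V; y \<in> vcarrier V; z \<in> vcarrier V\<rbrakk>
    \<Longrightarrow> vadd V (vminus V x y) (vminus V y z) = vminus V x z"
  by (simp add: vminus_def add_assoc add_inverse_cancel)

lemma scale_minus:
  "\<lbrakk>x \<in> vcarrier V; y \<in> vcarrier V\<rbrakk>
    \<Longrightarrow> vscale V c (vminus V x y) = vminus V (vscale V c x) (vscale V c y)"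
  by (simp add: vminus_def scale_add_right scale_scale)

lemma minus_swap:
  "\<lbrakk>x \<in> vcarrier V; y \<in> vcarrier V\<rbrakk> \<Longrightarrow> vscale V (-1) (vminus V x y) = vminus V y x"
  by (simp add: vminus_def scale_add_right scale_scale add_commute)

end

text \<open>Null vectors are allowed, so that the same estimates serve Hilbert norms, the seminorms
  on the free *-algebra and those on Cauchy sequences.\<close>

locale seminormed_space = complex_vector_space V for V :: "('a, 'm) cvs_scheme" +
  fixes nrm :: "'a \<Rightarrow> real"
  assumes nrm_nonneg: "x \<in> vcarrier V \<Longrightarrow> 0 \<le> nrm x"
    and nrm_scale: "x \<in> vcarrier V \<Longrightarrow> nrm (vscale V c x) = cmod c * nrm x"
    and nrm_triangle: "\<lbrakk>x \<in> vcarrier V; y \<in> vcarrier V\<rbrakk> \<Longrightarrow> nrm (vadd V x y) \<le> nrm x + nrm y"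
begin

lemma nrm_zero [simp]: "nrm (vzero V) = 0"
  using nrm_scale[of "vzero V" 0] by simp

lemma nrm_minus_commute:
  "\<lbrakk>x \<in> vcarrier V; y \<in> vcarrier V\<rbrakk> \<Longrightarrow> nrm (vminus V x y) = nrm (vminus V y x)"
  using nrm_scale[of "vminus V x y" "-1"] by (simp add: minus_swap)

lemma nrm_minus_trans:
  "\<lbrakk>x \<in> vcarrier V; y \<in> vcarrier V; z \<in> vcarrier V\<rbrakk>
    \<Longrightarrow> nrm (vminus V x z) \<le> nrm (vminus V x y) + nrm (vminus V y z)"
  using nrm_triangle[of "vminus V x y" "vminus V y z"] by (simp add: minus_trans)

lemma nrm_minus_add:
  "\<lbrakk>x \<in> vcarrier V; y \<in> vcarrier V; x' \<in> vcarrier V; y' \<in> vcarrier V\<rbrakk>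
    \<Longrightarrow> nrm (vminus V (vadd V x y) (vadd V x' y')) \<le> nrm (vminus V x x') + nrm (vminus V y y')"
  by (simp add: minus_add_add nrm_triangle)

lemma nrm_le_minus:
  "\<lbrakk>x \<in> vcarrier V; y \<in> vcarrier V\<rbrakk> \<Longrightarrow> nrm x \<le> nrm (vminus V x y) + nrm y"
  using nrm_triangle[of "vminus V x y" y] by (simp add: minus_add_cancel)

lemma abs_nrm_diff:
  "\<lbrakk>x \<in> vcarrier V; y \<in> vcarrier V\<rbrakk> \<Longrightarrow> \<bar>nrm x - nrm y\<bar> \<le> nrm (vminus V x y)"
  using nrm_le_minus[of x y] nrm_le_minus[of y x] nrm_minus_commute[of x y] by simp

lemma nrm_scale_minus:
  "\<lbrakk>x \<in> vcarrier V; y \<in> vcarrier V\<rbrakk>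
    \<Longrightarrow> nrm (vminus V (vscale V c x) (vscale V c y)) = cmod c * nrm (vminus V x y)"
  by (simp add: scale_minus [symmetric] nrm_scale)

lemma vconverges_nrm:
  assumes "\<And>n. x n \<in> vcarrier V" "l \<in> vcarrier V" "vconverges V nrm x l"
  shows "(\<lambda>n. nrm (x n)) \<longlonglongrightarrow> nrm l"
proof -
  have "(\<lambda>n. nrm (x n) - nrm l) \<longlonglongrightarrow> 0"
    by (rule Lim_null_comparison[OF _ assms(3)[unfolded vconverges_def]])
      (simp add: abs_nrm_diff assms eventually_sequentially)
  then show ?thesis by (simp add: LIM_zero_iff)
qed

lemma vconverges_vcauchy:
  assumes "\<And>n. x n \<in> vcarrier V" "l \<in> vcarrier V" "vconverges V nrm x l"
  shows "vcauchy V nrm x"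
  unfolding vcauchy_def
proof (intro conjI allI impI)
  fix e :: real assume "e > 0"
  then obtain N where N: "\<And>n. n \<ge> N \<Longrightarrow> nrm (vminus V (x n) l) < e / 2"
    using order_tendstoD(2)[OF assms(3)[unfolded vconverges_def], of "e / 2"]
    by (auto simp: eventually_sequentially)
  have "nrm (vminus V (x m) (x n)) < e" if "m \<ge> N" "n \<ge> N" for m n
    using nrm_minus_trans[of "x m" l "x n"] N[OF that(1)] N[OF that(2)] assms(1,2)
      nrm_minus_commute[of l "x n"] by simp
  then show "\<exists>N. \<forall>m\<ge>N. \<forall>n\<ge>N. nrm (vminus V (x m) (x n)) < e" by blast
qed (use assms in simp)

lemma vcauchy_nrm:
  assumes "vcauchy V nrm x"
  shows "Cauchy (\<lambda>n. nrm (x n))"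
proof (rule CauchyI)
  fix e :: real assume "e > 0"
  then obtain N where N: "\<And>m n. m \<ge> N \<Longrightarrow> n \<ge> N \<Longrightarrow> nrm (vminus V (x m) (x n)) < e"
    using vcauchyE[OF assms] by metis
  have "norm (nrm (x m) - nrm (x n)) < e" if "m \<ge> N" "n \<ge> N" for m n
    using abs_nrm_diff[of "x m" "x n"] N[OF that] vcauchy_closed[OF assms] by simp
  then show "\<exists>M. \<forall>m\<ge>M. \<forall>n\<ge>M. norm (nrm (x m) - nrm (x n)) < e" by blast
qed

lemma vcauchy_bounded:
  assumes "vcauchy V nrm x"
  obtains K where "K > 0" "\<And>n. nrm (x n) \<le> K"
  using Cauchy_Bseq[OF vcauchy_nrm[OF assms]] unfolding Bseq_def by (auto simp: abs_le_iff)

end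

section \<open>Hilbert spaces\<close>

context hilbert_space
begin

lemma inner_add_right:
  "\<lbrakk>x \<in> vcarrier H; y \<in> vcarrier H; z \<in> vcarrier H\<rbrakk>
    \<Longrightarrow> hinner H x (vadd H y z) = hinner H x y + hinner H x z"
  by (metis inner_add_left inner_commute add_closed complex_cnj_add)

lemma inner_scale_right:
  "\<lbrakk>x \<in> vcarrier H; y \<in> vcarrier H\<rbrakk> \<Longrightarrow> hinner H x (vscale H c y) = cnj c * hinner H x y"
  by (metis inner_scale_left inner_commute scale_closed complex_cnj_mult)

lemma inner_zero_left [simp]: "x \<in> vcarrier H \<Longrightarrow> hinner H (vzero H) x = 0"
  using inner_scale_left[of "vzero H" x 0] by simp

lemma inner_zero_right [simp]: "x \<in> vcarrier H \<Longrightarrow> hinner H x (vzero H) = 0"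
  using inner_scale_right[of x "vzero H" 0] by simp

lemmas inner_simps = inner_add_left inner_add_right inner_scale_left inner_scale_right

lemma inner_minus_left:
  "\<lbrakk>x \<in> vcarrier H; y \<in> vcarrier H; z \<in> vcarrier H\<rbrakk>
    \<Longrightarrow> hinner H (vminus H x y) z = hinner H x z - hinner H y z"
  by (simp add: vminus_def inner_simps)

lemma inner_minus_right:
  "\<lbrakk>x \<in> vcarrier H; y \<in> vcarrier H; z \<in> vcarrier H\<rbrakk>
    \<Longrightarrow> hinner H x (vminus H y z) = hinner H x y - hinner H x z"
  by (simp add: vminus_def inner_simps)

lemma Im_inner_self [simp]: "x \<in> vcarrier H \<Longrightarrow> Im (hinner H x x) = 0"
  using inner_commute[of x x] by (simp add: complex_eq_iff)

lemma hnorm_sq: "x \<in> vcarrier H \<Longrightarrow> (hnorm H x)\<^sup>2 = Re (hinner H x x)"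
  by (simp add: hnorm_def inner_nonneg)

lemma inner_self: "x \<in> vcarrier H \<Longrightarrow> hinner H x x = complex_of_real ((hnorm H x)\<^sup>2)"
  by (simp add: complex_eq_iff hnorm_sq)

lemma hnorm_nonneg [simp]: "x \<in> vcarrier H \<Longrightarrow> 0 \<le> hnorm H x"
  by (simp add: hnorm_def inner_nonneg)

lemma hnorm_eq_zero: "x \<in> vcarrier H \<Longrightarrow> hnorm H x = 0 \<longleftrightarrow> x = vzero H"
  using inner_definite[of x] by (auto simp: hnorm_def complex_eq_iff)

lemma Re_inner_commute:
  "\<lbrakk>x \<in> vcarrier H; y \<in> vcarrier H\<rbrakk> \<Longrightarrow> Re (hinner H x y) = Re (hinner H y x)"
  by (metis inner_commute cnj.sel(1))

lemma inner_eqI: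
  assumes "x \<in> vcarrier H" "y \<in> vcarrier H"
    and "\<And>z. z \<in> vcarrier H \<Longrightarrow> hinner H z x = hinner H z y"
  shows "x = y"
proof -
  have "hinner H (vminus H x y) (vminus H x y) = 0"
    using assms by (subst inner_minus_right) auto
  then show ?thesis using inner_definite[of "vminus H x y"] minus_eq_zero_iff[of x y] assms(1,2) by simp
qed

lemma hnorm_scale: "x \<in> vcarrier H \<Longrightarrow> hnorm H (vscale H c x) = cmod c * hnorm H x"
proof -
  assume x: "x \<in> vcarrier H"
  have "hinner H (vscale H c x) (vscale H c x) = (c * cnj c) * hinner H x x"
    using x by (simp add: inner_simps)
  also have "\<dots> = complex_of_real ((cmod c)\<^sup>2 * (hnorm H x)\<^sup>2)"
    using x by (simp only: complex_norm_square[symmetric] inner_self of_real_mult)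
  finally have "Re (hinner H (vscale H c x) (vscale H c x)) = (cmod c * hnorm H x)\<^sup>2"
    by (simp add: power_mult_distrib)
  then show ?thesis using x by (simp add: hnorm_def real_sqrt_mult inner_nonneg)
qed

lemma cauchy_schwarz:
  assumes x: "x \<in> vcarrier H" and y: "y \<in> vcarrier H"
  shows "cmod (hinner H x y) \<le> hnorm H x * hnorm H y"
proof (cases "hnorm H y = 0")
  case True
  then show ?thesis using x y hnorm_eq_zero[of y] by simp
next
  case False
  define b where "b = (hnorm H y)\<^sup>2"
  define i where "i = hinner H x y"
  have b: "b > 0" using False y by (simp add: b_def)
  \<comment> \<open>The coefficient of the orthogonal projection of \<open>x\<close> onto the line
    through \<open>y\<close>, for which the expansion below collapses to the Cauchy-Schwarz
    bound.\<close>
  define c where "c = i / complex_of_real b"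
  have "0 \<le> Re (hinner H (vminus H x (vscale H c y)) (vminus H x (vscale H c y)))"
    using x y by (simp add: inner_nonneg)
  also have "hinner H (vminus H x (vscale H c y)) (vminus H x (vscale H c y))
      = complex_of_real ((hnorm H x)\<^sup>2) - cnj c * i - c * cnj i + c * cnj c * complex_of_real b"
  proof -
    have "hinner H (vminus H x (vscale H c y)) (vminus H x (vscale H c y))
        = hinner H x x - cnj c * i - c * hinner H y x + c * cnj c * hinner H y y"
      using x y by (simp add: inner_minus_left inner_minus_right inner_simps i_def algebra_simps)
    moreover have "hinner H y x = cnj i" using inner_commute[OF y x] by (simp only: i_def)
    ultimately show ?thesis by (simp only: inner_self[OF x] inner_self[OF y] b_def)
  qed
  also have "\<dots> = complex_of_real ((hnorm H x)\<^sup>2) - complex_of_real ((cmod i)\<^sup>2 / b)"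
    using b by (simp add: c_def field_simps complex_norm_square[symmetric] del: of_real_power)
  finally have "(cmod i)\<^sup>2 / b \<le> (hnorm H x)\<^sup>2" by simp
  then have "(cmod i)\<^sup>2 \<le> (hnorm H x * hnorm H y)\<^sup>2"
    using b by (simp add: field_simps b_def power_mult_distrib)
  then show ?thesis
    using power2_le_imp_le[of "cmod i" "hnorm H x * hnorm H y"] x y by (simp add: i_def)
qed

lemma hnorm_add_sq:
  "\<lbrakk>x \<in> vcarrier H; y \<in> vcarrier H\<rbrakk>
    \<Longrightarrow> (hnorm H (vadd H x y))\<^sup>2 = (hnorm H x)\<^sup>2 + 2 * Re (hinner H x y) + (hnorm H y)\<^sup>2"
  using Re_inner_commute[of x y] by (simp add: hnorm_sq inner_simps)

lemma hnorm_minus_sq: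
  "\<lbrakk>x \<in> vcarrier H; y \<in> vcarrier H\<rbrakk>
    \<Longrightarrow> (hnorm H (vminus H x y))\<^sup>2 = (hnorm H x)\<^sup>2 - 2 * Re (hinner H x y) + (hnorm H y)\<^sup>2"
  using Re_inner_commute[of x y] by (simp add: hnorm_sq inner_minus_left inner_minus_right)

lemma hnorm_triangle:
  assumes "x \<in> vcarrier H" "y \<in> vcarrier H"
  shows "hnorm H (vadd H x y) \<le> hnorm H x + hnorm H y"
proof (rule power2_le_imp_le)
  have "Re (hinner H x y) \<le> hnorm H x * hnorm H y"
    using cauchy_schwarz[OF assms] complex_Re_le_cmod order_trans by blast
  then show "(hnorm H (vadd H x y))\<^sup>2 \<le> (hnorm H x + hnorm H y)\<^sup>2"
    using assms by (simp add: hnorm_add_sq power2_sum)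
qed (use assms in simp)

lemma seminormed: "seminormed_space H (hnorm H)"
  by unfold_locales (auto simp: hnorm_scale hnorm_triangle)

sublocale hs: seminormed_space H "hnorm H"
  by (rule seminormed)

end

lemma quadratic_nonneg_imp_zero:
  fixes a b :: real
  assumes "\<And>t. 0 \<le> a * t\<^sup>2 + 2 * b * t" "a \<ge> 0"
  shows "b = 0"
proof -
  \<comment> \<open>The point -b/(a + 1) instead of the vertex -b/a keeps the denominator positive
    when a = 0; the polynomial takes the value -b^2 (a + 2)/(a + 1)^2 there.\<close>
  have "0 \<le> a * (b / (a + 1))\<^sup>2 - 2 * b * (b / (a + 1))"
    using assms(1)[of "- (b / (a + 1))"] by simp
  also have "\<dots> = - (b\<^sup>2 * (a + 2) / (a + 1)\<^sup>2)"
    using assms(2) by (simp add: divide_simps) algebra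
  finally have "b\<^sup>2 * (a + 2) / (a + 1)\<^sup>2 \<le> 0" by simp
  moreover have "b\<^sup>2 * (a + 2) / (a + 1)\<^sup>2 > 0" if "b \<noteq> 0"
    using that assms(2) by (intro divide_pos_pos mult_pos_pos) auto
  ultimately show ?thesis by force
qed

context hilbert_space
begin

text \<open>The representing vector minimises \<open>\<parallel>x\<parallel>\<^sup>2 - 2 Re (f x)\<close>; this avoids orthogonal
  complements.\<close>

lemma riesz:
  fixes f :: "'h \<Rightarrow> complex"
  assumes add: "\<And>x y. \<lbrakk>x \<in> vcarrier H; y \<in> vcarrier H\<rbrakk> \<Longrightarrow> f (vadd H x y) = f x + f y"
    and scale: "\<And>c x. x \<in> vcarrier H \<Longrightarrow> f (vscale H c x) = c * f x"
    and bd: "\<And>x. x \<in> vcarrier H \<Longrightarrow> cmod (f x) \<le> K * hnorm H x"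
  obtains u where "u \<in> vcarrier H" "\<And>v. v \<in> vcarrier H \<Longrightarrow> f v = hinner H v u"
proof -
  define J where "J x = (hnorm H x)\<^sup>2 - 2 * Re (f x)" for x
  have J_lower: "- (K\<^sup>2) \<le> J x" if "x \<in> vcarrier H" for x
  proof -
    have "0 \<le> (hnorm H x - K)\<^sup>2" by simp
    then have "- (K\<^sup>2) \<le> (hnorm H x)\<^sup>2 - 2 * (K * hnorm H x)" by (simp add: power2_diff mult_ac)
    also have "\<dots> \<le> J x"
      using bd[OF that] complex_Re_le_cmod[of "f x"] by (simp add: J_def)
    finally show ?thesis .
  qed
  define m where "m = Inf (J ` vcarrier H)"
  have bdd: "bdd_below (J ` vcarrier H)" using J_lower by (auto intro!: bdd_belowI2)
  have ne: "J ` vcarrier H \<noteq> {}" using zero_closed by blast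
  have m_le: "m \<le> J x" if "x \<in> vcarrier H" for x
    unfolding m_def by (rule cINF_lower[OF bdd that])
  have "\<exists>x\<in>vcarrier H. J x < m + 1 / Suc n" for n
    using cInf_lessD[OF ne, of "m + 1 / Suc n"] by (auto simp: m_def)
  then obtain x where x: "\<And>n. x n \<in> vcarrier H" and Jx: "\<And>n. J (x n) < m + 1 / Suc n"
    by metis
  \<comment> \<open>The parallelogram law for \<open>J\<close>: the linear parts cancel. Since the
    midpoint has \<open>J\<close> at least \<open>m\<close>, a minimising sequence is
    Cauchy.\<close>
  have par: "(hnorm H (vminus H a b))\<^sup>2 = 2 * J a + 2 * J b - 4 * J (vscale H (1/2) (vadd H a b))"
    if "a \<in> vcarrier H" "b \<in> vcarrier H" for a b
  proof -
    have "J (vscale H (1/2) (vadd H a b)) = (hnorm H (vadd H a b))\<^sup>2 / 4 - (Re (f a) + Re (f b))"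
      using that unfolding J_def by (simp add: hnorm_scale power_divide scale add field_simps)
    then show ?thesis
      using that by (simp add: J_def hnorm_add_sq hnorm_minus_sq field_simps)
  qed
  have dist: "(hnorm H (vminus H (x a) (x b)))\<^sup>2 \<le> 2 / Suc a + 2 / Suc b" for a b
  proof -
    have "m \<le> J (vscale H (1/2) (vadd H (x a) (x b)))" by (intro m_le) (simp add: x)
    moreover have "2 / real (Suc a) = 2 * (1 / real (Suc a))" "2 / real (Suc b) = 2 * (1 / real (Suc b))"
      by simp_all
    ultimately show ?thesis
      using par[OF x x, of a b] Jx[of a] Jx[of b] by linarith
  qed
  have "vcauchy H (hnorm H) x"
    unfolding vcauchy_def
  proof (intro conjI allI impI)
    fix e :: real assume e: "e > 0"
    obtain N where N: "inverse (real (Suc N)) < e\<^sup>2 / 4"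
      using reals_Archimedean[of "e\<^sup>2 / 4"] e by auto
    have "hnorm H (vminus H (x a) (x b)) < e" if "a \<ge> N" "b \<ge> N" for a b
    proof (rule power2_less_imp_less)
      have "1 / Suc a \<le> 1 / Suc N" "1 / Suc b \<le> 1 / Suc N"
        using that by (auto simp: frac_le)
      then show "(hnorm H (vminus H (x a) (x b)))\<^sup>2 < e\<^sup>2"
        using dist[of a b] N by (simp add: inverse_eq_divide)
    qed (use e in simp)
    then show "\<exists>N. \<forall>a\<ge>N. \<forall>b\<ge>N. hnorm H (vminus H (x a) (x b)) < e" by blast
  qed (use x in simp)
  then obtain u where u: "u \<in> vcarrier H" and conv: "vconverges H (hnorm H) x u"
    using hilbert_complete unfolding vcomplete_def by blast
  have fm: "f (vminus H a b) = f a - f b" if "a \<in> vcarrier H" "b \<in> vcarrier H" for a b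
    using that by (simp add: vminus_def add scale)
  have "(\<lambda>n. f (x n) - f u) \<longlonglongrightarrow> 0"
  proof (rule Lim_null_comparison)
    show "\<forall>\<^sub>F n in sequentially. norm (f (x n) - f u) \<le> K * hnorm H (vminus H (x n) u)"
      using bd[of "vminus H (x _) u"] fm x u by simp
    show "(\<lambda>n. K * hnorm H (vminus H (x n) u)) \<longlonglongrightarrow> 0"
      using conv unfolding vconverges_def by (rule tendsto_mult_right_zero)
  qed
  then have "(\<lambda>n. f (x n)) \<longlonglongrightarrow> f u" by (simp add: LIM_zero_iff)
  then have "(\<lambda>n. J (x n)) \<longlonglongrightarrow> J u"
    unfolding J_def by (intro tendsto_intros hs.vconverges_nrm x u conv)
  moreover have "(\<lambda>n. m + 1 / Suc n) \<longlonglongrightarrow> m + 0"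
    by (intro tendsto_intros) (rule LIMSEQ_Suc, rule lim_1_over_n)
  ultimately have Ju: "J u \<le> m"
    using Jx by (intro LIMSEQ_le[of _ "J u" _ m]) (auto intro!: less_imp_le exI[of _ 0])
  \<comment> \<open>At a minimum the real polynomial J(u + t v) - J(u) is nonnegative and has no
    constant term, so its linear coefficient vanishes.\<close>
  have Re_eq: "Re (f v) = Re (hinner H v u)" if v: "v \<in> vcarrier H" for v
  proof -
    have "0 \<le> (hnorm H v)\<^sup>2 * t\<^sup>2 + 2 * (Re (hinner H v u) - Re (f v)) * t" for t :: real
    proof -
      have "J u \<le> J (vadd H u (vscale H (complex_of_real t) v))"
        using Ju m_le u v by (meson add_closed order_trans scale_closed)
      then show ?thesis
        using u v Re_inner_commute[OF u v] unfolding J_def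
        by (simp add: hnorm_add_sq hnorm_scale inner_simps add scale power_mult_distrib algebra_simps)
    qed
    then show ?thesis using quadratic_nonneg_imp_zero[of "(hnorm H v)\<^sup>2"] by fastforce
  qed
  \<comment> \<open>The imaginary part at v is the real part at the vector -i v.\<close>
  have "f v = hinner H v u" if v: "v \<in> vcarrier H" for v
    using Re_eq[OF v] Re_eq[of "vscale H (- \<i>) v"] u v
    by (simp add: complex_eq_iff scale inner_simps)
  then show ?thesis using that u by blast
qed

end

section \<open>Bounded operators\<close>

lemma bounded_op_closed: "\<lbrakk>bounded_op H R; x \<in> vcarrier H\<rbrakk> \<Longrightarrow> R x \<in> vcarrier H"
  by (auto simp: bounded_op_def)

lemma bounded_op_add:
  "\<lbrakk>bounded_op H R; x \<in> vcarrier H; y \<in> vcarrier H\<rbrakk> \<Longrightarrow> R (vadd H x y) = vadd H (R x) (R y)"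
  by (auto simp: bounded_op_def)

lemma bounded_op_scale:
  "\<lbrakk>bounded_op H R; x \<in> vcarrier H\<rbrakk> \<Longrightarrow> R (vscale H c x) = vscale H c (R x)"
  by (auto simp: bounded_op_def)

lemma bounded_op_eqI:
  "\<lbrakk>bounded_op H S; bounded_op H R; \<And>x. x \<in> vcarrier H \<Longrightarrow> S x = R x\<rbrakk> \<Longrightarrow> S = R"
  by (auto simp: bounded_op_def intro: extensionalityI)

context hilbert_space
begin

lemma bounded_opE:
  assumes "bounded_op H R"
  obtains K where "K \<ge> 0" "\<And>x. x \<in> vcarrier H \<Longrightarrow> hnorm H (R x) \<le> K * hnorm H x"
proof -
  obtain K where K: "\<forall>x\<in>vcarrier H. hnorm H (R x) \<le> K * hnorm H x"
    using assms by (auto simp: bounded_op_def)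
  have "hnorm H (R x) \<le> max K 0 * hnorm H x" if "x \<in> vcarrier H" for x
    using K that mult_right_mono[of K "max K 0" "hnorm H x"] by force
  then show ?thesis using that[of "max K 0"] by simp
qed

lemma adjoint_exists:
  assumes R: "bounded_op H R"
  obtains R' where "bounded_op H R'"
    "\<And>x y. \<lbrakk>x \<in> vcarrier H; y \<in> vcarrier H\<rbrakk> \<Longrightarrow> hinner H (R x) y = hinner H x (R' y)"
proof -
  obtain K where K: "K \<ge> 0" "\<And>x. x \<in> vcarrier H \<Longrightarrow> hnorm H (R x) \<le> K * hnorm H x"
    using bounded_opE[OF R] by metis
  have Kb: "cmod (hinner H (R x) y) \<le> K * hnorm H y * hnorm H x"
    if "x \<in> vcarrier H" "y \<in> vcarrier H" for x y
    using cauchy_schwarz[OF bounded_op_closed[OF R that(1)] that(2)]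
      mult_right_mono[OF K(2)[OF that(1)], of "hnorm H y"] that by (simp add: mult_ac)
  have "\<exists>u. u \<in> vcarrier H \<and> (\<forall>x\<in>vcarrier H. hinner H (R x) y = hinner H x u)"
    if y: "y \<in> vcarrier H" for y
    using riesz[of "\<lambda>x. hinner H (R x) y" "K * hnorm H y"] Kb[OF _ y] y bounded_op_closed[OF R]
    by (smt (verit, best) R bounded_op_add bounded_op_scale inner_add_left inner_scale_left)
  then obtain F where F: "\<And>y. y \<in> vcarrier H \<Longrightarrow> F y \<in> vcarrier H"
    "\<And>x y. \<lbrakk>x \<in> vcarrier H; y \<in> vcarrier H\<rbrakk> \<Longrightarrow> hinner H (R x) y = hinner H x (F y)"
    by metis
  have "hnorm H (F y) \<le> K * hnorm H y" if y: "y \<in> vcarrier H" for y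
  proof -
    have "(hnorm H (F y))\<^sup>2 = Re (hinner H (R (F y)) y)"
      using y F by (simp add: hnorm_sq)
    also have "\<dots> \<le> K * hnorm H y * hnorm H (F y)"
      using Kb[OF F(1)[OF y] y] complex_Re_le_cmod order_trans by blast
    finally show ?thesis
      using K(1) y F(1)[OF y] hnorm_nonneg[OF y] hnorm_nonneg[OF F(1)[OF y]]
      by (cases "hnorm H (F y) = 0") (auto simp: power2_eq_square)
  qed
  \<comment> \<open>Operators are functions that are undefined off the carrier, so \<open>F\<close>
    is restricted; its linearity follows by testing against inner products.\<close>
  then have "bounded_op H (restrict F (vcarrier H))"
    using F unfolding bounded_op_def
    by (auto intro!: exI[of _ K] inner_eqI simp: inner_simps bounded_op_closed[OF R] F(2)[symmetric])
  then show ?thesis using F(2) that[of "restrict F (vcarrier H)"] by simp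
qed

lemma adjoint_unique:
  assumes "bounded_op H S"
    and "\<And>x y. \<lbrakk>x \<in> vcarrier H; y \<in> vcarrier H\<rbrakk> \<Longrightarrow> hinner H (R x) y = hinner H x (S y)"
  shows "adjoint_op H R = S"
  unfolding adjoint_op_def
proof (rule the_equality)
  fix R' assume R': "bounded_op H R' \<and>
    (\<forall>x\<in>vcarrier H. \<forall>y\<in>vcarrier H. hinner H (R x) y = hinner H x (R' y))"
  show "R' = S"
    using R' assms by (intro bounded_op_eqI[of H]) (auto intro!: inner_eqI simp: bounded_op_closed)
qed (use assms in simp)

lemma
  assumes R: "bounded_op H R"
  shows adjoint_bounded: "bounded_op H (adjoint_op H R)"
    and adjoint_inner: "\<lbrakk>x \<in> vcarrier H; y \<in> vcarrier H\<rbrakk>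
      \<Longrightarrow> hinner H (R x) y = hinner H x (adjoint_op H R y)"
proof -
  obtain R' where R': "bounded_op H R'"
    "\<And>x y. \<lbrakk>x \<in> vcarrier H; y \<in> vcarrier H\<rbrakk> \<Longrightarrow> hinner H (R x) y = hinner H x (R' y)"
    using adjoint_exists[OF R] by metis
  then have "adjoint_op H R = R'" by (rule adjoint_unique)
  with R' show "bounded_op H (adjoint_op H R)"
    "\<lbrakk>x \<in> vcarrier H; y \<in> vcarrier H\<rbrakk> \<Longrightarrow> hinner H (R x) y = hinner H x (adjoint_op H R y)"
    by auto
qed

lemma adjoint_inner':
  "\<lbrakk>bounded_op H R; x \<in> vcarrier H; y \<in> vcarrier H\<rbrakk>
    \<Longrightarrow> hinner H x (R y) = hinner H (adjoint_op H R x) y"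
  by (metis adjoint_inner inner_commute bounded_op_closed adjoint_bounded)

lemma opnorm_bdd:
  assumes "bounded_op H R"
  shows "bdd_above {hnorm H (R x) |x. x \<in> vcarrier H \<and> hnorm H x \<le> 1}"
proof -
  obtain K where K: "K \<ge> 0" "\<And>x. x \<in> vcarrier H \<Longrightarrow> hnorm H (R x) \<le> K * hnorm H x"
    using bounded_opE[OF assms] by metis
  show ?thesis
    by (rule bdd_aboveI[of _ K]) (use K in \<open>auto intro: order_trans[OF _ mult_left_le]\<close>)
qed

lemma opnorm_le:
  assumes "0 \<le> K" "\<And>x. x \<in> vcarrier H \<Longrightarrow> hnorm H (R x) \<le> K * hnorm H x"
  shows "opnorm H R \<le> K"
  unfolding opnorm_def
proof (rule cSup_least)
  show "{hnorm H (R x) |x. x \<in> vcarrier H \<and> hnorm H x \<le> 1} \<noteq> {}"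
    using zero_closed by (auto intro!: exI[of _ "vzero H"])
qed (use assms in \<open>auto intro: order_trans[OF _ mult_left_le]\<close>)

lemma opnorm_nonneg: "bounded_op H R \<Longrightarrow> 0 \<le> opnorm H R"
  unfolding opnorm_def
  by (rule order_trans[OF hnorm_nonneg[of "R (vzero H)"] cSup_upper[OF _ opnorm_bdd]])
    (auto simp: bounded_op_closed intro!: exI[of _ "vzero H"])

lemma opnorm_bound:
  assumes R: "bounded_op H R" and x: "x \<in> vcarrier H"
  shows "hnorm H (R x) \<le> opnorm H R * hnorm H x"
proof (cases "hnorm H x = 0")
  case True
  then have "x = vscale H 0 x" using x hnorm_eq_zero by simp
  then have "R x = vscale H 0 (R x)" using R x bounded_op_scale by metis
  then have "R x = vzero H" using bounded_op_closed[OF R x] by simp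
  then show ?thesis using True by simp
next
  case False
  then have pos: "hnorm H x > 0" using x by (simp add: less_le)
  define y where "y = vscale H (1 / complex_of_real (hnorm H x)) x"
  have "hnorm H y = 1" "y \<in> vcarrier H"
    using x pos by (auto simp: y_def hnorm_scale norm_divide)
  then have "hnorm H (R y) \<le> opnorm H R"
    unfolding opnorm_def by (intro cSup_upper[OF _ opnorm_bdd[OF R]]) auto
  then show ?thesis
    using x pos bounded_op_closed[OF R x]
    by (simp add: y_def bounded_op_scale[OF R] hnorm_scale norm_divide field_simps)
qed

lemma opnorm_boundI: "\<lbrakk>bounded_op H R; x \<in> vcarrier H; opnorm H R \<le> K\<rbrakk> \<Longrightarrow> hnorm H (R x) \<le> K * hnorm H x"
  by (rule order_trans[OF opnorm_bound mult_right_mono]) auto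

end

lemma bop_alg_simps [simp]:
  "vcarrier (bop_alg H) = {R. bounded_op H R}"
  "astar (bop_alg H) = adjoint_op H"
  "anorm (bop_alg H) = opnorm H"
  "x \<in> vcarrier H \<Longrightarrow> vzero (bop_alg H) x = vzero H"
  "x \<in> vcarrier H \<Longrightarrow> vadd (bop_alg H) S R x = vadd H (S x) (R x)"
  "x \<in> vcarrier H \<Longrightarrow> vscale (bop_alg H) c R x = vscale H c (R x)"
  "x \<in> vcarrier H \<Longrightarrow> amult (bop_alg H) S R x = S (R x)"
  by (simp_all add: bop_alg_def compose_def)

text \<open>Shared by B(H), the free *-algebra, its quotients and the algebras of Cauchy sequences,
  so that the estimates below are proved once.\<close>

locale cstar_seminormed = star_algebra A for A :: "('a, 'm) nstar_alg_scheme" +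
  assumes semi_nonneg: "x \<in> vcarrier A \<Longrightarrow> 0 \<le> anorm A x"
    and semi_scale: "x \<in> vcarrier A \<Longrightarrow> anorm A (vscale A c x) = cmod c * anorm A x"
    and semi_triangle: "\<lbrakk>x \<in> vcarrier A; y \<in> vcarrier A\<rbrakk>
          \<Longrightarrow> anorm A (vadd A x y) \<le> anorm A x + anorm A y"
    and semi_mult: "\<lbrakk>x \<in> vcarrier A; y \<in> vcarrier A\<rbrakk>
          \<Longrightarrow> anorm A (amult A x y) \<le> anorm A x * anorm A y"
    and semi_cstar: "x \<in> vcarrier A \<Longrightarrow> anorm A (amult A (astar A x) x) = (anorm A x)\<^sup>2"

context hilbert_space
begin

lemma bop_add_bounded [simp]:
  assumes "bounded_op H S" "bounded_op H R"
  shows "bounded_op H (vadd (bop_alg H) S R)"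
proof -
  have "hnorm H (vadd H (S x) (R x)) \<le> (opnorm H S + opnorm H R) * hnorm H x"
    if "x \<in> vcarrier H" for x
    using that assms hnorm_triangle[of "S x" "R x"] opnorm_bound[of S x] opnorm_bound[of R x]
    by (simp add: bounded_op_closed distrib_right)
  then show ?thesis
    using assms unfolding bounded_op_def[of H "vadd _ _ _"]
    by (auto simp: bop_alg_def bounded_op_closed bounded_op_add bounded_op_scale scale_add_right add_ac
        intro!: exI[of _ "opnorm H S + opnorm H R"])
qed

lemma bop_scale_bounded [simp]:
  assumes "bounded_op H R"
  shows "bounded_op H (vscale (bop_alg H) c R)"
proof -
  have "hnorm H (vscale H c (R x)) \<le> (cmod c * opnorm H R) * hnorm H x"
    if "x \<in> vcarrier H" for x
    using that assms mult_left_mono[OF opnorm_bound[of R x], of "cmod c"]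
    by (simp add: bounded_op_closed hnorm_scale mult.assoc)
  then show ?thesis
    using assms unfolding bounded_op_def[of H "vscale _ _ _"]
    by (auto simp: bop_alg_def bounded_op_closed bounded_op_add bounded_op_scale scale_add_right scale_scale
        mult.commute intro!: exI[of _ "cmod c * opnorm H R"])
qed

lemma bop_compose_bound:
  assumes "bounded_op H S" "bounded_op H R" "x \<in> vcarrier H"
  shows "hnorm H (S (R x)) \<le> (opnorm H S * opnorm H R) * hnorm H x"
  using assms opnorm_bound[of S "R x"] mult_left_mono[OF opnorm_bound[of R x] opnorm_nonneg[of S]]
  by (simp add: bounded_op_closed mult.assoc)

lemma bop_mult_bounded [simp]:
  assumes "bounded_op H S" "bounded_op H R"
  shows "bounded_op H (amult (bop_alg H) S R)"
  using assms unfolding bounded_op_def[of H "amult _ _ _"]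
  by (auto simp: bop_alg_def bounded_op_closed bounded_op_add bounded_op_scale compose_def
      intro!: exI[of _ "opnorm H S * opnorm H R"] bop_compose_bound)

lemma bop_zero_bounded [simp]: "bounded_op H (vzero (bop_alg H))"
  unfolding bounded_op_def by (auto simp: bop_alg_def intro!: exI[of _ 0])

lemma bop_id_bounded: "bounded_op H (\<lambda>x\<in>vcarrier H. x)"
  unfolding bounded_op_def by (auto intro!: exI[of _ 1])

lemma bop_id_unit: "is_unit (bop_alg H) (\<lambda>x\<in>vcarrier H. x)"
  unfolding is_unit_def
  by (auto intro!: bounded_op_eqI[of H] simp: bop_id_bounded bounded_op_closed)

declare adjoint_bounded [simp]

lemma bop_star_algebra: "star_algebra (bop_alg H)"
proof (unfold_locales, goal_cases)
  case (19 x) then show ?case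
    by (simp, intro adjoint_unique) (auto simp: adjoint_inner')
next
  case (20 x y) then show ?case
    by (simp, intro adjoint_unique) (auto simp: bounded_op_closed inner_simps adjoint_inner)
next
  case (21 x c) then show ?case
    by (simp, intro adjoint_unique) (auto simp: bounded_op_closed inner_simps adjoint_inner)
next
  case (22 x y) then show ?case
    by (simp, intro adjoint_unique) (auto simp: bounded_op_closed adjoint_inner)
qed (auto intro!: bounded_op_eqI[of H] simp: bounded_op_closed bounded_op_add bounded_op_scale
      scale_add_right scale_add_left scale_scale add_inverse add_ac)

lemma bop_cstar_seminormed: "cstar_seminormed (bop_alg H)"
proof -
  interpret B: star_algebra "bop_alg H" by (rule bop_star_algebra)
  have scale_le: "opnorm H (vscale (bop_alg H) c R) \<le> cmod c * opnorm H R"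
    if "bounded_op H R" for c R
    using that by (intro opnorm_le)
      (auto simp: opnorm_nonneg hnorm_scale bounded_op_closed mult.assoc intro!: mult_left_mono opnorm_bound)
  show ?thesis
  proof (unfold_locales, goal_cases)
    case (1 R) then show ?case by (simp add: opnorm_nonneg)
  next
    case (2 R c)
    show ?case
    proof (cases "c = 0")
      case True
      then have "vscale (bop_alg H) c R = vzero (bop_alg H)" using 2 by (metis B.scale_zero_left)
      moreover have "opnorm H (vzero (bop_alg H)) \<le> 0" by (intro opnorm_le) auto
      moreover have "0 \<le> opnorm H (vzero (bop_alg H))" by (intro opnorm_nonneg) (simp add: bop_zero_bounded)
      ultimately show ?thesis using True by (simp only: bop_alg_simps) simp
    next
      case False
      \<comment> \<open>The reverse inequality is \<open>scale_le\<close> for the scalar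
        1/c.\<close>
      have "R = vscale (bop_alg H) (1 / c) (vscale (bop_alg H) c R)"
        using 2 False B.scale_scale[OF 2, of "1 / c" c] B.scale_one[OF 2] by simp
      then have "opnorm H R \<le> cmod (1 / c) * opnorm H (vscale (bop_alg H) c R)"
        using scale_le[of "vscale (bop_alg H) c R" "1 / c"] 2 by (simp add: bop_scale_bounded)
      then have "cmod c * opnorm H R \<le> opnorm H (vscale (bop_alg H) c R)"
        using False by (simp add: norm_divide field_simps)
      then show ?thesis using scale_le[of R c] 2 by simp
    qed
  next
    case (3 S R)
    have "hnorm H (vadd H (S x) (R x)) \<le> (opnorm H S + opnorm H R) * hnorm H x"
      if "x \<in> vcarrier H" for x
      using that 3 hnorm_triangle[of "S x" "R x"] opnorm_bound[of S x] opnorm_bound[of R x]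
      by (simp add: bounded_op_closed distrib_right)
    then show ?case using 3 by (auto simp: opnorm_nonneg intro!: opnorm_le)
  next
    case (4 S R)
    then show ?case
      by (auto simp: opnorm_nonneg intro!: opnorm_le bop_compose_bound)
  next
    case (5 R)
    then have R: "bounded_op H R" by simp
    \<comment> \<open>||R x||^2 = <x, R*R x> and Cauchy-Schwarz bound ||R||^2 by ||R*R||. The other
      direction is submultiplicativity, once ||R*|| is known to be at most ||R||.\<close>
    have sq: "(hnorm H (R x))\<^sup>2 \<le> opnorm H (amult (bop_alg H) (adjoint_op H R) R) * (hnorm H x)\<^sup>2"
      if x: "x \<in> vcarrier H" for x
    proof -
      have "(hnorm H (R x))\<^sup>2 = Re (hinner H x (adjoint_op H R (R x)))"
        using R x by (simp add: hnorm_sq bounded_op_closed adjoint_inner)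
      also have "\<dots> \<le> hnorm H x * hnorm H (adjoint_op H R (R x))"
        using R x by (intro order_trans[OF complex_Re_le_cmod cauchy_schwarz])
          (auto simp: bounded_op_closed adjoint_bounded)
      also have "hnorm H (adjoint_op H R (R x)) = hnorm H (amult (bop_alg H) (adjoint_op H R) R x)"
        using x by simp
      also have "hnorm H x * \<dots> \<le> hnorm H x * (opnorm H (amult (bop_alg H) (adjoint_op H R) R) * hnorm H x)"
        using R x by (intro mult_left_mono opnorm_bound) auto
      finally show ?thesis
        using x by (simp add: power2_eq_square mult_ac)
    qed
    let ?N = "opnorm H (amult (bop_alg H) (adjoint_op H R) R)"
    have N0: "0 \<le> ?N" using R by (auto intro!: opnorm_nonneg)
    have le1: "opnorm H R \<le> sqrt ?N"
    proof (rule opnorm_le)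
      fix x assume x: "x \<in> vcarrier H"
      show "hnorm H (R x) \<le> sqrt ?N * hnorm H x"
        by (rule power2_le_imp_le) (use sq[OF x] N0 x in \<open>auto simp: power_mult_distrib\<close>)
    qed (use N0 in simp)
    have adj: "opnorm H (adjoint_op H R) \<le> opnorm H R"
    proof (rule opnorm_le)
      fix x assume x: "x \<in> vcarrier H"
      let ?y = "adjoint_op H R x"
      have y: "?y \<in> vcarrier H" using R x by (simp add: bounded_op_closed adjoint_bounded)
      have "(hnorm H ?y)\<^sup>2 = Re (hinner H (R ?y) x)"
        using R x y by (simp add: hnorm_sq adjoint_inner)
      also have "\<dots> \<le> hnorm H (R ?y) * hnorm H x"
        using R x y by (intro order_trans[OF complex_Re_le_cmod cauchy_schwarz]) (auto simp: bounded_op_closed)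
      also have "\<dots> \<le> opnorm H R * hnorm H ?y * hnorm H x"
        using R x y by (intro mult_right_mono opnorm_bound) auto
      finally show "hnorm H ?y \<le> opnorm H R * hnorm H x"
        using hnorm_nonneg[OF y] hnorm_nonneg[OF x] opnorm_nonneg[OF R]
        by (cases "hnorm H ?y = 0") (auto simp: power2_eq_square)
    qed (use R opnorm_nonneg in simp)
    have "?N \<le> opnorm H (adjoint_op H R) * opnorm H R"
      using R by (intro opnorm_le) (auto simp: opnorm_nonneg adjoint_bounded intro!: bop_compose_bound)
    also have "\<dots> \<le> (opnorm H R)\<^sup>2"
      using adj opnorm_nonneg[OF R] by (simp add: power2_eq_square mult_right_mono)
    finally have "?N \<le> (opnorm H R)\<^sup>2" .
    moreover have "(opnorm H R)\<^sup>2 \<le> ?N"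
      using le1 opnorm_nonneg[OF R] N0 real_le_rsqrt real_sqrt_le_iff
      by (metis power_mono real_sqrt_pow2)
    ultimately show ?case by simp
  qed
qed

end

section \<open>The free *-algebra and its evaluation homomorphisms\<close>

text \<open>The empty word is the unit of convolution, so scalar multiplication is a ring
  multiplication and inherits the ring laws.\<close>

lemma fscale_conv_mult: "fscale c x = Poly_Mapping.single 0 c * x"
  by (simp add: fscale_def mult_map_scale_conv_mult)

lemma fscale_add_right: "fscale c (x + y) = fscale c x + fscale c y"
  by (simp add: fscale_conv_mult distrib_left)

lemma fscale_add_left: "fscale (c + d) x = fscale c x + fscale d x"
  by (rule poly_mapping_eqI) (simp add: lookup_fscale lookup_add distrib_right)

lemma fscale_fscale [simp]: "fscale c (fscale d x) = fscale (c * d) x"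
  by (rule poly_mapping_eqI) (simp add: lookup_fscale)

lemma fscale_one [simp]: "fscale 1 x = x"
  by (rule poly_mapping_eqI) (simp add: lookup_fscale)

lemma fscale_0_left [simp]: "fscale 0 x = 0"
  by (rule poly_mapping_eqI) (simp add: lookup_fscale)

lemma fscale_0_right [simp]: "fscale c 0 = 0"
  by (simp add: fscale_conv_mult)

lemma fscale_minus_one: "fscale (-1) x = - x"
  by (rule poly_mapping_eqI) (simp add: lookup_fscale)

lemma fscale_minus_right: "fscale c (x - y) = fscale c x - fscale c y"
  by (simp add: fscale_conv_mult right_diff_distrib)

lemma fscale_mult_left: "fscale c x * y = fscale c (x * y)"
  by (simp add: fscale_conv_mult mult.assoc)

lemma fscale_single [simp]: "fscale c (Poly_Mapping.single w d) = Poly_Mapping.single w (c * d)"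
  by (simp add: fscale_conv_mult mult_single)

lemma sum_singles:
  fixes x :: "'a \<Rightarrow>\<^sub>0 'b::comm_monoid_add"
  shows "x = (\<Sum>w\<in>Poly_Mapping.keys x. Poly_Mapping.single w (Poly_Mapping.lookup x w))"
proof (rule poly_mapping_eqI)
  fix k
  show "Poly_Mapping.lookup x k
      = Poly_Mapping.lookup (\<Sum>w\<in>Poly_Mapping.keys x. Poly_Mapping.single w (Poly_Mapping.lookup x w)) k"
    by (cases "k \<in> Poly_Mapping.keys x")
      (auto simp: lookup_sum lookup_single when_def in_keys_iff)
qed

text \<open>The monomial case is restricted to words of \<open>x\<close>; this is what allows a
  membership or degree assumption on \<open>x\<close> to be used there.\<close>

lemma sum_singles_induct:
  fixes x :: "'a \<Rightarrow>\<^sub>0 'b::comm_monoid_add"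
  assumes "P 0"
    and "\<And>w c. w \<in> Poly_Mapping.keys x \<Longrightarrow> P (Poly_Mapping.single w c)"
    and add: "\<And>x y. P x \<Longrightarrow> P y \<Longrightarrow> P (x + y)"
  shows "P x"
proof -
  have "P (\<Sum>w\<in>S. Poly_Mapping.single w (Poly_Mapping.lookup x w))"
    if "finite S" "S \<subseteq> Poly_Mapping.keys x" for S
    using that by (induction) (auto intro: assms)
  then show ?thesis using sum_singles[of x] by (metis finite_keys order_refl)
qed

text \<open>Convolution over words is not commutative, so moving a scalar past the left factor is
  checked on monomials, where only the empty word has to be moved.\<close>

lemma fscale_mult_right: "x * fscale c y = fscale c (x * y)"
proof -
  have "Poly_Mapping.single w d * fscale c y = fscale c (Poly_Mapping.single w d * y)" for w d
    by (simp add: fscale_conv_mult mult.assoc[symmetric] mult_single mult.commute)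
  then show ?thesis
    by (induction x rule: sum_singles_induct) (auto simp: distrib_right fscale_add_right)
qed

lemma word_star_add: "word_star (u + v) = word_star v + word_star u"
  by (simp add: word_star_def plus_word_def)

lemma word_star_zero [simp]: "word_star 0 = 0"
  by (simp add: word_star_def zero_word_def)

lemma word_star_eq_iff: "word_star u = v \<longleftrightarrow> u = word_star v"
  by auto

lemma fstar_add: "fstar (x + y) = fstar x + fstar y"
  by (rule poly_mapping_eqI) (simp add: lookup_fstar lookup_add)

lemma fstar_minus: "fstar (x - y) = fstar x - fstar y"
  by (rule poly_mapping_eqI) (simp add: lookup_fstar lookup_minus)

lemma fstar_zero [simp]: "fstar 0 = 0"
  by (rule poly_mapping_eqI) (simp add: lookup_fstar)

lemma fstar_single [simp]: "fstar (Poly_Mapping.single w c) = Poly_Mapping.single (word_star w) (cnj c)"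
  by (rule poly_mapping_eqI) (auto simp: lookup_fstar lookup_single when_def word_star_eq_iff)

lemma fstar_fstar [simp]: "fstar (fstar x) = x"
  by (rule poly_mapping_eqI) (simp add: lookup_fstar)

lemma fstar_fscale: "fstar (fscale c x) = fscale (cnj c) (fstar x)"
  by (rule poly_mapping_eqI) (simp add: lookup_fstar lookup_fscale)

lemma fstar_sum: "fstar (sum f S) = (\<Sum>i\<in>S. fstar (f i))"
  by (induction S rule: infinite_finite_induct) (simp_all add: fstar_add)

lemma fstar_mult: "fstar (x * y) = fstar y * fstar x"
proof (induction x rule: sum_singles_induct)
  case (2 w c)
  show ?case
    by (induction y rule: sum_singles_induct)
      (auto simp: mult_single word_star_add mult.commute fstar_add distrib_left distrib_right)
qed (auto simp: fstar_add distrib_left distrib_right)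

lemma keys_fscale: "Poly_Mapping.keys (fscale c x) \<subseteq> Poly_Mapping.keys x"
  by (auto simp: in_keys_iff lookup_fscale)

lemma keys_fstar: "Poly_Mapping.keys (fstar x) = word_star ` Poly_Mapping.keys x"
  by (auto simp: in_keys_iff lookup_fstar) (metis image_eqI in_keys_iff word_star_word_star)

lemma mem_free_star:
  "x \<in> vcarrier (free_star G) \<longleftrightarrow>
    (\<forall>w\<in>Poly_Mapping.keys x. w \<noteq> 0 \<and> set (letters w) \<subseteq> G <+> G)"
  by (simp add: free_star_def)

lemma free_star_simps [simp]:
  "vzero (free_star G) = 0" "vadd (free_star G) = (+)" "vscale (free_star G) = fscale"
  "amult (free_star G) = (*)" "astar (free_star G) = fstar"
  by (simp_all add: free_star_def)

lemma zero_mem [simp]: "0 \<in> vcarrier (free_star G)"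
  by (simp add: mem_free_star)

lemma gen_mem [simp]: "gen g \<in> vcarrier (free_star G) \<longleftrightarrow> g \<in> G"
  by (auto simp: mem_free_star gen_def zero_word_def)

lemma add_mem [simp]:
  "\<lbrakk>x \<in> vcarrier (free_star G); y \<in> vcarrier (free_star G)\<rbrakk> \<Longrightarrow> x + y \<in> vcarrier (free_star G)"
  using Poly_Mapping.keys_add[of x y] unfolding mem_free_star by blast

lemma fscale_mem [simp]: "x \<in> vcarrier (free_star G) \<Longrightarrow> fscale c x \<in> vcarrier (free_star G)"
  using keys_fscale[of c x] unfolding mem_free_star by blast

lemma uminus_mem [simp]: "x \<in> vcarrier (free_star G) \<Longrightarrow> - x \<in> vcarrier (free_star G)"
  using fscale_mem[of x G "-1"] by (simp add: fscale_minus_one)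

lemma minus_mem [simp]:
  "\<lbrakk>x \<in> vcarrier (free_star G); y \<in> vcarrier (free_star G)\<rbrakk> \<Longrightarrow> x - y \<in> vcarrier (free_star G)"
  using add_mem[of x G "- y"] by simp

lemma sum_mem [simp]:
  "(\<And>i. i \<in> S \<Longrightarrow> f i \<in> vcarrier (free_star G)) \<Longrightarrow> sum f S \<in> vcarrier (free_star G)"
  by (induction S rule: infinite_finite_induct) auto

lemma word_add_eq_zero: "(u :: 'l word) + v = 0 \<longleftrightarrow> u = 0 \<and> v = 0"
  by (cases u; cases v) (simp add: plus_word_def zero_word_def)

lemma letters_add [simp]: "letters (u + v) = letters u @ letters v"
  by (simp add: plus_word_def)

lemma mult_mem [simp]:
  "\<lbrakk>x \<in> vcarrier (free_star G); y \<in> vcarrier (free_star G)\<rbrakk> \<Longrightarrow> x * y \<in> vcarrier (free_star G)"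
  using keys_mult[of x y] unfolding mem_free_star by (fastforce simp: word_add_eq_zero)

lemma letter_star_Plus: "letter_star l \<in> G <+> G \<longleftrightarrow> l \<in> G <+> G"
  by (cases l) auto

lemma fstar_mem [simp]: "x \<in> vcarrier (free_star G) \<Longrightarrow> fstar x \<in> vcarrier (free_star G)"
  unfolding mem_free_star keys_fstar
  by (auto simp: word_star_def subset_iff letter_star_Plus zero_word_def simp del: Plus_def)
    (metis word.collapse)+

lemma free_star_minus [simp]: "vminus (free_star G) x y = x - y"
  by (simp add: vminus_def fscale_minus_one)

lemma free_star_algebra: "star_algebra (free_star G)"
  by unfold_locales
    (auto simp: add.assoc add.commute fscale_add_right fscale_add_left fscale_minus_one mult.assoc
      distrib_left distrib_right fscale_mult_left fscale_mult_right fstar_add fstar_fscale fstar_mult)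

lemma letter_cases: "Poly_Mapping.single (Word [l]) (1 :: complex) = (case l of Inl g \<Rightarrow> gen g | Inr g \<Rightarrow> fstar (gen g))"
  by (cases l) (auto simp: gen_def word_star_def)

lemma single_Cons:
  "Poly_Mapping.single (Word (l # ls)) c
    = Poly_Mapping.single (Word [l]) (1 :: complex) * Poly_Mapping.single (Word ls) c"
  by (simp add: mult_single plus_word_def)

text \<open>A nonempty word is a product of letters, and a letter is a generator or its star.
  One-letter words form the base case because the empty word lies outside the carrier.\<close>

lemma free_star_induct [consumes 1, case_names zero gen add scale mult star]:
  assumes x: "x \<in> vcarrier (free_star G)"
    and zero: "P 0"
    and gen: "\<And>g. g \<in> G \<Longrightarrow> P (gen g)"
    and add: "\<And>x y. \<lbrakk>x \<in> vcarrier (free_star G); y \<in> vcarrier (free_star G); P x; P y\<rbrakk> \<Longrightarrow> P (x + y)"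
    and scale: "\<And>c x. \<lbrakk>x \<in> vcarrier (free_star G); P x\<rbrakk> \<Longrightarrow> P (fscale c x)"
    and mult: "\<And>x y. \<lbrakk>x \<in> vcarrier (free_star G); y \<in> vcarrier (free_star G); P x; P y\<rbrakk> \<Longrightarrow> P (x * y)"
    and star: "\<And>x. \<lbrakk>x \<in> vcarrier (free_star G); P x\<rbrakk> \<Longrightarrow> P (fstar x)"
  shows "P x"
proof -
  let ?Q = "\<lambda>x. x \<in> vcarrier (free_star G) \<and> P x"
  have letter: "?Q (Poly_Mapping.single (Word [l]) 1)" if "l \<in> G <+> G" for l
    using that by (auto simp: letter_cases gen star)
  have word: "?Q (Poly_Mapping.single (Word ls) 1)" if "ls \<noteq> []" "set ls \<subseteq> G <+> G" for ls
    using that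
  proof (induction ls)
    case (Cons l ls)
    then show ?case
    proof (cases "ls = []")
      case False
      then have "?Q (Poly_Mapping.single (Word ls) 1)" "?Q (Poly_Mapping.single (Word [l]) 1)"
        using Cons letter[of l] by auto
      then show ?thesis using mult single_Cons[of l ls 1] by simp
    qed (use Cons letter[of l] in simp)
  qed simp
  have single: "?Q (Poly_Mapping.single w c)" if "w \<in> Poly_Mapping.keys x" for w c
  proof -
    have "letters w \<noteq> []" "set (letters w) \<subseteq> G <+> G"
      using x that unfolding mem_free_star by (metis word.collapse zero_word_def, blast)
    then have "?Q (Poly_Mapping.single w 1)" using word[of "letters w"] by simp
    then show ?thesis using scale[of "Poly_Mapping.single w 1" c] fscale_mem[of "Poly_Mapping.single w 1" G c] by simp
  qed
  have "?Q x" by (rule sum_singles_induct[where P = ?Q]) (use single zero add in auto)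
  then show ?thesis by simp
qed

section \<open>Evaluation of the free *-algebra in a unital *-algebra\<close>

fun letter_val :: "('a, 'm) star_alg_scheme \<Rightarrow> ('g \<Rightarrow> 'a) \<Rightarrow> 'g + 'g \<Rightarrow> 'a" where
  "letter_val A t (Inl g) = t g"
| "letter_val A t (Inr g) = astar A (t g)"

definition word_val :: "('a, 'm) star_alg_scheme \<Rightarrow> 'a \<Rightarrow> ('g \<Rightarrow> 'a) \<Rightarrow> ('g + 'g) word \<Rightarrow> 'a" where
  "word_val A e t w = foldr (\<lambda>l. amult A (letter_val A t l)) (letters w) e"

text \<open>The target is a carrier-based record, not a type class, so the finite sum is a
  \<open>finprod\<close> in the commutative monoid formed by \<open>vadd\<close> and
  \<open>vzero\<close>.\<close>

definition ev :: "('a, 'm) star_alg_scheme \<Rightarrow> 'a \<Rightarrow> ('g \<Rightarrow> 'a) \<Rightarrow> 'g free_alg \<Rightarrow> 'a" where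
  "ev A e t x = finprod \<lparr>carrier = vcarrier A, monoid.mult = vadd A, one = vzero A\<rparr>
     (\<lambda>w. vscale A (Poly_Mapping.lookup x w) (word_val A e t w)) (Poly_Mapping.keys x)"

context star_algebra
begin

declare mult_closed [simp] star_closed [simp] star_star [simp]

lemma mult_zero_left [simp]: "x \<in> vcarrier A \<Longrightarrow> amult A (vzero A) x = vzero A"
  by (metis mult_scale_left scale_zero_left mult_closed zero_closed)

lemma mult_zero_right [simp]: "x \<in> vcarrier A \<Longrightarrow> amult A x (vzero A) = vzero A"
  by (metis mult_scale_right scale_zero_left mult_closed zero_closed)

lemma star_zero [simp]: "astar A (vzero A) = vzero A"
  by (metis star_scale scale_zero_left zero_closed complex_cnj_zero star_closed)

lemma is_unit_unique: "is_unit A e \<Longrightarrow> is_unit A e' \<Longrightarrow> e = e'"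
  unfolding is_unit_def by metis

lemma aunit_eq: "is_unit A e \<Longrightarrow> aunit A = e"
  unfolding aunit_def by (rule the_equality) (auto intro: is_unit_unique)

lemma star_unit: "is_unit A e \<Longrightarrow> astar A e = e"
  unfolding is_unit_def by (metis star_closed star_mult star_star)

lemma mult_minus_left:
  "\<lbrakk>x \<in> vcarrier A; y \<in> vcarrier A; z \<in> vcarrier A\<rbrakk>
    \<Longrightarrow> amult A (vminus A x y) z = vminus A (amult A x z) (amult A y z)"
  by (simp add: vminus_def mult_add_left mult_scale_left)

lemma mult_minus_right:
  "\<lbrakk>x \<in> vcarrier A; y \<in> vcarrier A; z \<in> vcarrier A\<rbrakk>
    \<Longrightarrow> amult A x (vminus A y z) = vminus A (amult A x y) (amult A x z)"
  by (simp add: vminus_def mult_add_right mult_scale_right)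

lemma star_minus:
  "\<lbrakk>x \<in> vcarrier A; y \<in> vcarrier A\<rbrakk> \<Longrightarrow> astar A (vminus A x y) = vminus A (astar A x) (astar A y)"
  by (simp add: vminus_def star_add star_scale)

end

text \<open>\<open>t\<close> takes values in the carrier on the whole type of generators, so the
  evaluation is a homomorphism without side conditions; its uses send letters with an index outside
  \<open>I\<close> to zero.\<close>

locale evaluation = star_algebra A for A :: "('a, 'm) star_alg_scheme" +
  fixes e :: 'a and t :: "'g \<Rightarrow> 'a"
  assumes unit: "is_unit A e" and val_closed [simp]: "t g \<in> vcarrier A"
begin

lemma unit_closed [simp]: "e \<in> vcarrier A"
  and unit_mult [simp]: "x \<in> vcarrier A \<Longrightarrow> amult A e x = x" "x \<in> vcarrier A \<Longrightarrow> amult A x e = x"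
  using unit by (auto simp: is_unit_def)

lemma unit_star [simp]: "astar A e = e"
  by (rule star_unit[OF unit])

lemma letter_val_closed [simp]: "letter_val A t l \<in> vcarrier A"
  by (cases l) auto

lemma word_val_closed [simp]: "word_val A e t w \<in> vcarrier A"
proof -
  have "foldr (\<lambda>l. amult A (letter_val A t l)) ls e \<in> vcarrier A" for ls
    by (induction ls) auto
  then show ?thesis by (simp add: word_val_def)
qed

lemma word_val_zero: "word_val A e t 0 = e"
  by (simp add: word_val_def zero_word_def)

lemma word_val_add: "word_val A e t (u + v) = amult A (word_val A e t u) (word_val A e t v)"
proof -
  have "foldr (\<lambda>l. amult A (letter_val A t l)) us (word_val A e t v)
      = amult A (foldr (\<lambda>l. amult A (letter_val A t l)) us e) (word_val A e t v)" for us
  proof (induction us)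
    case (Cons l us)
    have "foldr (\<lambda>l. amult A (letter_val A t l)) us e \<in> vcarrier A"
      using word_val_closed[of "Word us"] by (simp add: word_val_def)
    then show ?case using Cons by (simp add: mult_assoc)
  qed simp
  then show ?thesis by (simp add: word_val_def)
qed

lemma word_val_letter: "word_val A e t (Word [l]) = letter_val A t l"
  by (simp add: word_val_def)

lemma word_val_star: "word_val A e t (word_star w) = astar A (word_val A e t w)"
proof -
  have "word_val A e t (word_star (Word ls)) = astar A (word_val A e t (Word ls))" for ls
  proof (induction ls)
    case (Cons l ls)
    have "Word (l # ls) = Word [l] + Word ls" by (simp add: plus_word_def)
    moreover have "letter_val A t (letter_star l) = astar A (letter_val A t l)" by (cases l) auto
    moreover have "word_star (Word [l]) = Word [letter_star l]" by (simp add: word_star_def)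
    ultimately show ?case
      using Cons by (simp add: word_star_add word_val_add word_val_letter star_mult)
  qed (simp add: word_val_zero[unfolded zero_word_def] word_star_def)
  then show ?thesis by (metis word.collapse)
qed

interpretation cm: comm_monoid "\<lparr>carrier = vcarrier A, monoid.mult = vadd A, one = vzero A\<rparr>"
  by unfold_locales (auto simp: add_ac)

lemma ev_closed [simp]: "ev A e t x \<in> vcarrier A"
  unfolding ev_def by (rule cm.finprod_closed[simplified]) simp

text \<open>Cancellation can shrink the support of a sum, so additivity is proved over a common
  finite set of words that contains all three supports.\<close>

lemma ev_superset:
  assumes "finite K" "Poly_Mapping.keys x \<subseteq> K"
  shows "ev A e t x = finprod \<lparr>carrier = vcarrier A, monoid.mult = vadd A, one = vzero A\<rparr>
     (\<lambda>w. vscale A (Poly_Mapping.lookup x w) (word_val A e t w)) K"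
  unfolding ev_def
  by (rule cm.finprod_mono_neutral_cong_left) (use assms in \<open>auto simp: in_keys_iff\<close>)

lemma ev_zero [simp]: "ev A e t 0 = vzero A"
  by (simp add: ev_def)

lemma ev_add: "ev A e t (x + y) = vadd A (ev A e t x) (ev A e t y)"
proof -
  let ?K = "Poly_Mapping.keys x \<union> Poly_Mapping.keys y"
  have *: "ev A e t z = finprod \<lparr>carrier = vcarrier A, monoid.mult = vadd A, one = vzero A\<rparr>
     (\<lambda>w. vscale A (Poly_Mapping.lookup z w) (word_val A e t w)) ?K" if "z \<in> {x, y, x + y}" for z
    using that Poly_Mapping.keys_add[of x y] by (intro ev_superset) auto
  show ?thesis
    by (subst (1 2 3) *)
      (use cm.finprod_multf[of "\<lambda>w. vscale A (Poly_Mapping.lookup x w) (word_val A e t w)" ?K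
        "\<lambda>w. vscale A (Poly_Mapping.lookup y w) (word_val A e t w)"]
       in \<open>auto simp: lookup_add scale_add_left Pi_iff\<close>)
qed

lemma ev_single: "ev A e t (Poly_Mapping.single w c) = vscale A c (word_val A e t w)"
  using ev_superset[of "{w}" "Poly_Mapping.single w c"]
  by (simp add: cm.finprod_insert[of "{}", simplified] split: if_splits)

lemma ev_gen [simp]: "ev A e t (gen g) = t g"
  by (simp add: gen_def ev_single word_val_letter)

lemma ev_mult: "ev A e t (x * y) = amult A (ev A e t x) (ev A e t y)"
proof (induction x rule: sum_singles_induct)
  case (2 w c)
  show ?case
    by (induction y rule: sum_singles_induct)
      (auto simp: mult_single ev_single word_val_add ev_add distrib_left mult_add_right
        mult_scale_left mult_scale_right scale_scale mult.commute)
qed (auto simp: ev_add distrib_right mult_add_left)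

lemma ev_scale: "ev A e t (fscale c x) = vscale A c (ev A e t x)"
  by (induction x rule: sum_singles_induct)
    (auto simp: ev_single scale_scale fscale_add_right scale_add_right ev_add)

lemma ev_minus: "ev A e t (x - y) = vminus A (ev A e t x) (ev A e t y)"
proof -
  have "x - y = x + fscale (-1) y" by (simp add: fscale_minus_one)
  then show ?thesis by (simp only: ev_add ev_scale vminus_def)
qed

lemma ev_star: "ev A e t (fstar x) = astar A (ev A e t x)"
  by (induction x rule: sum_singles_induct)
    (auto simp: ev_single word_val_star star_scale ev_add star_add fstar_add)

lemma star_hom_ev: "star_hom (free_star G) A (ev A e t)"
  by (auto simp: star_hom_def ev_add ev_scale ev_mult ev_star)

end

section \<open>Separation and completion of a C*-seminorm\<close>

lemma cstar_algebra_iff: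
  "cstar_algebra A \<longleftrightarrow> cstar_seminormed A \<and>
    (\<forall>x\<in>vcarrier A. anorm A x = 0 \<longrightarrow> x = vzero A) \<and> vcomplete A (anorm A)"
  by (auto simp: cstar_algebra_def cstar_algebra_axioms_def cstar_seminormed_def cstar_seminormed_axioms_def)

context cstar_seminormed
begin

lemma seminormed: "seminormed_space A (anorm A)"
  by unfold_locales (auto simp: semi_nonneg semi_scale semi_triangle)

sublocale ns: seminormed_space A "anorm A"
  by (rule seminormed)

declare semi_nonneg [simp]

text \<open>||y||^2 = ||y*y|| and submultiplicativity give that ||y|| is at most ||y*||, and the
  roles of y and y* can be exchanged.\<close>

lemma semi_star: "x \<in> vcarrier A \<Longrightarrow> anorm A (astar A x) = anorm A x"
proof -
  have "anorm A y \<le> anorm A (astar A y)" if y: "y \<in> vcarrier A" for y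
  proof (cases "anorm A y = 0")
    case False
    have "anorm A y * anorm A y \<le> anorm A (astar A y) * anorm A y"
      using semi_cstar[OF y] semi_mult[of "astar A y" y] y by (simp add: power2_eq_square)
    then show ?thesis using False y by (simp add: less_le)
  qed (use y in simp)
  from this[of x] this[of "astar A x"] show "x \<in> vcarrier A \<Longrightarrow> ?thesis" by simp
qed

text \<open>From xy - x'y' = x(y - y') + (x - x')y'. The continuity of multiplication rests on it,
  for sequences, for classes and for the fixed point iteration.\<close>

lemma semi_minus_mult:
  assumes "x \<in> vcarrier A" "y \<in> vcarrier A" "x' \<in> vcarrier A" "y' \<in> vcarrier A"
  shows "anorm A (vminus A (amult A x y) (amult A x' y'))
    \<le> anorm A x * anorm A (vminus A y y') + anorm A (vminus A x x') * anorm A y'"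
proof -
  have "vminus A (amult A x y) (amult A x' y')
      = vadd A (amult A x (vminus A y y')) (amult A (vminus A x x') y')"
    using assms by (simp add: mult_minus_left mult_minus_right minus_trans)
  then show ?thesis
    using assms semi_triangle[of "amult A x (vminus A y y')" "amult A (vminus A x x') y'"]
      semi_mult[of x "vminus A y y'"] semi_mult[of "vminus A x x'" y'] by simp
qed

lemma semi_minus_star:
  "\<lbrakk>x \<in> vcarrier A; y \<in> vcarrier A\<rbrakk>
    \<Longrightarrow> anorm A (vminus A (astar A x) (astar A y)) = anorm A (vminus A x y)"
  by (simp add: star_minus[symmetric] semi_star)

lemma vconverges_add:
  assumes "\<And>n. x n \<in> vcarrier A" "\<And>n. y n \<in> vcarrier A" "a \<in> vcarrier A" "b \<in> vcarrier A"
    "vconverges A (anorm A) x a" "vconverges A (anorm A) y b"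
  shows "vconverges A (anorm A) (\<lambda>n. vadd A (x n) (y n)) (vadd A a b)"
  unfolding vconverges_def
proof (rule Lim_null_comparison)
  show "\<forall>\<^sub>F n in sequentially. norm (anorm A (vminus A (vadd A (x n) (y n)) (vadd A a b)))
      \<le> anorm A (vminus A (x n) a) + anorm A (vminus A (y n) b)"
    using assms by (simp add: ns.nrm_minus_add)
  show "(\<lambda>n. anorm A (vminus A (x n) a) + anorm A (vminus A (y n) b)) \<longlonglongrightarrow> 0"
    using tendsto_add[OF assms(5,6)[unfolded vconverges_def]] by simp
qed

lemma vconverges_scale:
  assumes "\<And>n. x n \<in> vcarrier A" "a \<in> vcarrier A" "vconverges A (anorm A) x a"
  shows "vconverges A (anorm A) (\<lambda>n. vscale A c (x n)) (vscale A c a)"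
  using assms unfolding vconverges_def by (simp add: ns.nrm_scale_minus tendsto_mult_right_zero)

lemma vconverges_star:
  assumes "\<And>n. x n \<in> vcarrier A" "a \<in> vcarrier A" "vconverges A (anorm A) x a"
  shows "vconverges A (anorm A) (\<lambda>n. astar A (x n)) (astar A a)"
  using assms unfolding vconverges_def by (simp add: semi_minus_star)

lemma vconverges_mult:
  assumes "\<And>n. x n \<in> vcarrier A" "\<And>n. y n \<in> vcarrier A" "a \<in> vcarrier A" "b \<in> vcarrier A"
    "vconverges A (anorm A) x a" "vconverges A (anorm A) y b"
  shows "vconverges A (anorm A) (\<lambda>n. amult A (x n) (y n)) (amult A a b)"
  unfolding vconverges_def
proof (rule Lim_null_comparison)
  show "\<forall>\<^sub>F n in sequentially. norm (anorm A (vminus A (amult A (x n) (y n)) (amult A a b)))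
      \<le> anorm A (x n) * anorm A (vminus A (y n) b) + anorm A (vminus A (x n) a) * anorm A b"
    using assms by (simp add: semi_minus_mult)
  have "(\<lambda>n. anorm A (x n) * anorm A (vminus A (y n) b) + anorm A (vminus A (x n) a) * anorm A b)
      \<longlonglongrightarrow> anorm A a * 0 + 0 * anorm A b"
    using assms ns.vconverges_nrm[of x a] unfolding vconverges_def by (intro tendsto_intros) auto
  then show "(\<lambda>n. anorm A (x n) * anorm A (vminus A (y n) b) + anorm A (vminus A (x n) a) * anorm A b)
      \<longlonglongrightarrow> 0" by simp
qed

end

text \<open>The axioms are equations and inequalities in the operations and so pass to images under
  a map that preserves operations and norm. This serves the quotient map as well as copies of an
  algebra in another type.\<close>

lemma cstar_seminormed_image:
  assumes "cstar_seminormed A" and hom: "star_hom A B f"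
    and img: "vcarrier B = f ` vcarrier A" and zero: "f (vzero A) = vzero B"
    and nrm: "\<And>x. x \<in> vcarrier A \<Longrightarrow> anorm B (f x) = anorm A x"
  shows "cstar_seminormed B"
proof -
  interpret A: cstar_seminormed A by fact
  have ops: "\<And>x y. \<lbrakk>x \<in> vcarrier A; y \<in> vcarrier A\<rbrakk> \<Longrightarrow> vadd B (f x) (f y) = f (vadd A x y)"
    "\<And>x y. \<lbrakk>x \<in> vcarrier A; y \<in> vcarrier A\<rbrakk> \<Longrightarrow> amult B (f x) (f y) = f (amult A x y)"
    "\<And>c x. x \<in> vcarrier A \<Longrightarrow> vscale B c (f x) = f (vscale A c x)"
    "\<And>x. x \<in> vcarrier A \<Longrightarrow> astar B (f x) = f (astar A x)"
    using hom by (auto simp: star_hom_def)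
  show ?thesis
    by unfold_locales
      (auto simp: img ops zero[symmetric] nrm A.add_ac A.add_inverse A.scale_add_right A.scale_add_left
        A.scale_scale A.mult_assoc A.mult_add_left A.mult_add_right A.mult_scale_left A.mult_scale_right
        A.star_add A.star_scale A.star_mult A.semi_scale A.semi_triangle A.semi_mult A.semi_cstar)
qed

section \<open>The quotient by the null space\<close>

definition null_class :: "('a, 'm) nstar_alg_scheme \<Rightarrow> 'a \<Rightarrow> 'a set" where
  "null_class A x = null_rel A `` {x}"

context cstar_seminormed
begin

lemma null_class_iff:
  "x' \<in> null_class A x \<longleftrightarrow> x \<in> vcarrier A \<and> x' \<in> vcarrier A \<and> anorm A (vminus A x x') = 0"
  by (auto simp: null_class_def null_rel_def)

lemma null_class_self: "x \<in> vcarrier A \<Longrightarrow> x \<in> null_class A x"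
  by (simp add: null_class_iff)

lemma null_class_eq_iff:
  assumes x: "x \<in> vcarrier A" and y: "y \<in> vcarrier A"
  shows "null_class A x = null_class A y \<longleftrightarrow> anorm A (vminus A x y) = 0"
proof
  assume "null_class A x = null_class A y"
  then have "y \<in> null_class A x" using null_class_self[OF y] by simp
  then show "anorm A (vminus A x y) = 0" by (simp add: null_class_iff)
next
  assume 0: "anorm A (vminus A x y) = 0"
  have "anorm A (vminus A x z) = 0 \<longleftrightarrow> anorm A (vminus A y z) = 0" if z: "z \<in> vcarrier A" for z
    using ns.nrm_minus_trans[OF x y z] ns.nrm_minus_trans[OF y x z] 0 ns.nrm_minus_commute[OF x y]
      semi_nonneg[OF minus_closed[OF x z]] semi_nonneg[OF minus_closed[OF y z]]
    by (intro iffI; linarith)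
  then show "null_class A x = null_class A y"
    using x y by (auto simp: null_class_iff)
qed

lemma null_class_eqI:
  "\<lbrakk>x \<in> vcarrier A; y \<in> vcarrier A; anorm A (vminus A x y) \<le> 0\<rbrakk>
    \<Longrightarrow> null_class A x = null_class A y"
  by (simp add: null_class_eq_iff antisym)

lemma separation_carrier: "vcarrier (separation A) = null_class A ` vcarrier A"
  by (auto simp: separation_def Let_def quotient_def null_class_def)

lemma null_class_congI:
  assumes "x' \<in> null_class A x" "y' \<in> null_class A y"
  shows "null_class A (vadd A x' y') = null_class A (vadd A x y)"
    "null_class A (vscale A c x') = null_class A (vscale A c x)"
    "null_class A (amult A x' y') = null_class A (amult A x y)"
    "null_class A (astar A x') = null_class A (astar A x)"
    "anorm A x' = anorm A x"
proof -
  have *: "x \<in> vcarrier A" "x' \<in> vcarrier A" "y \<in> vcarrier A" "y' \<in> vcarrier A"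
    "anorm A (vminus A x' x) = 0" "anorm A (vminus A y' y) = 0"
    using assms ns.nrm_minus_commute by (auto simp: null_class_iff)
  show "null_class A (vadd A x' y') = null_class A (vadd A x y)"
    using ns.nrm_minus_add[of x' y' x y] * by (intro null_class_eqI) auto
  show "null_class A (vscale A c x') = null_class A (vscale A c x)"
    using * by (simp add: null_class_eq_iff ns.nrm_scale_minus)
  show "null_class A (amult A x' y') = null_class A (amult A x y)"
    using semi_minus_mult[of x' y' x y] * by (intro null_class_eqI) auto
  show "null_class A (astar A x') = null_class A (astar A x)"
    using * by (simp add: null_class_eq_iff semi_minus_star)
  show "anorm A x' = anorm A x"
    using ns.abs_nrm_diff[of x' x] * by simp
qed

text \<open>The quotient operations are unions over representatives; by the congruence rules all
  members of such a union coincide.\<close>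

lemma separation_add:
  assumes x: "x \<in> vcarrier A" and y: "y \<in> vcarrier A"
  shows "vadd (separation A) (null_class A x) (null_class A y) = null_class A (vadd A x y)"
  unfolding separation_def Let_def cvs.simps null_class_def[symmetric]
  by (intro UN_constant_eq[OF null_class_self[OF x]] UN_constant_eq[OF null_class_self[OF y]]
      ballI null_class_congI)

lemma separation_scale:
  assumes x: "x \<in> vcarrier A"
  shows "vscale (separation A) c (null_class A x) = null_class A (vscale A c x)"
  unfolding separation_def Let_def cvs.simps null_class_def[symmetric]
  by (intro UN_constant_eq[OF null_class_self[OF x]] ballI null_class_congI(2)[OF _ null_class_self[OF x]])

lemma separation_mult:
  assumes x: "x \<in> vcarrier A" and y: "y \<in> vcarrier A"
  shows "amult (separation A) (null_class A x) (null_class A y) = null_class A (amult A x y)"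
  unfolding separation_def Let_def star_alg.simps null_class_def[symmetric]
  by (intro UN_constant_eq[OF null_class_self[OF x]] UN_constant_eq[OF null_class_self[OF y]]
      ballI null_class_congI)

lemma separation_star:
  assumes x: "x \<in> vcarrier A"
  shows "astar (separation A) (null_class A x) = null_class A (astar A x)"
  unfolding separation_def Let_def star_alg.simps null_class_def[symmetric]
  by (intro UN_constant_eq[OF null_class_self[OF x]] ballI null_class_congI(4)[OF _ null_class_self[OF x]])

text \<open>The seminorm is constant on a class, so the infimum is taken over a single
  value.\<close>

lemma separation_norm:
  assumes x: "x \<in> vcarrier A"
  shows "anorm (separation A) (null_class A x) = anorm A x"
proof -
  have "anorm A ` null_class A x = {anorm A x}"
    using null_class_congI(5)[OF _ null_class_self[OF x]] null_class_self[OF x] by blast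
  then show ?thesis by (simp add: separation_def Let_def)
qed

lemmas separation_ops = separation_add separation_scale separation_mult separation_star separation_norm

lemma separation_zero: "vzero (separation A) = null_class A (vzero A)"
  by (simp add: separation_def Let_def null_class_def)

lemma separation_hom: "star_hom A (separation A) (null_class A)"
  by (auto simp: star_hom_def separation_ops separation_carrier)

lemma separation_cstar_seminormed: "cstar_seminormed (separation A)"
  by (rule cstar_seminormed_image[OF cstar_seminormed_axioms separation_hom separation_carrier])
    (auto simp: separation_zero separation_ops)

lemma separation_definite:
  "X \<in> vcarrier (separation A) \<Longrightarrow> anorm (separation A) X = 0 \<Longrightarrow> X = vzero (separation A)"
  using null_class_eqI[OF _ zero_closed]
  by (auto simp only: separation_carrier separation_norm separation_zero minus_zero)

lemma separation_minus:
  "\<lbrakk>x \<in> vcarrier A; y \<in> vcarrier A\<rbrakk>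
    \<Longrightarrow> vminus (separation A) (null_class A x) (null_class A y) = null_class A (vminus A x y)"
  by (simp add: vminus_def separation_ops)

text \<open>The norm of a class is the norm of any representative, so a Cauchy sequence of classes
  lifts to a Cauchy sequence without passing to a subsequence.\<close>

lemma separation_complete:
  assumes "vcomplete A (anorm A)"
  shows "vcomplete (separation A) (anorm (separation A))"
  unfolding vcomplete_def
proof (intro allI impI)
  fix X assume X: "vcauchy (separation A) (anorm (separation A)) X"
  have "\<forall>n. \<exists>x\<in>vcarrier A. X n = null_class A x"
    using vcauchy_closed[OF X] by (auto simp: separation_carrier)
  then obtain x where x: "\<And>n. x n \<in> vcarrier A" "\<And>n. X n = null_class A (x n)" by metis
  have "vcauchy A (anorm A) x"
    using X x(1) unfolding vcauchy_def x(2) by (simp add: separation_minus separation_ops)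
  then obtain l where l: "l \<in> vcarrier A" "vconverges A (anorm A) x l"
    using assms unfolding vcomplete_def by blast
  then show "\<exists>l\<in>vcarrier (separation A). vconverges (separation A) (anorm (separation A)) X l"
    using x by (auto simp: vconverges_def separation_carrier separation_minus separation_ops)
qed

section \<open>The algebra of Cauchy sequences and the completion\<close>

lemma cauchy_alg_simps [simp]:
  "vcarrier (cauchy_alg A) = {x. vcauchy A (anorm A) x}"
  "vzero (cauchy_alg A) = (\<lambda>n. vzero A)"
  "vadd (cauchy_alg A) x y = (\<lambda>n. vadd A (x n) (y n))"
  "vscale (cauchy_alg A) c x = (\<lambda>n. vscale A c (x n))"
  "amult (cauchy_alg A) x y = (\<lambda>n. amult A (x n) (y n))"
  "astar (cauchy_alg A) x = (\<lambda>n. astar A (x n))"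
  "anorm (cauchy_alg A) x = lim (\<lambda>n. anorm A (x n))"
  by (simp_all add: cauchy_alg_def)

lemma cauchy_alg_minus [simp]: "vminus (cauchy_alg A) x y = (\<lambda>n. vminus A (x n) (y n))"
  by (simp add: vminus_def)

lemma vcauchy_const: "x \<in> vcarrier A \<Longrightarrow> vcauchy A (anorm A) (\<lambda>n. x)"
  by (simp add: vcauchy_def)

lemma vcauchy_add:
  assumes x: "vcauchy A (anorm A) x" and y: "vcauchy A (anorm A) y"
  shows "vcauchy A (anorm A) (\<lambda>n. vadd A (x n) (y n))"
  unfolding vcauchy_def
proof (intro conjI allI impI)
  note c [simp] = vcauchy_closed[OF x] vcauchy_closed[OF y]
  fix e :: real assume e: "e > 0"
  obtain N1 where N1: "\<And>m n. m \<ge> N1 \<Longrightarrow> n \<ge> N1 \<Longrightarrow> anorm A (vminus A (x m) (x n)) < e / 2"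
    using vcauchyE[OF x, of "e / 2"] e by auto
  obtain N2 where N2: "\<And>m n. m \<ge> N2 \<Longrightarrow> n \<ge> N2 \<Longrightarrow> anorm A (vminus A (y m) (y n)) < e / 2"
    using vcauchyE[OF y, of "e / 2"] e by auto
  have "anorm A (vminus A (vadd A (x m) (y m)) (vadd A (x n) (y n))) < e"
    if "m \<ge> max N1 N2" "n \<ge> max N1 N2" for m n
    using ns.nrm_minus_add[of "x m" "y m" "x n" "y n"] N1[of m n] N2[of m n] that by simp
  then show "\<exists>N. \<forall>m\<ge>N. \<forall>n\<ge>N. anorm A (vminus A (vadd A (x m) (y m)) (vadd A (x n) (y n))) < e" by blast
qed (use vcauchy_closed[OF x] vcauchy_closed[OF y] in simp)

lemma vcauchy_mult:
  assumes x: "vcauchy A (anorm A) x" and y: "vcauchy A (anorm A) y"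
  shows "vcauchy A (anorm A) (\<lambda>n. amult A (x n) (y n))"
  unfolding vcauchy_def
proof (intro conjI allI impI)
  note c [simp] = vcauchy_closed[OF x] vcauchy_closed[OF y]
  fix e :: real assume e: "e > 0"
  obtain K where K: "K > 0" "\<And>n. anorm A (x n) \<le> K" using ns.vcauchy_bounded[OF x] by metis
  obtain L where L: "L > 0" "\<And>n. anorm A (y n) \<le> L" using ns.vcauchy_bounded[OF y] by metis
  \<comment> \<open>The tolerances are crossed: differences of \<open>x\<close> get multiplied by
    the bound \<open>L\<close> for \<open>y\<close>, and conversely.\<close>
  obtain N1 where N1: "\<And>m n. m \<ge> N1 \<Longrightarrow> n \<ge> N1 \<Longrightarrow> anorm A (vminus A (x m) (x n)) < e / (2 * L)"
    using vcauchyE[OF x, of "e / (2 * L)"] e L by auto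
  obtain N2 where N2: "\<And>m n. m \<ge> N2 \<Longrightarrow> n \<ge> N2 \<Longrightarrow> anorm A (vminus A (y m) (y n)) < e / (2 * K)"
    using vcauchyE[OF y, of "e / (2 * K)"] e K by auto
  have "anorm A (vminus A (amult A (x m) (y m)) (amult A (x n) (y n))) < e"
    if "m \<ge> max N1 N2" "n \<ge> max N1 N2" for m n
  proof -
    have "anorm A (x m) * anorm A (vminus A (y m) (y n)) \<le> K * anorm A (vminus A (y m) (y n))"
      using K by (intro mult_right_mono) auto
    also have "\<dots> < K * (e / (2 * K))"
      using K N2[of m n] that by (intro mult_strict_left_mono) auto
    finally have 1: "anorm A (x m) * anorm A (vminus A (y m) (y n)) < e / 2" using K by simp
    have "anorm A (vminus A (x m) (x n)) * anorm A (y n) \<le> anorm A (vminus A (x m) (x n)) * L"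
      using L by (intro mult_left_mono) auto
    also have "\<dots> < e / (2 * L) * L"
      using L N1[of m n] that by (intro mult_strict_right_mono) auto
    finally have "anorm A (vminus A (x m) (x n)) * anorm A (y n) < e / 2" using L by simp
    with 1 show ?thesis using semi_minus_mult[of "x m" "y m" "x n" "y n"] by simp
  qed
  then show "\<exists>N. \<forall>m\<ge>N. \<forall>n\<ge>N. anorm A (vminus A (amult A (x m) (y m)) (amult A (x n) (y n))) < e" by blast
qed (use vcauchy_closed[OF x] vcauchy_closed[OF y] in simp)

lemma vcauchy_scale:
  assumes x: "vcauchy A (anorm A) x"
  shows "vcauchy A (anorm A) (\<lambda>n. vscale A c (x n))"
proof (cases "c = 0")
  case True
  then show ?thesis using vcauchy_closed[OF x] by (simp add: vcauchy_const)
next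
  case False
  show ?thesis
    unfolding vcauchy_def
  proof (intro conjI allI impI)
    fix e :: real assume e: "e > 0"
    obtain N where N: "\<And>m n. m \<ge> N \<Longrightarrow> n \<ge> N \<Longrightarrow> anorm A (vminus A (x m) (x n)) < e / cmod c"
      using vcauchyE[OF x, of "e / cmod c"] e False by auto
    have "anorm A (vminus A (vscale A c (x m)) (vscale A c (x n))) < e" if "m \<ge> N" "n \<ge> N" for m n
      using N[OF that] False vcauchy_closed[OF x] by (simp add: ns.nrm_scale_minus field_simps)
    then show "\<exists>N. \<forall>m\<ge>N. \<forall>n\<ge>N. anorm A (vminus A (vscale A c (x m)) (vscale A c (x n))) < e" by blast
  qed (use vcauchy_closed[OF x] in simp)
qed

lemma vcauchy_star: "vcauchy A (anorm A) x \<Longrightarrow> vcauchy A (anorm A) (\<lambda>n. astar A (x n))"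
  by (simp add: vcauchy_def semi_minus_star)

lemma cauchy_norm_lim:
  assumes "vcauchy A (anorm A) x"
  shows "(\<lambda>n. anorm A (x n)) \<longlonglongrightarrow> lim (\<lambda>n. anorm A (x n))"
  using ns.vcauchy_nrm[OF assms] by (simp add: Cauchy_convergent_iff convergent_LIMSEQ_iff)

lemma cauchy_star_algebra: "star_algebra (cauchy_alg A)"
  by unfold_locales
    (auto simp: vcauchy_const vcauchy_add vcauchy_mult vcauchy_scale vcauchy_star vcauchy_closed
        add_ac add_inverse scale_add_right scale_add_left scale_scale mult_assoc mult_add_left mult_add_right
        mult_scale_left mult_scale_right star_add star_scale star_mult)

lemma cauchy_cstar_seminormed: "cstar_seminormed (cauchy_alg A)"
proof -
  interpret D: star_algebra "cauchy_alg A" by (rule cauchy_star_algebra)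
  note L = cauchy_norm_lim
  show ?thesis
  proof (unfold_locales, goal_cases)
    case (1 x)
    then have x: "vcauchy A (anorm A) x" by simp
    show ?case
      using LIMSEQ_le_const[OF L[OF x], of 0] vcauchy_closed[OF x] by auto
  next
    case (2 x c)
    then have x: "vcauchy A (anorm A) x" by simp
    have "(\<lambda>n. anorm A (vscale A c (x n))) \<longlonglongrightarrow> cmod c * lim (\<lambda>n. anorm A (x n))"
      using tendsto_mult_left[OF L[OF x], of "cmod c"] vcauchy_closed[OF x] by (simp add: semi_scale)
    then show ?case by (simp add: limI)
  next
    case (3 x y)
    then have x: "vcauchy A (anorm A) x" and y: "vcauchy A (anorm A) y" by auto
    show ?case
      using LIMSEQ_le[OF L[OF vcauchy_add[OF x y]] tendsto_add[OF L[OF x] L[OF y]]]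
        vcauchy_closed[OF x] vcauchy_closed[OF y] by (simp add: semi_triangle)
  next
    case (4 x y)
    then have x: "vcauchy A (anorm A) x" and y: "vcauchy A (anorm A) y" by auto
    show ?case
      using LIMSEQ_le[OF L[OF vcauchy_mult[OF x y]] tendsto_mult[OF L[OF x] L[OF y]]]
        vcauchy_closed[OF x] vcauchy_closed[OF y] by (simp add: semi_mult)
  next
    case (5 x)
    then have x: "vcauchy A (anorm A) x" by simp
    have "(\<lambda>n. anorm A (amult A (astar A (x n)) (x n))) \<longlonglongrightarrow> (lim (\<lambda>n. anorm A (x n)))\<^sup>2"
      using tendsto_power[OF L[OF x], of 2] vcauchy_closed[OF x] by (simp add: semi_cstar)
    then show ?case by (simp add: limI)
  qed
qed

lemma cauchy_complete: "vcomplete (cauchy_alg A) (anorm (cauchy_alg A))"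
  unfolding vcomplete_def
proof (intro allI impI)
  interpret D: cstar_seminormed "cauchy_alg A" by (rule cauchy_cstar_seminormed)
  fix X assume X: "vcauchy (cauchy_alg A) (anorm (cauchy_alg A)) X"
  have c: "vcauchy A (anorm A) (X n)" for n using vcauchy_closed[OF X, of n] by simp
  have cl [simp]: "X n k \<in> vcarrier A" for n k using vcauchy_closed[OF c] .
  have "\<exists>N. \<forall>j\<ge>N. \<forall>k\<ge>N. anorm A (vminus A (X n j) (X n k)) < 1 / Suc n" for n
    using c[of n] unfolding vcauchy_def by simp
  then obtain N where N: "\<And>n j k. j \<ge> N n \<Longrightarrow> k \<ge> N n \<Longrightarrow> anorm A (vminus A (X n j) (X n k)) < 1 / Suc n"
    by metis
  \<comment> \<open>The diagonal limit: from the index \<open>N n\<close> on, the sequence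
    \<open>X n\<close> stays within 1/(n + 1) of the value \<open>Y n\<close>.\<close>
  define Y where "Y n = X n (N n)" for n
  have clY [simp]: "Y n \<in> vcarrier A" for n by (simp add: Y_def)
  define d where "d m n = anorm (cauchy_alg A) (vminus (cauchy_alg A) (X m) (X n))" for m n
  have d_lim: "(\<lambda>k. anorm A (vminus A (X m k) (X n k))) \<longlonglongrightarrow> d m n" for m n
    using cauchy_norm_lim[of "vminus (cauchy_alg A) (X m) (X n)"] D.minus_closed[of "X m" "X n"] c
    by (simp add: d_def)
  \<comment> \<open>The route from \<open>Y m\<close> to \<open>Y n\<close> passes through
    \<open>X m k\<close> and \<open>X n k\<close> for large k; the length of its middle part tends
    to the distance of \<open>X m\<close> and \<open>X n\<close>.\<close>
  have Y_diff: "anorm A (vminus A (Y m) (Y n)) \<le> 1 / Suc m + 1 / Suc n + d m n" for m n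
  proof (rule LIMSEQ_le_const)
    show "(\<lambda>k. 1 / Suc m + 1 / Suc n + anorm A (vminus A (X m k) (X n k))) \<longlonglongrightarrow> 1 / Suc m + 1 / Suc n + d m n"
      by (intro tendsto_intros d_lim)
    have "anorm A (vminus A (Y m) (Y n)) \<le> 1 / Suc m + 1 / Suc n + anorm A (vminus A (X m k) (X n k))"
      if "k \<ge> max (N m) (N n)" for k
      using ns.nrm_minus_trans[of "Y m" "X m k" "Y n"] ns.nrm_minus_trans[of "X m k" "X n k" "Y n"]
        N[of m "N m" k] N[of n k "N n"] that by (simp add: Y_def)
    then show "\<exists>K. \<forall>k\<ge>K. anorm A (vminus A (Y m) (Y n)) \<le> 1 / Suc m + 1 / Suc n + anorm A (vminus A (X m k) (X n k))"
      by blast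
  qed
  have small: "\<exists>M. \<forall>m\<ge>M. \<forall>n\<ge>M. 1 / Suc m + anorm A (vminus A (Y m) (Y n)) < e" if e: "e > 0" for e
  proof -
    obtain M1 where M1: "inverse (real (Suc M1)) < e / 4" using reals_Archimedean[of "e / 4"] e by auto
    obtain M2 where M2: "\<And>m n. m \<ge> M2 \<Longrightarrow> n \<ge> M2 \<Longrightarrow> d m n < e / 4"
      using vcauchyE[OF X, of "e / 4"] e unfolding d_def by auto
    have "1 / Suc m + anorm A (vminus A (Y m) (Y n)) < e" if "m \<ge> max M1 M2" "n \<ge> max M1 M2" for m n
    proof -
      have "1 / Suc m \<le> 1 / Suc M1" "1 / Suc n \<le> 1 / Suc M1" using that by (auto simp: frac_le)
      then show ?thesis
        using Y_diff[of m n] M2[of m n] M1 that by (simp add: inverse_eq_divide)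
    qed
    then show ?thesis by blast
  qed
  have Y: "vcauchy A (anorm A) Y"
    unfolding vcauchy_def
  proof (intro conjI allI impI)
    fix e :: real assume "e > 0"
    then obtain M where M: "\<forall>m\<ge>M. \<forall>n\<ge>M. 1 / Suc m + anorm A (vminus A (Y m) (Y n)) < e"
      using small by metis
    have "anorm A (vminus A (Y m) (Y n)) < e" if "m \<ge> M" "n \<ge> M" for m n
      using M that by (smt (verit) divide_nonneg_nonneg of_nat_0_le_iff)
    then show "\<exists>M. \<forall>m\<ge>M. \<forall>n\<ge>M. anorm A (vminus A (Y m) (Y n)) < e" by blast
  qed simp
  have "vconverges (cauchy_alg A) (anorm (cauchy_alg A)) X Y"
    unfolding vconverges_def
  proof (rule LIMSEQ_I)
    fix e :: real assume "e > 0"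
    then obtain M where M: "\<And>m n. m \<ge> M \<Longrightarrow> n \<ge> M \<Longrightarrow> 1 / Suc m + anorm A (vminus A (Y m) (Y n)) < e / 2"
      using small[of "e / 2"] by auto
    have "norm (anorm (cauchy_alg A) (vminus (cauchy_alg A) (X n) Y) - 0) < e" if n: "n \<ge> M" for n
    proof -
      have cm: "vminus (cauchy_alg A) (X n) Y \<in> vcarrier (cauchy_alg A)"
        using c Y by (intro D.minus_closed) auto
      have "anorm (cauchy_alg A) (vminus (cauchy_alg A) (X n) Y) \<le> e / 2"
      proof (rule LIMSEQ_le_const2)
        show "(\<lambda>k. anorm A (vminus A (X n k) (Y k))) \<longlonglongrightarrow> anorm (cauchy_alg A) (vminus (cauchy_alg A) (X n) Y)"
          using cauchy_norm_lim[of "vminus (cauchy_alg A) (X n) Y"] cm by simp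
        have "anorm A (vminus A (X n k) (Y k)) \<le> e / 2" if "k \<ge> max (N n) M" for k
          using ns.nrm_minus_trans[of "X n k" "Y n" "Y k"] N[of n k "N n"] M[of n k] n that
          by (simp add: Y_def)
        then show "\<exists>K. \<forall>k\<ge>K. anorm A (vminus A (X n k) (Y k)) \<le> e / 2" by blast
      qed
      then show ?thesis using D.semi_nonneg[OF cm] \<open>e > 0\<close> by simp
    qed
    then show "\<exists>M. \<forall>n\<ge>M. norm (anorm (cauchy_alg A) (vminus (cauchy_alg A) (X n) Y) - 0) < e" by blast
  qed
  then show "\<exists>l\<in>vcarrier (cauchy_alg A). vconverges (cauchy_alg A) (anorm (cauchy_alg A)) X l"
    using Y by auto
qed

lemma completion_cstar: "cstar_algebra (completion A)"
proof -
  interpret D: cstar_seminormed "cauchy_alg A" by (rule cauchy_cstar_seminormed)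
  show ?thesis
    unfolding completion_def cstar_algebra_iff
    using D.separation_cstar_seminormed D.separation_definite D.separation_complete[OF cauchy_complete] by blast
qed

lemma completion_hom: "star_hom A (completion A) (\<lambda>x. null_class (cauchy_alg A) (\<lambda>n. x))"
proof -
  interpret D: cstar_seminormed "cauchy_alg A" by (rule cauchy_cstar_seminormed)
  show ?thesis
    unfolding completion_def star_hom_def
    using D.separation_ops D.separation_carrier by (auto simp: vcauchy_const)
qed

lemma completion_norm:
  assumes x: "x \<in> vcarrier A"
  shows "anorm (completion A) (null_class (cauchy_alg A) (\<lambda>n. x)) = anorm A x"
proof -
  interpret D: cstar_seminormed "cauchy_alg A" by (rule cauchy_cstar_seminormed)
  show ?thesis
    unfolding completion_def using x by (simp add: D.separation_norm vcauchy_const)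
qed

lemma completion_dense:
  assumes X: "X \<in> vcarrier (completion A)" and e: "e > 0"
  obtains x where "x \<in> vcarrier A"
    "anorm (completion A) (vminus (completion A) X (null_class (cauchy_alg A) (\<lambda>n. x))) < e"
proof -
  interpret D: cstar_seminormed "cauchy_alg A" by (rule cauchy_cstar_seminormed)
  obtain s where s: "vcauchy A (anorm A) s" "X = null_class (cauchy_alg A) s"
    using X by (auto simp: completion_def D.separation_carrier)
  obtain N where N: "\<And>m n. m \<ge> N \<Longrightarrow> n \<ge> N \<Longrightarrow> anorm A (vminus A (s m) (s n)) < e / 2"
    using vcauchyE[OF s(1), of "e / 2"] e by auto
  note c = vcauchy_closed[OF s(1)]
  have d: "vminus (cauchy_alg A) s (\<lambda>n. s N) \<in> vcarrier (cauchy_alg A)"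
    using s c by (intro D.minus_closed) (auto simp: vcauchy_const)
  have "anorm (completion A) (vminus (completion A) X (null_class (cauchy_alg A) (\<lambda>n. s N)))
      = anorm (cauchy_alg A) (vminus (cauchy_alg A) s (\<lambda>n. s N))"
    unfolding completion_def s(2) using s(1) c d
    by (subst D.separation_minus) (auto simp: vcauchy_const D.separation_ops)
  also have "\<dots> \<le> e / 2"
    using cauchy_norm_lim[of "vminus (cauchy_alg A) s (\<lambda>n. s N)"] d N less_imp_le
    by (intro LIMSEQ_le_const2[of "\<lambda>k. anorm A (vminus A (s k) (s N))"]) (auto intro!: exI[of _ N])
  finally show ?thesis using that[OF c[of N]] e by simp
qed

end

section \<open>C*-seminorms on the free *-algebra\<close>

lemma star_homD:
  assumes "star_hom A B f"
  shows "x \<in> vcarrier A \<Longrightarrow> f x \<in> vcarrier B"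
    "\<lbrakk>x \<in> vcarrier A; y \<in> vcarrier A\<rbrakk> \<Longrightarrow> f (vadd A x y) = vadd B (f x) (f y)"
    "x \<in> vcarrier A \<Longrightarrow> f (vscale A c x) = vscale B c (f x)"
    "\<lbrakk>x \<in> vcarrier A; y \<in> vcarrier A\<rbrakk> \<Longrightarrow> f (amult A x y) = amult B (f x) (f y)"
    "x \<in> vcarrier A \<Longrightarrow> f (astar A x) = astar B (f x)"
  using assms by (auto simp: star_hom_def)

lemma star_hom_minus:
  assumes "star_hom A B f" "star_algebra A" "x \<in> vcarrier A" "y \<in> vcarrier A"
  shows "f (vminus A x y) = vminus B (f x) (f y)"
proof -
  interpret A: star_algebra A by fact
  show ?thesis using assms(3,4) by (simp add: vminus_def star_homD[OF assms(1)])
qed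

lemma star_hom_zero:
  assumes "star_hom A B f" "star_algebra A" "star_algebra B"
  shows "f (vzero A) = vzero B"
proof -
  interpret A: star_algebra A by fact
  interpret B: star_algebra B by fact
  have "f (vscale A 0 (vzero A)) = vscale B 0 (f (vzero A))" by (simp only: star_homD(3)[OF assms(1)] A.zero_closed)
  then show ?thesis using star_homD(1)[OF assms(1) A.zero_closed] by simp
qed

lemma free_hom_simps:
  assumes "star_hom (free_star G) B f"
  shows "x \<in> vcarrier (free_star G) \<Longrightarrow> f x \<in> vcarrier B"
    "\<lbrakk>x \<in> vcarrier (free_star G); y \<in> vcarrier (free_star G)\<rbrakk> \<Longrightarrow> f (x + y) = vadd B (f x) (f y)"
    "\<lbrakk>x \<in> vcarrier (free_star G); y \<in> vcarrier (free_star G)\<rbrakk> \<Longrightarrow> f (x - y) = vminus B (f x) (f y)"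
    "x \<in> vcarrier (free_star G) \<Longrightarrow> f (fscale c x) = vscale B c (f x)"
    "\<lbrakk>x \<in> vcarrier (free_star G); y \<in> vcarrier (free_star G)\<rbrakk> \<Longrightarrow> f (x * y) = amult B (f x) (f y)"
    "x \<in> vcarrier (free_star G) \<Longrightarrow> f (fstar x) = astar B (f x)"
  using star_homD[OF assms] star_hom_minus[OF assms free_star_algebra] by auto

definition fnorm :: "'g set \<Rightarrow> ('g free_alg \<Rightarrow> real) \<Rightarrow> 'g free_alg nstar_alg" where
  "fnorm G N = star_alg.extend (free_star G) (nstar_alg.fields N)"

lemma fnorm_simps [simp]:
  "vcarrier (fnorm G N) = vcarrier (free_star G)"
  "vzero (fnorm G N) = 0" "vadd (fnorm G N) = (+)" "vscale (fnorm G N) = fscale"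
  "amult (fnorm G N) = (*)" "astar (fnorm G N) = fstar" "anorm (fnorm G N) = N"
  by (simp_all add: fnorm_def star_alg.extend_def nstar_alg.fields_def)

lemma fnorm_minus [simp]: "vminus (fnorm G N) x y = x - y"
  by (simp add: vminus_def fscale_minus_one)

lemma fnorm_star_algebra: "star_algebra (fnorm G N)"
proof -
  interpret F: star_algebra "free_star G" by (rule free_star_algebra)
  show ?thesis
    using F.star_algebra_axioms
    unfolding star_algebra_def complex_vector_space_def star_algebra_axioms_def by simp
qed

lemma free_star_hom_fnorm: "star_hom (fnorm G N) B f \<longleftrightarrow> star_hom (free_star G) B f"
  by (simp add: star_hom_def)

lemma free_normed_eq: "free_normed U G RN RS = fnorm G (rep_norm U G RN RS)"
  by (simp add: free_normed_def fnorm_def)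

lemma pullback_cstar_seminormed:
  assumes hom: "star_hom (free_star G) B f" and "cstar_seminormed B"
  shows "cstar_seminormed (fnorm G (\<lambda>x. anorm B (f x)))"
proof -
  interpret B: cstar_seminormed B by fact
  interpret F: star_algebra "fnorm G (\<lambda>x. anorm B (f x))" by (rule fnorm_star_algebra)
  show ?thesis
    by unfold_locales
      (auto simp: free_hom_simps[OF hom] B.semi_scale B.semi_triangle B.semi_mult B.semi_cstar)
qed

locale free_seminorm = cstar_seminormed "fnorm G N" for G :: "'g set" and N :: "'g free_alg \<Rightarrow> real"
begin

lemmas N_nonneg = semi_nonneg[simplified]
  and N_scale = semi_scale[simplified]
  and N_add = semi_triangle[simplified]
  and N_mult = semi_mult[simplified]
  and N_cstar = semi_cstar[simplified]
  and N_star = semi_star[simplified]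

text \<open>Equality in the C*-algebra that \<open>N\<close> defines, read off on representatives.
  Membership is built in, so that chains of congruences carry their side conditions along.\<close>

definition cg :: "'g free_alg \<Rightarrow> 'g free_alg \<Rightarrow> bool" (infix \<open>\<simeq>\<close> 50) where
  "x \<simeq> y \<longleftrightarrow> x \<in> vcarrier (free_star G) \<and> y \<in> vcarrier (free_star G) \<and> N (x - y) = 0"

lemma cg_memD: "x \<simeq> y \<Longrightarrow> x \<in> vcarrier (free_star G)" "x \<simeq> y \<Longrightarrow> y \<in> vcarrier (free_star G)"
  by (auto simp: cg_def)

lemma N_zero [simp]: "N 0 = 0"
  using ns.nrm_zero by simp

lemma cg_refl [simp]: "x \<in> vcarrier (free_star G) \<Longrightarrow> x \<simeq> x"
  by (simp add: cg_def)

lemma cg_sym: "x \<simeq> y \<Longrightarrow> y \<simeq> x"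
  using ns.nrm_minus_commute[of x y] by (simp add: cg_def)

lemma cg_trans [trans]: "x \<simeq> y \<Longrightarrow> y \<simeq> z \<Longrightarrow> x \<simeq> z"
  using ns.nrm_minus_trans[of x y z] N_nonneg[of "x - z"] by (simp add: cg_def)

lemma cg_add: "x \<simeq> x' \<Longrightarrow> y \<simeq> y' \<Longrightarrow> x + y \<simeq> x' + y'"
  using ns.nrm_minus_add[of x y x' y'] N_nonneg[of "x + y - (x' + y')"] by (simp add: cg_def)

lemma cg_mult: "x \<simeq> x' \<Longrightarrow> y \<simeq> y' \<Longrightarrow> x * y \<simeq> x' * y'"
  using semi_minus_mult[of x y x' y'] N_nonneg[of "x * y - x' * y'"] by (simp add: cg_def)

lemma cg_fscale: "x \<simeq> y \<Longrightarrow> fscale c x \<simeq> fscale c y"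
  using ns.nrm_scale_minus[of x y c] by (simp add: cg_def)

lemma cg_fstar: "x \<simeq> y \<Longrightarrow> fstar x \<simeq> fstar y"
  using semi_minus_star[of x y] by (simp add: cg_def)

lemma cg_diff: "x \<simeq> x' \<Longrightarrow> y \<simeq> y' \<Longrightarrow> x - y \<simeq> x' - y'"
  using cg_add[of x x' "fscale (-1) y" "fscale (-1) y'"] cg_fscale[of y y' "-1"]
  by (simp add: fscale_minus_one)

lemma cg_sum: "(\<And>i. i \<in> S \<Longrightarrow> f i \<simeq> g i) \<Longrightarrow> sum f S \<simeq> sum g S"
  by (induction S rule: infinite_finite_induct) (auto intro: cg_add)

lemma cg_mult_left: "x \<simeq> y \<Longrightarrow> z \<in> vcarrier (free_star G) \<Longrightarrow> z * x \<simeq> z * y"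
  by (rule cg_mult) auto

lemma cg_mult_right: "x \<simeq> y \<Longrightarrow> z \<in> vcarrier (free_star G) \<Longrightarrow> x * z \<simeq> y * z"
  by (rule cg_mult) auto

lemma cg_zero_iff: "x \<simeq> 0 \<longleftrightarrow> x \<in> vcarrier (free_star G) \<and> N x = 0"
  by (simp add: cg_def)

lemma cg_diff_zero: "x - y \<simeq> 0 \<Longrightarrow> x \<in> vcarrier (free_star G) \<Longrightarrow> y \<in> vcarrier (free_star G) \<Longrightarrow> x \<simeq> y"
  by (simp add: cg_def)

lemma cg_N: "x \<simeq> y \<Longrightarrow> N x = N y"
  using ns.abs_nrm_diff[of x y] by (simp add: cg_def)

text \<open>The C*-identity turns p*p = p into (N p)^2 = N p. The bounds by 1 on generators,
  residues and products of projections all come from it.\<close>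

lemma projection_norm:
  assumes "fstar p \<simeq> p" "p * p \<simeq> p"
  shows "N p = 0 \<or> N p = 1"
proof -
  have p: "p \<in> vcarrier (free_star G)" using assms cg_memD by blast
  have "(N p)\<^sup>2 = N (fstar p * p)" using N_cstar p by simp
  also have "\<dots> = N p" by (rule cg_N[OF cg_trans[OF cg_mult_right[OF assms(1) p] assms(2)]])
  finally show ?thesis by (auto simp: power2_eq_square)
qed

end

section \<open>The Exel-Laca relations from the Cuntz-Krieger relations\<close>

definition rproj :: "'i \<Rightarrow> 'i ck_gen free_alg" where
  "rproj i = gen (T i) * fstar (gen (T i))"

definition iproj :: "'i \<Rightarrow> 'i ck_gen free_alg" where
  "iproj i = fstar (gen (T i)) * gen (T i)"

lemma fstar_rproj [simp]: "fstar (rproj i) = rproj i"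
  and fstar_iproj [simp]: "fstar (iproj i) = iproj i"
  by (simp_all add: rproj_def iproj_def fstar_mult)

lemma ck_gens_mem [simp]: "T i \<in> ck_gens I \<longleftrightarrow> i \<in> I" "One \<in> ck_gens I"
  by (auto simp: ck_gens_def)

lemma rproj_mem [simp]: "i \<in> I \<Longrightarrow> rproj i \<in> vcarrier (free_star (ck_gens I))"
  and iproj_mem [simp]: "i \<in> I \<Longrightarrow> iproj i \<in> vcarrier (free_star (ck_gens I))"
  by (simp_all add: rproj_def iproj_def)

text \<open>The first of three layers. It contains the norm relations only, which already bound the
  norm of every element by a constant independent of \<open>N\<close>.\<close>

locale ck_relations = free_seminorm "ck_gens I" N for I :: "'i set" and N +
  fixes A :: "'i \<Rightarrow> 'i \<Rightarrow> complex"
  assumes zero_one: "\<lbrakk>i \<in> I; j \<in> I\<rbrakk> \<Longrightarrow> A i j = 0 \<or> A i j = 1"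
    and norm_rel: "(x, \<eta>) \<in> ck_RN I \<Longrightarrow> N x \<le> \<eta>"
begin

notation cg (infix \<open>\<simeq>\<close> 50)

lemma eq_rel_cg:
  assumes "eq_rel x y \<in> ck_RN I" "x \<in> vcarrier (free_star (ck_gens I))" "y \<in> vcarrier (free_star (ck_gens I))"
  shows "x \<simeq> y"
  using norm_rel[of "x - y" 0] N_nonneg[of "x - y"] assms by (simp add: cg_def eq_rel_def)

lemma isometry_rel: "i \<in> I \<Longrightarrow> gen (T i) * fstar (gen (T i)) * gen (T i) \<simeq> gen (T i)"
  by (rule eq_rel_cg) (auto simp: ck_RN_def)

lemma One_cg:
  shows One_star: "fstar (gen One) \<simeq> gen One" and One_idem: "gen One * gen One \<simeq> gen One"
  by (rule cg_sym, rule eq_rel_cg; auto simp: ck_RN_def)+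

text \<open>The relations make \<open>gen One\<close> a unit for the generators only; induction
  extends this to all elements. Both sides are proved together because the star exchanges
  them.\<close>

lemma unit_cg:
  assumes "x \<in> vcarrier (free_star (ck_gens I))"
  shows "gen One * x \<simeq> x \<and> x * gen One \<simeq> x"
  using assms
proof (induction x rule: free_star_induct)
  case (gen g)
  then consider "g = One" | i where "g = T i" "i \<in> I" by (auto simp: ck_gens_def)
  then show ?case
  proof cases
    case (2 i)
    have "gen One * gen (T i) \<simeq> gen (T i)" "gen (T i) \<simeq> gen (T i) * gen One"
      using 2 by (auto intro!: eq_rel_cg simp: ck_RN_def)
    then show ?thesis using 2 cg_sym by auto
  qed (use One_idem in auto)
next
  case (mult x y)
  then show ?case
    using cg_mult_right[of "gen One * x" x y] cg_mult_left[of "y * gen One" y x] by (simp add: mult.assoc)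
next
  case (star x)
  have "fstar (gen One) * x \<simeq> x" "x * fstar (gen One) \<simeq> x"
    using star cg_trans[OF cg_mult_right[OF One_star, of x], of x]
      cg_trans[OF cg_mult_left[OF One_star, of x], of x] by auto
  from this[THEN cg_fstar] show ?case by (simp add: fstar_mult)
next
  case (add x y)
  then show ?case using cg_add[of "gen One * x" x] cg_add[of "x * gen One" x] by (simp add: distrib_left distrib_right)
next
  case (scale c x)
  then show ?case using cg_fscale by (simp add: fscale_mult_left fscale_mult_right)
qed simp

lemma One_left: "x \<in> vcarrier (free_star (ck_gens I)) \<Longrightarrow> gen One * x \<simeq> x"
  and One_right: "x \<in> vcarrier (free_star (ck_gens I)) \<Longrightarrow> x * gen One \<simeq> x"
  using unit_cg by auto

lemma rproj_idem: "i \<in> I \<Longrightarrow> rproj i * rproj i \<simeq> rproj i"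
  using cg_mult_right[OF isometry_rel[of i], of "fstar (gen (T i))"] by (simp add: rproj_def mult.assoc)

lemma iproj_idem: "i \<in> I \<Longrightarrow> iproj i * iproj i \<simeq> iproj i"
  using cg_mult_left[OF isometry_rel[of i], of "fstar (gen (T i))"] by (simp add: iproj_def mult.assoc)

text \<open>For a partial isometry, N(T_i)^2 = N(T_i* T_i) is the norm of a projection.\<close>

lemma generator_norm: "g \<in> ck_gens I \<Longrightarrow> N (gen g) \<le> 1"
proof -
  assume "g \<in> ck_gens I"
  then consider "g = One" | i where "g = T i" "i \<in> I" by (auto simp: ck_gens_def)
  then show ?thesis
  proof cases
    case 1
    then show ?thesis using projection_norm[OF One_star One_idem] by auto
  next
    case 2
    have "N (iproj i) \<le> 1" using projection_norm[of "iproj i"] iproj_idem[of i] 2 by auto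
    then have "(N (gen (T i)))\<^sup>2 \<le> 1" using N_cstar[of "gen (T i)"] 2 by (simp add: iproj_def)
    then show ?thesis using 2 by (simp add: power2_le_iff_abs_le abs_le_iff power_le_one_iff abs_square_le_1)
  qed
qed

end

text \<open>This layer is common to both sides: representations satisfy it by (CK1) and (CK2), the
  Exel-Laca algebra by (EL2) and (EL3).\<close>

locale ck_orth = ck_relations I N A for I :: "'i set" and N and A +
  assumes orthogonal: "\<lbrakk>i \<in> I; j \<in> I; i \<noteq> j\<rbrakk> \<Longrightarrow> N (rproj i * rproj j) = 0"
    and init_range: "\<lbrakk>i \<in> I; j \<in> I\<rbrakk> \<Longrightarrow> N (iproj i * rproj j - fscale (A i j) (rproj j)) = 0"
begin

notation cg (infix \<open>\<simeq>\<close> 50)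

lemma rproj_orth: "\<lbrakk>i \<in> I; j \<in> I; i \<noteq> j\<rbrakk> \<Longrightarrow> rproj i * rproj j \<simeq> 0"
  by (simp add: cg_zero_iff orthogonal)

lemma iproj_rproj: "\<lbrakk>i \<in> I; j \<in> I\<rbrakk> \<Longrightarrow> iproj i * rproj j \<simeq> fscale (A i j) (rproj j)"
  by (simp add: cg_def init_range)

lemma rproj_iproj:
  assumes "i \<in> I" "j \<in> I"
  shows "rproj j * iproj i \<simeq> fscale (A i j) (rproj j)"
proof -
  have "cnj (A i j) = A i j" using zero_one[OF assms] by auto
  then show ?thesis using cg_fstar[OF iproj_rproj[OF assms]] by (simp add: fstar_mult fstar_fscale)
qed

lemma iproj_iproj_rproj:
  "\<lbrakk>i \<in> I; j \<in> I; k \<in> I\<rbrakk> \<Longrightarrow> iproj i * iproj j * rproj k \<simeq> fscale (A i k * A j k) (rproj k)"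
  using cg_trans[OF cg_mult_left[OF iproj_rproj[of j k], of "iproj i"]]
    cg_fscale[OF iproj_rproj[of i k], of "A j k"]
  by (simp add: mult.assoc fscale_mult_right mult.commute)

lemma sum_rproj_mult:
  assumes "finite X" "X \<subseteq> I" "j \<in> I"
  shows "(\<Sum>i\<in>X. fscale (c i) (rproj i)) * rproj j \<simeq> fscale (if j \<in> X then c j else 0) (rproj j)"
  using assms
proof (induction X)
  case (insert i X)
  let ?r = "\<Sum>i\<in>X. fscale (c i) (rproj i)"
  have one: "fscale (c i) (rproj i) * rproj j \<simeq> fscale (if i = j then c j else 0) (rproj j)"
    using insert rproj_idem[of j] rproj_orth[of i j] cg_fscale[of "rproj i * rproj j" "if i = j then rproj j else 0" "c i"]
    by (auto simp: fscale_mult_left)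
  have IH: "?r * rproj j \<simeq> fscale (if j \<in> X then c j else 0) (rproj j)"
    using insert by auto
  have coeff: "(if i = j then c j else 0) + (if j \<in> X then c j else 0) = (if j \<in> insert i X then c j else 0)"
    using insert.hyps by auto
  show ?case
    using cg_add[OF one IH]
    unfolding sum.insert[OF insert.hyps] distrib_right fscale_add_left[symmetric] coeff .
qed simp

lemma sum_rproj_cong:
  assumes "finite X" "X \<subseteq> I"
  shows "(\<Sum>i\<in>X. fscale (c i) (rproj i)) * (\<Sum>i\<in>X. fscale (d i) (rproj i)) \<simeq> (\<Sum>i\<in>X. fscale (c i * d i) (rproj i))"
proof -
  have "(\<Sum>i\<in>X. fscale (c i) (rproj i)) * fscale (d j) (rproj j) \<simeq> fscale (c j * d j) (rproj j)" if "j \<in> X" for j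
    using cg_fscale[OF sum_rproj_mult[of X j c], of "d j"] that assms by (auto simp: fscale_mult_right mult.commute)
  then show ?thesis by (auto simp: sum_distrib_left intro!: cg_sum)
qed

text \<open>The members of the nets in (CK1) and (CK2) are projections modulo null elements. Their
  uniform bound is what lets strong convergence pass to direct sums.\<close>

lemma One_residue_norm:
  assumes "finite X" "X \<subseteq> I"
  shows "N (gen One - (\<Sum>i\<in>X. rproj i)) \<le> 1"
proof -
  let ?S = "\<Sum>i\<in>X. rproj i"
  let ?M = "vcarrier (free_star (ck_gens I))"
  have S: "?S \<in> ?M" using assms by (intro sum_mem rproj_mem) auto
  have SS: "?S * ?S \<simeq> ?S" using sum_rproj_cong[OF assms, of "\<lambda>_. 1" "\<lambda>_. 1"] by simp
  have "(gen One - ?S) * (gen One - ?S) = (gen One * gen One - ?S * gen One) - (gen One * ?S - ?S * ?S)"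
    by (simp add: algebra_simps)
  also have "\<dots> \<simeq> (gen One - ?S) - (?S - ?S)"
    by (intro cg_diff One_idem One_right One_left S SS)
  finally have "(gen One - ?S) * (gen One - ?S) \<simeq> gen One - ?S" by simp
  moreover have "fstar (gen One - ?S) \<simeq> gen One - ?S"
    using cg_diff[OF One_star cg_refl[OF S]] by (simp add: fstar_minus fstar_sum)
  ultimately show ?thesis using projection_norm by fastforce
qed

text \<open>Since the entries are 0 or 1, the partial sum is a projection that the initial
  projection fixes from both sides, and so the difference is again a projection.\<close>

lemma iproj_residue_norm:
  assumes "finite X" "X \<subseteq> I" "i \<in> I"
  shows "N (iproj i - (\<Sum>j\<in>X. fscale (A i j) (rproj j))) \<le> 1"
proof -
  let ?S = "\<Sum>j\<in>X. fscale (A i j) (rproj j)"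
  have S: "?S \<in> vcarrier (free_star (ck_gens I))" using assms by (auto intro!: sum_mem)
  have AA: "A i j * A i j = A i j" "cnj (A i j) = A i j" if "j \<in> X" for j
    using zero_one[OF assms(3) subsetD[OF assms(2) that]] by auto
  have sq: "(\<Sum>j\<in>X. fscale (A i j * A i j) (rproj j)) = ?S"
    by (intro sum.cong) (simp_all add: AA)
  have SS: "?S * ?S \<simeq> ?S" using sum_rproj_cong[OF assms(1,2), of "A i" "A i"] sq by simp
  have QS: "iproj i * ?S \<simeq> ?S"
  proof -
    have "iproj i * ?S \<simeq> (\<Sum>j\<in>X. fscale (A i j * A i j) (rproj j))"
      unfolding sum_distrib_left
      using cg_fscale[OF iproj_rproj] assms by (intro cg_sum) (auto simp: fscale_mult_right)
    then show ?thesis by (simp only: sq)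
  qed
  have star: "fstar ?S = ?S" by (auto simp: fstar_sum fstar_fscale AA intro!: sum.cong)
  have SQ: "?S * iproj i \<simeq> ?S"
    using cg_fstar[OF QS] by (simp add: fstar_mult star)
  have "(iproj i - ?S) * (iproj i - ?S) = (iproj i * iproj i - ?S * iproj i) - (iproj i * ?S - ?S * ?S)"
    by (simp add: algebra_simps)
  also have "\<dots> \<simeq> (iproj i - ?S) - (?S - ?S)"
    by (intro cg_diff iproj_idem SS QS SQ assms)
  finally have "(iproj i - ?S) * (iproj i - ?S) \<simeq> iproj i - ?S" by simp
  moreover have "fstar (iproj i - ?S) \<simeq> iproj i - ?S"
    using assms S by (simp add: fstar_minus star)
  ultimately show ?thesis using projection_norm by fastforce
qed

text \<open>On a range projection every factor acts as the scalar A x j or 1 - A y j. Distinctness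
  of the lists matches the product along them with the products over sets in
  \<open>EL_coeff\<close>.\<close>

lemma prod_rproj:
  assumes "set xs \<subseteq> I" "set ys \<subseteq> I" "distinct xs" "distinct ys" "j \<in> I"
  shows "foldr (*) (map iproj xs @ map (\<lambda>y. gen One - iproj y) ys) (gen One) * rproj j
    \<simeq> fscale (EL_coeff A (set xs) (set ys) j) (rproj j)"
proof -
  have ys: "foldr (*) (map (\<lambda>y. gen One - iproj y) ys) (gen One) * rproj j
      \<simeq> fscale (\<Prod>y\<in>set ys. 1 - A y j) (rproj j)"
    using assms(2,4)
  proof (induction ys)
    case (Cons y ys)
    have "(gen One - iproj y) * rproj j \<simeq> fscale (1 - A y j) (rproj j)"
    proof -
      have "fscale (1 - A y j) (rproj j) = rproj j - fscale (A y j) (rproj j)"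
        by (rule poly_mapping_eqI) (simp add: lookup_fscale lookup_minus left_diff_distrib)
      then show ?thesis
        using cg_diff[OF One_left[of "rproj j"] iproj_rproj[of y j]] Cons.prems assms(5)
        by (simp add: left_diff_distrib)
    qed
    from cg_fscale[OF this, of "\<Prod>y\<in>set ys. 1 - A y j"] Cons show ?case
      using cg_mult_left[OF Cons.IH, of "gen One - iproj y"]
      by (auto simp: mult.assoc fscale_mult_right mult.commute intro: cg_trans)
  qed (use One_left[of "rproj j"] assms(5) in simp)
  show ?thesis
    using assms(1,3)
  proof (induction xs)
    case Nil
    then show ?case using ys by (simp add: EL_coeff_def)
  next
    case (Cons x xs)
    have "fscale (EL_coeff A (set xs) (set ys) j) (iproj x * rproj j)
        \<simeq> fscale (EL_coeff A (set (x # xs)) (set ys) j) (rproj j)"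
      using cg_fscale[OF iproj_rproj[of x j], of "EL_coeff A (set xs) (set ys) j"] Cons.prems assms(5)
      by (simp add: EL_coeff_def mult_ac)
    then show ?case
      using cg_mult_left[OF Cons.IH, of "iproj x"] Cons.prems
      by (auto simp: mult.assoc fscale_mult_right intro: cg_trans)
  qed
qed

end

text \<open>The assumption is all that survives of the strong operator convergence in (CK1):
  elements are determined by their products with the range projections.\<close>

locale ck_seminorm = ck_orth I N A for I :: "'i set" and N and A +
  assumes detect: "\<lbrakk>x \<in> vcarrier (free_star (ck_gens I)); \<And>j. j \<in> I \<Longrightarrow> N (x * rproj j) = 0\<rbrakk>
          \<Longrightarrow> N (x * gen One) = 0"
begin

notation cg (infix \<open>\<simeq>\<close> 50)

lemma detect_cg:
  assumes x: "x \<in> vcarrier (free_star (ck_gens I))" and y: "y \<in> vcarrier (free_star (ck_gens I))"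
    and eq: "\<And>j. j \<in> I \<Longrightarrow> x * rproj j \<simeq> y * rproj j"
  shows "x \<simeq> y"
proof -
  have "N ((x - y) * gen One) = 0"
    using x y eq by (intro detect) (auto simp: cg_def left_diff_distrib)
  then have "(x - y) * gen One \<simeq> 0" using x y by (simp add: cg_zero_iff)
  then have "x - y \<simeq> 0" using cg_trans[OF cg_sym[OF One_right[of "x - y"]]] x y by simp
  then show ?thesis by (rule cg_diff_zero) fact+
qed

text \<open>Both products act on the k-th range projection as the scalar A i k times A j k.\<close>

lemma iproj_commute: "\<lbrakk>i \<in> I; j \<in> I\<rbrakk> \<Longrightarrow> iproj i * iproj j \<simeq> iproj j * iproj i"
proof (rule detect_cg)
  fix k assume "i \<in> I" "j \<in> I" "k \<in> I"
  then show "iproj i * iproj j * rproj k \<simeq> iproj j * iproj i * rproj k"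
    using cg_trans[OF iproj_iproj_rproj[of i j k]] cg_sym[OF iproj_iproj_rproj[of j i k]]
    by (simp add: mult.commute)
qed auto

lemma foldr_mem:
  "(\<And>x. x \<in> set zs \<Longrightarrow> x \<in> vcarrier (free_star G)) \<Longrightarrow> e \<in> vcarrier (free_star G)
    \<Longrightarrow> foldr (*) zs e \<in> vcarrier (free_star G) \<and> foldr (+) zs e \<in> vcarrier (free_star G)"
  by (induction zs) auto

lemma foldr_plus_eq_sum:
  "distinct js \<Longrightarrow> foldr (+) (map f js) (0 :: 'b :: comm_monoid_add) = sum f (set js)"
  by (induction js) auto

text \<open>Both sides multiply each range projection by the same scalar; for an index outside
  \<open>js\<close> it is zero on both sides by the choice of \<open>js\<close>.\<close>

lemma EL_product:
  assumes "set xs \<subseteq> I" "set ys \<subseteq> I" "distinct xs" "distinct ys" "distinct js"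
    and js: "set js = {j \<in> I. EL_coeff A (set xs) (set ys) j \<noteq> 0}"
  shows "foldr (*) (map iproj xs @ map (\<lambda>y. gen One - iproj y) ys) (gen One)
    \<simeq> (\<Sum>j\<in>set js. fscale (EL_coeff A (set xs) (set ys) j) (rproj j))"
proof (rule detect_cg)
  show "foldr (*) (map iproj xs @ map (\<lambda>y. gen One - iproj y) ys) (gen One) \<in> vcarrier (free_star (ck_gens I))"
    by (rule conjunct1[OF foldr_mem]) (use assms in auto)
  show "(\<Sum>j\<in>set js. fscale (EL_coeff A (set xs) (set ys) j) (rproj j)) \<in> vcarrier (free_star (ck_gens I))"
    using js by (auto intro!: sum_mem)
  fix k assume k: "k \<in> I"
  show "foldr (*) (map iproj xs @ map (\<lambda>y. gen One - iproj y) ys) (gen One) * rproj k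
    \<simeq> (\<Sum>j\<in>set js. fscale (EL_coeff A (set xs) (set ys) j) (rproj j)) * rproj k"
  proof (rule cg_trans[OF prod_rproj[OF assms(1-4) k] cg_sym])
    have coeff: "(if k \<in> set js then EL_coeff A (set xs) (set ys) k else 0) = EL_coeff A (set xs) (set ys) k"
      using js k by auto
    have sub: "set js \<subseteq> I" using js by auto
    show "(\<Sum>j\<in>set js. fscale (EL_coeff A (set xs) (set ys) j) (rproj j)) * rproj k
        \<simeq> fscale (EL_coeff A (set xs) (set ys) k) (rproj k)"
      using sum_rproj_mult[OF finite_set sub k, of "EL_coeff A (set xs) (set ys)"] unfolding coeff .
  qed
qed

text \<open>Congruences become equations under a homomorphism that kills the null elements. It is
  applied with \<open>B\<close> a copy of the completed algebra.\<close>

lemma EL_family_hom: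
  assumes hom: "star_hom (free_star (ck_gens I)) B h" and B: "star_algebra B"
    and unit: "h (gen One) = aunit B"
    and null: "\<And>x. \<lbrakk>x \<in> vcarrier (free_star (ck_gens I)); N x = 0\<rbrakk> \<Longrightarrow> h x = vzero B"
  shows "EL_family I A B (\<lambda>i. h (gen (T i)))"
proof -
  interpret B: star_algebra B by fact
  note hs = free_hom_simps[OF hom]
  have eq: "h x = h y" if "x \<simeq> y" for x y
    using null[of "x - y"] that B.minus_eq_zero_iff[of "h x" "h y"] hs by (simp add: cg_def)
  have zero: "h 0 = vzero B" by (rule null) simp_all
  have ip: "init_proj B (h (gen (T i))) = h (iproj i)" and rp: "range_proj B (h (gen (T i))) = h (rproj i)"
    if "i \<in> I" for i
    using that by (simp_all add: init_proj_def range_proj_def iproj_def rproj_def hs)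
  have prod: "foldr (amult B) (map h zs) (aunit B) = h (foldr (*) zs (gen One))"
    if "\<And>x. x \<in> set zs \<Longrightarrow> x \<in> vcarrier (free_star (ck_gens I))" for zs
    using that
  proof (induction zs)
    case (Cons z zs)
    then show ?case using foldr_mem[of zs "ck_gens I" "gen One"] by (simp add: hs)
  qed (simp add: unit)
  have sum: "foldr (vadd B) (map h zs) (vzero B) = h (foldr (+) zs 0)"
    if "\<And>x. x \<in> set zs \<Longrightarrow> x \<in> vcarrier (free_star (ck_gens I))" for zs
    using that
  proof (induction zs)
    case (Cons z zs)
    then show ?case using foldr_mem[of zs "ck_gens I" 0] by (simp add: hs)
  qed (simp add: zero)
  show ?thesis
    unfolding EL_family_def
  proof (intro conjI ballI allI impI, goal_cases)
    case (1 i) then show ?case by (simp add: hs)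
  next
    case (2 i) then show ?case using eq[OF isometry_rel[of i]] by (simp add: hs)
  next
    case (3 i j) then show ?case using eq[OF iproj_commute[of i j]] by (simp add: ip hs)
  next
    case (4 i j) then show ?case using eq[OF rproj_orth[of i j]] by (simp add: rp hs zero)
  next
    case (5 i j) then show ?case using eq[OF iproj_rproj[of i j]] by (simp add: ip rp hs)
  next
    case (6 xs ys js)
    then have sub: "set xs \<subseteq> I" "set ys \<subseteq> I" "set js \<subseteq> I" by auto
    let ?c = "EL_coeff A (set xs) (set ys)"
    let ?zs = "map iproj xs @ map (\<lambda>y. gen One - iproj y) ys"
    let ?ss = "map (\<lambda>j. fscale (?c j) (rproj j)) js"
    have m1: "map (\<lambda>x. init_proj B (h (gen (T x)))) xs
        @ map (\<lambda>y. vminus B (aunit B) (init_proj B (h (gen (T y))))) ys = map h ?zs"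
      using sub by (auto simp: ip hs unit)
    have m2: "map (\<lambda>j. vscale B (?c j) (range_proj B (h (gen (T j))))) js = map h ?ss"
      using sub by (auto simp: rp hs)
    have p: "foldr (amult B) (map h ?zs) (aunit B) = h (foldr (*) ?zs (gen One))"
      by (rule prod) (use sub in auto)
    have s: "foldr (vadd B) (map h ?ss) (vzero B) = h (foldr (+) ?ss 0)"
      by (rule sum) (use sub in auto)
    have "h (foldr (*) ?zs (gen One)) = h (foldr (+) ?ss 0)"
      using eq[OF EL_product[of xs ys js]] 6 by (simp add: foldr_plus_eq_sum)
    then show ?case unfolding m1 m2 p s .
  qed
qed

end

lemma ck_seminorm_relations: "ck_seminorm I N A \<Longrightarrow> ck_relations I N A"
  by (rule ck_orth.axioms(1)[OF ck_seminorm.axioms(1)])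

section \<open>Representations of the Cuntz-Krieger triple\<close>

lemma (in hilbert_space) hnorm_le_zeroD: "\<lbrakk>hnorm H x \<le> 0; x \<in> vcarrier H\<rbrakk> \<Longrightarrow> x = vzero H"
  by (metis hnorm_eq_zero hnorm_nonneg order_antisym)

lemma representation_hom:
  "representation G RN RS H \<rho> \<Longrightarrow> star_hom (free_star G) (bop_alg H) \<rho>"
  and representation_hilbert: "representation G RN RS H \<rho> \<Longrightarrow> hilbert_space H"
  by (simp_all add: representation_def)

lemma representation_bounded:
  "\<lbrakk>representation G RN RS H \<rho>; x \<in> vcarrier (free_star G)\<rbrakk> \<Longrightarrow> bounded_op H (\<rho> x)"
  using free_hom_simps(1)[OF representation_hom] by fastforce

lemma representation_seminorm:
  assumes "representation G RN RS H \<rho>"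
  shows "cstar_seminormed (fnorm G (\<lambda>x. opnorm H (\<rho> x)))"
  using pullback_cstar_seminormed[OF representation_hom[OF assms]
      hilbert_space.bop_cstar_seminormed[OF representation_hilbert[OF assms]]] by simp

lemma representation_apply:
  assumes rep: "representation G RN RS H \<rho>" and v: "v \<in> vcarrier H"
  shows "\<lbrakk>x \<in> vcarrier (free_star G); y \<in> vcarrier (free_star G)\<rbrakk> \<Longrightarrow> \<rho> (x + y) v = vadd H (\<rho> x v) (\<rho> y v)"
    "\<lbrakk>x \<in> vcarrier (free_star G); y \<in> vcarrier (free_star G)\<rbrakk> \<Longrightarrow> \<rho> (x - y) v = vminus H (\<rho> x v) (\<rho> y v)"
    "x \<in> vcarrier (free_star G) \<Longrightarrow> \<rho> (fscale c x) v = vscale H c (\<rho> x v)"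
    "\<lbrakk>x \<in> vcarrier (free_star G); y \<in> vcarrier (free_star G)\<rbrakk> \<Longrightarrow> \<rho> (x * y) v = \<rho> x (\<rho> y v)"
    "\<lbrakk>x \<in> vcarrier (free_star G); w \<in> vcarrier H\<rbrakk> \<Longrightarrow> hinner H (\<rho> x v) w = hinner H v (\<rho> (fstar x) w)"
    "x \<in> vcarrier (free_star G) \<Longrightarrow> \<rho> x v \<in> vcarrier H"
proof -
  interpret H: hilbert_space H using rep by (rule representation_hilbert)
  note hom = free_hom_simps[OF representation_hom[OF rep]]
  show "\<lbrakk>x \<in> vcarrier (free_star G); w \<in> vcarrier H\<rbrakk> \<Longrightarrow> hinner H (\<rho> x v) w = hinner H v (\<rho> (fstar x) w)"
    using v representation_bounded[OF rep] by (simp add: hom H.adjoint_inner)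
qed (use v representation_bounded[OF rep] in
    \<open>auto simp: free_hom_simps[OF representation_hom[OF rep]] bounded_op_closed vminus_def\<close>)

lemma CK1_mem: "fin_net I (\<lambda>X. gen One - (\<Sum>i\<in>X. rproj i)) \<in> ck_RS I A"
  and CK2_mem: "i \<in> I \<Longrightarrow> fin_net I (\<lambda>X. iproj i - (\<Sum>j\<in>X. fscale (A i j) (rproj j))) \<in> ck_RS I A"
  by (auto simp: ck_RS_def rproj_def iproj_def)

lemma fin_net_SOT:
  assumes "representation G RN RS H \<rho>" "fin_net I x \<in> RS" "v \<in> vcarrier H" "e > 0"
  shows "\<exists>X. finite X \<and> X \<subseteq> I \<and>
    (\<forall>Y. finite Y \<and> Y \<subseteq> I \<and> X \<subseteq> Y \<longrightarrow> hnorm H (\<rho> (x Y) v) < e)"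
proof -
  have "\<forall>(D, le, x)\<in>RS. \<forall>v\<in>vcarrier H. \<forall>e>0. \<exists>d\<in>D. \<forall>k\<in>D. le d k \<longrightarrow> hnorm H (\<rho> (x k) v) < e"
    using assms(1) by (simp add: representation_def)
  from bspec[OF this assms(2)] show ?thesis
    using assms(3,4) by (simp add: fin_net_def Bex_def conj_assoc imp_conjL)
qed

text \<open>Orthogonality comes from comparing norms in (CK1). In the other two cases the member of
  the net, multiplied by the element in question, no longer depends on the finite set, so that
  arbitrarily small means zero.\<close>

lemma representation_ck_seminorm:
  assumes rep: "representation (ck_gens I) (ck_RN I) (ck_RS I A) H \<rho>"
    and zero_one: "\<forall>i\<in>I. \<forall>j\<in>I. A i j \<in> {0, 1}"
  shows "ck_seminorm I (\<lambda>x. opnorm H (\<rho> x)) A"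
proof -
  interpret H: hilbert_space H using rep by (rule representation_hilbert)
  interpret ck_relations I "\<lambda>x. opnorm H (\<rho> x)" A
    using rep zero_one
    by (intro ck_relations.intro free_seminorm.intro representation_seminorm ck_relations_axioms.intro)
      (auto simp: representation_def)
  let ?M = "vcarrier (free_star (ck_gens I))"
  note app = representation_apply[OF rep]
  note bdd = representation_bounded[OF rep]
  have null: "opnorm H (\<rho> x) = 0" if "x \<in> ?M" "\<And>v. v \<in> vcarrier H \<Longrightarrow> \<rho> x v = vzero H" for x
    using H.opnorm_le[of 0 "\<rho> x"] H.opnorm_nonneg[OF bdd[OF that(1)]] that by (simp add: antisym)
  have null': "\<rho> x v = vzero H" if "x \<in> ?M" "opnorm H (\<rho> x) = 0" "v \<in> vcarrier H" for x v
  proof -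
    have "hnorm H (\<rho> x v) \<le> 0" using H.opnorm_bound[OF bdd, of x v] that by simp
    then show ?thesis using app(6) that by (intro H.hnorm_le_zeroD) auto
  qed
  have cong: "\<rho> x v = \<rho> y v" if "cg x y" "v \<in> vcarrier H" for x y v
    using null'[of "x - y" v] that H.minus_eq_zero_iff[of "\<rho> x v" "\<rho> y v"] app[OF that(2)]
    by (simp add: cg_def)
  have orth: "opnorm H (\<rho> (rproj i * rproj j)) = 0" if ij: "i \<in> I" "j \<in> I" "i \<noteq> j" for i j
  proof (rule null)
    fix v assume v: "v \<in> vcarrier H"
    define w where "w = \<rho> (rproj j) v"
    have w: "w \<in> vcarrier H" using v ij by (simp add: w_def app)
    have "\<rho> (gen One) w = w" "\<rho> (rproj j) w = w"
      using cong[OF One_left[of "rproj j"] v] cong[OF rproj_idem[OF ij(2)] v] ij v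
      by (simp_all add: w_def app)
    have sq: "Re (hinner H (\<rho> (rproj k) w) w) = (hnorm H (\<rho> (rproj k) w))\<^sup>2" if "k \<in> I" for k
    proof -
      have "hinner H (\<rho> (rproj k) w) w = hinner H (\<rho> (rproj k) (\<rho> (rproj k) w)) w"
        using cong[OF rproj_idem[OF that] w] that w by (simp add: app)
      also have "\<dots> = hinner H (\<rho> (rproj k) w) (\<rho> (rproj k) w)"
        using that w by (simp add: app)
      finally show ?thesis using that w by (simp add: H.hnorm_sq app)
    qed
    have sum: "Re (hinner H (\<rho> (\<Sum>k\<in>X. rproj k) w) w) = (\<Sum>k\<in>X. (hnorm H (\<rho> (rproj k) w))\<^sup>2)"
      if "finite X" "X \<subseteq> I" for X
      using that
    proof (induction X)
      case empty
      have "\<rho> 0 w = vzero H" by (rule null'[of 0]) (use w in auto)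
      then show ?case using w by simp
    next
      case (insert k X)
      then have "(\<Sum>k\<in>X. rproj k) \<in> ?M" by (intro sum_mem rproj_mem) auto
      then show ?case using insert w by (simp add: app(1,6) H.inner_add_left sq)
    qed
    \<comment> \<open>The summands of <S w, w> are nonnegative and the one for \<open>j\<close>
      already equals ||w||^2, so the one for \<open>i\<close> is at most the error of the
      net.\<close>
    have small: "(hnorm H (\<rho> (rproj i) w))\<^sup>2 \<le> e * hnorm H w" if e: "e > 0" for e
    proof -
      obtain X where X: "finite X" "X \<subseteq> I" and Xe: "\<forall>Y. finite Y \<and> Y \<subseteq> I \<and> X \<subseteq> Y
          \<longrightarrow> hnorm H (\<rho> (gen One - (\<Sum>i\<in>Y. rproj i)) w) < e"
        using fin_net_SOT[OF rep CK1_mem w e] by (elim exE conjE)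
      define Y where "Y = insert i (insert j X)"
      have Y: "finite Y" "X \<subseteq> Y" "Y \<subseteq> I" using X ij by (auto simp: Y_def)
      let ?S = "\<Sum>i\<in>Y. rproj i"
      have S: "?S \<in> ?M" using Y by (intro sum_mem rproj_mem) auto
      have "(hnorm H (\<rho> (rproj i) w))\<^sup>2 + (hnorm H w)\<^sup>2 = (\<Sum>k\<in>{i, j}. (hnorm H (\<rho> (rproj k) w))\<^sup>2)"
        using ij(3) \<open>\<rho> (rproj j) w = w\<close> by simp
      also have "\<dots> \<le> (\<Sum>k\<in>Y. (hnorm H (\<rho> (rproj k) w))\<^sup>2)"
        using Y by (intro sum_mono2) (auto simp: Y_def)
      also have "\<dots> = Re (hinner H (\<rho> ?S w) w)" using sum Y by simp
      also have "\<dots> = (hnorm H w)\<^sup>2 + - Re (hinner H (\<rho> (gen One - ?S) w) w)"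
        using w S \<open>\<rho> (gen One) w = w\<close> by (simp add: app H.inner_minus_left H.hnorm_sq)
      also have "- Re (hinner H (\<rho> (gen One - ?S) w) w) \<le> hnorm H (\<rho> (gen One - ?S) w) * hnorm H w"
        using H.cauchy_schwarz[of "\<rho> (gen One - ?S) w" w] abs_Re_le_cmod[of "hinner H (\<rho> (gen One - ?S) w) w"]
          w S by (simp add: app(6))
      also have "\<dots> \<le> e * hnorm H w"
        using Xe Y w by (intro mult_right_mono) (auto intro: less_imp_le)
      finally show ?thesis by simp
    qed
    have "(hnorm H (\<rho> (rproj i) w))\<^sup>2 \<le> 0 + d" if d: "d > 0" for d
    proof -
      \<comment> \<open>One is added because \<open>w\<close> may be zero.\<close>
      have pos: "hnorm H w + 1 > 0" using H.hnorm_nonneg[OF w] by simp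
      have "d / (hnorm H w + 1) * hnorm H w \<le> d"
        using d pos H.hnorm_nonneg[OF w] by (simp add: field_simps)
      then show ?thesis using small[of "d / (hnorm H w + 1)"] d pos by simp
    qed
    then have "(hnorm H (\<rho> (rproj i) w))\<^sup>2 \<le> 0" by (rule field_le_epsilon)
    then have "\<rho> (rproj i) w = vzero H" using H.hnorm_eq_zero app(6) w ij by simp
    then show "\<rho> (rproj i * rproj j) v = vzero H" using v ij by (simp add: app w_def)
  qed (use ij in simp)
  have zeroI: "\<rho> x v = vzero H"
    if "x \<in> ?M" "v \<in> vcarrier H" "\<And>e. e > 0 \<Longrightarrow> hnorm H (\<rho> x v) \<le> e" for x v
  proof (rule H.hnorm_le_zeroD[OF _ app(6)[OF that(2,1)]])
    show "hnorm H (\<rho> x v) \<le> 0" by (rule field_le_epsilon) (use that(3) in simp)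
  qed
  have rproj_sum: "cg ((\<Sum>i\<in>X. fscale (c i) (rproj i)) * rproj j) (fscale (c j) (rproj j))"
    if "finite X" "X \<subseteq> I" "j \<in> X" for X c j
  proof -
    have "cg (\<Sum>i\<in>X. fscale (c i) (rproj i * rproj j)) (\<Sum>i\<in>X. if i = j then fscale (c j) (rproj j) else 0)"
    proof (rule cg_sum)
      fix i assume "i \<in> X"
      then have "i \<in> I" "j \<in> I" using that by auto
      then show "cg (fscale (c i) (rproj i * rproj j)) (if i = j then fscale (c j) (rproj j) else 0)"
        using that orth[of i j] cg_fscale[OF rproj_idem[of j], of "c j"]
          cg_fscale[of "rproj i * rproj j" 0 "c i"] by (auto simp: cg_zero_iff)
    qed
    then show ?thesis using that by (simp add: sum_distrib_right fscale_mult_left)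
  qed
  show ?thesis
  proof unfold_locales
    show "opnorm H (\<rho> (rproj i * rproj j)) = 0" if "i \<in> I" "j \<in> I" "i \<noteq> j" for i j
      using orth that by simp
    show "opnorm H (\<rho> (iproj i * rproj j - fscale (A i j) (rproj j))) = 0" if ij: "i \<in> I" "j \<in> I" for i j
    proof (rule null)
      fix v assume v: "v \<in> vcarrier H"
      have w: "\<rho> (rproj j) v \<in> vcarrier H" using v ij by (simp add: app)
      show "\<rho> (iproj i * rproj j - fscale (A i j) (rproj j)) v = vzero H"
      proof (rule zeroI)
        fix e :: real assume e: "e > 0"
        obtain X where X: "finite X" "X \<subseteq> I" and Xe: "\<forall>Y. finite Y \<and> Y \<subseteq> I \<and> X \<subseteq> Y
            \<longrightarrow> hnorm H (\<rho> (iproj i - (\<Sum>j\<in>Y. fscale (A i j) (rproj j))) (\<rho> (rproj j) v)) < e"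
          using fin_net_SOT[OF rep CK2_mem[OF ij(1)] w e] by (elim exE conjE)
        \<comment> \<open>Inserting \<open>j\<close> into the finite set makes the product with the
          j-th range projection independent of the rest of the set.\<close>
        let ?S = "\<Sum>k\<in>insert j X. fscale (A i k) (rproj k)"
        have S: "?S \<in> ?M" using X ij by (intro sum_mem fscale_mem rproj_mem) auto
        have "cg ((iproj i - ?S) * rproj j) (iproj i * rproj j - fscale (A i j) (rproj j))"
          using cg_diff[OF cg_refl[of "iproj i * rproj j"] rproj_sum[of "insert j X" j "A i"]] X ij
          by (simp add: left_diff_distrib)
        from cong[OF this v] show "hnorm H (\<rho> (iproj i * rproj j - fscale (A i j) (rproj j)) v) \<le> e"
          using Xe[rule_format, of "insert j X"] X ij v S
          by (simp add: app(4)[symmetric] less_imp_le subset_insertI del: sum.insert)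
      qed (use v ij in auto)
    qed (use ij in simp)
    fix x assume x: "x \<in> ?M" and det: "\<And>j. j \<in> I \<Longrightarrow> opnorm H (\<rho> (x * rproj j)) = 0"
    show "opnorm H (\<rho> (x * gen One)) = 0"
    proof (rule null)
      fix v assume v: "v \<in> vcarrier H"
      show "\<rho> (x * gen One) v = vzero H"
      proof (rule zeroI)
        fix e :: real assume e: "e > 0"
        define K where "K = opnorm H (\<rho> x) + 1"
        have K: "K > 0" "opnorm H (\<rho> x) \<le> K" using H.opnorm_nonneg[OF bdd[OF x]] by (auto simp: K_def)
        have "e / K > 0" using e K by simp
        from fin_net_SOT[OF rep CK1_mem v this]
        obtain X where X: "finite X" "X \<subseteq> I" and Xe: "hnorm H (\<rho> (gen One - (\<Sum>i\<in>X. rproj i)) v) < e / K"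
          by blast
        let ?S = "\<Sum>i\<in>X. rproj i"
        have S: "?S \<in> ?M" using X by (intro sum_mem rproj_mem) auto
        \<comment> \<open>By assumption \<open>x\<close> kills the partial sum, so it may be applied
          to the remainder of \<open>v\<close> alone, which (CK1) makes small.\<close>
        have "cg (x * ?S) (\<Sum>i\<in>X. 0)"
          unfolding sum_distrib_left using X x det by (intro cg_sum) (auto simp: cg_zero_iff)
        then have "cg (x * (gen One - ?S)) (x * gen One)"
          using cg_diff[OF cg_refl[of "x * gen One"], of "x * ?S" 0] x by (simp add: right_diff_distrib)
        from cong[OF this v] have "hnorm H (\<rho> (x * gen One) v) = hnorm H (\<rho> x (\<rho> (gen One - ?S) v))"
          using x S v by (simp add: app(4))
        also have "\<dots> \<le> K * hnorm H (\<rho> (gen One - ?S) v)"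
          using K x S v by (intro H.opnorm_boundI bdd app) auto
        also have "\<dots> \<le> K * (e / K)" using K Xe by (intro mult_left_mono) auto
        finally show "hnorm H (\<rho> (x * gen One) v) \<le> e" using K by simp
      qed (use x v in auto)
    qed (use x in simp)
  qed
qed

text \<open>The constant is uniform in \<open>N\<close>: it makes the supremum in the universal
  seminorm finite and bounds the components of an operator on a direct sum.\<close>

lemma ck_uniform_bound:
  assumes "x \<in> vcarrier (free_star (ck_gens I))"
  shows "\<exists>K\<ge>0. \<forall>N A. ck_relations I N A \<longrightarrow> N x \<le> K"
  using assms
proof (induction x rule: free_star_induct)
  case zero
  show ?case by (auto intro!: exI[of _ 0] simp: free_seminorm.N_zero ck_relations_def)
next
  case (gen g)
  have "N (Defs.gen g) \<le> 1" if "ck_relations I N A" for N A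
    using ck_relations.generator_norm[OF that gen] .
  then show ?case by (intro exI[of _ 1]) auto
next
  case (add x y)
  then obtain K L where K: "K \<ge> 0" "\<And>N A. ck_relations I N A \<Longrightarrow> N x \<le> K"
    and L: "L \<ge> 0" "\<And>N A. ck_relations I N A \<Longrightarrow> N y \<le> L" by metis
  have "N (x + y) \<le> K + L" if "ck_relations I N A" for N A
    using free_seminorm.N_add[OF ck_relations.axioms(1)[OF that] add(1,2)] K(2)[OF that] L(2)[OF that] by simp
  then show ?case using K L by (intro exI[of _ "K + L"]) auto
next
  case (scale c x)
  then obtain K where K: "K \<ge> 0" "\<And>N A. ck_relations I N A \<Longrightarrow> N x \<le> K" by metis
  have "N (fscale c x) \<le> cmod c * K" if "ck_relations I N A" for N A
    using free_seminorm.N_scale[OF ck_relations.axioms(1)[OF that] scale(1)] K(2)[OF that]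
    by (simp add: mult_left_mono)
  then show ?case using K by (intro exI[of _ "cmod c * K"]) auto
next
  case (mult x y)
  then obtain K L where K: "K \<ge> 0" "\<And>N A. ck_relations I N A \<Longrightarrow> N x \<le> K"
    and L: "L \<ge> 0" "\<And>N A. ck_relations I N A \<Longrightarrow> N y \<le> L" by metis
  have "N (x * y) \<le> K * L" if "ck_relations I N A" for N A
    using free_seminorm.N_mult[OF ck_relations.axioms(1)[OF that] mult(1,2)]
      mult_mono[OF K(2)[OF that] L(2)[OF that] K(1)]
      free_seminorm.N_nonneg[OF ck_relations.axioms(1)[OF that] mult(2)] by simp
  then show ?case using K L by (intro exI[of _ "K * L"]) auto
next
  case (star x)
  then show ?case using free_seminorm.N_star[OF ck_relations.axioms(1)] by metis
qed

section \<open>Direct sums of Hilbert spaces and admissibility\<close>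

lemma hsum_mem:
  "f \<in> vcarrier (hsum \<Lambda> H) \<longleftrightarrow>
    f \<in> (\<Pi>\<^sub>E k\<in>\<Lambda>. vcarrier (H k)) \<and> (\<lambda>k. (hnorm (H k) (f k))\<^sup>2) summable_on \<Lambda>"
  by (simp add: hsum_def)

lemma hsum_simps [simp]:
  "k \<in> \<Lambda> \<Longrightarrow> vzero (hsum \<Lambda> H) k = vzero (H k)"
  "k \<in> \<Lambda> \<Longrightarrow> vadd (hsum \<Lambda> H) f g k = vadd (H k) (f k) (g k)"
  "k \<in> \<Lambda> \<Longrightarrow> vscale (hsum \<Lambda> H) c f k = vscale (H k) c (f k)"
  "hinner (hsum \<Lambda> H) f g = (\<Sum>\<^sub>\<infinity>k\<in>\<Lambda>. hinner (H k) (f k) (g k))"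
  by (simp_all add: hsum_def)

lemma hsum_minus [simp]: "k \<in> \<Lambda> \<Longrightarrow> vminus (hsum \<Lambda> H) f g k = vminus (H k) (f k) (g k)"
  by (simp add: vminus_def)

lemma hsum_ext:
  "vzero (hsum \<Lambda> H) \<in> extensional \<Lambda>" "vadd (hsum \<Lambda> H) f g \<in> extensional \<Lambda>"
  "vscale (hsum \<Lambda> H) c f \<in> extensional \<Lambda>"
  by (simp_all add: hsum_def)

lemma hsum_eqI:
  "\<lbrakk>f \<in> vcarrier (hsum \<Lambda> H); g \<in> vcarrier (hsum \<Lambda> H); \<And>k. k \<in> \<Lambda> \<Longrightarrow> f k = g k\<rbrakk> \<Longrightarrow> f = g"
  by (auto simp: hsum_mem intro: PiE_ext)

lemma hsum_closed: "\<lbrakk>f \<in> vcarrier (hsum \<Lambda> H); k \<in> \<Lambda>\<rbrakk> \<Longrightarrow> f k \<in> vcarrier (H k)"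
  by (auto simp: hsum_mem)

lemma hsum_summable: "f \<in> vcarrier (hsum \<Lambda> H) \<Longrightarrow> (\<lambda>k. (hnorm (H k) (f k))\<^sup>2) summable_on \<Lambda>"
  by (simp add: hsum_mem)

locale hilbert_family =
  fixes \<Lambda> :: "'k set" and H :: "'k \<Rightarrow> 'h hilbert"
  assumes hilbert: "k \<in> \<Lambda> \<Longrightarrow> hilbert_space (H k)"
begin

lemma hsum_memI:
  assumes ext: "f \<in> extensional \<Lambda>" and cl: "\<And>k. k \<in> \<Lambda> \<Longrightarrow> f k \<in> vcarrier (H k)"
    and s: "s summable_on \<Lambda>" and leq: "\<And>k. k \<in> \<Lambda> \<Longrightarrow> (hnorm (H k) (f k))\<^sup>2 \<le> s k"
  shows "f \<in> vcarrier (hsum \<Lambda> H)"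
  using ext cl summable_on_comparison_test[OF s leq] by (auto simp: hsum_mem PiE_iff)

lemma hsum_add_closed:
  assumes f: "f \<in> vcarrier (hsum \<Lambda> H)" and g: "g \<in> vcarrier (hsum \<Lambda> H)"
  shows "vadd (hsum \<Lambda> H) f g \<in> vcarrier (hsum \<Lambda> H)"
proof (rule hsum_memI[OF hsum_ext(2)])
  show "(\<lambda>k. 2 * (hnorm (H k) (f k))\<^sup>2 + 2 * (hnorm (H k) (g k))\<^sup>2) summable_on \<Lambda>"
    using f g by (intro summable_on_add summable_on_cmult_right hsum_summable)
  fix k assume k: "k \<in> \<Lambda>"
  interpret Hk: hilbert_space "H k" using k by (rule hilbert)
  note c = hsum_closed[OF f k] hsum_closed[OF g k]
  show "vadd (hsum \<Lambda> H) f g k \<in> vcarrier (H k)" using c k by simp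
  have "(hnorm (H k) (vadd (H k) (f k) (g k)))\<^sup>2 \<le> (hnorm (H k) (f k) + hnorm (H k) (g k))\<^sup>2"
    using c by (intro power_mono Hk.hnorm_triangle) auto
  also have "\<dots> \<le> 2 * (hnorm (H k) (f k))\<^sup>2 + 2 * (hnorm (H k) (g k))\<^sup>2"
    using sum_squares_bound[of "hnorm (H k) (f k)" "hnorm (H k) (g k)"] by (simp add: power2_sum)
  finally show "(hnorm (H k) (vadd (hsum \<Lambda> H) f g k))\<^sup>2
      \<le> 2 * (hnorm (H k) (f k))\<^sup>2 + 2 * (hnorm (H k) (g k))\<^sup>2" using k by simp
qed

lemma hsum_scale_closed:
  assumes f: "f \<in> vcarrier (hsum \<Lambda> H)"
  shows "vscale (hsum \<Lambda> H) c f \<in> vcarrier (hsum \<Lambda> H)"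
proof (rule hsum_memI[OF hsum_ext(3)])
  show "(\<lambda>k. (cmod c)\<^sup>2 * (hnorm (H k) (f k))\<^sup>2) summable_on \<Lambda>"
    using f by (intro summable_on_cmult_right hsum_summable)
  fix k assume k: "k \<in> \<Lambda>"
  interpret Hk: hilbert_space "H k" using k by (rule hilbert)
  show "vscale (hsum \<Lambda> H) c f k \<in> vcarrier (H k)"
    "(hnorm (H k) (vscale (hsum \<Lambda> H) c f k))\<^sup>2 \<le> (cmod c)\<^sup>2 * (hnorm (H k) (f k))\<^sup>2"
    using hsum_closed[OF f k] k by (simp_all add: Hk.hnorm_scale power_mult_distrib)
qed

lemma hsum_zero_closed: "vzero (hsum \<Lambda> H) \<in> vcarrier (hsum \<Lambda> H)"
proof (rule hsum_memI[OF hsum_ext(1)])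
  show "(\<lambda>_. 0 :: real) summable_on \<Lambda>" by simp
  fix k assume k: "k \<in> \<Lambda>"
  interpret Hk: hilbert_space "H k" using k by (rule hilbert)
  show "vzero (hsum \<Lambda> H) k \<in> vcarrier (H k)" "(hnorm (H k) (vzero (hsum \<Lambda> H) k))\<^sup>2 \<le> 0"
    using k by simp_all
qed

lemma hsum_inner_summable:
  assumes f: "f \<in> vcarrier (hsum \<Lambda> H)" and g: "g \<in> vcarrier (hsum \<Lambda> H)"
  shows "(\<lambda>k. hinner (H k) (f k) (g k)) summable_on \<Lambda>"
proof -
  have "(\<lambda>k. cmod (hinner (H k) (f k) (g k))) summable_on \<Lambda>"
  proof (rule summable_on_comparison_test)
    show "(\<lambda>k. (hnorm (H k) (f k))\<^sup>2 + (hnorm (H k) (g k))\<^sup>2) summable_on \<Lambda>"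
      using f g by (intro summable_on_add hsum_summable)
    fix k assume k: "k \<in> \<Lambda>"
    interpret Hk: hilbert_space "H k" using k by (rule hilbert)
    note c = hsum_closed[OF f k] hsum_closed[OF g k]
    have "cmod (hinner (H k) (f k) (g k)) \<le> hnorm (H k) (f k) * hnorm (H k) (g k)"
      using c by (rule Hk.cauchy_schwarz)
    also have "\<dots> \<le> (hnorm (H k) (f k))\<^sup>2 + (hnorm (H k) (g k))\<^sup>2"
      using sum_squares_bound[of "hnorm (H k) (f k)" "hnorm (H k) (g k)"]
        mult_nonneg_nonneg[OF Hk.hnorm_nonneg[OF c(1)] Hk.hnorm_nonneg[OF c(2)]] by linarith
    finally show "cmod (hinner (H k) (f k) (g k)) \<le> (hnorm (H k) (f k))\<^sup>2 + (hnorm (H k) (g k))\<^sup>2" .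
  qed simp
  then show ?thesis by (rule abs_summable_summable)
qed

lemma hsum_inner_self:
  assumes f: "f \<in> vcarrier (hsum \<Lambda> H)"
  shows "hinner (hsum \<Lambda> H) f f = complex_of_real (\<Sum>\<^sub>\<infinity>k\<in>\<Lambda>. (hnorm (H k) (f k))\<^sup>2)"
proof -
  have "hinner (hsum \<Lambda> H) f f = (\<Sum>\<^sub>\<infinity>k\<in>\<Lambda>. complex_of_real ((hnorm (H k) (f k))\<^sup>2))"
    using hilbert_space.inner_self[OF hilbert hsum_closed[OF f]] by (auto intro!: infsum_cong)
  also have "\<dots> = complex_of_real (\<Sum>\<^sub>\<infinity>k\<in>\<Lambda>. (hnorm (H k) (f k))\<^sup>2)"
    by (rule infsumI[OF has_sum_of_real[OF has_sum_infsum[OF hsum_summable[OF f]]]])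
  finally show ?thesis .
qed

lemma hsum_norm_sq:
  assumes f: "f \<in> vcarrier (hsum \<Lambda> H)"
  shows "(hnorm (hsum \<Lambda> H) f)\<^sup>2 = (\<Sum>\<^sub>\<infinity>k\<in>\<Lambda>. (hnorm (H k) (f k))\<^sup>2)"
  unfolding hnorm_def[of "hsum \<Lambda> H"] hsum_inner_self[OF f]
  by (simp add: infsum_nonneg)

lemma hsum_norm_nonneg: "f \<in> vcarrier (hsum \<Lambda> H) \<Longrightarrow> 0 \<le> hnorm (hsum \<Lambda> H) f"
  unfolding hnorm_def[of "hsum \<Lambda> H"] by (subst hsum_inner_self) (simp_all add: infsum_nonneg)

lemma hsum_component_le:
  assumes f: "f \<in> vcarrier (hsum \<Lambda> H)" and k: "k \<in> \<Lambda>"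
  shows "hnorm (H k) (f k) \<le> hnorm (hsum \<Lambda> H) f"
proof (rule power2_le_imp_le)
  show "(hnorm (H k) (f k))\<^sup>2 \<le> (hnorm (hsum \<Lambda> H) f)\<^sup>2"
    unfolding hsum_norm_sq[OF f] using finite_sum_le_infsum[OF hsum_summable[OF f], of "{k}"] k by simp
qed (rule hsum_norm_nonneg[OF f])

lemma hsum_norm_leI:
  assumes f: "f \<in> vcarrier (hsum \<Lambda> H)" and c: "0 \<le> c"
    and leq: "\<And>S. \<lbrakk>finite S; S \<subseteq> \<Lambda>\<rbrakk> \<Longrightarrow> (\<Sum>k\<in>S. (hnorm (H k) (f k))\<^sup>2) \<le> c\<^sup>2"
  shows "hnorm (hsum \<Lambda> H) f \<le> c"
proof (rule power2_le_imp_le[OF _ c])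
  show "(hnorm (hsum \<Lambda> H) f)\<^sup>2 \<le> c\<^sup>2"
    unfolding hsum_norm_sq[OF f] by (rule infsum_le_finite_sums[OF hsum_summable[OF f] leq])
qed

lemma hsum_vector_space: "complex_vector_space (hsum \<Lambda> H)"
proof -
  note vs = hilbert_space.axioms(1)[OF hilbert]
  note cl [simp] = hsum_zero_closed hsum_add_closed hsum_scale_closed hsum_closed[of _ \<Lambda> H]
  show ?thesis
  proof (unfold_locales, goal_cases)
    case (4 f g h) then show ?case
      by (intro hsum_eqI[of _ \<Lambda> H]) (simp_all add: complex_vector_space.add_assoc[OF vs])
  next
    case (5 f g) then show ?case
      by (intro hsum_eqI[of _ \<Lambda> H]) (simp_all add: complex_vector_space.add_commute[OF vs])
  next
    case (6 f) then show ?case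
      by (intro hsum_eqI[of _ \<Lambda> H]) (simp_all add: complex_vector_space.add_zero[OF vs])
  next
    case (7 f) then show ?case
      by (intro hsum_eqI[of _ \<Lambda> H]) (simp_all add: complex_vector_space.add_inverse[OF vs])
  next
    case (8 f g c) then show ?case
      by (intro hsum_eqI[of _ \<Lambda> H]) (simp_all add: complex_vector_space.scale_add_right[OF vs])
  next
    case (9 f c d) then show ?case
      by (intro hsum_eqI[of _ \<Lambda> H]) (simp_all add: complex_vector_space.scale_add_left[OF vs])
  next
    case (10 f c d) then show ?case
      by (intro hsum_eqI[of _ \<Lambda> H]) (simp_all add: complex_vector_space.scale_scale[OF vs])
  next
    case (11 f) then show ?case
      by (intro hsum_eqI[of _ \<Lambda> H]) (simp_all add: complex_vector_space.scale_one[OF vs])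
  qed simp_all
qed

lemma hsum_complete: "vcomplete (hsum \<Lambda> H) (hnorm (hsum \<Lambda> H))"
  unfolding vcomplete_def
proof (intro allI impI)
  interpret V: complex_vector_space "hsum \<Lambda> H" by (rule hsum_vector_space)
  fix F assume F: "vcauchy (hsum \<Lambda> H) (hnorm (hsum \<Lambda> H)) F"
  have Fc: "F n \<in> vcarrier (hsum \<Lambda> H)" for n using vcauchy_closed[OF F] .
  have "\<exists>l. l \<in> vcarrier (H k) \<and> vconverges (H k) (hnorm (H k)) (\<lambda>n. F n k) l" if k: "k \<in> \<Lambda>" for k
  proof -
    interpret Hk: hilbert_space "H k" using k by (rule hilbert)
    have "vcauchy (H k) (hnorm (H k)) (\<lambda>n. F n k)"
      unfolding vcauchy_def
    proof (intro conjI allI impI)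
      fix e :: real assume "e > 0"
      then obtain N where N: "\<And>m n. m \<ge> N \<Longrightarrow> n \<ge> N \<Longrightarrow> hnorm (hsum \<Lambda> H) (vminus (hsum \<Lambda> H) (F m) (F n)) < e"
        using vcauchyE[OF F] by metis
      have "hnorm (H k) (vminus (H k) (F m k) (F n k)) < e" if "m \<ge> N" "n \<ge> N" for m n
        using hsum_component_le[OF V.minus_closed[OF Fc Fc] k, of m n] N[OF that] k by simp
      then show "\<exists>N. \<forall>m\<ge>N. \<forall>n\<ge>N. hnorm (H k) (vminus (H k) (F m k) (F n k)) < e" by blast
    qed (use hsum_closed[OF Fc k] in simp)
    then show ?thesis using Hk.hilbert_complete unfolding vcomplete_def by blast
  qed
  then obtain l where l: "\<And>k. k \<in> \<Lambda> \<Longrightarrow> l k \<in> vcarrier (H k)"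
    and lim: "\<And>k. k \<in> \<Lambda> \<Longrightarrow> vconverges (H k) (hnorm (H k)) (\<lambda>n. F n k) (l k)" by metis
  define D where "D m = (\<lambda>k\<in>\<Lambda>. vminus (H k) (F m k) (l k))" for m
  have Dc: "D m k \<in> vcarrier (H k)" if "k \<in> \<Lambda>" for m k
  proof -
    interpret Hk: hilbert_space "H k" using that by (rule hilbert)
    show ?thesis using that l hsum_closed[OF Fc] by (simp add: D_def)
  qed
  \<comment> \<open>Finite partial sums of ||F m - F n||^2 are bounded uniformly in large n, and n
    may tend to infinity in finitely many coordinates at a time.\<close>
  have tail: "(\<Sum>k\<in>S. (hnorm (H k) (D m k))\<^sup>2) \<le> e\<^sup>2"
    if N: "\<And>n. n \<ge> N \<Longrightarrow> hnorm (hsum \<Lambda> H) (vminus (hsum \<Lambda> H) (F m) (F n)) < e" and S: "finite S" "S \<subseteq> \<Lambda>"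
    for m N S e
  proof (rule LIMSEQ_le_const2)
    show "(\<lambda>n. \<Sum>k\<in>S. (hnorm (H k) (vminus (H k) (F m k) (F n k)))\<^sup>2) \<longlonglongrightarrow> (\<Sum>k\<in>S. (hnorm (H k) (D m k))\<^sup>2)"
    proof (intro tendsto_sum tendsto_power)
      fix k assume "k \<in> S"
      then have k: "k \<in> \<Lambda>" using S by blast
      interpret Hk: hilbert_space "H k" using k by (rule hilbert)
      have c: "F n k \<in> vcarrier (H k)" for n using hsum_closed[OF Fc k] .
      have "vminus (H k) (vminus (H k) (F m k) (F n k)) (vminus (H k) (F m k) (l k)) = vminus (H k) (l k) (F n k)" for n
        using Hk.minus_trans[of "l k" "F m k" "F n k"] Hk.minus_swap[of "F m k" "l k"] c l[OF k]
        by (simp add: vminus_def[of "H k" "vminus (H k) _ _"] Hk.add_commute)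
      then have "vconverges (H k) (hnorm (H k)) (\<lambda>n. vminus (H k) (F m k) (F n k)) (D m k)"
        using lim[OF k] c l[OF k] k Hk.hs.nrm_minus_commute[OF l[OF k] c]
        by (simp add: vconverges_def D_def)
      then show "(\<lambda>n. hnorm (H k) (vminus (H k) (F m k) (F n k))) \<longlonglongrightarrow> hnorm (H k) (D m k)"
        using c by (intro Hk.hs.vconverges_nrm) (auto intro!: Dc k)
    qed
    have "(\<Sum>k\<in>S. (hnorm (H k) (vminus (H k) (F m k) (F n k)))\<^sup>2) \<le> e\<^sup>2" if n: "n \<ge> N" for n
    proof -
      let ?d = "vminus (hsum \<Lambda> H) (F m) (F n)"
      have d: "?d \<in> vcarrier (hsum \<Lambda> H)" using Fc by simp
      have "(\<Sum>k\<in>S. (hnorm (H k) (?d k))\<^sup>2) \<le> (hnorm (hsum \<Lambda> H) ?d)\<^sup>2"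
        unfolding hsum_norm_sq[OF d] using S by (intro finite_sum_le_infsum hsum_summable d) auto
      also have "\<dots> \<le> e\<^sup>2" using N[OF n] hsum_norm_nonneg[OF d] by (intro power_mono) auto
      finally show ?thesis using S by (simp add: subset_iff cong: sum.cong)
    qed
    then show "\<exists>N. \<forall>n\<ge>N. (\<Sum>k\<in>S. (hnorm (H k) (vminus (H k) (F m k) (F n k)))\<^sup>2) \<le> e\<^sup>2" by blast
  qed
  have D_mem: "D m \<in> vcarrier (hsum \<Lambda> H) \<and> hnorm (hsum \<Lambda> H) (D m) \<le> e"
    if N: "\<And>n. n \<ge> N \<Longrightarrow> hnorm (hsum \<Lambda> H) (vminus (hsum \<Lambda> H) (F m) (F n)) < e" for m N e
  proof -
    have e: "e \<ge> 0" using N[of N] hsum_norm_nonneg[OF V.minus_closed[OF Fc Fc]] by (meson less_imp_le order_trans order_refl)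
    have "(\<lambda>k. (hnorm (H k) (D m k))\<^sup>2) summable_on \<Lambda>"
      by (rule nonneg_bdd_above_summable_on) (use tail[OF N] in \<open>auto intro!: bdd_aboveI\<close>)
    then have "D m \<in> vcarrier (hsum \<Lambda> H)"
      using Dc by (auto simp: hsum_mem D_def)
    with hsum_norm_leI[OF this e tail[OF N]] show ?thesis by simp
  qed
  define L where "L = (\<lambda>k\<in>\<Lambda>. l k)"
  obtain N1 where N1: "\<And>m n. m \<ge> N1 \<Longrightarrow> n \<ge> N1 \<Longrightarrow> hnorm (hsum \<Lambda> H) (vminus (hsum \<Lambda> H) (F m) (F n)) < 1"
    using vcauchyE[OF F, of 1] by auto
  have "D N1 \<in> vcarrier (hsum \<Lambda> H)" using D_mem[of N1 N1 1] N1 by blast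
  then have "vminus (hsum \<Lambda> H) (F N1) (D N1) \<in> vcarrier (hsum \<Lambda> H)" using Fc by simp
  \<comment> \<open>Square summability of the coordinatewise limit is obtained by writing it as a
    difference of two members of the direct sum.\<close>
  moreover have "vminus (hsum \<Lambda> H) (F N1) (D N1) = L"
  proof (rule extensionalityI[of _ \<Lambda>])
    fix k assume k: "k \<in> \<Lambda>"
    interpret Hk: hilbert_space "H k" using k by (rule hilbert)
    show "vminus (hsum \<Lambda> H) (F N1) (D N1) k = L k"
      using Hk.minus_swap[of "F N1 k" "l k"] Hk.minus_add_cancel[of "l k" "F N1 k"] hsum_closed[OF Fc k] l[OF k] k
      by (simp add: L_def D_def vminus_def[of "H k" _ "vminus _ _ _"] Hk.add_commute)
  qed (simp_all add: vminus_def hsum_ext L_def)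
  ultimately have L: "L \<in> vcarrier (hsum \<Lambda> H)" by simp
  have D_eq: "vminus (hsum \<Lambda> H) (F m) L = D m" for m
    by (rule extensionalityI[of _ \<Lambda>]) (auto simp: vminus_def hsum_ext L_def D_def)
  have "vconverges (hsum \<Lambda> H) (hnorm (hsum \<Lambda> H)) F L"
    unfolding vconverges_def D_eq
  proof (rule LIMSEQ_I)
    fix e :: real assume e: "e > 0"
    then obtain N where N: "\<And>m n. m \<ge> N \<Longrightarrow> n \<ge> N \<Longrightarrow> hnorm (hsum \<Lambda> H) (vminus (hsum \<Lambda> H) (F m) (F n)) < e / 2"
      using vcauchyE[OF F, of "e / 2"] by auto
    have "norm (hnorm (hsum \<Lambda> H) (D m) - 0) < e" if "m \<ge> N" for m
      using D_mem[of N m "e / 2"] N[OF that] hsum_norm_nonneg[of "D m"] e by auto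
    then show "\<exists>N. \<forall>m\<ge>N. norm (hnorm (hsum \<Lambda> H) (D m) - 0) < e" by blast
  qed
  then show "\<exists>l\<in>vcarrier (hsum \<Lambda> H). vconverges (hsum \<Lambda> H) (hnorm (hsum \<Lambda> H)) F l"
    using L by blast
qed

lemma hsum_hilbert: "hilbert_space (hsum \<Lambda> H)"
proof -
  interpret V: complex_vector_space "hsum \<Lambda> H" by (rule hsum_vector_space)
  note s = hsum_inner_summable
  show ?thesis
  proof (unfold_locales, goal_cases)
    case (1 f g h)
    have "hinner (hsum \<Lambda> H) (vadd (hsum \<Lambda> H) f g) h
        = (\<Sum>\<^sub>\<infinity>k\<in>\<Lambda>. hinner (H k) (f k) (h k) + hinner (H k) (g k) (h k))"
      using hilbert_space.inner_add_left[OF hilbert] 1 by (auto intro!: infsum_cong simp: hsum_closed)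
    then show ?case using 1 by (simp add: infsum_add s)
  next
    case (2 f g c)
    have "hinner (hsum \<Lambda> H) (vscale (hsum \<Lambda> H) c f) g = (\<Sum>\<^sub>\<infinity>k\<in>\<Lambda>. c * hinner (H k) (f k) (g k))"
      using hilbert_space.inner_scale_left[OF hilbert] 2 by (auto intro!: infsum_cong simp: hsum_closed)
    then show ?case using 2 by (simp add: infsum_cmult_right' )
  next
    case (3 f g)
    have "hinner (hsum \<Lambda> H) f g = (\<Sum>\<^sub>\<infinity>k\<in>\<Lambda>. cnj (hinner (H k) (g k) (f k)))"
      unfolding hsum_simps
    proof (rule infsum_cong)
      fix k assume k: "k \<in> \<Lambda>"
      show "hinner (H k) (f k) (g k) = cnj (hinner (H k) (g k) (f k))"
        by (rule hilbert_space.inner_commute[OF hilbert[OF k] hsum_closed[OF 3(1) k] hsum_closed[OF 3(2) k]])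
    qed
    then show ?case by simp
  next
    case (4 f) then show ?case by (subst hsum_inner_self) (auto intro!: infsum_nonneg)
  next
    case (5 f)
    have z: "(\<Sum>\<^sub>\<infinity>k\<in>\<Lambda>. (hnorm (H k) (f k))\<^sup>2) = 0"
      using 5 hsum_inner_self[of f] by (metis of_real_eq_0_iff)
    have "f k = vzero (H k)" if k: "k \<in> \<Lambda>" for k
    proof -
      have "(hnorm (H k) (f k))\<^sup>2 = 0"
        using nonneg_infsum_le_0D[OF _ hsum_summable[OF 5(1)] _ k] z by simp
      then show ?thesis using hilbert_space.hnorm_eq_zero[OF hilbert[OF k] hsum_closed[OF 5(1) k]] k by simp
    qed
    then show ?case using 5 by (intro hsum_eqI[of _ \<Lambda> H]) (auto intro: hsum_zero_closed)
  next
    case 6 show ?case by (rule hsum_complete)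
  qed
qed

lemma hsum_op_apply: "f \<in> vcarrier (hsum \<Lambda> H) \<Longrightarrow> k \<in> \<Lambda> \<Longrightarrow> hsum_op \<Lambda> H R f k = R k (f k)"
  by (simp add: hsum_op_def)

context
  fixes R :: "'k \<Rightarrow> 'h \<Rightarrow> 'h" and K :: real
  assumes R: "\<And>k. k \<in> \<Lambda> \<Longrightarrow> bounded_op (H k) (R k)" and K: "0 \<le> K" "\<And>k. k \<in> \<Lambda> \<Longrightarrow> opnorm (H k) (R k) \<le> K"
begin

lemma hsum_op_closed:
  assumes f: "f \<in> vcarrier (hsum \<Lambda> H)"
  shows "hsum_op \<Lambda> H R f \<in> vcarrier (hsum \<Lambda> H)"
proof (rule hsum_memI)
  show "(\<lambda>k. K\<^sup>2 * (hnorm (H k) (f k))\<^sup>2) summable_on \<Lambda>"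
    using f by (intro summable_on_cmult_right hsum_summable)
  show "hsum_op \<Lambda> H R f \<in> extensional \<Lambda>" using f by (simp add: hsum_op_def)
  fix k assume k: "k \<in> \<Lambda>"
  interpret Hk: hilbert_space "H k" using k by (rule hilbert)
  note c = hsum_closed[OF f k]
  show "hsum_op \<Lambda> H R f k \<in> vcarrier (H k)" using c R k f by (simp add: hsum_op_apply bounded_op_closed)
  have "(hnorm (H k) (R k (f k)))\<^sup>2 \<le> (K * hnorm (H k) (f k))\<^sup>2"
    using c R k K by (intro power_mono Hk.opnorm_boundI) (auto simp: bounded_op_closed)
  then show "(hnorm (H k) (hsum_op \<Lambda> H R f k))\<^sup>2 \<le> K\<^sup>2 * (hnorm (H k) (f k))\<^sup>2"
    using f k by (simp add: hsum_op_apply power_mult_distrib)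
qed

lemma hsum_op_norm:
  assumes f: "f \<in> vcarrier (hsum \<Lambda> H)"
  shows "hnorm (hsum \<Lambda> H) (hsum_op \<Lambda> H R f) \<le> K * hnorm (hsum \<Lambda> H) f"
proof (rule hsum_norm_leI[OF hsum_op_closed[OF f]])
  fix S assume S: "finite S" "S \<subseteq> \<Lambda>"
  have "(\<Sum>k\<in>S. (hnorm (H k) (hsum_op \<Lambda> H R f k))\<^sup>2) \<le> (\<Sum>k\<in>S. K\<^sup>2 * (hnorm (H k) (f k))\<^sup>2)"
  proof (rule sum_mono)
    fix k assume "k \<in> S"
    then have k: "k \<in> \<Lambda>" using S by blast
    interpret Hk: hilbert_space "H k" using k by (rule hilbert)
    have "(hnorm (H k) (R k (f k)))\<^sup>2 \<le> (K * hnorm (H k) (f k))\<^sup>2"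
      using hsum_closed[OF f k] R k K by (intro power_mono Hk.opnorm_boundI) (auto simp: bounded_op_closed)
    then show "(hnorm (H k) (hsum_op \<Lambda> H R f k))\<^sup>2 \<le> K\<^sup>2 * (hnorm (H k) (f k))\<^sup>2"
      using f k by (simp add: hsum_op_apply power_mult_distrib)
  qed
  also have "\<dots> \<le> K\<^sup>2 * (\<Sum>\<^sub>\<infinity>k\<in>\<Lambda>. (hnorm (H k) (f k))\<^sup>2)"
    unfolding sum_distrib_left[symmetric] using S f
    by (intro mult_left_mono finite_sum_le_infsum hsum_summable) auto
  also have "\<dots> = (K * hnorm (hsum \<Lambda> H) f)\<^sup>2"
    using hsum_norm_sq[OF f] by (simp add: power_mult_distrib)
  finally show "(\<Sum>k\<in>S. (hnorm (H k) (hsum_op \<Lambda> H R f k))\<^sup>2) \<le> (K * hnorm (hsum \<Lambda> H) f)\<^sup>2" .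
qed (use K f hsum_norm_nonneg in simp)

lemma hsum_op_bounded: "bounded_op (hsum \<Lambda> H) (hsum_op \<Lambda> H R)"
  unfolding bounded_op_def
proof (intro conjI allI ballI)
  show "hsum_op \<Lambda> H R \<in> extensional (vcarrier (hsum \<Lambda> H))" by (simp add: hsum_op_def)
  show "\<exists>K. \<forall>x\<in>vcarrier (hsum \<Lambda> H). hnorm (hsum \<Lambda> H) (hsum_op \<Lambda> H R x) \<le> K * hnorm (hsum \<Lambda> H) x"
    using hsum_op_norm by blast
  fix f assume f: "f \<in> vcarrier (hsum \<Lambda> H)"
  show "hsum_op \<Lambda> H R (vscale (hsum \<Lambda> H) c f) = vscale (hsum \<Lambda> H) c (hsum_op \<Lambda> H R f)" for c
    by (rule hsum_eqI[of _ \<Lambda> H])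
      (use f R in \<open>auto simp: hsum_op_apply hsum_op_closed hsum_scale_closed bounded_op_scale hsum_closed\<close>)
  fix g assume g: "g \<in> vcarrier (hsum \<Lambda> H)"
  show "hsum_op \<Lambda> H R (vadd (hsum \<Lambda> H) f g) = vadd (hsum \<Lambda> H) (hsum_op \<Lambda> H R f) (hsum_op \<Lambda> H R g)"
    by (rule hsum_eqI[of _ \<Lambda> H])
      (use f g R in \<open>auto simp: hsum_op_apply hsum_op_closed hsum_add_closed bounded_op_add hsum_closed\<close>)
qed (use hsum_op_closed in auto)

lemma hsum_op_norm_le: "opnorm (hsum \<Lambda> H) (hsum_op \<Lambda> H R) \<le> K"
  by (rule hilbert_space.opnorm_le[OF hsum_hilbert K(1) hsum_op_norm])

end

text \<open>Pointwise convergence to zero passes to direct sums because the nets are uniformly bounded: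
  all but finitely many components of a vector contribute little.\<close>

lemma hsum_net_small:
  fixes R :: "'d \<Rightarrow> 'k \<Rightarrow> 'h \<Rightarrow> 'h"
  assumes dir: "directed D leq" and R: "\<And>k d. \<lbrakk>k \<in> \<Lambda>; d \<in> D\<rbrakk> \<Longrightarrow> bounded_op (H k) (R d k)"
    and K: "0 \<le> K" "\<And>k d. \<lbrakk>k \<in> \<Lambda>; d \<in> D\<rbrakk> \<Longrightarrow> opnorm (H k) (R d k) \<le> K"
    and small: "\<And>k v e. \<lbrakk>k \<in> \<Lambda>; v \<in> vcarrier (H k); e > 0\<rbrakk>
      \<Longrightarrow> \<exists>d\<in>D. \<forall>d'\<in>D. leq d d' \<longrightarrow> hnorm (H k) (R d' k v) < e"
    and f: "f \<in> vcarrier (hsum \<Lambda> H)" and e: "e > 0"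
  shows "\<exists>d\<in>D. \<forall>d'\<in>D. leq d d' \<longrightarrow> hnorm (hsum \<Lambda> H) (hsum_op \<Lambda> H (R d') f) < e"
proof -
  define s where "s = (\<lambda>k. (hnorm (H k) (f k))\<^sup>2)"
  have s: "s summable_on \<Lambda>" using hsum_summable[OF f] by (simp add: s_def)
  \<comment> \<open>\<open>L\<close> replaces K^2, which may be zero, in a denominator.\<close>
  define L where "L = K\<^sup>2 + 1"
  have L: "L > 0" "K\<^sup>2 \<le> L" by (simp_all add: L_def add_nonneg_pos)
  define \<delta> where "\<delta> = e\<^sup>2 / (4 * L)"
  have \<delta>: "\<delta> > 0" using e L by (simp add: \<delta>_def)
  obtain S where S: "finite S" "S \<subseteq> \<Lambda>" and tail: "dist (sum s S) (infsum s \<Lambda>) \<le> \<delta>"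
    using infsum_finite_approximation[OF s \<delta>] by metis
  have tail': "sum s S' \<le> \<delta>" if "finite S'" "S' \<subseteq> \<Lambda> - S" for S'
  proof -
    have "sum s S + sum s S' = sum s (S \<union> S')" using that S by (intro sum.union_disjoint[symmetric]) auto
    also have "\<dots> \<le> infsum s \<Lambda>" using that S by (intro finite_sum_le_infsum s) (auto simp: s_def)
    finally show ?thesis using tail by (auto simp: dist_real_def)
  qed
  \<comment> \<open>Chosen so that the coordinates in \<open>S\<close> contribute at most e^2/4,
    whatever the size of \<open>S\<close>. The tail contributes at most as much again, and e^2/2 is
    strictly below e^2.\<close>
  define \<epsilon> where "\<epsilon> = sqrt (e\<^sup>2 / (4 * (real (card S) + 1)))"
  have \<epsilon>: "\<epsilon> > 0" and \<epsilon>2: "\<epsilon>\<^sup>2 = e\<^sup>2 / (4 * (real (card S) + 1))" using e by (auto simp: \<epsilon>_def)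
  have "\<exists>d\<in>D. \<forall>d'\<in>D. leq d d' \<longrightarrow> (\<forall>k\<in>S. hnorm (H k) (R d' k (f k)) < \<epsilon>)"
    using S
  proof (induction S)
    case empty
    obtain d where "d \<in> D" using dir unfolding directed_def by (elim conjE) blast
    then show ?case by auto
  next
    case (insert k S)
    then have k: "k \<in> \<Lambda>" and S: "S \<subseteq> \<Lambda>" by auto
    obtain d1 where d1: "d1 \<in> D" "\<forall>d'\<in>D. leq d1 d' \<longrightarrow> (\<forall>k\<in>S. hnorm (H k) (R d' k (f k)) < \<epsilon>)"
      using insert.IH[OF S] by (elim bexE)
    obtain d2 where d2: "d2 \<in> D" "\<forall>d'\<in>D. leq d2 d' \<longrightarrow> hnorm (H k) (R d' k (f k)) < \<epsilon>"
      using small[OF k hsum_closed[OF f k] \<epsilon>] by (elim bexE)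
    have dirs: "\<forall>i\<in>D. \<forall>j\<in>D. \<exists>k\<in>D. leq i k \<and> leq j k"
      using dir unfolding directed_def by (elim conjE)
    have tr: "\<forall>i\<in>D. \<forall>j\<in>D. \<forall>k\<in>D. leq i j \<and> leq j k \<longrightarrow> leq i k"
      using dir unfolding directed_def by (elim conjE)
    obtain d3 where d3: "d3 \<in> D" "leq d1 d3" "leq d2 d3" using dirs d1(1) d2(1) by blast
    have "\<forall>k\<in>insert k S. hnorm (H k) (R d' k (f k)) < \<epsilon>" if d': "d' \<in> D" "leq d3 d'" for d'
    proof -
      have "leq d1 d'" "leq d2 d'" using tr d1(1) d2(1) d3 d' by blast+
      then show ?thesis using d1(2) d2(2) d'(1) by simp
    qed
    then show ?case using d3(1) by blast
  qed
  then obtain d where d: "d \<in> D" "\<forall>d'\<in>D. leq d d' \<longrightarrow> (\<forall>k\<in>S. hnorm (H k) (R d' k (f k)) < \<epsilon>)"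
    by (elim bexE)
  have "hnorm (hsum \<Lambda> H) (hsum_op \<Lambda> H (R d') f) < e" if d': "d' \<in> D" "leq d d'" for d'
  proof -
    have "hnorm (hsum \<Lambda> H) (hsum_op \<Lambda> H (R d') f) \<le> sqrt (e\<^sup>2 / 2)"
    proof (rule hsum_norm_leI)
      show "hsum_op \<Lambda> H (R d') f \<in> vcarrier (hsum \<Lambda> H)"
        using R K d' f by (intro hsum_op_closed[of "R d'" K]) auto
      fix S' assume S': "finite S'" "S' \<subseteq> \<Lambda>"
      let ?g = "\<lambda>k. (hnorm (H k) (R d' k (f k)))\<^sup>2"
      have "(\<Sum>k\<in>S'. (hnorm (H k) (hsum_op \<Lambda> H (R d') f k))\<^sup>2) = sum ?g S'"
        using S' f by (intro sum.cong) (auto simp: hsum_op_apply subset_iff)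
      also have "\<dots> = sum ?g (S' \<inter> S) + sum ?g (S' - S)"
        using S' by (simp add: sum.Int_Diff)
      also have "sum ?g (S' \<inter> S) \<le> e\<^sup>2 / 4"
      proof -
        have "sum ?g (S' \<inter> S) \<le> sum ?g S" using S by (intro sum_mono2) auto
        also have "\<dots> \<le> (\<Sum>k\<in>S. \<epsilon>\<^sup>2)"
        proof (rule sum_mono)
          fix k assume k: "k \<in> S"
          then have k': "k \<in> \<Lambda>" using S by blast
          note c = bounded_op_closed[OF R[OF k' d'(1)] hsum_closed[OF f k']]
          have "hnorm (H k) (R d' k (f k)) < \<epsilon>" using d(2) d' k by simp
          then show "?g k \<le> \<epsilon>\<^sup>2"
            by (rule power_mono[OF less_imp_le hilbert_space.hnorm_nonneg[OF hilbert[OF k'] c]])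
        qed
        also have "\<dots> \<le> e\<^sup>2 / 4" unfolding \<epsilon>2 using e by (simp add: field_simps)
        finally show ?thesis .
      qed
      also have "sum ?g (S' - S) \<le> e\<^sup>2 / 4"
      proof -
        have "sum ?g (S' - S) \<le> (\<Sum>k\<in>S' - S. K\<^sup>2 * s k)"
        proof (rule sum_mono)
          fix k assume "k \<in> S' - S"
          then have k: "k \<in> \<Lambda>" using S' by blast
          interpret Hk: hilbert_space "H k" using k by (rule hilbert)
          have "?g k \<le> (K * hnorm (H k) (f k))\<^sup>2"
            by (rule power_mono[OF Hk.opnorm_boundI[OF R[OF k d'(1)] hsum_closed[OF f k] K(2)[OF k d'(1)]]
                Hk.hnorm_nonneg[OF bounded_op_closed[OF R[OF k d'(1)] hsum_closed[OF f k]]]])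
          then show "?g k \<le> K\<^sup>2 * s k" by (simp add: s_def power_mult_distrib)
        qed
        also have "\<dots> \<le> K\<^sup>2 * \<delta>"
          unfolding sum_distrib_left[symmetric] using S' by (intro mult_left_mono tail') auto
        also have "\<dots> \<le> e\<^sup>2 / 4"
        proof -
          have "K\<^sup>2 * \<delta> \<le> L * \<delta>" using \<delta> L by (intro mult_right_mono) auto
          also have "\<dots> = e\<^sup>2 / 4" using L by (simp add: \<delta>_def)
          finally show ?thesis .
        qed
        finally show ?thesis .
      qed
      finally show "(\<Sum>k\<in>S'. (hnorm (H k) (hsum_op \<Lambda> H (R d') f k))\<^sup>2) \<le> (sqrt (e\<^sup>2 / 2))\<^sup>2" by simp
    qed simp
    also have "sqrt (e\<^sup>2 / 2) < sqrt (e\<^sup>2)" using e by (intro real_sqrt_less_mono) simp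
    finally show ?thesis using e by simp
  qed
  then show ?thesis using d(1) by blast
qed

end

text \<open>\<open>bd\<close> makes the direct sum of the operators bounded; \<open>net_bd\<close>,
  a bound that is uniform along the net as well, is what strong convergence on the direct sum rests
  on.\<close>

lemma hsum_representation:
  fixes \<rho> :: "'k \<Rightarrow> 'g free_alg \<Rightarrow> 'h \<Rightarrow> 'h"
  assumes triple: "generating_triple G RN RS"
    and rep: "\<And>k. k \<in> \<Lambda> \<Longrightarrow> representation G RN RS (H k) (\<rho> k)"
    and bd: "\<And>x. x \<in> vcarrier (free_star G) \<Longrightarrow> \<exists>K\<ge>0. \<forall>k\<in>\<Lambda>. opnorm (H k) (\<rho> k x) \<le> K"
    and net_bd: "\<And>D leq x. (D, leq, x) \<in> RS \<Longrightarrow> \<exists>K\<ge>0. \<forall>k\<in>\<Lambda>. \<forall>d\<in>D. opnorm (H k) (\<rho> k (x d)) \<le> K"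
  shows "representation G RN RS (hsum \<Lambda> H) (\<lambda>x. hsum_op \<Lambda> H (\<lambda>k. \<rho> k x))"
proof -
  interpret hilbert_family \<Lambda> H
    by (rule hilbert_family.intro) (rule representation_hilbert[OF rep])
  interpret S: hilbert_space "hsum \<Lambda> H" by (rule hsum_hilbert)
  note b = representation_bounded[OF rep]
  let ?\<rho> = "\<lambda>x. hsum_op \<Lambda> H (\<lambda>k. \<rho> k x)"
  have bop: "bounded_op (hsum \<Lambda> H) (?\<rho> x)" if x: "x \<in> vcarrier (free_star G)" for x
  proof -
    obtain K where K: "0 \<le> K" "\<forall>k\<in>\<Lambda>. opnorm (H k) (\<rho> k x) \<le> K"
      using bd[OF x] by (elim exE conjE)
    show ?thesis by (rule hsum_op_bounded[of _ K]) (use K b x in auto)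
  qed
  have hom: "star_hom (free_star G) (bop_alg (hsum \<Lambda> H)) ?\<rho>"
    unfolding star_hom_def free_star_simps
  proof (intro conjI ballI allI funcsetI)
    fix x assume x: "x \<in> vcarrier (free_star G)"
    show "?\<rho> x \<in> vcarrier (bop_alg (hsum \<Lambda> H))" using bop[OF x] by simp
    show "?\<rho> (fscale c x) = vscale (bop_alg (hsum \<Lambda> H)) c (?\<rho> x)" for c
      by (intro bounded_op_eqI[of "hsum \<Lambda> H"] hsum_eqI[of _ \<Lambda> H])
        (use x bop bounded_op_closed[OF bop] in \<open>auto simp: hsum_op_apply representation_apply(3)[OF rep] hsum_closed\<close>)
    show "?\<rho> (fstar x) = astar (bop_alg (hsum \<Lambda> H)) (?\<rho> x)"
    proof (simp, rule S.adjoint_unique[symmetric])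
      show "bounded_op (hsum \<Lambda> H) (?\<rho> (fstar x))" using bop x by simp
      fix f g assume "f \<in> vcarrier (hsum \<Lambda> H)" "g \<in> vcarrier (hsum \<Lambda> H)"
      then show "hinner (hsum \<Lambda> H) (?\<rho> x f) g = hinner (hsum \<Lambda> H) f (?\<rho> (fstar x) g)"
        using x by (auto intro!: infsum_cong simp: hsum_op_apply representation_apply(5)[OF rep] hsum_closed)
    qed
    fix y assume y: "y \<in> vcarrier (free_star G)"
    show "?\<rho> (x + y) = vadd (bop_alg (hsum \<Lambda> H)) (?\<rho> x) (?\<rho> y)"
      by (intro bounded_op_eqI[of "hsum \<Lambda> H"] hsum_eqI[of _ \<Lambda> H])
        (use x y bop bounded_op_closed[OF bop] in \<open>auto simp: hsum_op_apply representation_apply(1)[OF rep] hsum_closed\<close>)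
    show "?\<rho> (x * y) = amult (bop_alg (hsum \<Lambda> H)) (?\<rho> x) (?\<rho> y)"
      by (intro bounded_op_eqI[of "hsum \<Lambda> H"] hsum_eqI[of _ \<Lambda> H])
        (use x y bop bounded_op_closed[OF bop] in \<open>auto simp: hsum_op_apply representation_apply(4)[OF rep] hsum_closed\<close>)
  qed
  show ?thesis
    unfolding representation_def
  proof (intro conjI hsum_hilbert hom; clarify)
    fix x \<eta> assume r: "(x, \<eta>) \<in> RN"
    then have x: "x \<in> vcarrier (free_star G)" "0 \<le> \<eta>" using triple by (auto simp: generating_triple_def)
    have "opnorm (H k) (\<rho> k x) \<le> \<eta>" if "k \<in> \<Lambda>" for k
      using rep[OF that] r by (auto simp: representation_def)
    then show "opnorm (hsum \<Lambda> H) (?\<rho> x) \<le> \<eta>"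
      by (rule hsum_op_norm_le[rotated 2]) (use x b in auto)
  next
    fix D leq x f and e :: real
    assume r: "(D, leq, x) \<in> RS" and f: "f \<in> vcarrier (hsum \<Lambda> H)" and e: "e > 0"
    then have dir: "directed D leq" and x: "\<And>d. d \<in> D \<Longrightarrow> x d \<in> vcarrier (free_star G)"
      using triple by (auto simp: generating_triple_def)
    obtain K where K: "K \<ge> 0" "\<And>k d. \<lbrakk>k \<in> \<Lambda>; d \<in> D\<rbrakk> \<Longrightarrow> opnorm (H k) (\<rho> k (x d)) \<le> K"
      using net_bd[OF r] by blast
    have small: "\<exists>d\<in>D. \<forall>d'\<in>D. leq d d' \<longrightarrow> hnorm (H k) (\<rho> k (x d') v) < e"
      if "k \<in> \<Lambda>" "v \<in> vcarrier (H k)" "e > 0" for k v e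
    proof -
      have "\<forall>(D, leq, x)\<in>RS. \<forall>v\<in>vcarrier (H k). \<forall>e>0. \<exists>d\<in>D. \<forall>d'\<in>D. leq d d' \<longrightarrow> hnorm (H k) (\<rho> k (x d') v) < e"
        using rep[OF that(1)] by (simp add: representation_def)
      from bspec[OF this r] show ?thesis using that(2,3) by simp
    qed
    show "\<exists>d\<in>D. \<forall>k\<in>D. leq d k \<longrightarrow> hnorm (hsum \<Lambda> H) (?\<rho> (x k) f) < e"
      by (rule hsum_net_small[where R = "\<lambda>d k. \<rho> k (x d)", OF dir _ K small f e]) (use b x in auto)
  qed
qed

section \<open>Admissibility of the Cuntz-Krieger triple\<close>

lemma ck_generating_triple: "generating_triple (ck_gens I) (ck_RN I) (ck_RS I A)"
  unfolding generating_triple_def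
proof (intro conjI)
  have dir: "directed {X. finite X \<and> X \<subseteq> I} (\<subseteq>)"
    unfolding directed_def
  proof (intro conjI ballI impI, goal_cases)
    case (4 i j)
    then show ?case by (intro bexI[of _ "i \<union> j"]) auto
  qed auto
  have sums: "X \<subseteq> I \<Longrightarrow> (\<Sum>i\<in>X. fscale (c i) (gen (T i) * fstar (gen (T i)))) \<in> vcarrier (free_star (ck_gens I))" for X c
    by (intro sum_mem fscale_mem mult_mem fstar_mem) auto
  show "\<forall>(D, leq, x)\<in>ck_RS I A. directed D leq \<and> (\<forall>k\<in>D. x k \<in> vcarrier (free_star (ck_gens I)))"
    using dir sums sums[of _ "\<lambda>_. 1"] by (auto simp: ck_RS_def fin_net_def)
qed (auto simp: ck_gens_def[of I] ck_RN_def eq_rel_def)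

lemma ck_admissible:
  assumes zero_one: "\<forall>i\<in>I. \<forall>j\<in>I. A i j \<in> {0, 1}"
  shows "admissible TYPE('a) TYPE('u) (ck_gens I) (ck_RN I) (ck_RS I A)"
  unfolding admissible_def
proof (intro conjI ck_generating_triple allI impI)
  fix \<Lambda> :: "'a set" and H :: "'a \<Rightarrow> 'u hilbert" and \<rho>
  assume rep: "\<forall>\<alpha>\<in>\<Lambda>. representation (ck_gens I) (ck_RN I) (ck_RS I A) (H \<alpha>) (\<rho> \<alpha>)"
  then have ck: "ck_seminorm I (\<lambda>x. opnorm (H k) (\<rho> k x)) A" if "k \<in> \<Lambda>" for k
    using representation_ck_seminorm zero_one that by blast
  show "representation (ck_gens I) (ck_RN I) (ck_RS I A) (hsum \<Lambda> H) (\<lambda>x. hsum_op \<Lambda> H (\<lambda>\<alpha>. \<rho> \<alpha> x))"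
  proof (rule hsum_representation[OF ck_generating_triple])
    show "\<exists>K\<ge>0. \<forall>k\<in>\<Lambda>. opnorm (H k) (\<rho> k x) \<le> K" if "x \<in> vcarrier (free_star (ck_gens I))" for x
      using ck_uniform_bound[OF that] ck ck_seminorm_relations by metis
    \<comment> \<open>The bound is 1, as the members of the nets are projections in every
      component.\<close>
    show "\<exists>K\<ge>0. \<forall>k\<in>\<Lambda>. \<forall>d\<in>D. opnorm (H k) (\<rho> k (x d)) \<le> K" if "(D, leq, x) \<in> ck_RS I A" for D leq x
      using that ck_orth.One_residue_norm[OF ck_seminorm.axioms(1)[OF ck]]
        ck_orth.iproj_residue_norm[OF ck_seminorm.axioms(1)[OF ck]]
      by (intro exI[of _ 1]) (auto simp: ck_RS_def fin_net_def rproj_def iproj_def)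
  qed (use rep in blast)
qed

section \<open>A representation in which no generator vanishes\<close>

text \<open>The space is the l2-space over \<open>Z = I \<times> lists\<close>. As the lists over \<open>I\<close> are at least as many
  as the elements of \<open>I\<close>, the sets \<open>{j. A i j \<noteq> 0} \<times> lists\<close> and \<open>{i} \<times> lists\<close> are in bijection, and
  such a bijection of basis vectors is a partial isometry with these initial and final spaces.\<close>

definition cspace :: "complex hilbert" where
  "cspace = \<lparr>vcarrier = UNIV, vzero = 0, vadd = (+), vscale = (*), hinner = (\<lambda>x y. x * cnj y)\<rparr>"

lemma cspace_simps [simp]:
  "vcarrier cspace = UNIV" "vzero cspace = 0" "vadd cspace = (+)" "vscale cspace = (*)"
  "hinner cspace x y = x * cnj y" "hnorm cspace x = cmod x" "vminus cspace x y = x - y"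
  by (simp_all add: cspace_def hnorm_def vminus_def cmod_def power2_eq_square)

lemma cspace_hilbert: "hilbert_space cspace"
proof (unfold_locales, goal_cases)
  case 17
  show ?case
    unfolding vcomplete_def
  proof (intro allI impI)
    fix x assume "vcauchy cspace (hnorm cspace) x"
    then have "Cauchy x" by (simp add: vcauchy_def Cauchy_def dist_norm)
    then obtain l where "x \<longlonglongrightarrow> l" using Cauchy_convergent convergentD by blast
    then have "(\<lambda>n. cmod (x n - l)) \<longlonglongrightarrow> 0" using LIM_zero tendsto_norm_zero by blast
    then show "\<exists>l\<in>vcarrier cspace. vconverges cspace (hnorm cspace) x l"
      by (auto simp: vconverges_def)
  qed
qed (auto simp: algebra_simps)

abbreviation l2 :: "'k set \<Rightarrow> ('k \<Rightarrow> complex) hilbert" where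
  "l2 Z \<equiv> hsum Z (\<lambda>_. cspace)"

lemma l2_mem: "f \<in> vcarrier (l2 Z) \<longleftrightarrow> f \<in> extensional Z \<and> (\<lambda>z. (cmod (f z))\<^sup>2) summable_on Z"
  by (auto simp: hsum_mem PiE_def)

lemma l2_family: "hilbert_family Z (\<lambda>_. cspace)"
  by (simp add: hilbert_family_def cspace_hilbert)

lemmas l2_hilbert = hilbert_family.hsum_hilbert[OF l2_family]

lemma l2_norm_sq: "f \<in> vcarrier (l2 Z) \<Longrightarrow> (hnorm (l2 Z) f)\<^sup>2 = (\<Sum>\<^sub>\<infinity>z\<in>Z. (cmod (f z))\<^sup>2)"
  using hilbert_family.hsum_norm_sq[OF l2_family] by simp

text \<open>Composition with the partial map \<open>g\<close>, extended by zero. For injective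
  \<open>g\<close> it is a partial isometry whose adjoint is given by the inverse of
  \<open>g\<close>.\<close>

definition shift_op :: "'k set \<Rightarrow> 'k set \<Rightarrow> ('k \<Rightarrow> 'k) \<Rightarrow> ('k \<Rightarrow> complex) \<Rightarrow> 'k \<Rightarrow> complex" where
  "shift_op Z D g = (\<lambda>f\<in>vcarrier (l2 Z). \<lambda>z\<in>Z. if z \<in> D then f (g z) else 0)"

lemma shift_op_apply:
  "\<lbrakk>f \<in> vcarrier (l2 Z); z \<in> Z\<rbrakk> \<Longrightarrow> shift_op Z D g f z = (if z \<in> D then f (g z) else 0)"
  by (simp add: shift_op_def)

lemma shift_op_closed:
  assumes D: "D \<subseteq> Z" "inj_on g D" "g ` D \<subseteq> Z" and f: "f \<in> vcarrier (l2 Z)"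
  shows "shift_op Z D g f \<in> vcarrier (l2 Z)"
    and "hnorm (l2 Z) (shift_op Z D g f) \<le> hnorm (l2 Z) f"
proof -
  let ?s = "\<lambda>z. (cmod (f z))\<^sup>2"
  have s: "?s summable_on Z" using f by (simp add: l2_mem)
  have s': "?s summable_on g ` D" by (rule summable_on_subset_banach[OF s D(3)])
  then have sD: "(\<lambda>z. ?s (g z)) summable_on D"
    using summable_on_reindex[OF D(2), of ?s] by (simp add: o_def)
  have s2: "(\<lambda>z. (cmod (shift_op Z D g f z))\<^sup>2) summable_on Z"
    by (rule iffD1[OF summable_on_cong_neutral sD]) (use D f in \<open>auto simp: shift_op_apply\<close>)
  show cl: "shift_op Z D g f \<in> vcarrier (l2 Z)"
    using s2 f by (simp add: l2_mem shift_op_def)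
  have "(\<Sum>\<^sub>\<infinity>z\<in>Z. (cmod (shift_op Z D g f z))\<^sup>2) = (\<Sum>\<^sub>\<infinity>z\<in>D. ?s (g z))"
    by (rule infsum_cong_neutral) (use D f in \<open>auto simp: shift_op_apply\<close>)
  also have "\<dots> = infsum ?s (g ` D)"
    using infsum_reindex[OF D(2), of ?s] by (simp add: o_def)
  also have "\<dots> \<le> infsum ?s Z"
    by (rule infsum_mono_neutral[OF s' s]) (use D in auto)
  finally have "(hnorm (l2 Z) (shift_op Z D g f))\<^sup>2 \<le> (hnorm (l2 Z) f)\<^sup>2"
    unfolding l2_norm_sq[OF cl] l2_norm_sq[OF f] .
  then show "hnorm (l2 Z) (shift_op Z D g f) \<le> hnorm (l2 Z) f"
    by (rule power2_le_imp_le[OF _ hilbert_space.hnorm_nonneg[OF l2_hilbert f]])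
qed

lemma shift_op_bounded:
  assumes D: "D \<subseteq> Z" "inj_on g D" "g ` D \<subseteq> Z"
  shows "bounded_op (l2 Z) (shift_op Z D g)"
  unfolding bounded_op_def
proof (intro conjI allI ballI funcsetI)
  interpret V: hilbert_space "l2 Z" by (rule l2_hilbert)
  show "shift_op Z D g \<in> extensional (vcarrier (l2 Z))" by (simp add: shift_op_def)
  show "\<exists>K. \<forall>f\<in>vcarrier (l2 Z). hnorm (l2 Z) (shift_op Z D g f) \<le> K * hnorm (l2 Z) f"
    using shift_op_closed(2)[OF D] by (intro exI[of _ 1]) simp
  fix f assume f: "f \<in> vcarrier (l2 Z)"
  show "shift_op Z D g f \<in> vcarrier (l2 Z)" by (rule shift_op_closed(1)[OF D f])
  have gD: "g z \<in> Z" if "z \<in> D" for z using D that by auto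
  show "shift_op Z D g (vscale (l2 Z) c f) = vscale (l2 Z) c (shift_op Z D g f)" for c
    by (rule hsum_eqI[of _ Z "\<lambda>_. cspace"])
      (use f gD in \<open>simp_all add: shift_op_apply shift_op_closed[OF D]\<close>)
  fix h assume h: "h \<in> vcarrier (l2 Z)"
  show "shift_op Z D g (vadd (l2 Z) f h) = vadd (l2 Z) (shift_op Z D g f) (shift_op Z D g h)"
    by (rule hsum_eqI[of _ Z "\<lambda>_. cspace"])
      (use f h gD in \<open>simp_all add: shift_op_apply shift_op_closed[OF D]\<close>)
qed

lemma shift_op_adjoint:
  assumes D: "D \<subseteq> Z" "inj_on g D" "g ` D \<subseteq> Z"
  shows "adjoint_op (l2 Z) (shift_op Z D g) = shift_op Z (g ` D) (inv_into D g)"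
proof (rule hilbert_space.adjoint_unique[OF l2_hilbert])
  have inv: "inj_on (inv_into D g) (g ` D)" "inv_into D g ` g ` D \<subseteq> Z"
    using D by (auto simp: inj_on_inv_into)
  show "bounded_op (l2 Z) (shift_op Z (g ` D) (inv_into D g))"
    by (rule shift_op_bounded[OF D(3) inv])
  fix f h assume f: "f \<in> vcarrier (l2 Z)" and h: "h \<in> vcarrier (l2 Z)"
  have "hinner (l2 Z) (shift_op Z D g f) h = (\<Sum>\<^sub>\<infinity>z\<in>D. f (g z) * cnj (h z))"
    unfolding hsum_simps by (rule infsum_cong_neutral) (use D f in \<open>auto simp: shift_op_apply\<close>)
  also have "\<dots> = (\<Sum>\<^sub>\<infinity>z\<in>D. f (g z) * cnj (h (inv_into D g (g z))))"
    using D by (intro infsum_cong) simp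
  also have "\<dots> = (\<Sum>\<^sub>\<infinity>y\<in>g ` D. f y * cnj (h (inv_into D g y)))"
    using infsum_reindex[OF D(2), of "\<lambda>y. f y * cnj (h (inv_into D g y))"] by (simp add: o_def)
  also have "\<dots> = hinner (l2 Z) f (shift_op Z (g ` D) (inv_into D g) h)"
    unfolding hsum_simps by (rule infsum_cong_neutral) (use D h in \<open>auto simp: shift_op_apply\<close>)
  finally show "hinner (l2 Z) (shift_op Z D g f) h = hinner (l2 Z) f (shift_op Z (g ` D) (inv_into D g) h)" .
qed

text \<open>One finite set serves all vectors dominated by \<open>f\<close>, in particular all the
  vectors to which the nets in (CK1) and (CK2) send \<open>f\<close>.\<close>

lemma l2_tail_small:
  assumes f: "f \<in> vcarrier (l2 Z)" and e: "e > 0"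
  shows "\<exists>S. finite S \<and> S \<subseteq> Z \<and> (\<forall>g\<in>vcarrier (l2 Z). (\<forall>z\<in>S. g z = 0) \<longrightarrow>
    (\<forall>z\<in>Z. cmod (g z) \<le> cmod (f z)) \<longrightarrow> hnorm (l2 Z) g < e)"
proof -
  let ?s = "\<lambda>z. (cmod (f z))\<^sup>2"
  have s: "?s summable_on Z" using f by (simp add: l2_mem)
  have e2: "e\<^sup>2 / 2 > 0" using e by simp
  obtain S where S: "finite S" "S \<subseteq> Z" and tail: "dist (sum ?s S) (infsum ?s Z) \<le> e\<^sup>2 / 2"
    using infsum_finite_approximation[OF s e2] by (elim exE conjE)
  have "hnorm (l2 Z) g < e"
    if g: "g \<in> vcarrier (l2 Z)" and z: "\<forall>z\<in>S. g z = 0" and le: "\<forall>z\<in>Z. cmod (g z) \<le> cmod (f z)" for g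
  proof -
    have "hnorm (l2 Z) g \<le> sqrt (e\<^sup>2 / 2)"
    proof (rule hilbert_family.hsum_norm_leI[OF l2_family g])
      fix S' assume S': "finite S'" "S' \<subseteq> Z"
      have "(\<Sum>z\<in>S'. (hnorm cspace (g z))\<^sup>2) = (\<Sum>z\<in>S' - S. (cmod (g z))\<^sup>2)"
        using S' z by (intro sum.mono_neutral_cong_right) auto
      also have "\<dots> \<le> sum ?s (S' - S)"
        using S' le by (intro sum_mono power_mono) auto
      also have "\<dots> = sum ?s (S' \<union> S) - sum ?s S"
        using S S' by (simp add: sum_diff[symmetric] Un_Diff)
      also have "\<dots> \<le> infsum ?s Z - sum ?s S"
        using S S' by (intro diff_right_mono finite_sum_le_infsum s) auto
      also have "\<dots> \<le> e\<^sup>2 / 2" using tail unfolding dist_real_def by linarith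
      also have "\<dots> = (sqrt (e\<^sup>2 / 2))\<^sup>2" by simp
      finally show "(\<Sum>z\<in>S'. (hnorm cspace (g z))\<^sup>2) \<le> (sqrt (e\<^sup>2 / 2))\<^sup>2" .
    qed simp
    also have "sqrt (e\<^sup>2 / 2) < sqrt (e\<^sup>2)" using e by (intro real_sqrt_less_mono) simp
    finally show ?thesis using e by simp
  qed
  then show ?thesis using S by blast
qed

text \<open>An infinite set absorbs a nonempty factor that is no larger. The condition on the rows
  of the matrix enters here: a zero row would make the factor empty.\<close>

lemma ck_bijections:
  fixes A :: "'i \<Rightarrow> 'i \<Rightarrow> complex"
  assumes "\<forall>i\<in>I. \<exists>j\<in>I. A i j \<noteq> 0"
  shows "\<exists>\<tau>. \<forall>i\<in>I. bij_betw (\<tau> i) ({j \<in> I. A i j \<noteq> 0} \<times> (UNIV :: 'i list set)) (UNIV :: 'i list set)"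
proof -
  have "\<exists>t. bij_betw t ({j \<in> I. A i j \<noteq> 0} \<times> (UNIV :: 'i list set)) (UNIV :: 'i list set)" if "i \<in> I" for i
  proof -
    let ?J = "{j \<in> I. A i j \<noteq> 0}"
    have "(card_of ?J, card_of (UNIV :: 'i list set)) \<in> ordLeq"
      by (rule card_of_ordLeqI[of "\<lambda>j. [j]"]) (auto intro: inj_onI)
    moreover have "?J \<noteq> {}" using assms that by blast
    ultimately have "(card_of (?J \<times> (UNIV :: 'i list set)), card_of (UNIV :: 'i list set)) \<in> ordIso"
      using card_of_Times_infinite[OF infinite_UNIV_listI, of ?J] by blast
    then show ?thesis by (simp add: card_of_ordIso)
  qed
  then have "\<forall>i\<in>I. \<exists>t. bij_betw t ({j \<in> I. A i j \<noteq> 0} \<times> (UNIV :: 'i list set)) (UNIV :: 'i list set)" by simp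
  then show ?thesis by (rule bchoice)
qed

lemma representation_zero_apply:
  assumes "representation G RN RS H \<rho>" "v \<in> vcarrier H" "x \<in> vcarrier (free_star G)" "opnorm H (\<rho> x) = 0"
  shows "\<rho> x v = vzero H"
proof -
  interpret H: hilbert_space H using assms(1) by (rule representation_hilbert)
  have "hnorm H (\<rho> x v) \<le> 0"
    using H.opnorm_bound[OF representation_bounded[OF assms(1,3)] assms(2)] assms(4) by simp
  then show ?thesis by (rule H.hnorm_le_zeroD[OF _ representation_apply(6)[OF assms(1,2,3)]])
qed

lemma ck_l2_representation:
  fixes A :: "'i \<Rightarrow> 'i \<Rightarrow> complex"
  assumes zero_one: "\<forall>i\<in>I. \<forall>j\<in>I. A i j \<in> {0, 1}"
    and no_zero_row: "\<forall>i\<in>I. \<exists>j\<in>I. A i j \<noteq> 0"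
  shows "\<exists>\<rho>. representation (ck_gens I) (ck_RN I) (ck_RS I A) (l2 (I \<times> (UNIV :: 'i list set))) \<rho> \<and>
    (\<forall>j\<in>I. opnorm (l2 (I \<times> (UNIV :: 'i list set))) (\<rho> (rproj j)) \<noteq> 0)"
proof -
  let ?Z = "I \<times> (UNIV :: 'i list set)"
  let ?H = "l2 ?Z"
  let ?M = "vcarrier (free_star (ck_gens I))"
  interpret H: hilbert_space ?H by (rule l2_hilbert)
  interpret B: cstar_seminormed "bop_alg ?H" by (rule H.bop_cstar_seminormed)
  obtain \<tau> where \<tau>': "\<forall>i\<in>I. bij_betw (\<tau> i) ({j \<in> I. A i j \<noteq> 0} \<times> (UNIV :: 'i list set)) (UNIV :: 'i list set)"
    using ck_bijections[OF no_zero_row] by (elim exE)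
  define D where "D i = {j \<in> I. A i j \<noteq> 0} \<times> (UNIV :: 'i list set)" for i
  have \<tau>: "bij_betw (\<tau> i) (D i) (UNIV :: 'i list set)" if "i \<in> I" for i using \<tau>' that by (simp add: D_def)
  define g where "g i z = (i, \<tau> i z)" for i z
  have g_inj: "inj_on (g i) (D i)" if "i \<in> I" for i
    using bij_betw_imp_inj_on[OF \<tau>[OF that]] by (auto simp: inj_on_def g_def)
  have g_img: "g i ` D i = {i} \<times> UNIV" if "i \<in> I" for i
  proof -
    have "g i ` D i = Pair i ` (\<tau> i ` D i)" by (simp add: image_image g_def)
    also have "\<dots> = {i} \<times> UNIV" using \<tau>[OF that] by (auto simp: bij_betw_def)
    finally show ?thesis .
  qed
  have sub: "D i \<subseteq> ?Z" "g i ` D i \<subseteq> ?Z" if "i \<in> I" for i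
    using that g_img[OF that] by (auto simp: D_def)
  \<comment> \<open>Pulling back along \<open>g i\<close> represents T_i*, and its adjoint
    \<open>S i\<close> represents T_i.\<close>
  define U where "U i = shift_op ?Z (D i) (g i)" for i
  have U: "bounded_op ?H (U i)" if "i \<in> I" for i
    unfolding U_def by (rule shift_op_bounded[OF sub(1)[OF that] g_inj[OF that] sub(2)[OF that]])
  define S where "S i = shift_op ?Z ({i} \<times> UNIV) (inv_into (D i) (g i))" for i
  have adjU: "adjoint_op ?H (U i) = S i" if "i \<in> I" for i
    unfolding U_def S_def using shift_op_adjoint[OF sub(1)[OF that] g_inj[OF that] sub(2)[OF that]] g_img[OF that] by simp
  have S: "bounded_op ?H (S i)" if "i \<in> I" for i using H.adjoint_bounded[OF U[OF that]] adjU[OF that] by simp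
  have adjS: "adjoint_op ?H (S i) = U i" if "i \<in> I" for i
    using B.star_star[of "U i"] U[OF that] adjU[OF that] by simp
  \<comment> \<open>Range and initial projections turn out to be multiplications by indicator
    functions of the first coordinate, so the relations can be verified point by point.\<close>
  have SU: "S i (U i f) z = (if fst z = i then f z else 0)" if i: "i \<in> I" and f: "f \<in> vcarrier ?H" and z: "z \<in> ?Z" for i f z
  proof -
    have Uf: "U i f \<in> vcarrier ?H" using bounded_op_closed[OF U[OF i] f] .
    have "inv_into (D i) (g i) z \<in> D i" "g i (inv_into (D i) (g i) z) = z" if "fst z = i"
    proof -
      have "z \<in> g i ` D i" unfolding g_img[OF i] using that by (cases z) simp
      then show "inv_into (D i) (g i) z \<in> D i" "g i (inv_into (D i) (g i) z) = z"
        by (rule inv_into_into, rule f_inv_into_f)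
    qed
    then show ?thesis using z sub(1)[OF i] f Uf
      by (cases z) (auto simp: S_def U_def shift_op_apply)
  qed
  have US: "U i (S i f) z = (if A i (fst z) \<noteq> 0 then f z else 0)" if i: "i \<in> I" and f: "f \<in> vcarrier ?H" and z: "z \<in> ?Z" for i f z
  proof -
    have Sf: "S i f \<in> vcarrier ?H" using bounded_op_closed[OF S[OF i] f] .
    have "g i z \<in> ?Z" "g i z \<in> {i} \<times> UNIV" "inv_into (D i) (g i) (g i z) = z" if "z \<in> D i"
      using subsetD[OF sub(2)[OF i] imageI[OF that]] inv_into_f_f[OF g_inj[OF i] that] by (simp_all add: g_def)
    moreover have "z \<in> D i \<longleftrightarrow> A i (fst z) \<noteq> 0" using z by (auto simp: D_def)
    ultimately show ?thesis using z f Sf by (auto simp: S_def U_def shift_op_apply)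
  qed
  define t where "t a = (case a of T i \<Rightarrow> if i \<in> I then S i else vzero (bop_alg ?H) | One \<Rightarrow> (\<lambda>v\<in>vcarrier ?H. v))" for a
  interpret E: evaluation "bop_alg ?H" "\<lambda>v\<in>vcarrier ?H. v" t
    by unfold_locales (auto simp: H.bop_id_unit t_def S H.bop_id_bounded split: ck_gen.splits)
  define \<rho> where "\<rho> = ev (bop_alg ?H) (\<lambda>v\<in>vcarrier ?H. v) t"
  have bd: "bounded_op ?H (\<rho> x)" for x using E.ev_closed[of x] by (simp add: \<rho>_def)
  have cl: "\<rho> x f \<in> vcarrier ?H" if "f \<in> vcarrier ?H" for x f by (rule bounded_op_closed[OF bd that])
  have \<rho>T: "\<rho> (gen (T i)) = S i" "\<rho> (fstar (gen (T i))) = U i" if "i \<in> I" for i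
    using that adjS[OF that] by (simp_all add: \<rho>_def E.ev_star t_def)
  have \<rho>1: "\<rho> (gen One) f = f" "\<rho> (fstar (gen One)) f = f" if "f \<in> vcarrier ?H" for f
    using that E.unit_star by (simp_all add: \<rho>_def E.ev_star t_def del: bop_alg_simps(2))
  have mult: "\<rho> (x * y) f = \<rho> x (\<rho> y f)" if "f \<in> vcarrier ?H" for x y f
    using that by (simp add: \<rho>_def E.ev_mult)
  have \<rho>eq: "\<rho> x = \<rho> y" if "\<And>f z. \<lbrakk>f \<in> vcarrier ?H; z \<in> ?Z\<rbrakk> \<Longrightarrow> \<rho> x f z = \<rho> y f z" for x y
    by (intro bounded_op_eqI[of ?H] bd hsum_eqI[of _ ?Z "\<lambda>_. cspace"] cl that)
  have P: "\<rho> (rproj i) f z = (if fst z = i then f z else 0)" if "i \<in> I" "f \<in> vcarrier ?H" "z \<in> ?Z" for i f z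
    using that SU[OF that] by (simp add: rproj_def mult \<rho>T)
  have Q: "\<rho> (iproj i) f z = (if A i (fst z) \<noteq> 0 then f z else 0)" if "i \<in> I" "f \<in> vcarrier ?H" "z \<in> ?Z" for i f z
    using that US[OF that] by (simp add: iproj_def mult \<rho>T)
  have diff: "\<rho> (x - y) f z = \<rho> x f z - \<rho> y f z" if "f \<in> vcarrier ?H" "z \<in> ?Z" for x y f z
    using that by (simp add: \<rho>_def E.ev_minus vminus_def)
  have sum: "\<rho> (\<Sum>i\<in>X. fscale (c i) (rproj i)) f z = (if fst z \<in> X then c (fst z) * f z else 0)"
    if "finite X" "X \<subseteq> I" "f \<in> vcarrier ?H" "z \<in> ?Z" for X c f z
    using that
  proof (induction X)
    case empty
    then show ?case by (simp add: \<rho>_def)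
  next
    case (insert i X)
    have "\<rho> (fscale (c i) (rproj i) + (\<Sum>i\<in>X. fscale (c i) (rproj i))) f z
        = c i * \<rho> (rproj i) f z + \<rho> (\<Sum>i\<in>X. fscale (c i) (rproj i)) f z"
      using insert.prems by (simp add: \<rho>_def E.ev_add E.ev_scale)
    then show ?case using insert P[of i f z] by auto
  qed
  have rel: "opnorm ?H (\<rho> (x - y)) \<le> 0" if "\<And>f z. \<lbrakk>f \<in> vcarrier ?H; z \<in> ?Z\<rbrakk> \<Longrightarrow> \<rho> x f z = \<rho> y f z" for x y
  proof (rule H.opnorm_le)
    fix f assume f: "f \<in> vcarrier ?H"
    have "\<rho> (x - y) f = vzero ?H"
      by (rule hsum_eqI[of _ ?Z "\<lambda>_. cspace"]) (use f cl that in \<open>auto simp: diff\<close>)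
    then show "hnorm ?H (\<rho> (x - y) f) \<le> 0 * hnorm ?H f" by simp
  qed simp
  \<comment> \<open>A net that acts at each point as 0 or 1, and as 0 over the finite set k, tends
    strongly to zero: k only has to contain the first coordinates of finitely many points that carry
    most of \<open>f\<close>.\<close>
  have SOT: "\<exists>d\<in>{X. finite X \<and> X \<subseteq> I}. \<forall>k\<in>{X. finite X \<and> X \<subseteq> I}. d \<subseteq> k \<longrightarrow> hnorm ?H (\<rho> (x k) f) < e"
    if f: "f \<in> vcarrier ?H" and e: "e > 0"
      and x: "\<And>k z. \<lbrakk>finite k; k \<subseteq> I; z \<in> ?Z\<rbrakk> \<Longrightarrow> \<rho> (x k) f z = 0 \<or> (fst z \<notin> k \<and> \<rho> (x k) f z = f z)" for x f e
  proof -
    obtain Y where Y: "finite Y" "Y \<subseteq> ?Z" and small: "\<forall>g\<in>vcarrier ?H. (\<forall>z\<in>Y. g z = 0) \<longrightarrow>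
        (\<forall>z\<in>?Z. cmod (g z) \<le> cmod (f z)) \<longrightarrow> hnorm ?H g < e"
      using l2_tail_small[OF f e] by (elim exE conjE)
    have "hnorm ?H (\<rho> (x k) f) < e" if k: "finite k" "k \<subseteq> I" "fst ` Y \<subseteq> k" for k
    proof -
      have "\<forall>z\<in>Y. \<rho> (x k) f z = 0" using x[OF k(1,2)] Y(2) k(3) by (meson image_subset_iff subsetD)
      moreover have "\<forall>z\<in>?Z. cmod (\<rho> (x k) f z) \<le> cmod (f z)"
      proof
        fix z assume "z \<in> ?Z"
        from x[OF k(1,2) this] show "cmod (\<rho> (x k) f z) \<le> cmod (f z)" by auto
      qed
      ultimately show ?thesis using small cl[OF f] by simp
    qed
    moreover have "finite (fst ` Y)" "fst ` Y \<subseteq> I" using Y by auto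
    ultimately show ?thesis by (intro bexI[of _ "fst ` Y"]) auto
  qed
  have "representation (ck_gens I) (ck_RN I) (ck_RS I A) ?H \<rho>"
    unfolding representation_def
  proof (intro conjI)
    show "star_hom (free_star (ck_gens I)) (bop_alg ?H) \<rho>" unfolding \<rho>_def by (rule E.star_hom_ev)
    have "opnorm ?H (\<rho> (gen (T i) * fstar (gen (T i)) * gen (T i) - gen (T i))) \<le> 0" if "i \<in> I" for i
    proof (rule rel)
      fix f z assume fz: "f \<in> vcarrier ?H" "z \<in> ?Z"
      have "\<rho> (gen (T i) * fstar (gen (T i)) * gen (T i)) f z = \<rho> (rproj i) (S i f) z"
        using fz that by (simp add: rproj_def mult \<rho>T)
      also have "\<dots> = (if fst z = i then S i f z else 0)"
        by (rule P[OF that bounded_op_closed[OF S[OF that] fz(1)] fz(2)])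
      also have "\<dots> = S i f z" using fz by (cases z) (auto simp: S_def shift_op_apply)
      finally show "\<rho> (gen (T i) * fstar (gen (T i)) * gen (T i)) f z = \<rho> (gen (T i)) f z"
        using that by (simp add: \<rho>T)
    qed
    moreover have "opnorm ?H (\<rho> (gen One - fstar (gen One))) \<le> 0"
      "opnorm ?H (\<rho> (gen One - gen One * gen One)) \<le> 0"
      by (rule rel, simp add: mult \<rho>1 cl)+
    moreover have "opnorm ?H (\<rho> (gen One * gen (T i) - gen (T i))) \<le> 0"
      "opnorm ?H (\<rho> (gen (T i) - gen (T i) * gen One)) \<le> 0" for i
      by (rule rel, simp add: mult \<rho>1 cl)+
    ultimately show "\<forall>(x, \<eta>)\<in>ck_RN I. opnorm ?H (\<rho> x) \<le> \<eta>"
      by (auto simp: ck_RN_def eq_rel_def)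
    show "\<forall>(D, leq, x)\<in>ck_RS I A. \<forall>f\<in>vcarrier ?H. \<forall>e>0. \<exists>d\<in>D. \<forall>k\<in>D. leq d k \<longrightarrow> hnorm ?H (\<rho> (x k) f) < e"
    proof -
      have 1: "\<exists>d\<in>{X. finite X \<and> X \<subseteq> I}. \<forall>k\<in>{X. finite X \<and> X \<subseteq> I}. d \<subseteq> k
          \<longrightarrow> hnorm ?H (\<rho> (gen One - (\<Sum>i\<in>k. rproj i)) f) < e" if "f \<in> vcarrier ?H" "e > 0" for f e
      proof (rule SOT[OF that])
        fix k z assume "finite k" "k \<subseteq> I" "z \<in> ?Z"
        then show "\<rho> (gen One - (\<Sum>i\<in>k. rproj i)) f z = 0 \<or>
            (fst z \<notin> k \<and> \<rho> (gen One - (\<Sum>i\<in>k. rproj i)) f z = f z)"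
          using sum[of k f z "\<lambda>_. 1"] that(1) by (simp add: diff \<rho>1)
      qed
      have 2: "\<exists>d\<in>{X. finite X \<and> X \<subseteq> I}. \<forall>k\<in>{X. finite X \<and> X \<subseteq> I}. d \<subseteq> k
          \<longrightarrow> hnorm ?H (\<rho> (iproj i - (\<Sum>j\<in>k. fscale (A i j) (rproj j))) f) < e"
        if "i \<in> I" "f \<in> vcarrier ?H" "e > 0" for i f e
      proof (rule SOT[OF that(2,3)])
        fix k z assume k: "finite k" "k \<subseteq> I" "z \<in> ?Z"
        then have "A i (fst z) = 0 \<or> A i (fst z) = 1" using zero_one that(1) by (cases z) auto
        then show "\<rho> (iproj i - (\<Sum>j\<in>k. fscale (A i j) (rproj j))) f z = 0 \<or>
            (fst z \<notin> k \<and> \<rho> (iproj i - (\<Sum>j\<in>k. fscale (A i j) (rproj j))) f z = f z)"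
          using sum[OF k(1,2) that(2) k(3), of "A i"] Q[OF that(1,2) k(3)] that(2) k(3)
          by (auto simp: diff)
      qed
      show ?thesis
        using 1 2 by (auto simp: ck_RS_def fin_net_def rproj_def[symmetric] iproj_def[symmetric])
    qed
  qed (rule l2_hilbert)
  moreover have "opnorm ?H (\<rho> (rproj j)) \<noteq> 0" if j: "j \<in> I" for j
  proof
    assume 0: "opnorm ?H (\<rho> (rproj j)) = 0"
    \<comment> \<open>The basis vector at (j, []), which the j-th range projection fixes.\<close>
    define f where "f = (\<lambda>z\<in>?Z. if z = (j, []) then 1 else (0 :: complex))"
    have "(\<lambda>z. (cmod (f z))\<^sup>2) summable_on ?Z"
      by (rule iffD1[OF summable_on_cong_neutral summable_on_finite[of "{(j, [])}" "\<lambda>z. (cmod (f z))\<^sup>2"]])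
        (use j in \<open>auto simp: f_def\<close>)
    then have f: "f \<in> vcarrier ?H" by (simp add: l2_mem f_def)
    have "\<rho> (rproj j) f = vzero ?H"
      using representation_zero_apply[OF calculation f _ 0] j by simp
    then have "\<rho> (rproj j) f (j, []) = 0" using j by simp
    then show False using P[OF j f, of "(j, [])"] j by (simp add: f_def)
  qed
  ultimately show ?thesis by blast
qed

text \<open>The universal seminorm only sees Hilbert spaces with carrier in the universe, so the
  vectors of a given representation are renamed along an injection.\<close>

lemma transport_representation:
  fixes H :: "'h hilbert" and \<phi> :: "'h \<Rightarrow> 'u"
  assumes triple: "generating_triple G RN RS"
    and rep: "representation G RN RS H \<rho>" and inj: "inj_on \<phi> (vcarrier H)"
  shows "\<exists>(H' :: 'u hilbert) \<rho>'. representation G RN RS H' \<rho>' \<and>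
    (\<forall>x\<in>vcarrier (free_star G). opnorm H' (\<rho>' x) = opnorm H (\<rho> x))"
proof -
  interpret H: hilbert_space H using rep by (rule representation_hilbert)
  let ?C = "vcarrier H"
  define \<psi> where "\<psi> = inv_into ?C \<phi>"
  have \<psi> [simp]: "\<psi> (\<phi> x) = x" if "x \<in> ?C" for x using that inj by (simp add: \<psi>_def)
  define H' where "H' = \<lparr>vcarrier = \<phi> ` ?C, vzero = \<phi> (vzero H), vadd = (\<lambda>x y. \<phi> (vadd H (\<psi> x) (\<psi> y))),
     vscale = (\<lambda>c x. \<phi> (vscale H c (\<psi> x))), hinner = (\<lambda>x y. hinner H (\<psi> x) (\<psi> y))\<rparr>"
  have H'_simps [simp]: "vcarrier H' = \<phi> ` ?C" "vzero H' = \<phi> (vzero H)"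
    "vadd H' x y = \<phi> (vadd H (\<psi> x) (\<psi> y))" "vscale H' c x = \<phi> (vscale H c (\<psi> x))"
    "hinner H' x y = hinner H (\<psi> x) (\<psi> y)" "hnorm H' x = hnorm H (\<psi> x)" for x y c
    by (simp_all add: H'_def hnorm_def)
  have minus [simp]: "vminus H' (\<phi> x) (\<phi> y) = \<phi> (vminus H x y)" if "x \<in> ?C" "y \<in> ?C" for x y
    using that by (simp add: vminus_def)
  have vs: "complex_vector_space H'"
    by unfold_locales
      (auto simp: H.add_ac H.add_inverse H.scale_add_right H.scale_add_left H.scale_scale)
  have complete: "vcomplete H' (hnorm H')"
    unfolding vcomplete_def
  proof (intro allI impI)
    fix X assume X: "vcauchy H' (hnorm H') X"
    have "\<forall>n. \<exists>x. x \<in> ?C \<and> X n = \<phi> x" using vcauchy_closed[OF X] by auto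
    then obtain x where x: "\<forall>n. x n \<in> ?C \<and> X n = \<phi> (x n)" by (rule choice[THEN exE])
    have "vcauchy H (hnorm H) x" using X x by (simp add: vcauchy_def)
    then obtain l where "l \<in> ?C" "vconverges H (hnorm H) x l"
      using H.hilbert_complete unfolding vcomplete_def by blast
    then show "\<exists>l\<in>vcarrier H'. vconverges H' (hnorm H') X l"
      using x by (intro bexI[of _ "\<phi> l"]) (simp_all add: vconverges_def)
  qed
  have hil: "hilbert_space H'"
  proof -
    have "hilbert_space_axioms H'"
    proof (unfold_locales, goal_cases)
      case (5 x)
      then show ?case using H.inner_definite by auto
    next
      case 6
      show ?case by (rule complete)
    next
      case (3 x y)
      then obtain a b where "a \<in> ?C" "b \<in> ?C" "x = \<phi> a" "y = \<phi> b" by auto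
      then show ?case using H.inner_commute[of a b] by simp
    qed (auto simp: H.inner_simps H.inner_nonneg)
    then show ?thesis using vs by (simp add: hilbert_space_def)
  qed
  interpret H': hilbert_space H' by (rule hil)
  define \<omega> where "\<omega> R = (\<lambda>v\<in>\<phi> ` ?C. \<phi> (R (\<psi> v)))" for R
  have \<omega> [simp]: "\<omega> R (\<phi> v) = \<phi> (R v)" if "v \<in> ?C" for R v using that by (simp add: \<omega>_def)
  have bdd: "bounded_op H' (\<omega> R)" if R: "bounded_op H R" for R
    unfolding bounded_op_def
  proof (intro conjI allI ballI)
    show "\<exists>K. \<forall>x\<in>vcarrier H'. hnorm H' (\<omega> R x) \<le> K * hnorm H' x"
      using H.opnorm_bound[OF R] by (intro exI[of _ "opnorm H R"]) (auto simp: bounded_op_closed[OF R])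
  qed (auto simp: bounded_op_closed[OF R] bounded_op_add[OF R] bounded_op_scale[OF R], simp add: \<omega>_def)
  note bop = representation_bounded[OF rep]
  have norm: "opnorm H' (\<omega> (\<rho> x)) = opnorm H (\<rho> x)" if x: "x \<in> vcarrier (free_star G)" for x
  proof -
    have "{hnorm H' (\<omega> (\<rho> x) v) |v. v \<in> vcarrier H' \<and> hnorm H' v \<le> 1}
        = {hnorm H (\<rho> x v) |v. v \<in> ?C \<and> hnorm H v \<le> 1}"
      (is "?L = ?R")
    proof
      show "?L \<subseteq> ?R" using bounded_op_closed[OF bop[OF x]] by auto
      show "?R \<subseteq> ?L"
      proof
        fix a assume "a \<in> ?R"
        then obtain v where "v \<in> ?C" "hnorm H v \<le> 1" "a = hnorm H (\<rho> x v)" by blast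
        then show "a \<in> ?L" using bounded_op_closed[OF bop[OF x]]
          by (intro CollectI exI[of _ "\<phi> v"]) simp
      qed
    qed
    then show ?thesis by (simp add: opnorm_def)
  qed
  note app = representation_apply[OF rep]
  have hom: "star_hom (free_star G) (bop_alg H') (\<lambda>x. \<omega> (\<rho> x))"
    unfolding star_hom_def free_star_simps
  proof (intro conjI ballI allI funcsetI)
    fix x assume x: "x \<in> vcarrier (free_star G)"
    show "\<omega> (\<rho> x) \<in> vcarrier (bop_alg H')" using bdd bop x by simp
    show "\<omega> (\<rho> (fscale c x)) = vscale (bop_alg H') c (\<omega> (\<rho> x))" for c
      by (rule bounded_op_eqI[of H']) (use x bdd bop in \<open>auto simp: app\<close>)
    show "\<omega> (\<rho> (fstar x)) = astar (bop_alg H') (\<omega> (\<rho> x))"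
    proof (simp only: bop_alg_simps, rule H'.adjoint_unique[symmetric])
      show "bounded_op H' (\<omega> (\<rho> (fstar x)))" using bdd bop x by simp
    qed (use x in \<open>auto simp: app\<close>)
    fix y assume y: "y \<in> vcarrier (free_star G)"
    show "\<omega> (\<rho> (x + y)) = vadd (bop_alg H') (\<omega> (\<rho> x)) (\<omega> (\<rho> y))"
      by (rule bounded_op_eqI[of H']) (use x y bdd bop in \<open>auto simp: app\<close>)
    show "\<omega> (\<rho> (x * y)) = amult (bop_alg H') (\<omega> (\<rho> x)) (\<omega> (\<rho> y))"
      by (rule bounded_op_eqI[of H']) (use x y bdd bop in \<open>auto simp: app\<close>)
  qed
  have "representation G RN RS H' (\<lambda>x. \<omega> (\<rho> x))"
    unfolding representation_def
  proof (intro conjI hil hom; clarify)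
    fix x \<eta> assume r: "(x, \<eta>) \<in> RN"
    then have "x \<in> vcarrier (free_star G)" using triple by (auto simp: generating_triple_def)
    from norm[OF this] show "opnorm H' (\<omega> (\<rho> x)) \<le> \<eta>" using rep r by (auto simp: representation_def)
  next
    fix D leq x v' and e :: real
    assume r: "(D, leq, x) \<in> RS" and "v' \<in> vcarrier H'" and e: "e > 0"
    then obtain v where v: "v \<in> ?C" "v' = \<phi> v" by auto
    have x: "x d \<in> vcarrier (free_star G)" if "d \<in> D" for d
      using triple r that by (auto simp: generating_triple_def)
    have "\<forall>(D, leq, x)\<in>RS. \<forall>v\<in>?C. \<forall>e>0. \<exists>d\<in>D. \<forall>k\<in>D. leq d k \<longrightarrow> hnorm H (\<rho> (x k) v) < e"
      using rep by (simp add: representation_def)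
    from bspec[OF this r] have "\<exists>d\<in>D. \<forall>k\<in>D. leq d k \<longrightarrow> hnorm H (\<rho> (x k) v) < e"
      using v(1) e by simp
    moreover have "hnorm H' (\<omega> (\<rho> (x k)) v') = hnorm H (\<rho> (x k) v)" if "k \<in> D" for k
      using v app(6)[OF v(1) x[OF that]] by simp
    ultimately show "\<exists>d\<in>D. \<forall>k\<in>D. leq d k \<longrightarrow> hnorm H' (\<omega> (\<rho> (x k)) v') < e" by simp
  qed
  with norm show ?thesis by blast
qed

text \<open>A square-summable function is determined by an enumeration of the points where it does not
  vanish together with its values there.\<close>

lemma l2_embeds:
  fixes I :: "'i set"
  shows "\<exists>\<phi> :: ('i \<times> 'i list \<Rightarrow> complex) \<Rightarrow> nat \<Rightarrow> 'i ck_gen free_alg.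
    inj_on \<phi> (vcarrier (l2 (I \<times> (UNIV :: 'i list set))))"
proof -
  let ?Z = "I \<times> (UNIV :: 'i list set)"
  define code :: "'i \<times> 'i list \<Rightarrow> ('i ck_gen + 'i ck_gen) word"
    where "code z = Word (map (\<lambda>i. Inl (T i)) (fst z # snd z))" for z
  have code_inj: "z = z'" if "code z = code z'" for z z'
  proof -
    have "map (\<lambda>i. Inl (T i) :: 'i ck_gen + 'i ck_gen) (fst z # snd z) = map (\<lambda>i. Inl (T i)) (fst z' # snd z')"
      using that by (simp add: code_def)
    then have "fst z # snd z = fst z' # snd z'" by (rule map_injective) (simp add: inj_on_def)
    then show ?thesis by (simp add: prod_eq_iff)
  qed
  define supp where "supp f = {z \<in> ?Z. f z \<noteq> (0 :: complex)}" for f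
  \<comment> \<open>For a finite support the enumeration repeats points. Injectivity compares the
    two sequences at one index at a time, so repetitions do no harm.\<close>
  define \<phi> where "\<phi> f n = (if supp f = {} then 0
    else Poly_Mapping.single (code (from_nat_into (supp f) n)) (f (from_nat_into (supp f) n)))" for f n
  have supp_cnt: "countable (supp f)" if "f \<in> vcarrier (l2 ?Z)" for f
  proof -
    have "countable {z \<in> ?Z. (cmod (f z))\<^sup>2 \<noteq> 0}"
      using that by (intro summable_countable_real) (simp add: l2_mem)
    then show ?thesis by (simp add: supp_def)
  qed
  have key: "g z = f z" if f: "f \<in> vcarrier (l2 ?Z)" and g: "g \<in> vcarrier (l2 ?Z)"
    and eq: "\<phi> f = \<phi> g" and z: "z \<in> supp f" for f g z
  proof -
    obtain n where n: "from_nat_into (supp f) n = z"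
      using from_nat_into_surj[OF supp_cnt[OF f] z] by blast
    have fz: "f z \<noteq> 0" using z by (simp add: supp_def)
    have "\<phi> f n = Poly_Mapping.single (code z) (f z)" using z n by (auto simp: \<phi>_def)
    then have "\<phi> g n = Poly_Mapping.single (code z) (f z)" using eq by simp
    moreover have ne: "supp g \<noteq> {}"
    proof
      assume "supp g = {}"
      then have "Poly_Mapping.single (code z) (f z) = 0" using calculation by (simp add: \<phi>_def)
      then show False using fz by (metis lookup_single_eq lookup_zero)
    qed
    ultimately have s: "Poly_Mapping.single (code (from_nat_into (supp g) n)) (g (from_nat_into (supp g) n))
        = Poly_Mapping.single (code z) (f z)"
      by (simp add: \<phi>_def)
    have "code (from_nat_into (supp g) n) = code z"
    proof (rule ccontr)
      assume "code (from_nat_into (supp g) n) \<noteq> code z"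
      then have "Poly_Mapping.lookup (Poly_Mapping.single (code (from_nat_into (supp g) n)) (g (from_nat_into (supp g) n))) (code z) = 0"
        by (simp add: lookup_single_not_eq)
      then show False using s fz by simp
    qed
    then have "from_nat_into (supp g) n = z" by (rule code_inj)
    then show ?thesis using s by (metis lookup_single_eq)
  qed
  have "inj_on \<phi> (vcarrier (l2 ?Z))"
  proof (rule inj_onI)
    fix f g assume f: "f \<in> vcarrier (l2 ?Z)" and g: "g \<in> vcarrier (l2 ?Z)" and eq: "\<phi> f = \<phi> g"
    show "f = g"
    proof (rule hsum_eqI[OF f g])
      fix z assume z: "z \<in> ?Z"
      show "f z = g z"
        using key[OF f g eq, of z] key[OF g f eq[symmetric], of z] z by (fastforce simp: supp_def)
    qed
  qed
  then show ?thesis by blast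
qed

section \<open>The universal seminorm\<close>

text \<open>\<open>emb\<close> expresses that the universe has room for sequences in the free
  *-algebra; the l2-space and the completed algebra are both placed there through it.\<close>

locale ck_universe =
  fixes I :: "'i set" and A :: "'i \<Rightarrow> 'i \<Rightarrow> complex"
    and emb :: "(nat \<Rightarrow> 'i ck_gen free_alg) \<Rightarrow> 'u"
  assumes entries: "\<forall>i\<in>I. \<forall>j\<in>I. A i j \<in> {0, 1}"
    and no_zero_row: "\<forall>i\<in>I. \<exists>j\<in>I. A i j \<noteq> 0"
    and inj_emb: "inj emb"
begin

abbreviation M :: "'i ck_gen free_alg set" where
  "M \<equiv> vcarrier (free_star (ck_gens I))"

abbreviation ckrep :: "'h hilbert \<Rightarrow> ('i ck_gen free_alg \<Rightarrow> 'h \<Rightarrow> 'h) \<Rightarrow> bool" where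
  "ckrep \<equiv> representation (ck_gens I) (ck_RN I) (ck_RS I A)"

definition N :: "'i ck_gen free_alg \<Rightarrow> real" where
  "N = rep_norm TYPE('u) (ck_gens I) (ck_RN I) (ck_RS I A)"

text \<open>The supremum that defines the universal seminorm would be meaningless over the empty
  set. The nonvanishing of the range projections is passed on to \<open>N\<close>.\<close>

lemma ckrep_exists:
  "\<exists>(H :: 'u hilbert) \<rho>. ckrep H \<rho> \<and> (\<forall>j\<in>I. opnorm H (\<rho> (rproj j)) \<noteq> 0)"
proof -
  obtain \<rho> where \<rho>: "ckrep (l2 (I \<times> (UNIV :: 'i list set))) \<rho>"
    and ne: "\<forall>j\<in>I. opnorm (l2 (I \<times> (UNIV :: 'i list set))) (\<rho> (rproj j)) \<noteq> 0"
    using ck_l2_representation[OF entries no_zero_row] by (elim exE conjE)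
  obtain \<phi> :: "('i \<times> 'i list \<Rightarrow> complex) \<Rightarrow> nat \<Rightarrow> 'i ck_gen free_alg"
    where "inj_on \<phi> (vcarrier (l2 (I \<times> (UNIV :: 'i list set))))"
    using l2_embeds[of I] by (elim exE)
  then have "inj_on (emb \<circ> \<phi>) (vcarrier (l2 (I \<times> (UNIV :: 'i list set))))"
    using inj_emb by (intro comp_inj_on) (auto intro: inj_on_subset)
  from transport_representation[OF ck_generating_triple \<rho> this]
  obtain H' :: "'u hilbert" and \<rho>' where "ckrep H' \<rho>'"
    "\<forall>x\<in>M. opnorm H' (\<rho>' x) = opnorm (l2 (I \<times> (UNIV :: 'i list set))) (\<rho> x)"
    by (elim exE conjE)
  then show ?thesis using ne by (intro exI[of _ H'] exI[of _ \<rho>']) simp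
qed

lemma ckrep_seminorm: "ckrep H \<rho> \<Longrightarrow> ck_seminorm I (\<lambda>x. opnorm H (\<rho> x)) A"
  using representation_ck_seminorm entries by blast

lemma ckrep_free: "ckrep H \<rho> \<Longrightarrow> free_seminorm (ck_gens I) (\<lambda>x. opnorm H (\<rho> x))"
  by (rule ck_relations.axioms(1)[OF ck_seminorm_relations[OF ckrep_seminorm]])

lemma N_upper:
  fixes H :: "'u hilbert"
  assumes "ckrep H \<rho>" "x \<in> M"
  shows "opnorm H (\<rho> x) \<le> N x"
  unfolding N_def rep_norm_def
proof (rule cSup_upper)
  show "opnorm H (\<rho> x) \<in> {opnorm H (\<rho> x) |(H :: 'u hilbert) \<rho>. ckrep H \<rho>}" using assms by blast
  obtain K where "\<forall>N A. ck_relations I N A \<longrightarrow> N x \<le> K"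
    using ck_uniform_bound[OF assms(2)] by (elim exE conjE)
  then show "bdd_above {opnorm H (\<rho> x) |(H :: 'u hilbert) \<rho>. ckrep H \<rho>}"
    using ck_seminorm_relations[OF ckrep_seminorm] by (intro bdd_aboveI[of _ K]) auto
qed

lemma N_least:
  assumes "\<And>(H :: 'u hilbert) \<rho>. ckrep H \<rho> \<Longrightarrow> opnorm H (\<rho> x) \<le> c"
  shows "N x \<le> c"
  unfolding N_def rep_norm_def
proof (rule cSup_least)
  show "{opnorm H (\<rho> x) |(H :: 'u hilbert) \<rho>. ckrep H \<rho>} \<noteq> {}" using ckrep_exists by blast
qed (use assms in auto)

lemma N_cstar_seminormed: "cstar_seminormed (fnorm (ck_gens I) N)"
proof -
  interpret F: star_algebra "fnorm (ck_gens I) N" by (rule fnorm_star_algebra)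
  have nonneg: "0 \<le> N x" if x: "x \<in> M" for x
  proof -
    obtain H :: "'u hilbert" and \<rho> where r: "ckrep H \<rho>" using ckrep_exists by blast
    show ?thesis using free_seminorm.N_nonneg[OF ckrep_free[OF r] x] N_upper[OF r x] by simp
  qed
  show ?thesis
  proof (unfold_locales, goal_cases)
    case (1 x) then show ?case using nonneg by simp
  next
    case (2 x c)
    then have x: "x \<in> M" by simp
    have sc: "opnorm H (\<rho> (fscale c x)) = cmod c * opnorm H (\<rho> x)" if "ckrep H \<rho>" for H :: "'u hilbert" and \<rho>
      using free_seminorm.N_scale[OF ckrep_free[OF that] x] .
    have "N (fscale c x) \<le> cmod c * N x"
      by (rule N_least) (simp add: sc mult_left_mono N_upper x)
    moreover have "cmod c * N x \<le> N (fscale c x)"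
    proof (cases "c = 0")
      case True
      then show ?thesis using nonneg[of "fscale c x"] x by simp
    next
      case False
      have "N x \<le> N (fscale c x) / cmod c"
      proof (rule N_least)
        fix H :: "'u hilbert" and \<rho> assume r: "ckrep H \<rho>"
        show "opnorm H (\<rho> x) \<le> N (fscale c x) / cmod c"
          using N_upper[OF r, of "fscale c x"] x False sc[OF r] by (simp add: field_simps)
      qed
      then show ?thesis using False by (simp add: field_simps)
    qed
    ultimately show ?case by simp
  next
    case (3 x y)
    then have xy: "x \<in> M" "y \<in> M" by simp_all
    have "N (x + y) \<le> N x + N y"
    proof (rule N_least)
      fix H :: "'u hilbert" and \<rho> assume r: "ckrep H \<rho>"
      show "opnorm H (\<rho> (x + y)) \<le> N x + N y"
        using free_seminorm.N_add[OF ckrep_free[OF r] xy] N_upper[OF r xy(1)] N_upper[OF r xy(2)] by simp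
    qed
    then show ?case by simp
  next
    case (4 x y)
    then have xy: "x \<in> M" "y \<in> M" by simp_all
    have "N (x * y) \<le> N x * N y"
    proof (rule N_least)
      fix H :: "'u hilbert" and \<rho> assume r: "ckrep H \<rho>"
      have "opnorm H (\<rho> x) * opnorm H (\<rho> y) \<le> N x * N y"
        by (intro mult_mono N_upper[OF r] xy nonneg free_seminorm.N_nonneg[OF ckrep_free[OF r]])
      then show "opnorm H (\<rho> (x * y)) \<le> N x * N y"
        using free_seminorm.N_mult[OF ckrep_free[OF r] xy] by simp
    qed
    then show ?case by simp
  next
    case (5 x)
    then have x: "x \<in> M" by simp
    have sq: "opnorm H (\<rho> (fstar x * x)) = (opnorm H (\<rho> x))\<^sup>2" if "ckrep H \<rho>" for H :: "'u hilbert" and \<rho>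
      using free_seminorm.N_cstar[OF ckrep_free[OF that] x] .
    have "N (fstar x * x) \<le> (N x)\<^sup>2"
    proof (rule N_least)
      fix H :: "'u hilbert" and \<rho> assume r: "ckrep H \<rho>"
      show "opnorm H (\<rho> (fstar x * x)) \<le> (N x)\<^sup>2"
        unfolding sq[OF r] by (rule power_mono[OF N_upper[OF r x] free_seminorm.N_nonneg[OF ckrep_free[OF r] x]])
    qed
    \<comment> \<open>The supremum property bounds \<open>N x\<close> itself, so the C*-identity is
      used under a square root.\<close>
    moreover have "N x \<le> sqrt (N (fstar x * x))"
    proof (rule N_least)
      fix H :: "'u hilbert" and \<rho> assume r: "ckrep H \<rho>"
      have "(opnorm H (\<rho> x))\<^sup>2 \<le> N (fstar x * x)"
        unfolding sq[OF r, symmetric] by (rule N_upper[OF r]) (use x in simp)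
      then show "opnorm H (\<rho> x) \<le> sqrt (N (fstar x * x))" by (rule real_le_rsqrt)
    qed
    then have "(N x)\<^sup>2 \<le> N (fstar x * x)"
      using power_mono[of "N x" "sqrt (N (fstar x * x))" 2] nonneg[OF x] nonneg[of "fstar x * x"] x by simp
    ultimately show ?case by simp
  qed
qed

sublocale free_seminorm "ck_gens I" N
  by (rule free_seminorm.intro[OF N_cstar_seminormed])

lemma N_zeroI:
  assumes "x \<in> M" "\<And>(H :: 'u hilbert) \<rho>. ckrep H \<rho> \<Longrightarrow> opnorm H (\<rho> x) = 0"
  shows "N x = 0"
  using N_least[of x 0] assms N_nonneg[of x] by simp

lemma N_zeroD: "\<lbrakk>N x = 0; ckrep H \<rho>; x \<in> M\<rbrakk> \<Longrightarrow> opnorm H (\<rho> x) = 0" for H :: "'u hilbert"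
  using N_upper[of H \<rho> x] free_seminorm.N_nonneg[OF ckrep_free, of H \<rho> x] by simp

text \<open>Upper bounds and vanishing pass to a supremum. For detection, the hypothesis on
  \<open>N\<close> holds in every representation, where detection is known.\<close>

lemma N_ck_seminorm: "ck_seminorm I N A"
proof unfold_locales
  show "A i j = 0 \<or> A i j = 1" if "i \<in> I" "j \<in> I" for i j using entries that by auto
  show "N x \<le> \<eta>" if "(x, \<eta>) \<in> ck_RN I" for x \<eta>
    using that by (intro N_least) (auto simp: representation_def)
  show "N (rproj i * rproj j) = 0" if "i \<in> I" "j \<in> I" "i \<noteq> j" for i j
    using that by (intro N_zeroI ck_orth.orthogonal[OF ck_seminorm.axioms(1)[OF ckrep_seminorm]]) auto
  show "N (iproj i * rproj j - fscale (A i j) (rproj j)) = 0" if "i \<in> I" "j \<in> I" for i j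
    using that by (intro N_zeroI ck_orth.init_range[OF ck_seminorm.axioms(1)[OF ckrep_seminorm]]) auto
  show "N (x * gen One) = 0" if x: "x \<in> M" and z: "\<And>j. j \<in> I \<Longrightarrow> N (x * rproj j) = 0" for x
  proof (rule N_zeroI)
    fix H :: "'u hilbert" and \<rho> assume r: "ckrep H \<rho>"
    show "opnorm H (\<rho> (x * gen One)) = 0"
      by (rule ck_seminorm.detect[OF ckrep_seminorm[OF r] x]) (rule N_zeroD[OF z r], use x in simp_all)
  qed (use x in simp)
qed

lemma N_rproj: "j \<in> I \<Longrightarrow> N (rproj j) \<noteq> 0"
  using ckrep_exists N_zeroD by (metis rproj_mem)

end

section \<open>Comparison of seminorms\<close>

text \<open>If the norms of the powers \<open>a^(2^k)\<close> are comparable up to a factor that grows subexponentially in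
  the exponent, then they agree, by the C*-identity for self-adjoint elements.\<close>

lemma dominated_powers_imp_le:
  fixes r s c d :: real
  assumes r: "0 \<le> r" and s: "0 \<le> s" and c: "0 \<le> c" and d: "0 \<le> d"
    and bound: "\<And>k. r ^ (2 ^ k) \<le> (c * 2 ^ k + d) * s ^ (2 ^ k)"
  shows "r \<le> s"
proof (rule ccontr)
  assume "\<not> r \<le> s"
  then have rs: "r > s" by simp
  have s0: "s > 0"
  proof (rule ccontr)
    assume "\<not> s > 0"
    then have "r \<le> 0" using s bound[of 0] by simp
    then show False using rs s by simp
  qed
  define h where "h = r / s - 1"
  have h: "h > 0" using rs s0 by (simp add: h_def)
  have b: "(1 + h) ^ (2 ^ k) \<le> c * 2 ^ k + d" for k
    using bound[of k] s0 by (simp add: h_def power_divide field_simps)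
  \<comment> \<open>Bernoulli alone grows linearly in m = 2^k, no faster than the bound. Squaring
    it, which means passing from k to k + 1, gives growth of order m^2.\<close>
  have m: "(2 ^ k) * h\<^sup>2 \<le> 2 * c + d" for k :: nat
  proof -
    let ?m = "2 ^ k :: nat"
    have "(real ?m * h)\<^sup>2 \<le> (1 + real ?m * h)\<^sup>2" using h by (intro power_mono) auto
    also have "\<dots> \<le> ((1 + h) ^ ?m)\<^sup>2"
      using h Bernoulli_inequality[of h ?m] by (intro power_mono) (auto simp: mult.commute)
    also have "\<dots> = (1 + h) ^ (2 ^ Suc k)" by (simp add: power_mult[symmetric] mult.commute)
    also have "\<dots> \<le> c * 2 ^ Suc k + d" by (rule b)
    also have "\<dots> \<le> (2 * c + d) * 2 ^ k"
      using d mult_left_mono[of 1 "2 ^ k" d] by (simp add: algebra_simps)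
    finally have "(2 ^ k) * ((2 ^ k) * h\<^sup>2) \<le> (2 ^ k) * (2 * c + d)"
      by (simp add: power2_eq_square mult_ac)
    then show ?thesis by simp
  qed
  have h2: "h\<^sup>2 > 0" using h by simp
  obtain k where "(2 * c + d) / h\<^sup>2 < 2 ^ k" using real_arch_pow[of 2] by auto
  then have "2 * c + d < 2 ^ k * h\<^sup>2" using h2 by (simp add: field_simps)
  then show False using m[of k] by simp
qed

text \<open>Repeated squaring gives a^(2^k) with one use of the C*-identity per step, and never
  produces the zeroth power, which lies outside the non-unital algebra.\<close>

definition iter_sq :: "nat \<Rightarrow> 'g free_alg \<Rightarrow> 'g free_alg" where
  "iter_sq k a = ((\<lambda>x. x * x) ^^ k) a"

lemma iter_sq_simps [simp]: "iter_sq 0 a = a" "iter_sq (Suc k) a = iter_sq k a * iter_sq k a"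
  by (simp_all add: iter_sq_def)

lemma iter_sq_mem: "a \<in> vcarrier (free_star G) \<Longrightarrow> iter_sq k a \<in> vcarrier (free_star G)"
  by (induction k) auto

lemma iter_sq_star: "fstar a = a \<Longrightarrow> fstar (iter_sq k a) = iter_sq k a"
  by (induction k) (auto simp: fstar_mult)

lemma (in free_seminorm) N_iter_sq:
  assumes "a \<in> vcarrier (free_star G)" "fstar a = a"
  shows "N (iter_sq k a) = N a ^ (2 ^ k)"
proof (induction k)
  case (Suc k)
  have "N (iter_sq (Suc k) a) = N (fstar (iter_sq k a) * iter_sq k a)"
    using iter_sq_star[OF assms(2)] by simp
  also have "\<dots> = (N (iter_sq k a))\<^sup>2" by (rule N_cstar[OF iter_sq_mem[OF assms(1)]])
  finally show ?case using Suc by (simp add: power_mult[symmetric] mult.commute)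
qed simp

text \<open>The product ends in \<open>gen One\<close> since the ring unit of
  \<open>'g free_alg\<close> is the empty word, which lies outside the carrier;
  \<open>iprods\<close> and \<open>EL_prod\<close> end in the same way.\<close>

definition lin_word :: "'i list \<Rightarrow> 'i ck_gen free_alg" where
  "lin_word \<mu> = foldr (*) (map (\<lambda>i. gen (T i)) \<mu>) (gen One)"

definition iprods :: "'i list \<Rightarrow> 'i ck_gen free_alg" where
  "iprods zs = foldr (*) (map iproj zs) (gen One)"

lemma lin_word_simps [simp]: "lin_word [] = gen One" "lin_word (i # \<mu>) = gen (T i) * lin_word \<mu>"
  and iprods_simps [simp]: "iprods [] = gen One" "iprods (i # zs) = iproj i * iprods zs"
  by (simp_all add: lin_word_def iprods_def)

definition EL_prod :: "'i list \<Rightarrow> 'i list \<Rightarrow> 'i ck_gen free_alg" where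
  "EL_prod xs ys = foldr (*) (map iproj xs @ map (\<lambda>y. gen One - iproj y) ys) (gen One)"

lemma EL_prod_simps [simp]: "EL_prod [] [] = gen One" "EL_prod (i # xs) ys = iproj i * EL_prod xs ys"
  "EL_prod [] (i # ys) = (gen One - iproj i) * EL_prod [] ys"
  by (simp_all add: EL_prod_def)

context ck_orth
begin

abbreviation M :: "'i ck_gen free_alg set" where
  "M \<equiv> vcarrier (free_star (ck_gens I))"

lemma lin_word_mem [simp]: "set \<mu> \<subseteq> I \<Longrightarrow> lin_word \<mu> \<in> M"
  by (induction \<mu>) auto

lemma iprods_mem [simp]: "set zs \<subseteq> I \<Longrightarrow> iprods zs \<in> M"
  by (induction zs) auto

lemma EL_prod_mem [simp]: "set xs \<subseteq> I \<Longrightarrow> set ys \<subseteq> I \<Longrightarrow> EL_prod xs ys \<in> M"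
proof -
  assume xs: "set xs \<subseteq> I" and ys: "set ys \<subseteq> I"
  have "EL_prod [] ys \<in> M" using ys by (induction ys) auto
  then show ?thesis using xs by (induction xs) auto
qed

section \<open>Products of generators with projections\<close>

lemma rproj_gen: "i \<in> I \<Longrightarrow> rproj i * gen (T i) \<simeq> gen (T i)"
  using isometry_rel[of i] by (simp add: rproj_def)

lemma rproj_gen_orth:
  assumes "i \<in> I" "j \<in> I" "i \<noteq> j"
  shows "rproj i * gen (T j) \<simeq> 0"
proof -
  have "rproj i * gen (T j) \<simeq> rproj i * (rproj j * gen (T j))"
    using assms by (intro cg_mult_left cg_sym[OF rproj_gen]) auto
  also have "rproj i * (rproj j * gen (T j)) \<simeq> 0 * gen (T j)"
    unfolding mult.assoc[symmetric] using assms by (intro cg_mult_right rproj_orth) auto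
  finally show ?thesis by simp
qed

lemma star_gen_rproj: "i \<in> I \<Longrightarrow> fstar (gen (T i)) * rproj i \<simeq> fstar (gen (T i))"
  using cg_fstar[OF rproj_gen[of i]] by (simp add: fstar_mult)

lemma star_gen_gen_orth:
  assumes "i \<in> I" "j \<in> I" "i \<noteq> j"
  shows "fstar (gen (T i)) * gen (T j) \<simeq> 0"
proof -
  have "fstar (gen (T i)) * gen (T j) \<simeq> (fstar (gen (T i)) * rproj i) * gen (T j)"
    using assms by (intro cg_mult_right cg_sym[OF star_gen_rproj]) auto
  also have "(fstar (gen (T i)) * rproj i) * gen (T j) \<simeq> fstar (gen (T i)) * 0"
    unfolding mult.assoc using assms by (intro cg_mult_left rproj_gen_orth) auto
  finally show ?thesis by simp
qed

lemma iproj_gen: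
  assumes "i \<in> I" "j \<in> I"
  shows "iproj i * gen (T j) \<simeq> fscale (A i j) (gen (T j))"
proof -
  have "iproj i * gen (T j) \<simeq> iproj i * (rproj j * gen (T j))"
    using assms by (intro cg_mult_left cg_sym[OF rproj_gen]) auto
  also have "iproj i * (rproj j * gen (T j)) \<simeq> fscale (A i j) (rproj j) * gen (T j)"
    unfolding mult.assoc[symmetric] using assms by (intro cg_mult_right iproj_rproj) auto
  also have "fscale (A i j) (rproj j) * gen (T j) \<simeq> fscale (A i j) (gen (T j))"
    unfolding fscale_mult_left using assms by (intro cg_fscale rproj_gen)
  finally show ?thesis .
qed

lemma star_gen_iproj:
  assumes "i \<in> I" "j \<in> I"
  shows "fstar (gen (T j)) * iproj i \<simeq> fscale (A i j) (fstar (gen (T j)))"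
proof -
  have "cnj (A i j) = A i j" using zero_one[OF assms] by auto
  then show ?thesis using cg_fstar[OF iproj_gen[OF assms]] by (simp add: fstar_mult fstar_fscale)
qed

lemma iprods_gen:
  assumes "set zs \<subseteq> I" "j \<in> I"
  shows "\<exists>c. iprods zs * gen (T j) \<simeq> fscale c (gen (T j))"
  using assms(1)
proof (induction zs)
  case Nil
  show ?case using One_left[of "gen (T j)"] assms(2) by (intro exI[of _ 1]) simp
next
  case (Cons z zs)
  then obtain c where c: "iprods zs * gen (T j) \<simeq> fscale c (gen (T j))" by auto
  have "iproj z * (iprods zs * gen (T j)) \<simeq> iproj z * fscale c (gen (T j))"
    using Cons.prems by (intro cg_mult_left c) auto
  also have "iproj z * fscale c (gen (T j)) \<simeq> fscale c (fscale (A z j) (gen (T j)))"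
    unfolding fscale_mult_right using Cons.prems assms by (intro cg_fscale iproj_gen) auto
  finally show ?case by (auto simp: mult.assoc)
qed

lemma star_gen_iprods:
  assumes "set zs \<subseteq> I" "j \<in> I"
  shows "\<exists>c. fstar (gen (T j)) * iprods zs \<simeq> fscale c (fstar (gen (T j)))"
  using assms(1)
proof (induction zs)
  case Nil
  show ?case using One_right[of "fstar (gen (T j))"] assms(2) by (intro exI[of _ 1]) simp
next
  case (Cons z zs)
  then obtain c where c: "fstar (gen (T j)) * iprods zs \<simeq> fscale c (fstar (gen (T j)))" by auto
  have "(fstar (gen (T j)) * iproj z) * iprods zs \<simeq> fscale (A z j) (fstar (gen (T j))) * iprods zs"
    using Cons.prems assms by (intro cg_mult_right star_gen_iproj) auto
  also have "fscale (A z j) (fstar (gen (T j))) * iprods zs \<simeq> fscale (A z j) (fscale c (fstar (gen (T j))))"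
    unfolding fscale_mult_left by (intro cg_fscale c)
  finally show ?case by (auto simp: mult.assoc)
qed

text \<open>The span of the elements \<open>T\<^bsub>\<mu>\<^esub> q T\<^bsub>\<nu>\<^esub>*\<close> with \<open>\<mu>\<close>, \<open>\<nu>\<close> of equal length at most \<open>n\<close> and \<open>q\<close> a product of
  initial projections, all indices being in \<open>F\<close>.\<close>

inductive core :: "'i set \<Rightarrow> nat \<Rightarrow> 'i ck_gen free_alg \<Rightarrow> bool" for F where
  core_iprods: "set zs \<subseteq> F \<Longrightarrow> core F n (iprods zs)"
| core_step: "core F n d \<Longrightarrow> i \<in> F \<Longrightarrow> j \<in> F \<Longrightarrow> core F (Suc n) (gen (T i) * d * fstar (gen (T j)))"
| core_add: "core F n x \<Longrightarrow> core F n y \<Longrightarrow> core F n (x + y)"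
| core_scale: "core F n x \<Longrightarrow> core F n (fscale c x)"
| core_cg: "core F n x \<Longrightarrow> x \<simeq> y \<Longrightarrow> core F n y"

section \<open>Closure properties of the increasing subspaces\<close>

lemma core_mem:
  assumes F: "F \<subseteq> I"
  shows "core F n x \<Longrightarrow> x \<in> M"
proof (induction rule: core.induct)
  case (core_iprods zs n) then show ?case using F by (intro iprods_mem) auto
next
  case (core_step n d i j)
  then have "i \<in> I" "j \<in> I" using F by auto
  then show ?case using core_step by simp
next
  case (core_cg n x y) then show ?case using cg_memD by blast
qed auto

lemma core_mono_level: "core F n x \<Longrightarrow> n \<le> m \<Longrightarrow> core F m x"
proof (induction arbitrary: m rule: core.induct)
  case (core_iprods zs n) then show ?case by (intro core.core_iprods)
next
  case (core_step n d i j)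
  obtain k where "m = Suc k" "n \<le> k" using core_step.prems by (cases m) auto
  then show ?case using core_step by (auto intro: core.core_step)
next
  case (core_add n x y) then show ?case by (auto intro: core.core_add)
next
  case (core_scale n x c) then show ?case by (auto intro: core.core_scale)
next
  case (core_cg n x y)
  from core_cg.IH[OF core_cg.prems] core_cg.hyps(2) show ?case by (rule core.core_cg)
qed

lemma core_mono_set: "core F n x \<Longrightarrow> F \<subseteq> F' \<Longrightarrow> core F' n x"
proof (induction rule: core.induct)
  case (core_iprods zs n) then show ?case by (intro core.core_iprods) auto
next
  case (core_step n d i j) then show ?case by (auto intro!: core.core_step)
next
  case (core_add n x y) then show ?case by (auto intro: core.core_add)
next
  case (core_scale n x c) then show ?case by (auto intro: core.core_scale)
next
  case (core_cg n x y)
  from core_cg.IH[OF core_cg.prems] core_cg.hyps(2) show ?case by (rule core.core_cg)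
qed

lemma core_One: "core F n (gen One)"
  using core_iprods[of "[]" F n] by simp

lemma core_zero: "core F n 0"
  using core_scale[OF core_One, of F n 0] by simp

lemma core_null: "0 \<simeq> x \<Longrightarrow> core F n x"
  by (rule core_cg[OF core_zero])

text \<open>A product of initial projections takes one more factor, and in front of T_j the
  projection becomes the scalar A i j. In both cases the level is preserved.\<close>

lemma core_iproj_left:
  assumes F: "F \<subseteq> I" and i: "i \<in> F"
  shows "core F n y \<Longrightarrow> core F n (iproj i * y)"
proof (induction rule: core.induct)
  case (core_iprods zs n) then show ?case using i core.core_iprods[of "i # zs" F n] by simp
next
  case (core_step n d j k)
  then have jk: "i \<in> I" "j \<in> I" "k \<in> I" "d \<in> M" using F i core_mem[OF F] by auto
  have "fscale (A i j) (gen (T j)) * (d * fstar (gen (T k))) \<simeq> (iproj i * gen (T j)) * (d * fstar (gen (T k)))"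
    using jk by (intro cg_mult_right cg_sym[OF iproj_gen]) auto
  moreover have "core F (Suc n) (fscale (A i j) (gen (T j) * d * fstar (gen (T k))))"
    using core_step by (intro core.core_scale core.core_step)
  ultimately show ?case
    by (intro core.core_cg[of F "Suc n" "fscale (A i j) (gen (T j) * d * fstar (gen (T k)))" "iproj i * _"])
      (simp_all only: fscale_mult_left mult.assoc)
next
  case (core_add n x y) then show ?case by (simp add: distrib_left core.core_add)
next
  case (core_scale n x c) then show ?case by (simp add: fscale_mult_right core.core_scale)
next
  case (core_cg n x y)
  have "iproj i * x \<simeq> iproj i * y" using core_cg.hyps(2) i F by (intro cg_mult_left) auto
  with core_cg.IH show ?case by (rule core.core_cg)
qed

text \<open>The star of a product of initial projections is the product along the reversed list;
  reversal takes the place of commutativity, which this layer does not contain.\<close>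

lemma core_star:
  assumes F: "F \<subseteq> I"
  shows "core F n y \<Longrightarrow> core F n (fstar y)"
proof (induction rule: core.induct)
  case (core_iprods zs n)
  have *: "fstar (iprods zs) * iprods us \<simeq> iprods (rev zs @ us)" if "set zs \<subseteq> I" "set us \<subseteq> I" for us
    using that
  proof (induction zs arbitrary: us)
    case Nil
    have "fstar (gen One) * iprods us \<simeq> gen One * iprods us" using Nil by (intro cg_mult_right One_star) auto
    also have "gen One * iprods us \<simeq> iprods us" using Nil by (intro One_left) auto
    finally show ?case by simp
  next
    case (Cons z zs)
    then show ?case using Cons.IH[of "z # us"] by (simp add: fstar_mult mult.assoc)
  qed
  have zs: "set zs \<subseteq> I" using core_iprods F by auto
  have "iprods (rev zs) \<simeq> fstar (iprods zs) * gen One" using cg_sym[OF *[of "[]"]] zs by simp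
  also have "fstar (iprods zs) * gen One \<simeq> fstar (iprods zs)" using zs by (intro One_right) simp
  finally have e: "iprods (rev zs) \<simeq> fstar (iprods zs)" .
  show ?case by (rule core.core_cg[OF core.core_iprods e]) (use core_iprods in simp)
next
  case (core_step n d i j)
  then show ?case using core.core_step[of F n "fstar d" j i] by (simp add: fstar_mult mult.assoc)
next
  case (core_add n x y) then show ?case by (simp add: fstar_add core.core_add)
next
  case (core_scale n x c) then show ?case by (simp add: fstar_fscale core.core_scale)
next
  case (core_cg n x y)
  from core_cg.IH cg_fstar[OF core_cg.hyps(2)] show ?case by (rule core.core_cg)
qed

lemma core_iproj_right:
  assumes F: "F \<subseteq> I" and i: "i \<in> F" and y: "core F n y"
  shows "core F n (y * iproj i)"
  using core_star[OF F core_iproj_left[OF F i core_star[OF F y]]] by (simp add: fstar_mult)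

lemma core_iprods_left:
  assumes F: "F \<subseteq> I" and y: "core F n y"
  shows "set zs \<subseteq> F \<Longrightarrow> core F n (iprods zs * y)"
proof (induction zs)
  case Nil
  have "y \<simeq> gen One * y" using cg_sym[OF One_left[OF core_mem[OF F y]]] .
  with y show ?case unfolding iprods_simps by (rule core_cg)
next
  case (Cons z zs) then show ?case using core_iproj_left[OF F, of z] by (simp add: mult.assoc)
qed

lemma core_iprods_right:
  assumes F: "F \<subseteq> I"
  shows "core F n y \<Longrightarrow> set zs \<subseteq> F \<Longrightarrow> core F n (y * iprods zs)"
proof (induction zs arbitrary: y)
  case Nil
  have "y \<simeq> y * gen One" using cg_sym[OF One_right[OF core_mem[OF F Nil(1)]]] .
  with Nil(1) show ?case unfolding iprods_simps by (rule core_cg)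
next
  case (Cons z zs)
  have "core F n (y * iproj z * iprods zs)"
    by (intro Cons.IH core_iproj_right[OF F]) (use Cons.prems in auto)
  then show ?case by (simp add: mult.assoc)
qed

text \<open>T_i d T_j* times T_k e T_l* vanishes for different j and k. For j = k the middle factor
  T_j* T_j is an initial projection and is absorbed into e. The level does not grow, which is what
  makes the argument with powers possible.\<close>

lemma core_mult:
  assumes F: "F \<subseteq> I"
  shows "core F n x \<Longrightarrow> core F n y \<Longrightarrow> core F n (x * y)"
proof (induction arbitrary: y rule: core.induct)
  case (core_iprods zs n) then show ?case using core_iprods_left[OF F] by simp
next
  case (core_step n d i j)
  then have mem: "i \<in> I" "j \<in> I" "d \<in> M" using F core_mem[OF F] by auto
  from \<open>core F (Suc n) y\<close> show ?case
  proof (induction "Suc n" y rule: core.induct)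
    case (core_iprods zs)
    then show ?case using core_step.hyps by (intro core_iprods_right[OF F] core.core_step) auto
  next
    case inner: (core_step e k l)
    then have mem': "k \<in> I" "l \<in> I" "e \<in> M" using F core_mem[OF F] by auto
    show ?case
    proof (cases "j = k")
      case True
      have "core F (Suc n) (gen (T i) * (d * (iproj j * e)) * fstar (gen (T l)))"
        using core_step inner core_iproj_left[OF F] by (intro core.core_step core_step.IH) auto
      then show ?thesis using True by (simp add: iproj_def mult.assoc)
    next
      case False
      have "0 * (e * fstar (gen (T l))) \<simeq> (fstar (gen (T j)) * gen (T k)) * (e * fstar (gen (T l)))"
        using False mem mem' by (intro cg_mult_right cg_sym[OF star_gen_gen_orth]) auto
      then have "(gen (T i) * d) * 0 \<simeq> (gen (T i) * d) * ((fstar (gen (T j)) * gen (T k)) * (e * fstar (gen (T l))))"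
        using mem by (intro cg_mult_left) auto
      then show ?thesis by (intro core_null) (simp add: mult.assoc)
    qed
  next
    case (core_add x y) then show ?case by (simp add: distrib_left core.core_add)
  next
    case (core_scale x c) then show ?case by (simp add: fscale_mult_right core.core_scale)
  next
    case (core_cg x y)
    have "gen (T i) * d * fstar (gen (T j)) * x \<simeq> gen (T i) * d * fstar (gen (T j)) * y"
      using core_cg.hyps(3) mem by (intro cg_mult_left) auto
    with core_cg.hyps(2) show ?case by (rule core.core_cg)
  qed
next
  case (core_add n x x') then show ?case by (simp add: distrib_right core.core_add)
next
  case (core_scale n x c) then show ?case by (simp add: fscale_mult_left core.core_scale)
next
  case (core_cg n x x')
  have "x * y \<simeq> x' * y" using core_cg.hyps(2) core_mem[OF F core_cg.prems] by (intro cg_mult_right)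
  with core_cg.IH[OF core_cg.prems] show ?case by (rule core.core_cg)
qed

text \<open>Compression strips one letter on each side; this drives the induction over the levels in
  \<open>core_bound\<close>.\<close>

lemma core_compress:
  assumes F: "F \<subseteq> I" and i: "i \<in> F" and j: "j \<in> F"
  shows "core F (Suc n) y \<Longrightarrow> core F n (fstar (gen (T i)) * y * gen (T j))"
proof (induction "Suc n" y rule: core.induct)
  have ij: "i \<in> I" "j \<in> I" using F i j by auto
  case (core_iprods zs)
  obtain c where "iprods zs * gen (T j) \<simeq> fscale c (gen (T j))"
    using iprods_gen[of zs j] core_iprods F ij by auto
  from cg_mult_left[OF cg_sym[OF this], of "fstar (gen (T i))"]
  have c: "fscale c (fstar (gen (T i)) * gen (T j)) \<simeq> fstar (gen (T i)) * (iprods zs * gen (T j))"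
    using ij by (simp add: fscale_mult_right)
  have "core F n (fstar (gen (T i)) * gen (T j))"
  proof (cases "i = j")
    case True
    have "core F n (iproj i * gen One)" using core.core_iprods[of "[i]" F n] i by simp
    from core.core_cg[OF this One_right[of "iproj i"]] show ?thesis using True ij by (simp add: iproj_def)
  next
    case False
    show ?thesis by (rule core_null[OF cg_sym[OF star_gen_gen_orth[OF ij False]]])
  qed
  from core.core_cg[OF core.core_scale[OF this] c] show ?case by (simp add: mult.assoc)
next
  have ij: "i \<in> I" "j \<in> I" using F i j by auto
  case (core_step d k l)
  then have mem: "k \<in> I" "l \<in> I" "d \<in> M" using F core_mem[OF F] by auto
  have eq: "fstar (gen (T i)) * (gen (T k) * d * fstar (gen (T l))) * gen (T j)
      = (fstar (gen (T i)) * gen (T k)) * (d * (fstar (gen (T l)) * gen (T j)))" by (simp add: mult.assoc)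
  show ?case
  proof (cases "i = k \<and> l = j")
    case True
    then show ?thesis
      using core_step i j core_iproj_left[OF F i core_iproj_right[OF F j, of n d]] by (simp add: iproj_def mult.assoc)
  next
    case False
    then consider "i \<noteq> k" | "l \<noteq> j" by blast
    then have "(fstar (gen (T i)) * gen (T k)) * (d * (fstar (gen (T l)) * gen (T j))) \<simeq> 0"
    proof cases
      case 1
      have "(fstar (gen (T i)) * gen (T k)) * (d * (fstar (gen (T l)) * gen (T j)))
          \<simeq> 0 * (d * (fstar (gen (T l)) * gen (T j)))"
        using 1 mem ij by (intro cg_mult_right star_gen_gen_orth) auto
      then show ?thesis by simp
    next
      case 2
      have "(fstar (gen (T i)) * gen (T k)) * (d * (fstar (gen (T l)) * gen (T j)))
          \<simeq> (fstar (gen (T i)) * gen (T k)) * (d * 0)"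
        using 2 mem ij by (intro cg_mult_left star_gen_gen_orth) auto
      then show ?thesis by simp
    qed
    then show ?thesis unfolding eq by (rule core_null[OF cg_sym])
  qed
next
  case (core_add x y) then show ?case by (simp add: distrib_left distrib_right core.core_add)
next
  case (core_scale x c) then show ?case by (simp add: fscale_mult_left fscale_mult_right core.core_scale)
next
  have ij: "i \<in> I" "j \<in> I" using F i j by auto
  case (core_cg x y)
  have "fstar (gen (T i)) * x * gen (T j) \<simeq> fstar (gen (T i)) * y * gen (T j)"
    using core_cg.hyps(3) ij by (intro cg_mult_left cg_mult_right) auto
  with core_cg.hyps(2) show ?case by (rule core.core_cg)
qed

lemma core_iter_sq: "F \<subseteq> I \<Longrightarrow> core F n a \<Longrightarrow> core F n (iter_sq k a)"
  by (induction k) (auto intro: core_mult)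

section \<open>Cutting down by the complement of finitely many range projections\<close>

definition resid :: "'i set \<Rightarrow> 'i ck_gen free_alg" where
  "resid F = gen One - (\<Sum>j\<in>F. rproj j)"

lemma sum_rproj_mem: "F \<subseteq> I \<Longrightarrow> (\<Sum>j\<in>F. rproj j) \<in> M"
  by (intro sum_mem rproj_mem) auto

lemma resid_mem: "F \<subseteq> I \<Longrightarrow> resid F \<in> M"
  using sum_rproj_mem[of F] by (simp add: resid_def)

lemma resid_star: "F \<subseteq> I \<Longrightarrow> fstar (resid F) \<simeq> resid F"
  using cg_diff[OF One_star cg_refl[OF sum_rproj_mem]] by (simp add: resid_def fstar_minus fstar_sum)

lemma resid_gen:
  assumes "finite F" "F \<subseteq> I" "j \<in> F"
  shows "resid F * gen (T j) \<simeq> 0"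
proof -
  have j: "j \<in> I" using assms by auto
  have "(\<Sum>i\<in>F. rproj i * gen (T j)) \<simeq> (\<Sum>i\<in>F. if i = j then gen (T j) else 0)"
    using assms j rproj_gen[OF j] rproj_gen_orth by (intro cg_sum) auto
  then have "(\<Sum>i\<in>F. rproj i) * gen (T j) \<simeq> gen (T j)" using assms by (simp add: sum_distrib_right)
  from cg_diff[OF One_left[of "gen (T j)"] this] j show ?thesis by (simp add: resid_def left_diff_distrib)
qed

lemma star_gen_resid:
  assumes "finite F" "F \<subseteq> I" "j \<in> F"
  shows "fstar (gen (T j)) * resid F \<simeq> 0"
proof -
  have j: "j \<in> I" using assms by auto
  have "fstar (gen (T j)) * resid F \<simeq> fstar (gen (T j)) * fstar (resid F)"
    using j by (intro cg_mult_left cg_sym[OF resid_star] assms) auto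
  also have "fstar (gen (T j)) * fstar (resid F) \<simeq> fstar 0"
    using cg_fstar[OF resid_gen[OF assms]] by (simp add: fstar_mult)
  finally show ?thesis by simp
qed

lemma rproj_resid:
  assumes "finite F" "F \<subseteq> I" "j \<in> F"
  shows "rproj j * resid F \<simeq> 0"
  using cg_mult_left[OF star_gen_resid[OF assms], of "gen (T j)"] assms by (auto simp: rproj_def mult.assoc)

lemma resid_rproj_notin:
  assumes "finite F" "F \<subseteq> I" "j \<in> I" "j \<notin> F"
  shows "resid F * rproj j \<simeq> rproj j"
proof -
  have "(\<Sum>i\<in>F. fscale 1 (rproj i)) * rproj j \<simeq> fscale (if j \<in> F then 1 else 0) (rproj j)"
    by (rule sum_rproj_mult[OF assms(1-3)])
  from cg_diff[OF One_left[of "rproj j"] this] assms show ?thesis by (simp add: resid_def left_diff_distrib)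
qed

text \<open>\<open>resid F\<close> is killed from the left by every T_j* with j in \<open>F\<close>,
  so the terms of positive level disappear and a level-zero element remains.\<close>

lemma core_compress_resid:
  assumes F: "finite F" "F \<subseteq> I"
  shows "core F n y \<Longrightarrow> \<exists>y0. core F 0 y0 \<and> y * resid F \<simeq> y0 * resid F"
proof (induction rule: core.induct)
  case (core_iprods zs n)
  then have "set zs \<subseteq> I" using F by auto
  then show ?case using core_iprods resid_mem[OF F(2)]
    by (intro exI[of _ "iprods zs"] conjI core.core_iprods cg_refl) auto
next
  case (core_step n d i j)
  then have mem: "i \<in> I" "j \<in> I" "d \<in> M" using F core_mem[OF F(2)] by auto
  have "(gen (T i) * d) * (fstar (gen (T j)) * resid F) \<simeq> (gen (T i) * d) * 0"
    using mem core_step by (intro cg_mult_left star_gen_resid F) auto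
  then show ?case by (intro exI[of _ 0]) (simp add: core_zero mult.assoc)
next
  case (core_add n x y)
  then obtain x0 y0 where "core F 0 x0" "x * resid F \<simeq> x0 * resid F" "core F 0 y0" "y * resid F \<simeq> y0 * resid F"
    by blast
  then show ?case by (intro exI[of _ "x0 + y0"]) (auto simp: distrib_right intro: core.core_add cg_add)
next
  case (core_scale n x c)
  then obtain x0 where "core F 0 x0" "x * resid F \<simeq> x0 * resid F" by blast
  then show ?case by (intro exI[of _ "fscale c x0"]) (auto simp: fscale_mult_left intro: core.core_scale cg_fscale)
next
  case (core_cg n x y)
  then obtain x0 where x0: "core F 0 x0" "x * resid F \<simeq> x0 * resid F" by blast
  have "y * resid F \<simeq> x * resid F"
    using cg_sym[OF core_cg.hyps(2)] resid_mem[OF F(2)] by (rule cg_mult_right)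
  from x0(1) cg_trans[OF this x0(2)] show ?case by blast
qed

text \<open>y T_j is a combination of a multiple of T_j and of elements that begin with some T_i,
  and \<open>resid F\<close> kills all of these from the left. So \<open>y\<close> has no mixed
  corners in the decomposition behind \<open>core_norm_split\<close>.\<close>

lemma resid_core_gen:
  assumes F: "finite F" "F \<subseteq> I" and j: "j \<in> F"
  shows "core F n y \<Longrightarrow> resid F * (y * gen (T j)) \<simeq> 0"
proof (induction rule: core.induct)
  have jI: "j \<in> I" using F j by auto
  case (core_iprods zs n)
  obtain c where "iprods zs * gen (T j) \<simeq> fscale c (gen (T j))"
    using iprods_gen[of zs j] core_iprods F jI by auto
  then have "resid F * (iprods zs * gen (T j)) \<simeq> resid F * fscale c (gen (T j))"
    using resid_mem[OF F(2)] by (rule cg_mult_left)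
  also have "resid F * fscale c (gen (T j)) \<simeq> fscale c 0"
    unfolding fscale_mult_right by (intro cg_fscale resid_gen F j)
  finally show ?case by simp
next
  have jI: "j \<in> I" using F j by auto
  case (core_step n d i k)
  then have mem: "i \<in> I" "k \<in> I" "d \<in> M" using F core_mem[OF F(2)] by auto
  have "(resid F * gen (T i)) * (d * fstar (gen (T k)) * gen (T j)) \<simeq> 0 * (d * fstar (gen (T k)) * gen (T j))"
    using mem core_step jI by (intro cg_mult_right resid_gen F) auto
  then show ?case by (simp add: mult.assoc)
next
  case (core_add n x y)
  from cg_add[OF core_add.IH] show ?case by (simp add: distrib_left distrib_right)
next
  case (core_scale n x c)
  from cg_fscale[OF core_scale.IH, of c] show ?case by (simp add: fscale_mult_left fscale_mult_right)
next
  have jI: "j \<in> I" using F j by auto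
  case (core_cg n x y)
  have "resid F * (y * gen (T j)) \<simeq> resid F * (x * gen (T j))"
    using cg_sym[OF core_cg.hyps(2)] resid_mem[OF F(2)] jI by (intro cg_mult_left cg_mult_right) auto
  from cg_trans[OF this core_cg.IH] show ?case .
qed

end

section \<open>Words of degree zero\<close>

context ck_orth
begin

text \<open>The normal form c T_mu q T_nu* of a word. Since c = 0 is allowed, a word that collapses
  to zero still counts as reduced in its own degree.\<close>

definition reduced :: "int \<Rightarrow> 'i ck_gen free_alg \<Rightarrow> bool" where
  "reduced d x \<longleftrightarrow> (\<exists>c \<mu> zs \<nu>. set \<mu> \<subseteq> I \<and> set zs \<subseteq> I \<and> set \<nu> \<subseteq> I \<and>
     int (length \<mu>) - int (length \<nu>) = d \<and>
     x \<simeq> fscale c (lin_word \<mu> * iprods zs * fstar (lin_word \<nu>)))"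

lemma reducedI:
  "\<lbrakk>set \<mu> \<subseteq> I; set zs \<subseteq> I; set \<nu> \<subseteq> I; int (length \<mu>) - int (length \<nu>) = d;
    x \<simeq> fscale c (lin_word \<mu> * iprods zs * fstar (lin_word \<nu>))\<rbrakk> \<Longrightarrow> reduced d x"
  unfolding reduced_def by blast

lemma reducedE:
  assumes "reduced d x"
  obtains c \<mu> zs \<nu> where "set \<mu> \<subseteq> I" "set zs \<subseteq> I" "set \<nu> \<subseteq> I"
    "int (length \<mu>) - int (length \<nu>) = d" "x \<simeq> fscale c (lin_word \<mu> * iprods zs * fstar (lin_word \<nu>))"
  using assms unfolding reduced_def by (elim exE conjE) (rule that)

lemma reduced_cg: "reduced d x \<Longrightarrow> y \<simeq> x \<Longrightarrow> reduced d y"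
  unfolding reduced_def using cg_trans by blast

lemma reduced_mem: "reduced d x \<Longrightarrow> x \<in> M"
  unfolding reduced_def using cg_memD(1) by blast

lemma reduced_One: "reduced 0 (gen One)"
proof (rule reducedI[of "[]" "[]" "[]" 0 _ 1])
  have "gen One * gen One * fstar (gen One) \<simeq> gen One * gen One * gen One"
    by (intro cg_mult_left One_star) auto
  also have "gen One * gen One * gen One \<simeq> gen One * gen One" by (intro cg_mult_right One_idem) auto
  also have "gen One * gen One \<simeq> gen One" by (rule One_idem)
  finally show "gen One \<simeq> fscale 1 (lin_word [] * iprods [] * fstar (lin_word []))"
    using cg_sym by simp
qed auto

lemma reduced_One_left: "reduced d x \<Longrightarrow> reduced d (gen One * x)"
  and reduced_One_star_left: "reduced d x \<Longrightarrow> reduced d (fstar (gen One) * x)"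
proof -
  assume x: "reduced d x"
  show "reduced d (gen One * x)" by (rule reduced_cg[OF x One_left[OF reduced_mem[OF x]]])
  show "reduced d (fstar (gen One) * x)"
    by (rule reduced_cg[OF x cg_trans[OF cg_mult_right[OF One_star] One_left]]) (rule reduced_mem[OF x])+
qed

lemma reduced_gen_left:
  assumes "reduced d x" "i \<in> I"
  shows "reduced (d + 1) (gen (T i) * x)"
  using assms(1)
proof (rule reducedE)
  fix c \<mu> zs \<nu>
  assume *: "set \<mu> \<subseteq> I" "set zs \<subseteq> I" "set \<nu> \<subseteq> I" "int (length \<mu>) - int (length \<nu>) = d"
    "x \<simeq> fscale c (lin_word \<mu> * iprods zs * fstar (lin_word \<nu>))"
  from cg_mult_left[OF *(5), of "gen (T i)"] assms(2)
  have "gen (T i) * x \<simeq> fscale c (lin_word (i # \<mu>) * iprods zs * fstar (lin_word \<nu>))"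
    by (simp add: fscale_mult_right mult.assoc)
  then show ?thesis by (rule reducedI[rotated 4]) (use * assms(2) in auto)
qed

lemma lin_word_snoc: "set \<nu> \<subseteq> I \<Longrightarrow> i \<in> I \<Longrightarrow> lin_word (\<nu> @ [i]) \<simeq> lin_word \<nu> * gen (T i)"
proof (induction \<nu>)
  case Nil
  have "gen (T i) * gen One \<simeq> gen (T i)" using Nil by (intro One_right) simp
  also have "gen (T i) \<simeq> gen One * gen (T i)" using Nil by (intro cg_sym[OF One_left]) simp
  finally show ?case by simp
next
  case (Cons j \<nu>)
  then show ?case using cg_mult_left[OF Cons.IH, of "gen (T j)"] by (simp add: mult.assoc)
qed

text \<open>With mu empty, T_i* passes q up to a scalar and is appended to nu. Otherwise it vanishes
  against a different first letter, or forms an initial projection with the same one. That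
  projection becomes a scalar at the next letter of mu, or joins q if there is none.\<close>

lemma reduced_star_gen_left:
  assumes "reduced d x" "i \<in> I"
  shows "reduced (d - 1) (fstar (gen (T i)) * x)"
  using assms(1)
proof (rule reducedE)
  fix c \<mu> zs \<nu>
  assume *: "set \<mu> \<subseteq> I" "set zs \<subseteq> I" "set \<nu> \<subseteq> I" "int (length \<mu>) - int (length \<nu>) = d"
    "x \<simeq> fscale c (lin_word \<mu> * iprods zs * fstar (lin_word \<nu>))"
  have x: "fstar (gen (T i)) * x \<simeq> fscale c (fstar (gen (T i)) * (lin_word \<mu> * iprods zs * fstar (lin_word \<nu>)))"
    using cg_mult_left[OF *(5), of "fstar (gen (T i))"] assms(2) by (simp add: fscale_mult_right)
  show ?thesis
  proof (cases \<mu>)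
    case Nil
    obtain c' where c': "fstar (gen (T i)) * iprods zs \<simeq> fscale c' (fstar (gen (T i)))"
      using star_gen_iprods[OF *(2) assms(2)] by blast
    have "fstar (gen (T i)) * (gen One * iprods zs * fstar (lin_word \<nu>))
        = (fstar (gen (T i)) * gen One) * (iprods zs * fstar (lin_word \<nu>))" by (simp add: mult.assoc)
    also have "\<dots> \<simeq> fstar (gen (T i)) * (iprods zs * fstar (lin_word \<nu>))"
      using assms(2) * by (intro cg_mult_right One_right) auto
    also have "fstar (gen (T i)) * (iprods zs * fstar (lin_word \<nu>)) \<simeq> fscale c' (fstar (gen (T i))) * fstar (lin_word \<nu>)"
      unfolding mult.assoc[symmetric] using * by (intro cg_mult_right c') auto
    also have "fscale c' (fstar (gen (T i))) * fstar (lin_word \<nu>) = fscale c' (fstar (lin_word \<nu> * gen (T i)))"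
      by (simp add: fscale_mult_left fstar_mult)
    also have "\<dots> \<simeq> fscale c' (fstar (lin_word (\<nu> @ [i])))"
      using * assms(2) by (intro cg_fscale cg_fstar cg_sym[OF lin_word_snoc]) auto
    also have "fscale c' (fstar (lin_word (\<nu> @ [i]))) \<simeq> fscale c' (gen One * gen One * fstar (lin_word (\<nu> @ [i])))"
      using * assms(2)
      by (intro cg_fscale cg_sym[OF cg_trans[OF cg_mult_right[OF One_idem] One_left]]) auto
    finally have y: "fstar (gen (T i)) * (gen One * iprods zs * fstar (lin_word \<nu>))
        \<simeq> fscale c' (gen One * gen One * fstar (lin_word (\<nu> @ [i])))" .
    have "fscale c (fstar (gen (T i)) * (gen One * iprods zs * fstar (lin_word \<nu>)))
        \<simeq> fscale (c * c') (gen One * gen One * fstar (lin_word (\<nu> @ [i])))"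
      using cg_fscale[OF y, of c] by simp
    from cg_trans[OF x[unfolded Nil lin_word_simps] this]
    have "fstar (gen (T i)) * x \<simeq> fscale (c * c') (lin_word [] * iprods [] * fstar (lin_word (\<nu> @ [i])))"
      by simp
    then show ?thesis by (rule reducedI[rotated 4]) (use * Nil assms(2) in auto)
  next
    case (Cons j \<mu>')
    have mem: "j \<in> I" "set \<mu>' \<subseteq> I" using *(1) Cons by auto
    have eq: "fstar (gen (T i)) * (lin_word \<mu> * iprods zs * fstar (lin_word \<nu>))
        = (fstar (gen (T i)) * gen (T j)) * (lin_word \<mu>' * iprods zs * fstar (lin_word \<nu>))"
      by (simp add: Cons mult.assoc)
    show ?thesis
    proof (cases "i = j")
      case False
      have "(fstar (gen (T i)) * gen (T j)) * (lin_word \<mu>' * iprods zs * fstar (lin_word \<nu>))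
          \<simeq> 0 * (lin_word \<mu>' * iprods zs * fstar (lin_word \<nu>))"
        using mem * assms(2) False by (intro cg_mult_right star_gen_gen_orth) auto
      from cg_trans[OF x cg_fscale[OF this[folded eq], of c]]
      have "fstar (gen (T i)) * x \<simeq> fscale 0 (lin_word \<mu>' * iprods zs * fstar (lin_word \<nu>))" by simp
      then show ?thesis by (rule reducedI[rotated 4]) (use * Cons in auto)
    next
      case True
      show ?thesis
      proof (cases \<mu>')
        case Nil
        have q: "iproj i * (gen One * iprods zs * fstar (lin_word \<nu>)) \<simeq> gen One * iprods (i # zs) * fstar (lin_word \<nu>)"
        proof -
          have "iproj i * gen One \<simeq> gen One * iproj i"
            using assms(2) by (intro cg_trans[OF One_right cg_sym[OF One_left]]) auto
          from cg_mult_right[OF this, of "iprods zs * fstar (lin_word \<nu>)"] show ?thesis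
            using * by (simp add: mult.assoc)
        qed
        have "fstar (gen (T i)) * x \<simeq> fscale c (iproj i * (gen One * iprods zs * fstar (lin_word \<nu>)))"
          using x[unfolded eq] True Nil by (simp add: iproj_def)
        from cg_trans[OF this cg_fscale[OF q]]
        have "fstar (gen (T i)) * x \<simeq> fscale c (lin_word [] * iprods (i # zs) * fstar (lin_word \<nu>))" by simp
        then show ?thesis by (rule reducedI[rotated 4]) (use * Cons Nil assms(2) in auto)
      next
        case (Cons k \<mu>'')
        have k: "k \<in> I" "set \<mu>'' \<subseteq> I" using mem Cons by auto
        have "(iproj i * gen (T k)) * (lin_word \<mu>'' * iprods zs * fstar (lin_word \<nu>))
            \<simeq> fscale (A i k) (gen (T k)) * (lin_word \<mu>'' * iprods zs * fstar (lin_word \<nu>))"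
          using k * assms(2) by (intro cg_mult_right iproj_gen) auto
        then have "iproj i * (lin_word \<mu>' * iprods zs * fstar (lin_word \<nu>))
            \<simeq> fscale (A i k) (lin_word \<mu>' * iprods zs * fstar (lin_word \<nu>))"
          by (simp add: Cons mult.assoc fscale_mult_left)
        note q = this
        have "fstar (gen (T i)) * x \<simeq> fscale c (iproj i * (lin_word \<mu>' * iprods zs * fstar (lin_word \<nu>)))"
          using x[unfolded eq] True by (simp add: iproj_def)
        from cg_trans[OF this cg_fscale[OF q]]
        have "fstar (gen (T i)) * x \<simeq> fscale (c * A i k) (lin_word \<mu>' * iprods zs * fstar (lin_word \<nu>))" by simp
        then show ?thesis by (rule reducedI[rotated 4]) (use * \<open>\<mu> = j # \<mu>'\<close> mem in auto)
      qed
    qed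
  qed
qed

end

section \<open>The gauge grading\<close>

fun letter_degree :: "'i ck_gen + 'i ck_gen \<Rightarrow> int" where
  "letter_degree (Inl (T i)) = 1"
| "letter_degree (Inl One) = 0"
| "letter_degree (Inr (T i)) = -1"
| "letter_degree (Inr One) = 0"

definition word_degree :: "('i ck_gen + 'i ck_gen) word \<Rightarrow> int" where
  "word_degree w = sum_list (map letter_degree (letters w))"

lemma word_degree_add [simp]: "word_degree (u + v) = word_degree u + word_degree v"
  by (simp add: word_degree_def)

lemma word_degree_star [simp]:
  fixes w :: "('i ck_gen + 'i ck_gen) word"
  shows "word_degree (word_star w) = - word_degree w"
proof -
  have "letter_degree (letter_star l) = - letter_degree l" for l :: "'i ck_gen + 'i ck_gen"
    by (cases l rule: letter_degree.cases) auto
  then have "sum_list (map letter_degree (rev (map letter_star ls))) = - sum_list (map letter_degree ls)"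
    for ls :: "('i ck_gen + 'i ck_gen) list"
    by (induction ls) simp_all
  then show ?thesis by (simp add: word_degree_def word_star_def)
qed

definition homog :: "int \<Rightarrow> 'i ck_gen free_alg \<Rightarrow> 'i ck_gen free_alg" where
  "homog d x = Poly_Mapping.mapp (\<lambda>w c. if word_degree w = d then c else 0) x"

lemma lookup_homog: "Poly_Mapping.lookup (homog d x) w = (if word_degree w = d then Poly_Mapping.lookup x w else 0)"
  by (auto simp: homog_def lookup_mapp when_def in_keys_iff)

lemma homog_mem [simp]: "x \<in> vcarrier (free_star G) \<Longrightarrow> homog d x \<in> vcarrier (free_star G)"
  unfolding mem_free_star by (auto simp: in_keys_iff lookup_homog split: if_splits)

lemma homog_keys: "w \<in> Poly_Mapping.keys (homog d x) \<Longrightarrow> word_degree w = d"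
  by (auto simp: in_keys_iff lookup_homog split: if_splits)

lemma sum_homog:
  assumes "\<And>w. w \<in> Poly_Mapping.keys x \<Longrightarrow> \<bar>word_degree w\<bar> \<le> int m"
  shows "(\<Sum>d\<in>{- int m..int m}. homog d x) = x"
proof (rule poly_mapping_eqI)
  fix w
  show "Poly_Mapping.lookup (\<Sum>d\<in>{- int m..int m}. homog d x) w = Poly_Mapping.lookup x w"
    using assms[of w] by (cases "w \<in> Poly_Mapping.keys x") (auto simp: lookup_sum lookup_homog in_keys_iff abs_le_iff)
qed

lemma iter_sq_degree:
  assumes "\<And>w. w \<in> Poly_Mapping.keys a \<Longrightarrow> \<bar>word_degree w\<bar> \<le> int m"
  shows "w \<in> Poly_Mapping.keys (iter_sq k a) \<Longrightarrow> \<bar>word_degree w\<bar> \<le> int (m * 2 ^ k)"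
proof (induction k arbitrary: w)
  case (Suc k)
  then obtain u v where "u \<in> Poly_Mapping.keys (iter_sq k a)" "v \<in> Poly_Mapping.keys (iter_sq k a)" "w = u + v"
    using keys_mult[of "iter_sq k a" "iter_sq k a"] by auto
  then show ?case using Suc.IH[of u] Suc.IH[of v] by simp
qed (use assms in simp)

context ck_orth
begin

lemma word_reduced:
  assumes "set ls \<subseteq> ck_gens I <+> ck_gens I" "ls \<noteq> []"
  shows "reduced (word_degree (Word ls)) (Poly_Mapping.single (Word ls) 1)"
proof -
  have step: "reduced (letter_degree l + d) (Poly_Mapping.single (Word [l]) 1 * x)"
    if "l \<in> ck_gens I <+> ck_gens I" "reduced d x" for l d x
    using that reduced_gen_left[of d x] reduced_star_gen_left[of d x] reduced_One_left[of d x] reduced_One_star_left[of d x]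
    by (auto simp: letter_cases ck_gens_def add.commute)
  \<comment> \<open>The extra factor \<open>gen One\<close> gives the empty word a normal form to
    start from; it is removed at the end.\<close>
  have "reduced (word_degree (Word ls)) (Poly_Mapping.single (Word ls) 1 * gen One)" if "set ls \<subseteq> ck_gens I <+> ck_gens I" for ls
    using that
  proof (induction ls)
    case Nil
    have "Poly_Mapping.single (Word []) 1 * gen One = (gen One :: 'i ck_gen free_alg)"
      by (simp add: zero_word_def[symmetric])
    then show ?case using reduced_One by (simp add: word_degree_def)
  next
    case (Cons l ls)
    have "Poly_Mapping.single (Word (l # ls)) (1 :: complex) * gen One
        = Poly_Mapping.single (Word [l]) 1 * (Poly_Mapping.single (Word ls) 1 * gen One)"
      unfolding single_Cons[of l ls] by (simp only: mult.assoc)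
    then show ?case using step[of l "word_degree (Word ls)"] Cons by (simp add: word_degree_def)
  qed
  moreover have "Poly_Mapping.single (Word ls) (1 :: complex) \<in> M"
    using assms by (auto simp: mem_free_star zero_word_def)
  ultimately show ?thesis using reduced_cg[OF _ cg_sym[OF One_right]] assms(1) by simp
qed

lemma reduced_zero_core:
  assumes "reduced 0 x"
  shows "\<exists>F n. finite F \<and> F \<subseteq> I \<and> core F n x"
  using assms
proof (rule reducedE)
  fix c \<mu> zs \<nu>
  assume *: "set \<mu> \<subseteq> I" "set zs \<subseteq> I" "set \<nu> \<subseteq> I" "int (length \<mu>) - int (length \<nu>) = 0"
    "x \<simeq> fscale c (lin_word \<mu> * iprods zs * fstar (lin_word \<nu>))"
  define F where "F = set \<mu> \<union> set zs \<union> set \<nu>"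
  have F: "finite F" "F \<subseteq> I" "set zs \<subseteq> F" using * by (auto simp: F_def)
  have "length \<mu> = length \<nu>" using * by simp
  then have "core F (length \<mu>) (lin_word \<mu> * iprods zs * fstar (lin_word \<nu>))" if "set \<mu> \<subseteq> F" "set \<nu> \<subseteq> F"
    using that
  proof (induction \<mu> \<nu> rule: list_induct2)
    case Nil
    have "iprods zs \<simeq> gen One * iprods zs" using *(2) by (intro cg_sym[OF One_left]) simp
    also have "gen One * iprods zs \<simeq> gen One * iprods zs * gen One"
      using *(2) by (intro cg_sym[OF One_right]) simp
    also have "gen One * iprods zs * gen One \<simeq> gen One * iprods zs * fstar (gen One)"
      using *(2) by (intro cg_mult_left cg_sym[OF One_star]) simp
    finally show ?case using core_cg[OF core_iprods[OF F(3)]] by simp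
  next
    case (Cons i \<mu> j \<nu>)
    then show ?case using core_step[of F "length \<mu>" "lin_word \<mu> * iprods zs * fstar (lin_word \<nu>)" i j]
      by (simp add: fstar_mult mult.assoc)
  qed
  then have "core F (length \<mu>) (fscale c (lin_word \<mu> * iprods zs * fstar (lin_word \<nu>)))"
    by (intro core_scale) (auto simp: F_def)
  then have "core F (length \<mu>) x" by (rule core_cg[OF _ cg_sym[OF *(5)]])
  then show ?thesis using F by blast
qed

text \<open>The subspaces increase with the index set and with the level, so finitely many words fit
  into one of them.\<close>

lemma degree_zero_core:
  assumes x: "x \<in> M" and deg: "\<And>w. w \<in> Poly_Mapping.keys x \<Longrightarrow> word_degree w = 0"
  shows "\<exists>F n. finite F \<and> F \<subseteq> I \<and> core F n x"
proof (rule sum_singles_induct[where P = "\<lambda>x. \<exists>F n. finite F \<and> F \<subseteq> I \<and> core F n x"])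
  show "\<exists>F n. finite F \<and> F \<subseteq> I \<and> core F n 0" using core_zero by blast
  fix w c assume w: "w \<in> Poly_Mapping.keys x"
  have "letters w \<noteq> []" "set (letters w) \<subseteq> ck_gens I <+> ck_gens I"
    using x w unfolding mem_free_star by (metis word.collapse zero_word_def, blast)
  from word_reduced[OF this(2,1)] have "reduced 0 (Poly_Mapping.single w 1)" using deg[OF w] by simp
  then obtain F n where "finite F" "F \<subseteq> I" "core F n (Poly_Mapping.single w 1)"
    using reduced_zero_core by blast
  then show "\<exists>F n. finite F \<and> F \<subseteq> I \<and> core F n (Poly_Mapping.single w c)"
    using core_scale[of F n "Poly_Mapping.single w 1" c] by auto
next
  fix x y assume "\<exists>F n. finite F \<and> F \<subseteq> I \<and> core F n x" "\<exists>F n. finite F \<and> F \<subseteq> I \<and> core F n y"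
  then obtain F n F' n' where "finite F" "F \<subseteq> I" "core F n x" "finite F'" "F' \<subseteq> I" "core F' n' y" by blast
  then show "\<exists>F n. finite F \<and> F \<subseteq> I \<and> core F n (x + y)"
    using core_add[OF core_mono_level[OF core_mono_set, of F n x "F \<union> F'" "max n n'"]
        core_mono_level[OF core_mono_set, of F' n' y "F \<union> F'" "max n n'"]]
    by (intro exI[of _ "F \<union> F'"] exI[of _ "max n n'"]) auto
qed

section \<open>Norm estimates for projections and corners\<close>

lemma iproj_norm: "i \<in> I \<Longrightarrow> N (iproj i) \<le> 1"
  using projection_norm[of "iproj i"] iproj_idem[of i] by auto

lemma One_minus_iproj_norm:
  assumes "i \<in> I"
  shows "N (gen One - iproj i) \<le> 1"
proof -
  have "(gen One - iproj i) * (gen One - iproj i)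
      = (gen One * gen One - iproj i * gen One) - (gen One * iproj i - iproj i * iproj i)"
    by (simp add: algebra_simps)
  also have "\<dots> \<simeq> (gen One - iproj i) - (iproj i - iproj i)"
    using assms by (intro cg_diff One_idem One_right One_left iproj_idem) auto
  finally have "(gen One - iproj i) * (gen One - iproj i) \<simeq> gen One - iproj i" by simp
  moreover have "fstar (gen One - iproj i) \<simeq> gen One - iproj i"
    using cg_diff[OF One_star cg_refl[of "iproj i"]] assms by (simp add: fstar_minus)
  ultimately show ?thesis using projection_norm by fastforce
qed

lemma EL_prod_norm:
  assumes "set xs \<subseteq> I" "set ys \<subseteq> I"
  shows "N (EL_prod xs ys) \<le> 1"
proof -
  have step: "N (a * b) \<le> 1" if "N a \<le> 1" "N b \<le> 1" "a \<in> M" "b \<in> M" for a b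
    using N_mult[OF that(3,4)] mult_mono[OF that(1,2)] N_nonneg[OF that(4)] by simp
  have "N (EL_prod [] ys) \<le> 1" using assms(2)
  proof (induction ys)
    case Nil then show ?case using generator_norm[of One] by simp
  next
    case (Cons y ys) then show ?case by (auto intro!: step One_minus_iproj_norm)
  qed
  then show ?thesis using assms(1)
  proof (induction xs)
    case (Cons x xs) then show ?case using assms(2) by (auto intro!: step iproj_norm)
  qed
qed

lemma resid_norm: "finite F \<Longrightarrow> F \<subseteq> I \<Longrightarrow> N (resid F) \<le> 1"
  unfolding resid_def by (rule One_residue_norm)

lemma iproj_resid_commute:
  assumes "finite F" "F \<subseteq> I" "i \<in> I"
  shows "iproj i * resid F \<simeq> resid F * iproj i"
proof -
  have "(\<Sum>j\<in>F. iproj i * rproj j) \<simeq> (\<Sum>j\<in>F. rproj j * iproj i)"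
    using assms by (intro cg_sum cg_trans[OF iproj_rproj cg_sym[OF rproj_iproj]]) auto
  then have "iproj i * (\<Sum>j\<in>F. rproj j) \<simeq> (\<Sum>j\<in>F. rproj j) * iproj i"
    by (simp add: sum_distrib_left sum_distrib_right)
  moreover have "iproj i * gen One \<simeq> gen One * iproj i"
    using assms by (intro cg_trans[OF One_right cg_sym[OF One_left]]) auto
  ultimately show ?thesis using cg_diff by (simp add: resid_def left_diff_distrib right_diff_distrib)
qed

lemma EL_prod_resid_commute:
  assumes F: "finite F" "F \<subseteq> I" and "set xs \<subseteq> I" "set ys \<subseteq> I"
  shows "EL_prod xs ys * resid F \<simeq> resid F * EL_prod xs ys"
proof -
  note r = resid_mem[OF F(2)]
  have step: "(a * b) * resid F \<simeq> resid F * (a * b)"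
    if "a * resid F \<simeq> resid F * a" "b * resid F \<simeq> resid F * b" "a \<in> M" "b \<in> M" for a b
  proof -
    have "a * (b * resid F) \<simeq> a * (resid F * b)" by (intro cg_mult_left that)
    also have "a * (resid F * b) \<simeq> (resid F * a) * b"
      unfolding mult.assoc[symmetric] by (intro cg_mult_right that)
    finally show ?thesis by (simp add: mult.assoc)
  qed
  have one: "gen One * resid F \<simeq> resid F * gen One"
    using r by (intro cg_trans[OF One_left cg_sym[OF One_right]])
  have "(gen One - iproj i) * resid F \<simeq> resid F * (gen One - iproj i)" if "i \<in> I" for i
    using cg_diff[OF one iproj_resid_commute[OF F that]] by (simp add: left_diff_distrib right_diff_distrib)
  then have "EL_prod [] ys * resid F \<simeq> resid F * EL_prod [] ys" using assms(4)
    by (induction ys) (auto simp del: mult.assoc intro!: step one)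
  then show ?thesis using assms(3)
    by (induction xs) (use assms(4) in \<open>auto intro!: step iproj_resid_commute F\<close>)
qed

text \<open>The unit is \<open>resid F\<close> plus the range projections in \<open>F\<close>. The
  corner of \<open>y\<close> from a range projection to \<open>resid F\<close> vanishes; the corners
  between two range projections are T_i (T_i* y T_j) T_j*, of norm at most that of the
  compression.\<close>

lemma core_norm_split:
  assumes F: "finite F" "F \<subseteq> I" and y: "y \<in> M" and core: "core F n y"
  shows "N y \<le> N (y * resid F) + (\<Sum>j\<in>F. \<Sum>i\<in>F. N (fstar (gen (T i)) * y * gen (T j)))"
proof -
  have split: "N u \<le> N (u * resid F) + (\<Sum>j\<in>F. N (u * rproj j))" if u: "u \<in> M" for u
  proof -
    have "u * gen One = u * resid F + (\<Sum>j\<in>F. u * rproj j)"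
      by (simp add: resid_def right_diff_distrib sum_distrib_left)
    then have "u \<simeq> u * resid F + (\<Sum>j\<in>F. u * rproj j)" using cg_sym[OF One_right[OF u]] by simp
    then have "N u = N (u * resid F + (\<Sum>j\<in>F. u * rproj j))" by (rule cg_N)
    also have "\<dots> \<le> N (u * resid F) + N (\<Sum>j\<in>F. u * rproj j)"
      using F u resid_mem[OF F(2)] by (intro N_add mult_mem sum_mem) auto
    also have "N (\<Sum>j\<in>F. u * rproj j) \<le> (\<Sum>j\<in>F. N (u * rproj j))"
      using F u
    proof (induction F)
      case (insert j F)
      have "(\<Sum>j\<in>F. u * rproj j) \<in> M" using insert by (intro sum_mem mult_mem) auto
      then show ?case using insert N_add[of "u * rproj j" "\<Sum>j\<in>F. u * rproj j"] by auto
    qed simp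
    finally show ?thesis by simp
  qed
  have "N (y * rproj j) \<le> (\<Sum>i\<in>F. N (fstar (gen (T i)) * y * gen (T j)))" if j: "j \<in> F" for j
  proof -
    have jI: "j \<in> I" using F j by auto
    have le_factor: "N (u * v) \<le> N u" if "u \<in> M" "v \<in> M" "N v \<le> 1" for u v
      using N_mult[OF that(1,2)] mult_left_mono[OF that(3) N_nonneg[OF that(1)]] by simp
    have "N (y * rproj j) \<le> N (y * gen (T j))"
      using le_factor[of "y * gen (T j)" "fstar (gen (T j))"] y jI generator_norm[of "T j"] N_star[of "gen (T j)"]
      by (simp add: rproj_def mult.assoc)
    \<comment> \<open>Passing to the adjoint lets the splitting on the right act on the
      left.\<close>
    also have "\<dots> = N (fstar (y * gen (T j)))" using y jI by (simp add: N_star)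
    also have "\<dots> \<le> N (fstar (y * gen (T j)) * resid F) + (\<Sum>i\<in>F. N (fstar (y * gen (T j)) * rproj i))"
      using y jI by (intro split) simp
    also have "N (fstar (y * gen (T j)) * resid F) = 0"
    proof -
      have "fstar (y * gen (T j)) * resid F \<simeq> fstar (y * gen (T j)) * fstar (resid F)"
        using y jI by (intro cg_mult_left cg_sym[OF resid_star] F) simp
      also have "fstar (y * gen (T j)) * fstar (resid F) \<simeq> fstar 0"
        unfolding fstar_mult[symmetric] by (intro cg_fstar resid_core_gen[OF F j core])
      finally show ?thesis by (simp add: cg_zero_iff)
    qed
    also have "0 + (\<Sum>i\<in>F. N (fstar (y * gen (T j)) * rproj i)) \<le> (\<Sum>i\<in>F. N (fstar (gen (T i)) * y * gen (T j)))"
      unfolding add_0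
    proof (rule sum_mono)
      fix i assume "i \<in> F"
      then have iI: "i \<in> I" using F by auto
      have "N (fstar (y * gen (T j)) * rproj i) = N (fstar (rproj i * (y * gen (T j))))"
        by (simp add: fstar_mult)
      also have "\<dots> = N (rproj i * (y * gen (T j)))" using y jI iI by (intro N_star) simp
      also have "\<dots> = N (gen (T i) * (fstar (gen (T i)) * y * gen (T j)))" by (simp add: rproj_def mult.assoc)
      also have "\<dots> \<le> N (gen (T i)) * N (fstar (gen (T i)) * y * gen (T j))"
        using y jI iI by (intro N_mult) auto
      also have "\<dots> \<le> 1 * N (fstar (gen (T i)) * y * gen (T j))"
        using y jI iI generator_norm[of "T i"] by (intro mult_right_mono N_nonneg) auto
      finally show "N (fstar (y * gen (T j)) * rproj i) \<le> N (fstar (gen (T i)) * y * gen (T j))" by simp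
    qed
    finally show ?thesis .
  qed
  then show ?thesis using split[OF y] sum_mono[of F "\<lambda>j. N (y * rproj j)"] by (meson add_left_mono order_trans)
qed

end

section \<open>The Exel-Laca relations determine the norm\<close>

lemma EL_coeff_zero_one:
  assumes "finite X" "finite Y" "\<And>x. x \<in> X \<union> Y \<Longrightarrow> A x j = 0 \<or> A x j = 1"
  shows "EL_coeff A X Y j = 0 \<or> EL_coeff A X Y j = 1"
proof -
  have prod01: "(\<Prod>x\<in>Z. f x) = 0 \<or> (\<Prod>x\<in>Z. f x) = (1 :: complex)"
    if "finite Z" "\<forall>x\<in>Z. f x = 0 \<or> f x = 1" for Z and f :: "'a \<Rightarrow> complex"
    using that by (induction Z) auto
  have "(\<Prod>x\<in>X. A x j) = 0 \<or> (\<Prod>x\<in>X. A x j) = 1" by (rule prod01) (use assms in auto)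
  moreover have "(\<Prod>y\<in>Y. 1 - A y j) = 0 \<or> (\<Prod>y\<in>Y. 1 - A y j) = 1" by (rule prod01) (use assms in auto)
  ultimately show ?thesis by (auto simp: EL_coeff_def)
qed

text \<open>\<open>N\<close> will be the seminorm pulled back from the Exel-Laca algebra and
  \<open>N2\<close> the universal one. Congruence refers to \<open>N\<close>; by
  \<open>dominated\<close> it preserves \<open>N2\<close> as well.\<close>

locale el_comparison = ck_orth I N A + second: free_seminorm "ck_gens I" N2
  for I :: "'i set" and N and A and N2 +
  assumes iproj_commute: "\<lbrakk>i \<in> I; j \<in> I\<rbrakk> \<Longrightarrow> N (iproj i * iproj j - iproj j * iproj i) = 0"
    and EL_relation: "\<lbrakk>set xs \<subseteq> I; set ys \<subseteq> I; distinct xs; distinct ys; distinct js;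
        set js = {j \<in> I. EL_coeff A (set xs) (set ys) j \<noteq> 0}\<rbrakk>
      \<Longrightarrow> N (EL_prod xs ys - (\<Sum>j\<in>set js. fscale (EL_coeff A (set xs) (set ys) j) (rproj j))) = 0"
    and dominated: "x \<in> vcarrier (free_star (ck_gens I)) \<Longrightarrow> N2 x \<le> N x"
    and rproj_nonzero: "j \<in> I \<Longrightarrow> N2 (rproj j) \<noteq> 0"
    and gauge: "x \<in> vcarrier (free_star (ck_gens I)) \<Longrightarrow> N2 (homog d x) \<le> N2 x"
begin

lemma N2_cg: "x \<simeq> y \<Longrightarrow> N2 x = N2 y"
proof -
  assume "x \<simeq> y"
  then have xy: "x \<in> M" "y \<in> M" "N (x - y) = 0" by (simp_all add: cg_def)
  then have "N2 (x - y) = 0" using dominated[of "x - y"] second.N_nonneg[of "x - y"] by simp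
  then show "N2 x = N2 y" using second.cg_N xy by (simp add: second.cg_def)
qed

lemma N2_mult_le: "\<lbrakk>x \<in> M; y \<in> M; N y \<le> 1\<rbrakk> \<Longrightarrow> N2 (x * y) \<le> N2 x"
proof -
  assume xy: "x \<in> M" "y \<in> M" "N y \<le> 1"
  then have "N2 x * N2 y \<le> N2 x * 1"
    using dominated[OF xy(2)] by (intro mult_left_mono second.N_nonneg) auto
  then show ?thesis using second.N_mult[OF xy(1,2)] by simp
qed

lemma iproj_cg_commute: "\<lbrakk>i \<in> I; j \<in> I\<rbrakk> \<Longrightarrow> iproj i * iproj j \<simeq> iproj j * iproj i"
  using iproj_commute by (simp add: cg_def)

section \<open>Products of initial projections and their complements\<close>

lemma iproj_minus_commute:
  assumes "i \<in> I" "j \<in> I"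
  shows "iproj i * (gen One - iproj j) \<simeq> (gen One - iproj j) * iproj i"
proof -
  have "iproj i * gen One \<simeq> gen One * iproj i"
    using assms by (intro cg_trans[OF One_right cg_sym[OF One_left]]) auto
  from cg_diff[OF this iproj_cg_commute[OF assms]] show ?thesis
    by (simp add: left_diff_distrib right_diff_distrib)
qed

lemma move_left:
  assumes "x * a \<simeq> a * x" "e \<in> M"
  shows "x * (a * e) \<simeq> a * (x * e)"
  using cg_mult_right[OF assms] by (simp add: mult.assoc)

lemma iproj_EL_prod_in:
  assumes "set xs \<subseteq> I" "set ys \<subseteq> I" "z \<in> set xs"
  shows "iproj z * EL_prod xs ys \<simeq> EL_prod xs ys"
  using assms(1,3)
proof (induction xs)
  case (Cons x xs)
  then have mem: "x \<in> I" "set xs \<subseteq> I" "z \<in> I" by auto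
  show ?case
  proof (cases "z = x")
    case True
    then show ?thesis using cg_mult_right[OF iproj_idem[OF mem(1)], of "EL_prod xs ys"] mem assms(2)
      by (simp add: mult.assoc)
  next
    case False
    have "iproj z * (iproj x * EL_prod xs ys) \<simeq> iproj x * (iproj z * EL_prod xs ys)"
      using mem assms(2) by (intro move_left iproj_cg_commute) auto
    also have "iproj x * (iproj z * EL_prod xs ys) \<simeq> iproj x * EL_prod xs ys"
      using mem Cons False by (intro cg_mult_left Cons.IH) auto
    finally show ?thesis by simp
  qed
qed simp

lemma iproj_EL_prod_out:
  assumes "set xs \<subseteq> I" "set ys \<subseteq> I" "z \<in> set ys"
  shows "iproj z * EL_prod xs ys \<simeq> 0"
proof -
  have z: "z \<in> I" using assms by auto
  have "iproj z * EL_prod [] ys \<simeq> 0" using assms(2,3)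
  proof (induction ys)
    case (Cons y ys)
    then have mem: "y \<in> I" "set ys \<subseteq> I" by auto
    show ?case
    proof (cases "z = y")
      case True
      have "iproj y * (gen One - iproj y) \<simeq> iproj y - iproj y"
        unfolding right_diff_distrib using mem by (intro cg_diff One_right iproj_idem) auto
      from cg_mult_right[OF this, of "EL_prod [] ys"] show ?thesis using True mem by (simp add: mult.assoc)
    next
      case False
      have "iproj z * ((gen One - iproj y) * EL_prod [] ys) \<simeq> (gen One - iproj y) * (iproj z * EL_prod [] ys)"
        using mem z by (intro move_left iproj_minus_commute) auto
      also have "(gen One - iproj y) * (iproj z * EL_prod [] ys) \<simeq> (gen One - iproj y) * 0"
        using mem Cons False by (intro cg_mult_left Cons.IH) auto
      finally show ?thesis by simp
    qed
  qed simp
  then show ?thesis using assms(1)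
  proof (induction xs)
    case (Cons x xs)
    then have mem: "x \<in> I" "set xs \<subseteq> I" by auto
    have "iproj z * (iproj x * EL_prod xs ys) \<simeq> iproj x * (iproj z * EL_prod xs ys)"
      using mem z assms(2) by (intro move_left iproj_cg_commute) auto
    also have "iproj x * (iproj z * EL_prod xs ys) \<simeq> iproj x * 0"
      using mem Cons by (intro cg_mult_left Cons.IH) auto
    finally show ?case by simp
  qed simp
qed

lemma EL_prod_cons_right:
  assumes "set xs \<subseteq> I" "set ys \<subseteq> I" "g \<in> I"
  shows "EL_prod xs (g # ys) \<simeq> (gen One - iproj g) * EL_prod xs ys"
  using assms(1)
proof (induction xs)
  case (Cons x xs)
  then have mem: "x \<in> I" "set xs \<subseteq> I" by auto
  have "iproj x * EL_prod xs (g # ys) \<simeq> iproj x * ((gen One - iproj g) * EL_prod xs ys)"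
    using mem Cons by (intro cg_mult_left Cons.IH) auto
  also have "iproj x * ((gen One - iproj g) * EL_prod xs ys) \<simeq> (gen One - iproj g) * (iproj x * EL_prod xs ys)"
    using mem assms by (intro move_left iproj_minus_commute) auto
  finally show ?case by simp
qed (use assms in simp)

text \<open>A product that decides every index of \<open>F\<close> is an atom: an initial projection
  with index in \<open>F\<close> acts on it as 1 or 0, hence every level-zero element acts as a
  scalar.\<close>

lemma core_zero_EL_prod:
  assumes F: "F \<subseteq> I" and xs: "set xs \<subseteq> I" and ys: "set ys \<subseteq> I" and sub: "F \<subseteq> set xs \<union> set ys"
  shows "core F 0 y \<Longrightarrow> \<exists>c. y * EL_prod xs ys \<simeq> fscale c (EL_prod xs ys)"
proof (induction "0 :: nat" y rule: core.induct)
  case (core_iprods zs)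
  then show ?case
  proof (induction zs)
    case Nil
    show ?case using One_left[of "EL_prod xs ys"] xs ys by (intro exI[of _ 1]) simp
  next
    case (Cons z zs)
    then obtain c where c: "iprods zs * EL_prod xs ys \<simeq> fscale c (EL_prod xs ys)" by auto
    have z: "z \<in> I" "z \<in> set xs \<or> z \<in> set ys" using Cons.prems F sub by auto
    have "iproj z * EL_prod xs ys \<simeq> fscale (if z \<in> set xs then 1 else 0) (EL_prod xs ys)"
      using iproj_EL_prod_in[OF xs ys, of z] iproj_EL_prod_out[OF xs ys, of z] z by auto
    from cg_fscale[OF this, of c]
    have "fscale c (iproj z * EL_prod xs ys) \<simeq> fscale (c * (if z \<in> set xs then 1 else 0)) (EL_prod xs ys)"
      by (simp only: fscale_fscale)
    moreover have "iprods (z # zs) * EL_prod xs ys \<simeq> fscale c (iproj z * EL_prod xs ys)"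
      using cg_mult_left[OF c, of "iproj z"] z by (simp add: fscale_mult_right mult.assoc)
    ultimately show ?case using cg_trans by blast
  qed
next
  case (core_add x y)
  then obtain c d where "x * EL_prod xs ys \<simeq> fscale c (EL_prod xs ys)" "y * EL_prod xs ys \<simeq> fscale d (EL_prod xs ys)"
    by blast
  from cg_add[OF this] show ?case by (intro exI[of _ "c + d"]) (simp add: distrib_right fscale_add_left)
next
  case (core_scale x d)
  then obtain c where "x * EL_prod xs ys \<simeq> fscale c (EL_prod xs ys)" by blast
  from cg_fscale[OF this, of d] show ?case by (intro exI[of _ "d * c"]) (simp add: fscale_mult_left)
next
  case (core_cg x y)
  then obtain c where c: "x * EL_prod xs ys \<simeq> fscale c (EL_prod xs ys)" by blast
  have "y * EL_prod xs ys \<simeq> x * EL_prod xs ys"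
    using xs ys by (intro cg_mult_right cg_sym[OF core_cg.hyps(3)]) auto
  from cg_trans[OF this c] show ?case by blast
qed

text \<open>The only use of (EL4): a product of initial projections and their complements, cut down by the
  complement of finitely many range projections, either vanishes or dominates a range projection.\<close>

lemma EL_prod_resid_le:
  assumes G: "finite G" "G \<subseteq> I" and xs: "set xs \<subseteq> I" "distinct xs" and ys: "set ys \<subseteq> I" "distinct ys"
  shows "N (EL_prod xs ys * resid G) \<le> N2 (EL_prod xs ys * resid G)"
proof -
  let ?E = "EL_prod xs ys"
  define J where "J = {j \<in> I. EL_coeff A (set xs) (set ys) j \<noteq> 0}"
  have E: "?E \<in> M" and r: "resid G \<in> M" using xs ys resid_mem[OF G(2)] by auto
  show ?thesis
  proof (cases "J \<subseteq> G")
    \<comment> \<open>(EL4) rewrites the product as a finite sum of range projections, and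
      \<open>resid G\<close> annihilates each of them.\<close>
    case True
    then have "finite J" using G finite_subset by blast
    then obtain js where js: "set js = J" "distinct js" using finite_distinct_list by blast
    have JI: "J \<subseteq> I" by (auto simp: J_def)
    have S: "(\<Sum>j\<in>J. fscale (EL_coeff A (set xs) (set ys) j) (rproj j)) \<in> M"
      using JI by (intro sum_mem fscale_mem rproj_mem) auto
    have "?E \<simeq> (\<Sum>j\<in>J. fscale (EL_coeff A (set xs) (set ys) j) (rproj j))"
      using EL_relation[OF xs(1) ys(1) xs(2) ys(2) js(2)] js(1) E S by (simp add: J_def cg_def)
    from cg_mult_right[OF this r]
    have "?E * resid G \<simeq> (\<Sum>j\<in>J. fscale (EL_coeff A (set xs) (set ys) j) (rproj j * resid G))"
      by (simp add: sum_distrib_right fscale_mult_left)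
    also have "(\<Sum>j\<in>J. fscale (EL_coeff A (set xs) (set ys) j) (rproj j * resid G))
        \<simeq> (\<Sum>j\<in>J. fscale (EL_coeff A (set xs) (set ys) j) 0)"
      using True G by (intro cg_sum cg_fscale rproj_resid) auto
    finally have "?E * resid G \<simeq> 0" by simp
    then have "N (?E * resid G) = 0" by (simp add: cg_zero_iff)
    then show ?thesis using second.N_nonneg[of "?E * resid G"] E r by simp
  next
    \<comment> \<open>The product cut down by \<open>resid G\<close> fixes the j-th range
      projection, which is not null for \<open>N2\<close>. So its \<open>N2\<close>-norm is at least
      1, whereas its \<open>N\<close>-norm is at most 1.\<close>
    case False
    then obtain j where j: "j \<in> I" "j \<notin> G" "EL_coeff A (set xs) (set ys) j \<noteq> 0" by (auto simp: J_def)
    have "EL_coeff A (set xs) (set ys) j = 0 \<or> EL_coeff A (set xs) (set ys) j = 1"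
      by (rule EL_coeff_zero_one) (use xs ys j zero_one in auto)
    with j have c: "EL_coeff A (set xs) (set ys) j = 1" by simp
    have "?E * resid G * rproj j \<simeq> ?E * rproj j"
      unfolding mult.assoc using E by (intro cg_mult_left resid_rproj_notin G j)
    also have "?E * rproj j \<simeq> rproj j"
      using prod_rproj[OF xs(1) ys(1) xs(2) ys(2) j(1)] c by (simp add: EL_prod_def)
    finally have "N2 (rproj j) \<le> N2 (?E * resid G) * N2 (rproj j)"
      using second.N_mult[of "?E * resid G" "rproj j"] E r j N2_cg by fastforce
    moreover have "N2 (rproj j) > 0"
      using rproj_nonzero[OF j(1)] second.N_nonneg[of "rproj j"] j(1) by simp
    ultimately have "1 \<le> N2 (?E * resid G)" by simp
    moreover have "N (?E * resid G) \<le> 1"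
      using N_mult[OF E r] mult_mono[OF EL_prod_norm[OF xs(1) ys(1)] resid_norm[OF G]] N_nonneg[OF r] by simp
    ultimately show ?thesis by simp
  qed
qed

text \<open>Each undecided index g splits the unit as q_g + (1 - q_g), which doubles the number of
  terms. Once all of \<open>F\<close> is decided, \<open>y\<close> acts as a scalar c, and both
  seminorms carry the same factor |c|. Moving the product past \<open>resid G\<close> bounds the
  \<open>N2\<close>-norm of each term by that of \<open>y * resid G\<close>.\<close>

lemma core_zero_split_bound:
  assumes F: "F \<subseteq> I" and G: "finite G" "G \<subseteq> I" and y: "core F 0 y"
  shows "\<lbrakk>set gs \<union> set xs \<union> set ys = F; distinct gs; distinct xs; distinct ys;
      set gs \<inter> (set xs \<union> set ys) = {}\<rbrakk>
    \<Longrightarrow> N (y * (EL_prod xs ys * resid G)) \<le> 2 ^ length gs * N2 (y * resid G)"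
proof (induction gs arbitrary: xs ys)
  case Nil
  note r = resid_mem[OF G(2)] and ym = core_mem[OF F y]
  let ?E = "EL_prod xs ys"
  have sub: "set xs \<subseteq> I" "set ys \<subseteq> I" using Nil F by auto
  then have E: "?E \<in> M" by simp
  obtain c where "y * ?E \<simeq> fscale c ?E"
    using core_zero_EL_prod[OF F sub _ y] Nil.prems(1) by auto
  from cg_mult_right[OF this r] have c: "y * (?E * resid G) \<simeq> fscale c (?E * resid G)"
    by (simp add: mult.assoc fscale_mult_left)
  have "N (y * (?E * resid G)) = cmod c * N (?E * resid G)"
    using cg_N[OF c] N_scale[of "?E * resid G" c] E r by simp
  also have "\<dots> \<le> cmod c * N2 (?E * resid G)"
    using sub Nil.prems by (intro mult_left_mono EL_prod_resid_le G) auto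
  also have "\<dots> = N2 (y * (?E * resid G))"
    using N2_cg[OF c] second.N_scale[of "?E * resid G" c] E r by simp
  also have "\<dots> = N2 (y * (resid G * ?E))"
    by (intro N2_cg cg_mult_left EL_prod_resid_commute G sub ym)
  also have "\<dots> \<le> N2 (y * resid G)"
    unfolding mult.assoc[symmetric] using ym r E EL_prod_norm[OF sub] by (intro N2_mult_le) auto
  finally show ?case by simp
next
  case (Cons g gs)
  note r = resid_mem[OF G(2)] and ym = core_mem[OF F y]
  let ?E = "EL_prod xs ys"
  have sub: "set xs \<subseteq> I" "set ys \<subseteq> I" "g \<in> I" using Cons.prems F by auto
  then have E: "?E \<in> M" by simp
  have "?E \<simeq> gen One * ?E" by (rule cg_sym[OF One_left[OF E]])
  also have "gen One * ?E = iproj g * ?E + (gen One - iproj g) * ?E" by (simp add: algebra_simps)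
  also have "\<dots> \<simeq> EL_prod (g # xs) ys + EL_prod xs (g # ys)"
    using sub by (intro cg_add cg_sym[OF EL_prod_cons_right]) auto
  finally have e: "?E \<simeq> EL_prod (g # xs) ys + EL_prod xs (g # ys)" .
  have "y * (?E * resid G) \<simeq> y * ((EL_prod (g # xs) ys + EL_prod xs (g # ys)) * resid G)"
    by (intro cg_mult_left cg_mult_right e r ym)
  then have "N (y * (?E * resid G)) = N (y * (EL_prod (g # xs) ys * resid G) + y * (EL_prod xs (g # ys) * resid G))"
    using cg_N by (simp only: distrib_left distrib_right)
  also have "\<dots> \<le> N (y * (EL_prod (g # xs) ys * resid G)) + N (y * (EL_prod xs (g # ys) * resid G))"
    using sub r ym by (intro N_add mult_mem EL_prod_mem) auto
  also have "\<dots> \<le> 2 ^ length gs * N2 (y * resid G) + 2 ^ length gs * N2 (y * resid G)"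
    using Cons.prems by (intro add_mono Cons.IH) auto
  finally show ?case by (simp add: mult_ac)
qed

lemma core_zero_bound:
  assumes F: "finite F" "F \<subseteq> I" and G: "finite G" "G \<subseteq> I" and y: "core F 0 y"
  shows "N (y * resid G) \<le> 2 ^ card F * N2 (y * resid G)"
proof -
  obtain gs where gs: "set gs = F" "distinct gs" using finite_distinct_list[OF F(1)] by blast
  have "N (y * resid G) = N (y * (gen One * resid G))"
    by (intro cg_N cg_mult_left cg_sym[OF One_left] resid_mem G core_mem[OF F(2) y])
  also have "\<dots> \<le> 2 ^ length gs * N2 (y * resid G)"
    using core_zero_split_bound[OF F(2) G y, of gs "[]" "[]"] gs by simp
  finally show ?thesis using gs distinct_card[of gs] by simp
qed

text \<open>The constant depends on \<open>F\<close> and \<open>n\<close> but not on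
  \<open>y\<close>. Level zero costs 2^|F|; each further level adds the |F|^2 compressions, bounded
  with the constant of the level below.\<close>

lemma core_bound:
  assumes F: "finite F" "F \<subseteq> I"
  shows "\<exists>K\<ge>0. \<forall>y. core F n y \<longrightarrow> N y \<le> K * N2 y"
proof (induction n)
  case 0
  have "N y \<le> 2 ^ card F * N2 y" if y: "core F 0 y" for y
  proof -
    note ym = core_mem[OF F(2) y]
    \<comment> \<open>For the empty set the residue is \<open>gen One\<close>, so the cut-down is
      vacuous.\<close>
    have e: "y * resid {} \<simeq> y" using One_right[OF ym] by (simp add: resid_def)
    show ?thesis using core_zero_bound[OF F _ _ y, of "{}"] cg_N[OF e] N2_cg[OF e] by simp
  qed
  then show ?case by (intro exI[of _ "2 ^ card F"]) simp
next
  case (Suc n)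
  then obtain K where K: "K \<ge> 0" "\<forall>y. core F n y \<longrightarrow> N y \<le> K * N2 y" by (elim exE conjE)
  have "N y \<le> (2 ^ card F + real (card F) * (real (card F) * K)) * N2 y" if y: "core F (Suc n) y" for y
  proof -
    note ym = core_mem[OF F(2) y] and r = resid_mem[OF F(2)]
    obtain y0 where y0: "core F 0 y0" "y * resid F \<simeq> y0 * resid F" using core_compress_resid[OF F y] by blast
    have "N (y * resid F) = N (y0 * resid F)" by (rule cg_N[OF y0(2)])
    also have "\<dots> \<le> 2 ^ card F * N2 (y0 * resid F)" by (rule core_zero_bound[OF F F y0(1)])
    also have "N2 (y0 * resid F) = N2 (y * resid F)" by (rule N2_cg[OF y0(2), symmetric])
    also have "2 ^ card F * N2 (y * resid F) \<le> 2 ^ card F * N2 y"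
      using N2_mult_le[OF ym r resid_norm[OF F]] by (intro mult_left_mono) auto
    finally have 1: "N (y * resid F) \<le> 2 ^ card F * N2 y" .
    have 2: "N (fstar (gen (T i)) * y * gen (T j)) \<le> K * N2 y" if ij: "i \<in> F" "j \<in> F" for i j
    proof -
      have mem: "i \<in> I" "j \<in> I" using ij F by auto
      have "N (fstar (gen (T i)) * y * gen (T j)) \<le> K * N2 (fstar (gen (T i)) * y * gen (T j))"
        using K(2) core_compress[OF F(2) ij y] by blast
      also have "N2 (fstar (gen (T i)) * y * gen (T j)) \<le> N2 (fstar (gen (T i)) * y)"
        using mem ym generator_norm[of "T j"] by (intro N2_mult_le) auto
      also have "\<dots> = N2 (fstar y * gen (T i))"
        using second.N_star[of "fstar (gen (T i)) * y"] mem ym by (simp add: fstar_mult)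
      also have "\<dots> \<le> N2 (fstar y)"
        using mem ym generator_norm[of "T i"] by (intro N2_mult_le) auto
      also have "\<dots> = N2 y" by (rule second.N_star[OF ym])
      finally show ?thesis using K(1) by (simp add: mult_left_mono)
    qed
    have "N y \<le> N (y * resid F) + (\<Sum>j\<in>F. \<Sum>i\<in>F. N (fstar (gen (T i)) * y * gen (T j)))"
      by (rule core_norm_split[OF F ym y])
    also have "\<dots> \<le> 2 ^ card F * N2 y + (\<Sum>j\<in>F. \<Sum>i\<in>F. K * N2 y)"
      using 1 2 by (intro add_mono sum_mono) auto
    also have "\<dots> = (2 ^ card F + real (card F) * (real (card F) * K)) * N2 y"
      by (simp add: algebra_simps)
    finally show ?thesis .
  qed
  then show ?case using K(1) by (intro exI[of _ "2 ^ card F + real (card F) * (real (card F) * K)"]) simp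
qed

section \<open>Removing the constant by taking powers\<close>

lemma self_adjoint_le:
  assumes a: "a \<in> M" "fstar a = a" and c: "0 \<le> c" and d: "0 \<le> d"
    and bound: "\<And>k. N (iter_sq k a) \<le> (c * 2 ^ k + d) * N2 (iter_sq k a)"
  shows "N a \<le> N2 a"
  by (rule dominated_powers_imp_le[OF N_nonneg[OF a(1)] second.N_nonneg[OF a(1)] c d])
    (use bound in \<open>simp add: N_iter_sq[OF a] second.N_iter_sq[OF a]\<close>)

lemma le_from_square:
  assumes y: "y \<in> M" and le: "N (fstar y * y) \<le> N2 (fstar y * y)"
  shows "N y \<le> N2 y"
proof (rule power2_le_imp_le)
  show "(N y)\<^sup>2 \<le> (N2 y)\<^sup>2" using le unfolding N_cstar[OF y] second.N_cstar[OF y] .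
qed (rule second.N_nonneg[OF y])

text \<open>The powers of y*y stay in the same subspace, because it is closed under products; hence
  one constant serves all of them.\<close>

lemma core_le:
  assumes F: "finite F" "F \<subseteq> I" and y: "core F n y"
  shows "N y \<le> N2 y"
proof (rule le_from_square[OF core_mem[OF F(2) y]])
  have a: "core F n (fstar y * y)" by (rule core_mult[OF F(2) core_star[OF F(2) y] y])
  obtain K where K: "K \<ge> 0" "\<forall>y. core F n y \<longrightarrow> N y \<le> K * N2 y"
    using core_bound[OF F, of n] by (elim exE conjE)
  show "N (fstar y * y) \<le> N2 (fstar y * y)"
  proof (rule self_adjoint_le[of _ 0 K])
    show "N (iter_sq k (fstar y * y)) \<le> (0 * 2 ^ k + K) * N2 (iter_sq k (fstar y * y))" for k
      using K(2) core_iter_sq[OF F(2) a] by simp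
  qed (use K(1) core_mem[OF F(2) a] in \<open>simp_all add: fstar_mult\<close>)
qed

text \<open>The only use of gauge invariance, and of the smaller seminorm alone; the Exel-Laca side
  contributes the C*-identity and \<open>core_le\<close>.\<close>

lemma homog_le:
  assumes x: "x \<in> M"
  shows "N (homog d x) \<le> N2 x"
proof -
  have h: "homog d x \<in> M" using x by simp
  have "N (homog d x) \<le> N2 (homog d x)"
  proof (rule le_from_square[OF h])
    have "word_degree w = 0" if w: "w \<in> Poly_Mapping.keys (fstar (homog d x) * homog d x)" for w
    proof -
      obtain u v where "u \<in> Poly_Mapping.keys (fstar (homog d x))" "v \<in> Poly_Mapping.keys (homog d x)" "w = u + v"
        using subsetD[OF keys_mult w] by blast
      then show ?thesis by (auto simp: keys_fstar dest!: homog_keys)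
    qed
    then obtain F n where "finite F" "F \<subseteq> I" "core F n (fstar (homog d x) * homog d x)"
      using degree_zero_core[of "fstar (homog d x) * homog d x"] h by auto
    then show "N (fstar (homog d x) * homog d x) \<le> N2 (fstar (homog d x) * homog d x)" by (rule core_le)
  qed
  then show ?thesis using gauge[OF x, of d] by simp
qed

theorem comparison_le:
  assumes x: "x \<in> M"
  shows "N x \<le> N2 x"
proof (rule le_from_square[OF x])
  let ?a = "fstar x * x"
  have a: "?a \<in> M" using x by simp
  have "finite ((\<lambda>w. nat \<bar>word_degree w\<bar>) ` Poly_Mapping.keys ?a)" by simp
  then obtain m where m: "\<forall>k \<in> (\<lambda>w. nat \<bar>word_degree w\<bar>) ` Poly_Mapping.keys ?a. k \<le> m"
    using finite_nat_set_iff_bounded_le by blast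
  then have deg: "\<bar>word_degree w\<bar> \<le> int m" if "w \<in> Poly_Mapping.keys ?a" for w using that by force
  have sum_le: "N (\<Sum>d\<in>D. homog d z) \<le> (\<Sum>d\<in>D. N (homog d z))" if "finite D" "z \<in> M" for D z
    using that
  proof (induction D)
    case (insert d D)
    then show ?case using N_add[of "homog d z" "\<Sum>d\<in>D. homog d z"] by simp
  qed simp
  show "N ?a \<le> N2 ?a"
  \<comment> \<open>The degrees in the 2^k-th power lie between -m 2^k and m 2^k, so there are 2 m
    2^k + 1 homogeneous components.\<close>
  proof (rule self_adjoint_le[of _ "2 * real m" 1])
    fix k
    let ?z = "iter_sq k ?a" and ?m = "m * 2 ^ k"
    have z: "?z \<in> M" by (rule iter_sq_mem[OF a])
    have "N ?z = N (\<Sum>d\<in>{- int ?m..int ?m}. homog d ?z)"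
      by (subst sum_homog) (use iter_sq_degree[OF deg] in auto)
    also have "\<dots> \<le> (\<Sum>d\<in>{- int ?m..int ?m}. N (homog d ?z))" by (rule sum_le[OF _ z]) simp
    also have "\<dots> \<le> (\<Sum>d\<in>{- int ?m..int ?m}. N2 ?z)" by (intro sum_mono homog_le z)
    also have "\<dots> = (2 * real m * 2 ^ k + 1) * N2 ?z" by (simp add: nat_add_distrib nat_mult_distrib)
    finally show "N ?z \<le> (2 * real m * 2 ^ k + 1) * N2 ?z" .
  qed (use a in \<open>simp_all add: fstar_mult\<close>)
qed

end

section \<open>Gauge invariance of the universal seminorm\<close>

text \<open>The gauge automorphism that multiplies each T_i by \<open>cis t\<close>, given on
  coefficients through the degree so that linearity is immediate.\<close>

definition twist :: "real \<Rightarrow> 'i ck_gen free_alg \<Rightarrow> 'i ck_gen free_alg" where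
  "twist t x = Poly_Mapping.mapp (\<lambda>w c. cis (of_int (word_degree w) * t) * c) x"

lemma lookup_twist: "Poly_Mapping.lookup (twist t x) w = cis (of_int (word_degree w) * t) * Poly_Mapping.lookup x w"
  by (auto simp: twist_def lookup_mapp when_def in_keys_iff)

lemma twist_single: "twist t (Poly_Mapping.single w c) = Poly_Mapping.single w (cis (of_int (word_degree w) * t) * c)"
  by (rule poly_mapping_eqI) (auto simp: lookup_twist lookup_single when_def)

lemma twist_add: "twist t (x + y) = twist t x + twist t y"
  by (rule poly_mapping_eqI) (simp add: lookup_twist lookup_add distrib_left)

lemma twist_diff: "twist t (x - y) = twist t x - twist t y"
  by (rule poly_mapping_eqI) (simp add: lookup_twist lookup_minus right_diff_distrib)

lemma twist_zero [simp]: "twist t 0 = 0"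
  by (rule poly_mapping_eqI) (simp add: lookup_twist)

lemma twist_fscale: "twist t (fscale c x) = fscale c (twist t x)"
  by (rule poly_mapping_eqI) (simp add: lookup_twist lookup_fscale)

lemma twist_sum: "twist t (sum f X) = (\<Sum>i\<in>X. twist t (f i))"
  by (induction X rule: infinite_finite_induct) (simp_all add: twist_add)

lemma twist_mult: "twist t (x * y) = twist t x * twist t y"
proof (induction x rule: sum_singles_induct)
  case (2 w c)
  show ?case
  proof (induction y rule: sum_singles_induct)
    case (2 v d)
    have "cis (of_int (word_degree w + word_degree v) * t)
        = cis (of_int (word_degree w) * t) * cis (of_int (word_degree v) * t)"
      by (simp add: cis_mult distrib_right)
    then show ?case by (simp only: mult_single twist_single word_degree_add) (simp add: mult_ac)
  qed (simp_all add: twist_add distrib_left)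
qed (simp_all add: twist_add distrib_right)

lemma twist_fstar: "twist t (fstar x) = fstar (twist t x)"
  by (rule poly_mapping_eqI) (simp add: lookup_twist lookup_fstar cis_cnj)

lemma twist_gen [simp]: "twist t (gen (T i)) = fscale (cis t) (gen (T i))" "twist t (gen One) = gen One"
  by (simp_all add: gen_def twist_single word_degree_def)

lemma twist_rproj [simp]: "twist t (rproj i) = rproj i"
  and twist_iproj [simp]: "twist t (iproj i) = iproj i"
  by (simp_all add: rproj_def iproj_def twist_mult twist_fstar fstar_fscale fscale_mult_left fscale_mult_right
      cis_cnj cis_mult)

lemma twist_mem [simp]: "x \<in> vcarrier (free_star G) \<Longrightarrow> twist t x \<in> vcarrier (free_star G)"
  unfolding mem_free_star by (auto simp: in_keys_iff lookup_twist)

text \<open>The elements in the norm relations are homogeneous of degree 0 or 1, so the twist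
  multiplies them by a number of modulus 1.\<close>

lemma twist_ck_RN:
  assumes "(x, \<eta>) \<in> ck_RN I"
  shows "\<exists>u. cmod u = 1 \<and> twist t x = fscale u x"
proof -
  have "twist t x = x \<or> twist t x = fscale (cis t) x"
    using assms by (auto simp: ck_RN_def eq_rel_def twist_diff twist_mult twist_fstar fstar_fscale
        fscale_mult_left fscale_mult_right fscale_minus_right cis_cnj cis_mult mult.assoc[symmetric])
  then show ?thesis
  proof
    assume "twist t x = x"
    then show ?thesis by (intro exI[of _ 1]) simp
  next
    assume "twist t x = fscale (cis t) x"
    then show ?thesis by (intro exI[of _ "cis t"]) simp
  qed
qed

text \<open>|e| < L keeps a nonzero e from being a multiple of L, so the summands are the powers of
  an L-th root of unity other than 1, and the geometric sum vanishes.\<close>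

lemma root_of_unity_sum:
  fixes e :: int and L :: nat
  assumes L: "\<bar>e\<bar> < int L"
  shows "(\<Sum>k<L. cis (of_int e * (2 * pi * real k / real L))) = (if e = 0 then of_nat L else 0)"
proof (cases "e = 0")
  case False
  define u where "u = cis (of_int e * (2 * pi / real L))"
  have L0: "real L > 0" using L by simp
  have u: "cis (of_int e * (2 * pi * real k / real L)) = u ^ k" for k
    unfolding u_def Complex.DeMoivre by (rule arg_cong[of _ _ cis]) (simp add: field_simps)
  have "u ^ L = cis (2 * pi * of_int e)"
    unfolding u_def Complex.DeMoivre by (rule arg_cong[of _ _ cis]) (use L0 in simp)
  then have uL: "u ^ L = 1" by (simp add: cis_multiple_2pi)
  have "u \<noteq> 1"
  proof
    assume "u = 1"
    then have "cos (of_int e * (2 * pi / real L)) = 1" by (simp add: u_def complex_eq_iff)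
    then obtain n :: int where "of_int e * (2 * pi / real L) = of_int n * 2 * pi"
      by (auto simp: cos_one_2pi_int)
    then have "real_of_int e = of_int n * real L" using L0 by (simp add: field_simps)
    then have e: "e = n * int L" by (metis of_int_eq_iff of_int_mult of_int_of_nat_eq)
    then have "n \<noteq> 0" using False by auto
    then have "int L \<le> \<bar>n\<bar> * int L" using mult_right_mono[of 1 "\<bar>n\<bar>" "int L"] by simp
    then show False using L e by (simp add: abs_mult)
  qed
  then have "(\<Sum>k<L. u ^ k) = 0" using uL by (simp add: geometric_sum)
  then show ?thesis using False unfolding u by simp
qed simp

text \<open>Finite Fourier inversion. A given element has finitely many degrees, so a large enough
  cyclic group replaces the integral over the circle.\<close>

lemma homog_average:
  assumes deg: "\<And>w. w \<in> Poly_Mapping.keys x \<Longrightarrow> \<bar>word_degree w - d\<bar> < int L" and L: "L > 0"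
  shows "homog d x = fscale (1 / of_nat L) (\<Sum>k<L. fscale (cis (- (of_int d * (2 * pi * real k / real L))))
    (twist (2 * pi * real k / real L) x))"
proof (rule poly_mapping_eqI)
  fix w
  let ?t = "\<lambda>k. 2 * pi * real k / real L"
  show "Poly_Mapping.lookup (homog d x) w = Poly_Mapping.lookup (fscale (1 / of_nat L)
      (\<Sum>k<L. fscale (cis (- (of_int d * ?t k))) (twist (?t k) x))) w"
  proof (cases "w \<in> Poly_Mapping.keys x")
    case True
    have "cis (- (of_int d * ?t k)) * (cis (of_int (word_degree w) * ?t k) * c)
        = cis (of_int (word_degree w - d) * ?t k) * c" for k c
    proof -
      have "cis (- (of_int d * ?t k)) * cis (of_int (word_degree w) * ?t k) = cis (of_int (word_degree w - d) * ?t k)"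
        unfolding cis_mult by (rule arg_cong[of _ _ cis]) (simp add: left_diff_distrib diff_divide_distrib)
      then show ?thesis by (simp add: mult.assoc[symmetric])
    qed
    then have "Poly_Mapping.lookup (fscale (1 / of_nat L) (\<Sum>k<L. fscale (cis (- (of_int d * ?t k))) (twist (?t k) x))) w
        = 1 / of_nat L * ((\<Sum>k<L. cis (of_int (word_degree w - d) * ?t k)) * Poly_Mapping.lookup x w)"
      by (simp only: lookup_fscale lookup_sum lookup_twist sum_distrib_right)
    also have "\<dots> = (if word_degree w = d then Poly_Mapping.lookup x w else 0)"
      unfolding root_of_unity_sum[OF deg[OF True]] using L by simp
    finally show ?thesis by (simp add: lookup_homog)
  next
    case False
    then have "Poly_Mapping.lookup x w = 0" by (simp add: in_keys_iff)
    then show ?thesis by (simp add: lookup_homog lookup_fscale lookup_sum lookup_twist)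
  qed
qed

context ck_universe
begin

text \<open>The nets in (CK1) and (CK2) are fixed by the twist since their members have degree
  zero.\<close>

lemma ckrep_twist:
  assumes rep: "ckrep H \<rho>"
  shows "ckrep H (\<lambda>x. \<rho> (twist t x))"
proof -
  note hom = free_hom_simps[OF representation_hom[OF rep]]
  have RN: "opnorm H (\<rho> (twist t x)) \<le> \<eta>" if r: "(x, \<eta>) \<in> ck_RN I" for x \<eta>
  proof -
    have x: "x \<in> M" using ck_generating_triple[of I A] r by (auto simp: generating_triple_def)
    obtain u where u: "cmod u = 1" "twist t x = fscale u x" using twist_ck_RN[OF r] by blast
    have "opnorm H (\<rho> (twist t x)) = opnorm H (\<rho> x)"
      using free_seminorm.N_scale[OF ckrep_free[OF rep] x, of u] u by simp
    then show ?thesis using rep r by (auto simp: representation_def)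
  qed
  have RS: "twist t (x k) = x k" if "(D, leq, x) \<in> ck_RS I A" for D leq x k
    using that by (auto simp: ck_RS_def fin_net_def rproj_def[symmetric] iproj_def[symmetric]
        twist_diff twist_sum twist_fscale)
  have SOT: "\<forall>(D, leq, x)\<in>ck_RS I A. \<forall>v\<in>vcarrier H. \<forall>e>0. \<exists>d\<in>D. \<forall>k\<in>D. leq d k \<longrightarrow> hnorm H (\<rho> (x k) v) < e"
    using rep by (simp add: representation_def)
  show ?thesis
    unfolding representation_def
  proof (intro conjI)
    show "star_hom (free_star (ck_gens I)) (bop_alg H) (\<lambda>x. \<rho> (twist t x))"
      unfolding star_hom_def free_star_simps
      by (intro conjI ballI allI funcsetI) (simp_all only: twist_add twist_fscale twist_mult twist_fstar hom twist_mem)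
    show "\<forall>(x, \<eta>)\<in>ck_RN I. opnorm H (\<rho> (twist t x)) \<le> \<eta>" using RN by blast
    show "\<forall>(D, leq, x)\<in>ck_RS I A. \<forall>v\<in>vcarrier H. \<forall>e>0. \<exists>d\<in>D. \<forall>k\<in>D. leq d k \<longrightarrow> hnorm H (\<rho> (twist t (x k)) v) < e"
    proof (intro ballI)
      fix p assume p: "p \<in> ck_RS I A"
      obtain D leq x where px: "p = (D, leq, x)" by (cases p)
      show "case p of (D, leq, x) \<Rightarrow> \<forall>v\<in>vcarrier H. \<forall>e>0. \<exists>d\<in>D. \<forall>k\<in>D. leq d k \<longrightarrow> hnorm H (\<rho> (twist t (x k)) v) < e"
        using bspec[OF SOT p] RS[OF p[unfolded px]] by (simp add: px)
    qed
  qed (rule representation_hilbert[OF rep])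
qed

lemma N_twist: "x \<in> M \<Longrightarrow> N (twist t x) \<le> N x"
  by (rule N_least) (rule N_upper[OF ckrep_twist])

lemma N_homog:
  assumes x: "x \<in> M"
  shows "N (homog d x) \<le> N x"
proof -
  have "finite ((\<lambda>w. nat \<bar>word_degree w - d\<bar>) ` Poly_Mapping.keys x)" by simp
  then obtain m where m: "\<forall>k \<in> (\<lambda>w. nat \<bar>word_degree w - d\<bar>) ` Poly_Mapping.keys x. k \<le> m"
    using finite_nat_set_iff_bounded_le by blast
  \<comment> \<open>The averaging formula wants the degrees strictly below \<open>L\<close>, hence
    the successor.\<close>
  define L where "L = Suc m"
  have L: "L > 0" and deg: "\<bar>word_degree w - d\<bar> < int L" if "w \<in> Poly_Mapping.keys x" for w
    using m that by (force simp: L_def)+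
  have L0: "L > 0" by (simp add: L_def)
  let ?f = "\<lambda>k. fscale (cis (- (of_int d * (2 * pi * real k / real L)))) (twist (2 * pi * real k / real L) x)"
  have f: "?f k \<in> M" "N (?f k) \<le> N x" for k
    using x N_scale[OF twist_mem[OF x]] N_twist[OF x] by simp_all
  have sum_le: "N (\<Sum>k\<in>D. ?f k) \<le> real (card D) * N x" if "finite D" for D
    using that
  proof (induction D)
    case (insert k D)
    have "N (?f k + (\<Sum>k\<in>D. ?f k)) \<le> N (?f k) + N (\<Sum>k\<in>D. ?f k)"
      using f(1) by (intro N_add sum_mem)
    then show ?case using insert f(2)[of k] by (simp add: distrib_right)
  qed simp
  have avg: "homog d x = fscale (1 / of_nat L) (\<Sum>k<L. ?f k)"
    by (rule homog_average[OF _ L0]) (rule deg)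
  have "N (homog d x) = 1 / real L * N (\<Sum>k<L. ?f k)"
    unfolding avg using N_scale[OF sum_mem[of "{..<L}" ?f], of "1 / of_nat L"] f(1) by (simp add: norm_divide)
  also have "\<dots> \<le> 1 / real L * (real (card {..<L}) * N x)"
    by (intro mult_left_mono sum_le) auto
  also have "\<dots> = N x" using L0 by simp
  finally show ?thesis .
qed

end

section \<open>The C*-algebra of the Cuntz-Krieger triple\<close>

context cstar_algebra
begin

sublocale sn: cstar_seminormed A
  using cstar_algebra_axioms by (simp add: cstar_algebra_iff)

lemma eq_if_norm_small:
  assumes "x \<in> vcarrier A" "y \<in> vcarrier A" "\<And>e. e > 0 \<Longrightarrow> anorm A (vminus A x y) \<le> e"
  shows "x = y"
proof -
  have "anorm A (vminus A x y) \<le> 0" by (rule field_le_epsilon) (use assms(3) in simp)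
  then have "anorm A (vminus A x y) = 0" by (rule antisym) (use assms(1,2) in \<open>simp add: norm_nonneg\<close>)
  then show ?thesis using norm_definite[of "vminus A x y"] minus_eq_zero_iff[of x y] assms(1,2) by simp
qed

lemma limit_unique:
  assumes "\<And>n. x n \<in> vcarrier A" "l \<in> vcarrier A" "l' \<in> vcarrier A"
    "vconverges A (anorm A) x l" "vconverges A (anorm A) x l'"
  shows "l = l'"
proof (rule eq_if_norm_small[OF assms(2,3)])
  fix e :: real assume "e > 0"
  have "(\<lambda>n. anorm A (vminus A (x n) l) + anorm A (vminus A (x n) l')) \<longlonglongrightarrow> 0 + 0"
    using assms(4,5) unfolding vconverges_def by (rule tendsto_add)
  moreover have "anorm A (vminus A l l') \<le> anorm A (vminus A (x n) l) + anorm A (vminus A (x n) l')" for n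
    using sn.ns.nrm_minus_trans[of l "x n" l'] sn.ns.nrm_minus_commute[of l "x n"] assms(1-3) by simp
  ultimately have "anorm A (vminus A l l') \<le> 0 + 0" by (intro LIMSEQ_le_const) auto
  then show "anorm A (vminus A l l') \<le> e" using \<open>e > 0\<close> by simp
qed

text \<open>A square root of \<open>1 - a\<close>, in the form \<open>1 - y\<close>: the solution of \<open>a = 2 y - y\<^sup>2\<close> is a fixed point
  of the contraction \<open>y \<mapsto> (a + y\<^sup>2) / 2\<close> of the ball of radius \<open>r\<close>. No unit and no functional
  calculus are needed.\<close>

lemma quadratic_solution:
  assumes a: "a \<in> vcarrier A" "astar A a = a" and r: "anorm A a \<le> r" "r < 1"
  shows "\<exists>y\<in>vcarrier A. astar A y = y \<and> vminus A (vscale A 2 y) (amult A y y) = a"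
proof -
  have r0: "0 \<le> r" using norm_nonneg[OF a(1)] r by simp
  define g where "g y = vscale A (1/2) (vadd A a (amult A y y))" for y
  define Y where "Y n = (g ^^ n) (vzero A)" for n
  have Y_Suc: "Y (Suc n) = g (Y n)" for n by (simp add: Y_def)
  have Y: "Y n \<in> vcarrier A \<and> astar A (Y n) = Y n \<and> anorm A (Y n) \<le> r" for n
  proof (induction n)
    case 0
    then show ?case using r0 by (simp add: Y_def)
  next
    case (Suc n)
    then have y: "Y n \<in> vcarrier A" "astar A (Y n) = Y n" "anorm A (Y n) \<le> r" by auto
    \<comment> \<open>The ball of radius r is invariant because (r + r^2)/2 is at most r for r <
      1.\<close>
    have "anorm A (vadd A a (amult A (Y n) (Y n))) \<le> r + r * r"
      using norm_triangle[of a "amult A (Y n) (Y n)"] norm_mult[OF y(1,1)] mult_mono[OF y(3,3) r0 norm_nonneg[OF y(1)]]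
        a y r by simp
    also have "\<dots> \<le> r + r * 1" using r0 r by (intro add_left_mono mult_left_mono) auto
    finally have "anorm A (Y (Suc n)) \<le> r" using a y by (simp add: Y_Suc g_def norm_scale)
    moreover have "astar A (Y (Suc n)) = Y (Suc n)"
      using a y by (simp add: Y_Suc g_def star_scale star_add star_mult)
    ultimately show ?case using a y by (simp add: Y_Suc g_def)
  qed
  then have Yc [simp]: "Y n \<in> vcarrier A" and Ys: "astar A (Y n) = Y n" and Yr: "anorm A (Y n) \<le> r" for n
    by auto
  \<comment> \<open>Writing x^2 - y^2 as x(x - y) + (x - y)y gives the factor 2r, and the half in
    \<open>g\<close> reduces it to r.\<close>
  have contr: "anorm A (vminus A (g x) (g y)) \<le> r * anorm A (vminus A x y)"
    if "x \<in> vcarrier A" "y \<in> vcarrier A" "anorm A x \<le> r" "anorm A y \<le> r" for x y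
  proof -
    have d0: "0 \<le> anorm A (vminus A x y)" using that by (intro norm_nonneg) simp
    have "anorm A (vminus A (g x) (g y)) = 1/2 * anorm A (vminus A (vadd A a (amult A x x)) (vadd A a (amult A y y)))"
      using that a by (simp add: g_def sn.ns.nrm_scale_minus)
    also have "anorm A (vminus A (vadd A a (amult A x x)) (vadd A a (amult A y y))) \<le> anorm A (vminus A (amult A x x) (amult A y y))"
      using sn.ns.nrm_minus_add[of a "amult A x x" a "amult A y y"] that a by simp
    also have "\<dots> \<le> anorm A x * anorm A (vminus A x y) + anorm A (vminus A x y) * anorm A y"
      using that by (intro sn.semi_minus_mult)
    also have "\<dots> \<le> r * anorm A (vminus A x y) + anorm A (vminus A x y) * r"
      using that d0 by (intro add_mono mult_right_mono mult_left_mono)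
    finally show ?thesis by simp
  qed
  have step: "anorm A (vminus A (Y (Suc n)) (Y n)) \<le> r ^ n" for n
  proof (induction n)
    case 0
    have "vminus A (Y (Suc 0)) (Y 0) = Y (Suc 0)" by (simp add: vminus_def Y_def[of 0])
    then show ?case using Yr[of "Suc 0"] r by simp
  next
    case (Suc n)
    have "anorm A (vminus A (Y (Suc (Suc n))) (Y (Suc n))) \<le> r * anorm A (vminus A (Y (Suc n)) (Y n))"
      unfolding Y_Suc[of "Suc n"] Y_Suc[of n] by (rule contr) (use Yr[of "Suc n"] Yr[of n] Yc[of "Suc n"] in \<open>simp_all add: Y_Suc\<close>)
    also have "\<dots> \<le> r * r ^ n" by (rule mult_left_mono[OF Suc.IH r0])
    finally show ?case by simp
  qed
  have tail: "anorm A (vminus A (Y (n + k)) (Y n)) \<le> r ^ n / (1 - r)" for n k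
  proof -
    have "anorm A (vminus A (Y (n + k)) (Y n)) \<le> (\<Sum>i<k. r ^ (n + i))"
    proof (induction k)
      case (Suc k)
      then show ?case
        using sn.ns.nrm_minus_trans[of "Y (Suc (n + k))" "Y (n + k)" "Y n"] step[of "n + k"] by simp
    qed simp
    also have "\<dots> = r ^ n * (\<Sum>i<k. r ^ i)" by (simp add: power_add sum_distrib_left)
    also have "\<dots> = r ^ n * ((1 - r ^ k) / (1 - r))" using r by (simp add: sum_gp_strict)
    also have "\<dots> \<le> r ^ n * (1 / (1 - r))"
      using r0 r by (intro mult_left_mono divide_right_mono) auto
    finally show ?thesis by simp
  qed
  have "vcauchy A (anorm A) Y"
    unfolding vcauchy_def
  proof (intro conjI allI impI)
    fix e :: real assume e: "e > 0"
    have "(\<lambda>n. r ^ n / (1 - r)) \<longlonglongrightarrow> 0 / (1 - r)"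
      using r r0 by (intro tendsto_intros LIMSEQ_power_zero) auto
    then have "\<forall>\<^sub>F n in sequentially. r ^ n / (1 - r) < e / 2"
      using e by (intro order_tendstoD(2)[of _ 0]) auto
    then obtain n where n: "r ^ n / (1 - r) < e / 2" by (auto simp: eventually_sequentially)
    have "anorm A (vminus A (Y i) (Y j)) < e" if "i \<ge> n" "j \<ge> n" for i j
      using sn.ns.nrm_minus_trans[of "Y i" "Y n" "Y j"] sn.ns.nrm_minus_commute[of "Y n" "Y j"]
        tail[of n "i - n"] tail[of n "j - n"] that n[THEN less_imp_le, THEN add_mono, OF n[THEN less_imp_le]] n
      by (simp del: less_divide_eq_numeral1)
    then show "\<exists>N. \<forall>m\<ge>N. \<forall>n\<ge>N. anorm A (vminus A (Y m) (Y n)) < e" by blast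
  qed simp
  then obtain y where y: "y \<in> vcarrier A" "vconverges A (anorm A) Y y"
    using norm_complete unfolding vcomplete_def by blast
  have "vconverges A (anorm A) (\<lambda>n. Y (Suc n)) y"
    using LIMSEQ_Suc[OF y(2)[unfolded vconverges_def]] by (simp add: vconverges_def)
  moreover have "vconverges A (anorm A) (\<lambda>n. Y (Suc n)) (g y)"
  proof -
    have "vconverges A (anorm A) (\<lambda>_. a) a" using a by (simp add: vconverges_def)
    then show ?thesis
      unfolding Y_Suc g_def using a y by (intro sn.vconverges_scale sn.vconverges_add sn.vconverges_mult) auto
  qed
  ultimately have fix_y: "y = g y" using a y by (intro limit_unique[of "\<lambda>n. Y (Suc n)"]) (auto simp: g_def)
  have "vconverges A (anorm A) Y (astar A y)"
    using sn.vconverges_star[OF Yc y] Ys by simp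
  then have "astar A y = y" using y by (intro limit_unique[of Y]) auto
  moreover have "vscale A 2 y = vadd A a (amult A y y)"
  proof -
    have "vscale A 2 y = vscale A 2 (g y)" using fix_y by simp
    also have "\<dots> = vadd A a (amult A y y)" using a y by (simp add: g_def scale_scale)
    finally show ?thesis .
  qed
  then have "vminus A (vscale A 2 y) (amult A y y) = a"
    using a y by (simp add: vminus_def add_assoc add_inverse)
  ultimately show ?thesis using y(1) by blast
qed

end

text \<open>The universal property is tested on algebras in the universe, so the completed algebra
  will be copied there with its operations carried along.\<close>

lemma transport_cstar_algebra:
  fixes g :: "'a \<Rightarrow> 'u"
  assumes "cstar_algebra C" and inj: "inj_on g (vcarrier C)"
  shows "\<exists>B :: 'u nstar_alg. cstar_algebra B \<and> star_hom C B g \<and> vcarrier B = g ` vcarrier C"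
proof -
  interpret C: cstar_algebra C by fact
  define h where "h = inv_into (vcarrier C) g"
  have h [simp]: "h (g x) = x" if "x \<in> vcarrier C" for x using that inj by (simp add: h_def)
  define B where "B = \<lparr>vcarrier = g ` vcarrier C, vzero = g (vzero C), vadd = (\<lambda>x y. g (vadd C (h x) (h y))),
     vscale = (\<lambda>c x. g (vscale C c (h x))), amult = (\<lambda>x y. g (amult C (h x) (h y))),
     astar = (\<lambda>x. g (astar C (h x))), anorm = (\<lambda>x. anorm C (h x))\<rparr>"
  have hom: "star_hom C B g" by (auto simp: star_hom_def B_def)
  have B: "cstar_seminormed B"
    by (rule cstar_seminormed_image[OF C.sn.cstar_seminormed_axioms hom]) (auto simp: B_def)
  have minus: "vminus B (g x) (g y) = g (vminus C x y)" if "x \<in> vcarrier C" "y \<in> vcarrier C" for x y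
    using that by (simp add: vminus_def B_def)
  have complete: "vcomplete B (anorm B)"
    unfolding vcomplete_def
  proof (intro allI impI)
    fix X assume X: "vcauchy B (anorm B) X"
    have "\<forall>n. \<exists>x. x \<in> vcarrier C \<and> X n = g x" using vcauchy_closed[OF X] by (auto simp: B_def)
    then obtain x where x: "\<forall>n. x n \<in> vcarrier C \<and> X n = g (x n)" by (rule choice[THEN exE])
    have "vcauchy C (anorm C) x" using X x by (simp add: vcauchy_def minus) (simp add: B_def)
    then obtain l where l: "l \<in> vcarrier C" "vconverges C (anorm C) x l"
      using C.norm_complete unfolding vcomplete_def by blast
    have "vconverges B (anorm B) X (g l)" using x l by (simp add: vconverges_def minus) (simp add: B_def)
    then show "\<exists>l\<in>vcarrier B. vconverges B (anorm B) X l" using l(1) by (auto simp: B_def)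
  qed
  have "cstar_algebra B"
    unfolding cstar_algebra_iff using B complete C.norm_definite by (auto simp: B_def)
  then show ?thesis using hom by (intro exI[of _ B]) (auto simp: B_def)
qed

context ck_universe
begin

section \<open>The completed algebra and the image of the free *-algebra\<close>

definition ck_cstar :: "'i ck_gen gen_cstar_elem nstar_alg" where
  "ck_cstar = gen_cstar TYPE('u) (ck_gens I) (ck_RN I) (ck_RS I A)"

definition embed :: "'i ck_gen free_alg \<Rightarrow> 'i ck_gen gen_cstar_elem" where
  "embed = gen_embed TYPE('u) (ck_gens I) (ck_RN I) (ck_RS I A)"

definition sep :: "'i ck_gen free_alg set nstar_alg" where
  "sep = separation (fnorm (ck_gens I) N)"

lemma ck_cstar_eq: "ck_cstar = completion sep"
  by (simp add: ck_cstar_def gen_cstar_def free_normed_eq sep_def N_def)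

lemma embed_eq: "embed x = null_class (cauchy_alg sep) (\<lambda>n. null_class (fnorm (ck_gens I) N) x)"
  by (simp add: embed_def gen_embed_def free_normed_eq sep_def N_def null_class_def)

lemma sep_seminormed: "cstar_seminormed sep"
  unfolding sep_def by (rule separation_cstar_seminormed)

sublocale C: cstar_algebra ck_cstar
  unfolding ck_cstar_eq by (rule cstar_seminormed.completion_cstar[OF sep_seminormed])

lemma embed_hom: "star_hom (free_star (ck_gens I)) ck_cstar embed"
proof -
  have 1: "star_hom (free_star (ck_gens I)) sep (null_class (fnorm (ck_gens I) N))"
    using separation_hom by (simp add: sep_def free_star_hom_fnorm)
  have 2: "star_hom sep ck_cstar (\<lambda>x. null_class (cauchy_alg sep) (\<lambda>n. x))"
    unfolding ck_cstar_eq by (rule cstar_seminormed.completion_hom[OF sep_seminormed])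
  show ?thesis
    using 1 2 unfolding star_hom_def embed_eq by (simp add: Pi_iff)
qed

lemmas embed_simps = free_hom_simps[OF embed_hom]

lemma embed_norm: "x \<in> M \<Longrightarrow> anorm ck_cstar (embed x) = N x"
  unfolding ck_cstar_eq embed_eq
  by (subst cstar_seminormed.completion_norm[OF sep_seminormed]) (simp_all add: sep_def separation_carrier separation_norm)

lemma embed_dense:
  assumes "X \<in> vcarrier ck_cstar" "e > 0"
  obtains x where "x \<in> M" "anorm ck_cstar (vminus ck_cstar X (embed x)) < e"
proof -
  obtain c where c: "c \<in> vcarrier sep"
    "anorm ck_cstar (vminus ck_cstar X (null_class (cauchy_alg sep) (\<lambda>n. c))) < e"
    using cstar_seminormed.completion_dense[OF sep_seminormed] assms unfolding ck_cstar_eq by metis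
  then obtain x where "x \<in> M" "c = null_class (fnorm (ck_gens I) N) x" by (auto simp: sep_def separation_carrier)
  then show ?thesis using c(2) that by (simp add: embed_eq)
qed

lemma embed_dense_seq:
  assumes X: "X \<in> vcarrier ck_cstar"
  obtains x where "\<And>n. x n \<in> M" "vconverges ck_cstar (anorm ck_cstar) (\<lambda>n. embed (x n)) X"
proof -
  have "\<exists>x. x \<in> M \<and> anorm ck_cstar (vminus ck_cstar X (embed x)) < 1 / Suc n" for n
    using embed_dense[OF X, of "1 / Suc n"] by (metis of_nat_0_less_iff zero_less_Suc zero_less_divide_1_iff)
  then obtain x where x: "\<And>n. x n \<in> M" "\<And>n. anorm ck_cstar (vminus ck_cstar X (embed (x n))) < 1 / Suc n"
    by metis
  have "(\<lambda>n. anorm ck_cstar (vminus ck_cstar (embed (x n)) X)) \<longlonglongrightarrow> 0"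
  proof (rule Lim_null_comparison)
    show "\<forall>\<^sub>F n in sequentially. norm (anorm ck_cstar (vminus ck_cstar (embed (x n)) X)) \<le> 1 / Suc n"
      using x X C.sn.ns.nrm_minus_commute[of X "embed (x _)"] embed_simps(1)[OF x(1)] less_imp_le[OF x(2)] by simp
    show "(\<lambda>n. 1 / real (Suc n)) \<longlonglongrightarrow> 0" by (rule LIMSEQ_Suc) (rule lim_1_over_n)
  qed
  then show ?thesis using that[of x] x(1) by (simp add: vconverges_def)
qed

text \<open>The unit laws hold on the dense image of the free *-algebra and pass to limits.\<close>

lemma embed_unit: "is_unit ck_cstar (embed (gen One))"
  unfolding is_unit_def
proof (intro conjI ballI)
  interpret ck: ck_seminorm I N A by (rule N_ck_seminorm)
  have o: "embed (gen One) \<in> vcarrier ck_cstar" by (rule embed_simps) simp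
  show "embed (gen One) \<in> vcarrier ck_cstar" by (rule o)
  have eq: "embed x = embed y" if "cg x y" for x y
  proof (rule C.eq_if_norm_small)
    have xy: "x \<in> M" "y \<in> M" "N (x - y) = 0" using that by (simp_all add: cg_def)
    then show "embed x \<in> vcarrier ck_cstar" "embed y \<in> vcarrier ck_cstar" by (simp_all add: embed_simps)
    have "anorm ck_cstar (vminus ck_cstar (embed x) (embed y)) = 0"
      using embed_norm[of "x - y"] xy by (simp add: embed_simps)
    then show "anorm ck_cstar (vminus ck_cstar (embed x) (embed y)) \<le> e" if "e > 0" for e using that by simp
  qed
  fix X assume X: "X \<in> vcarrier ck_cstar"
  obtain x where x: "\<And>n. x n \<in> M" "vconverges ck_cstar (anorm ck_cstar) (\<lambda>n. embed (x n)) X"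
    using embed_dense_seq[OF X] by metis
  have xc: "embed (x n) \<in> vcarrier ck_cstar" for n by (rule embed_simps(1)[OF x(1)])
  have const: "vconverges ck_cstar (anorm ck_cstar) (\<lambda>n. embed (gen One)) (embed (gen One))"
    using o by (simp add: vconverges_def)
  have "amult ck_cstar (embed (gen One)) (embed (x n)) = embed (x n)"
    "amult ck_cstar (embed (x n)) (embed (gen One)) = embed (x n)" for n
    using eq[OF ck.One_left[OF x(1)[of n]]] eq[OF ck.One_right[OF x(1)[of n]]] x(1)[of n] by (simp_all add: embed_simps)
  then have "vconverges ck_cstar (anorm ck_cstar) (\<lambda>n. embed (x n)) (amult ck_cstar (embed (gen One)) X)"
    "vconverges ck_cstar (anorm ck_cstar) (\<lambda>n. embed (x n)) (amult ck_cstar X (embed (gen One)))"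
    using C.sn.vconverges_mult[OF o xc o X const x(2)] C.sn.vconverges_mult[OF xc o X o x(2) const] by simp_all
  then show "amult ck_cstar (embed (gen One)) X = X" "amult ck_cstar X (embed (gen One)) = X"
    using C.limit_unique[OF xc _ X _ x(2)] X o by simp_all
qed

text \<open>Choosing one representing sequence of polynomials per element maps the algebra
  injectively to sequences, and \<open>emb\<close> carries these into the universe.\<close>

lemma ck_cstar_embeds: "\<exists>g :: 'i ck_gen gen_cstar_elem \<Rightarrow> 'u. inj_on g (vcarrier ck_cstar)"
proof -
  interpret S: cstar_seminormed sep by (rule sep_seminormed)
  interpret D: cstar_seminormed "cauchy_alg sep" by (rule S.cauchy_cstar_seminormed)
  have "\<exists>s :: nat \<Rightarrow> 'i ck_gen free_alg. X = null_class (cauchy_alg sep) (\<lambda>n. null_class (fnorm (ck_gens I) N) (s n))"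
    if X: "X \<in> vcarrier ck_cstar" for X
  proof -
    obtain S where S: "vcauchy sep (anorm sep) S" "X = null_class (cauchy_alg sep) S"
      using X by (auto simp: ck_cstar_eq completion_def D.separation_carrier)
    have "\<forall>n. \<exists>x. S n = null_class (fnorm (ck_gens I) N) x"
      using vcauchy_closed[OF S(1)] by (auto simp: sep_def separation_carrier)
    then obtain s where "\<forall>n. S n = null_class (fnorm (ck_gens I) N) (s n)" by (rule choice[THEN exE])
    then have "S = (\<lambda>n. null_class (fnorm (ck_gens I) N) (s n))" by auto
    then show ?thesis using S(2) by blast
  qed
  then have "\<forall>X\<in>vcarrier ck_cstar. \<exists>s :: nat \<Rightarrow> 'i ck_gen free_alg.
      X = null_class (cauchy_alg sep) (\<lambda>n. null_class (fnorm (ck_gens I) N) (s n))" by blast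
  then obtain s :: "_ \<Rightarrow> nat \<Rightarrow> 'i ck_gen free_alg" where s: "\<forall>X\<in>vcarrier ck_cstar.
      X = null_class (cauchy_alg sep) (\<lambda>n. null_class (fnorm (ck_gens I) N) (s X n))"
    by (rule bchoice[THEN exE])
  have "inj_on s (vcarrier ck_cstar)"
  proof (rule inj_onI)
    fix X Y assume "X \<in> vcarrier ck_cstar" "Y \<in> vcarrier ck_cstar" "s X = s Y"
    then show "X = Y" using bspec[OF s, of X] bspec[OF s, of Y] by simp
  qed
  then have "inj_on (emb \<circ> s) (vcarrier ck_cstar)"
    using inj_emb by (intro comp_inj_on) (auto intro: inj_on_subset)
  then show ?thesis by blast
qed

text \<open>In every representation \<open>2 \<sigma> - \<sigma>\<^sup>2 \<le> 1\<close> for self-adjoint \<open>\<sigma>\<close>.\<close>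

lemma N_sq_le:
  assumes z: "z \<in> M" and s: "s \<in> M" "fstar s = s"
  shows "(N z)\<^sup>2 \<le> 1 + N (fstar z * z - (fscale 2 s - s * s))"
proof -
  let ?r = "fstar z * z - (fscale 2 s - s * s)"
  have r: "?r \<in> M" using z s by simp
  have Nr: "0 \<le> N ?r" by (rule N_nonneg[OF r])
  have "N z \<le> sqrt (1 + N ?r)"
  proof (rule N_least)
    fix H :: "'u hilbert" and \<rho> assume rep: "ckrep H \<rho>"
    interpret H: hilbert_space H by (rule representation_hilbert[OF rep])
    note app = representation_apply[OF rep]
    show "opnorm H (\<rho> z) \<le> sqrt (1 + N ?r)"
    proof (rule H.opnorm_le)
      fix v assume v: "v \<in> vcarrier H"
      note c = app(6)[OF v z] app(6)[OF v s(1)] app(6)[OF v r]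
      have "(hnorm H (\<rho> z v))\<^sup>2 = Re (hinner H v (\<rho> (fstar z * z) v))"
        using v z c by (simp add: H.hnorm_sq app)
      also have "fstar z * z = ?r + (fscale 2 s - s * s)" by simp
      also have "Re (hinner H v (\<rho> (?r + (fscale 2 s - s * s)) v))
          = Re (hinner H v (\<rho> ?r v)) + (2 * Re (hinner H v (\<rho> s v)) - Re (hinner H v (\<rho> (s * s) v)))"
      proof -
        have m: "fscale 2 s \<in> M" "s * s \<in> M" "fscale 2 s - s * s \<in> M" using s by simp_all
        show ?thesis
          unfolding app(1)[OF v r m(3)] app(2)[OF v m(1,2)] app(3)[OF v s(1)]
          using v c app(6)[OF v m(2)] app(6)[OF v r] by (simp add: H.inner_add_right H.inner_minus_right H.inner_scale_right)
      qed
      also have "Re (hinner H v (\<rho> (s * s) v)) = (hnorm H (\<rho> s v))\<^sup>2"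
        using app(5)[OF v s(1) c(2)] v s c by (simp add: app(4) H.hnorm_sq)
      also have "Re (hinner H v (\<rho> ?r v)) + (2 * Re (hinner H v (\<rho> s v)) - (hnorm H (\<rho> s v))\<^sup>2)
          \<le> N ?r * (hnorm H v)\<^sup>2 + (hnorm H v)\<^sup>2"
      proof (rule add_mono)
        have "Re (hinner H v (\<rho> ?r v)) \<le> hnorm H v * hnorm H (\<rho> ?r v)"
          using H.cauchy_schwarz[OF v c(3)] complex_Re_le_cmod order_trans by blast
        also have "hnorm H (\<rho> ?r v) \<le> N ?r * hnorm H v"
          by (rule H.opnorm_boundI[OF representation_bounded[OF rep r] v N_upper[OF rep r]])
        finally show "Re (hinner H v (\<rho> ?r v)) \<le> N ?r * (hnorm H v)\<^sup>2"
          using v mult_left_mono[of _ _ "hnorm H v"] by (simp add: power2_eq_square mult_ac)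
        \<comment> \<open>Expanding this square gives the operator inequality at the vector
          \<open>v\<close>.\<close>
        have "0 \<le> (hnorm H (vminus H v (\<rho> s v)))\<^sup>2" by simp
        then show "2 * Re (hinner H v (\<rho> s v)) - (hnorm H (\<rho> s v))\<^sup>2 \<le> (hnorm H v)\<^sup>2"
          using H.hnorm_minus_sq[OF v c(2)] by simp
      qed
      also have "\<dots> = (sqrt (1 + N ?r) * hnorm H v)\<^sup>2" using Nr by (simp add: power_mult_distrib algebra_simps)
      finally show "hnorm H (\<rho> z v) \<le> sqrt (1 + N ?r) * hnorm H v"
        by (rule power2_le_imp_le) (use Nr v in simp)
    qed (use Nr in simp)
  qed
  then have "(N z)\<^sup>2 \<le> (sqrt (1 + N ?r))\<^sup>2" by (rule power_mono[OF _ N_nonneg[OF z]])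
  then show ?thesis using Nr by simp
qed

text \<open>Applying the homomorphism to b*b = 2y - y^2 gives the same identity in the completed
  algebra. The bound \<open>N_sq_le\<close> concerns elements of the free *-algebra, so the images
  of b and y are approximated there, and the defect \<open>r n\<close> of the identity tends to
  zero.\<close>

lemma hom_contractive_unit_ball:
  assumes "cstar_algebra B" and hom: "star_hom B ck_cstar \<phi>" and b: "b \<in> vcarrier B" and lt: "anorm B b < 1"
  shows "anorm ck_cstar (\<phi> b) \<le> 1"
proof -
  interpret B: cstar_algebra B by fact
  note h = star_homD[OF hom]
  let ?a = "amult B (astar B b) b"
  have "anorm B ?a < 1" using lt B.cstar_identity[OF b] B.norm_nonneg[OF b] by (simp add: power_less_one_iff abs_square_less_1)
  then obtain y where y: "y \<in> vcarrier B" "astar B y = y" "vminus B (vscale B 2 y) (amult B y y) = ?a"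
    using B.quadratic_solution[of ?a "anorm B ?a"] b by (auto simp: B.star_mult)
  note c = h(1)[OF b] h(1)[OF y(1)]
  have \<phi>y: "astar ck_cstar (\<phi> y) = \<phi> y" using h(5)[OF y(1)] y(2) by simp
  have eq: "amult ck_cstar (astar ck_cstar (\<phi> b)) (\<phi> b)
      = vminus ck_cstar (vscale ck_cstar 2 (\<phi> y)) (amult ck_cstar (\<phi> y) (\<phi> y))"
    using arg_cong[OF y(3), of \<phi>] star_hom_minus[OF hom B.star_algebra_axioms, of "vscale B 2 y" "amult B y y"] y(1) b
    by (simp add: h)
  obtain z where z: "\<And>n. z n \<in> M" "vconverges ck_cstar (anorm ck_cstar) (\<lambda>n. embed (z n)) (\<phi> b)"
    using embed_dense_seq[OF c(1)] by metis
  obtain x where x: "\<And>n. x n \<in> M" "vconverges ck_cstar (anorm ck_cstar) (\<lambda>n. embed (x n)) (\<phi> y)"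
    using embed_dense_seq[OF c(2)] by metis
  \<comment> \<open>Symmetrising makes the approximants self-adjoint, as \<open>N_sq_le\<close>
    demands; the limit is unchanged because the image of \<open>y\<close> is self-adjoint.\<close>
  define s where "s n = fscale (1/2) (x n + fstar (x n))" for n
  have s: "s n \<in> M" "fstar (s n) = s n" for n
    using x(1)[of n] by (simp_all add: s_def fstar_fscale fstar_add add.commute)
  define r where "r n = fstar (z n) * z n - (fscale 2 (s n) - s n * s n)" for n
  have r: "r n \<in> M" for n using z(1) s(1) by (simp add: r_def)
  have zc: "embed (z n) \<in> vcarrier ck_cstar" and xc: "embed (x n) \<in> vcarrier ck_cstar"
    and sc: "embed (s n) \<in> vcarrier ck_cstar" for n
    using embed_simps(1) z(1) x(1) s(1) by blast+
  have half: "vscale ck_cstar (1/2) (vadd ck_cstar (\<phi> y) (\<phi> y)) = \<phi> y"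
    using c(2) C.scale_add_left[of "\<phi> y" "1/2" "1/2"] by (simp add: C.scale_add_right)
  have "vconverges ck_cstar (anorm ck_cstar) (\<lambda>n. vscale ck_cstar (1/2) (vadd ck_cstar (embed (x n)) (astar ck_cstar (embed (x n)))))
      (vscale ck_cstar (1/2) (vadd ck_cstar (\<phi> y) (astar ck_cstar (\<phi> y))))"
    using xc c(2) x(2) by (intro C.sn.vconverges_scale C.sn.vconverges_add C.sn.vconverges_star) auto
  then have s_lim: "vconverges ck_cstar (anorm ck_cstar) (\<lambda>n. embed (s n)) (\<phi> y)"
    using x(1) half by (simp add: \<phi>y s_def embed_simps)
  have "vconverges ck_cstar (anorm ck_cstar)
      (\<lambda>n. vadd ck_cstar (amult ck_cstar (astar ck_cstar (embed (z n))) (embed (z n)))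
        (vscale ck_cstar (-1) (vadd ck_cstar (vscale ck_cstar 2 (embed (s n))) (vscale ck_cstar (-1) (amult ck_cstar (embed (s n)) (embed (s n)))))))
      (vadd ck_cstar (amult ck_cstar (astar ck_cstar (\<phi> b)) (\<phi> b))
        (vscale ck_cstar (-1) (vadd ck_cstar (vscale ck_cstar 2 (\<phi> y)) (vscale ck_cstar (-1) (amult ck_cstar (\<phi> y) (\<phi> y))))))"
    using zc sc c z(2) s_lim
    by (intro C.sn.vconverges_add C.sn.vconverges_mult C.sn.vconverges_star C.sn.vconverges_scale) auto
  moreover have "vadd ck_cstar (amult ck_cstar (astar ck_cstar (\<phi> b)) (\<phi> b))
        (vscale ck_cstar (-1) (vadd ck_cstar (vscale ck_cstar 2 (\<phi> y)) (vscale ck_cstar (-1) (amult ck_cstar (\<phi> y) (\<phi> y)))))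
      = vzero ck_cstar"
    using eq c C.minus_self[of "amult ck_cstar (astar ck_cstar (\<phi> b)) (\<phi> b)"] by (simp add: vminus_def)
  moreover have "vadd ck_cstar (amult ck_cstar (astar ck_cstar (embed (z n))) (embed (z n)))
        (vscale ck_cstar (-1) (vadd ck_cstar (vscale ck_cstar 2 (embed (s n))) (vscale ck_cstar (-1) (amult ck_cstar (embed (s n)) (embed (s n))))))
      = embed (r n)" for n
    using z(1)[of n] s(1)[of n] by (simp add: r_def embed_simps vminus_def)
  ultimately have "vconverges ck_cstar (anorm ck_cstar) (\<lambda>n. embed (r n)) (vzero ck_cstar)" by simp
  from C.sn.ns.vconverges_nrm[OF embed_simps(1)[OF r] C.zero_closed this]
  have r_lim: "(\<lambda>n. N (r n)) \<longlonglongrightarrow> 0" using embed_norm[OF r] by simp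
  have z_lim: "(\<lambda>n. N (z n)) \<longlonglongrightarrow> anorm ck_cstar (\<phi> b)"
    using C.sn.ns.vconverges_nrm[OF zc c(1) z(2)] embed_norm[OF z(1)] by simp
  have "(anorm ck_cstar (\<phi> b))\<^sup>2 \<le> 1 + 0"
  proof (rule LIMSEQ_le)
    show "(\<lambda>n. (N (z n))\<^sup>2) \<longlonglongrightarrow> (anorm ck_cstar (\<phi> b))\<^sup>2" by (intro tendsto_intros z_lim)
    show "(\<lambda>n. 1 + N (r n)) \<longlonglongrightarrow> 1 + 0" by (intro tendsto_intros r_lim)
    show "\<exists>k. \<forall>n\<ge>k. (N (z n))\<^sup>2 \<le> 1 + N (r n)"
      unfolding r_def using N_sq_le[OF z(1) s] by blast
  qed
  then show ?thesis using C.norm_nonneg[OF c(1)] by (simp add: power_le_one_iff abs_square_le_1)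
qed

lemma hom_contractive:
  assumes "cstar_algebra B" and hom: "star_hom B ck_cstar \<phi>" and b: "b \<in> vcarrier B"
  shows "anorm ck_cstar (\<phi> b) \<le> anorm B b"
proof (rule field_le_epsilon)
  interpret B: cstar_algebra B by fact
  fix e :: real assume e: "e > 0"
  \<comment> \<open>Adding e makes the scaling factor positive even for b of norm zero and puts b/c
    into the open unit ball.\<close>
  define c where "c = anorm B b + e"
  have c: "c > 0" "anorm B b < c" using e B.norm_nonneg[OF b] by (auto simp: c_def)
  have "anorm ck_cstar (\<phi> (vscale B (of_real (1 / c)) b)) \<le> 1"
    by (rule hom_contractive_unit_ball[OF assms(1) hom]) (use b c in \<open>simp_all add: B.norm_scale norm_divide\<close>)
  then have "anorm ck_cstar (\<phi> b) / c \<le> 1"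
    using b c star_homD(1,3)[OF hom] by (simp add: C.norm_scale norm_divide)
  then show "anorm ck_cstar (\<phi> b) \<le> anorm B b + e" using c by (simp add: c_def)
qed

end

section \<open>The comparison with the Exel-Laca algebra\<close>

lemma star_hom_comp:
  "\<lbrakk>star_hom A B f; star_hom B C g\<rbrakk> \<Longrightarrow> star_hom A C (\<lambda>x. g (f x))"
  unfolding star_hom_def by (simp add: Pi_iff)

lemma star_hom_inv_into:
  assumes "star_algebra A" and hom: "star_hom A B g" and inj: "inj_on g (vcarrier A)"
    and img: "vcarrier B = g ` vcarrier A"
  shows "star_hom B A (inv_into (vcarrier A) g)"
proof -
  interpret A: star_algebra A by fact
  note h = star_homD[OF hom]
  have inv [simp]: "inv_into (vcarrier A) g (g x) = x" if "x \<in> vcarrier A" for x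
    using inj that by simp
  have ops: "vadd B (g x) (g y) = g (vadd A x y)" "amult B (g x) (g y) = g (amult A x y)"
    "vscale B c (g x) = g (vscale A c x)" "astar B (g x) = g (astar A x)"
    if "x \<in> vcarrier A" "y \<in> vcarrier A" for x y c
    using that by (simp_all add: h)
  show ?thesis
    unfolding star_hom_def img by (auto simp: ops)
qed

context cstar_algebra
begin

section \<open>Closures of *-subalgebras\<close>

lemma approximating_sequence:
  assumes D: "D \<subseteq> vcarrier A" and a: "a \<in> vcarrier A"
    and approx: "\<And>\<epsilon>. \<epsilon> > 0 \<Longrightarrow> \<exists>d\<in>D. anorm A (vminus A d a) < \<epsilon>"
  obtains x where "\<forall>n. x n \<in> D" "vconverges A (anorm A) x a"
proof -
  have "\<forall>n. \<exists>d. d \<in> D \<and> anorm A (vminus A d a) < 1 / real (Suc n)"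
  proof
    fix n
    have "1 / real (Suc n) > 0" by simp
    from approx[OF this] show "\<exists>d. d \<in> D \<and> anorm A (vminus A d a) < 1 / real (Suc n)" by blast
  qed
  then obtain x where x: "\<forall>n. x n \<in> D \<and> anorm A (vminus A (x n) a) < 1 / real (Suc n)"
    by (rule choice[THEN exE])
  have "(\<lambda>n. anorm A (vminus A (x n) a)) \<longlonglongrightarrow> 0"
  proof (rule Lim_null_comparison)
    have "norm (anorm A (vminus A (x n) a)) \<le> 1 / real (Suc n)" for n
    proof -
      have "x n \<in> vcarrier A" using x D by blast
      then have "0 \<le> anorm A (vminus A (x n) a)" using a by (intro norm_nonneg) simp
      then show ?thesis using x by (simp add: less_imp_le)
    qed
    then show "\<forall>\<^sub>F n in sequentially. norm (anorm A (vminus A (x n) a)) \<le> 1 / real (Suc n)" by simp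
    show "(\<lambda>n. 1 / real (Suc n)) \<longlonglongrightarrow> 0" by (rule LIMSEQ_Suc) (rule lim_1_over_n)
  qed
  then show ?thesis using that[of x] x by (simp add: vconverges_def)
qed

text \<open>Sequential limits of \<open>D\<close> are closed under the operations by continuity, and
  under further limits by approximating twice within half the tolerance.\<close>

lemma closure_subalgebra:
  assumes D: "D \<subseteq> vcarrier A" "vzero A \<in> D"
    and ops: "\<And>x y. \<lbrakk>x \<in> D; y \<in> D\<rbrakk> \<Longrightarrow> vadd A x y \<in> D" "\<And>x y. \<lbrakk>x \<in> D; y \<in> D\<rbrakk> \<Longrightarrow> amult A x y \<in> D"
      "\<And>x. x \<in> D \<Longrightarrow> astar A x \<in> D" "\<And>x c. x \<in> D \<Longrightarrow> vscale A c x \<in> D"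
  shows "cstar_subalgebra A {a \<in> vcarrier A. \<exists>x. (\<forall>n. x n \<in> D) \<and> vconverges A (anorm A) x a}"
    (is "cstar_subalgebra A ?C")
proof -
  have inC: "l \<in> ?C" if "\<forall>n. x n \<in> D" "vconverges A (anorm A) x l" "l \<in> vcarrier A" for x l
    using that by blast
  have DC: "d \<in> ?C" if "d \<in> D" for d
  proof -
    have d: "d \<in> vcarrier A" using that D by blast
    then have "vconverges A (anorm A) (\<lambda>n. d) d" by (simp add: vconverges_def)
    then show ?thesis using d that by (intro inC[of "\<lambda>n. d"]) simp_all
  qed
  have ex: "\<exists>x. (\<forall>n. x n \<in> vcarrier A) \<and> (\<forall>n. x n \<in> D) \<and> vconverges A (anorm A) x a" if "a \<in> ?C" for a
    using that D(1) by blast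
  have add_mult: "vadd A a b \<in> ?C \<and> amult A a b \<in> ?C" if "a \<in> ?C" "b \<in> ?C" for a b
  proof -
    have ab: "a \<in> vcarrier A" "b \<in> vcarrier A" using that by auto
    obtain x where x: "\<forall>n. x n \<in> vcarrier A" "\<forall>n. x n \<in> D" "vconverges A (anorm A) x a"
      using ex[OF \<open>a \<in> ?C\<close>] by (elim exE conjE)
    obtain y where y: "\<forall>n. y n \<in> vcarrier A" "\<forall>n. y n \<in> D" "vconverges A (anorm A) y b"
      using ex[OF \<open>b \<in> ?C\<close>] by (elim exE conjE)
    have xc: "x n \<in> vcarrier A" and yc: "y n \<in> vcarrier A" for n using x y by auto
    have c: "vadd A a b \<in> vcarrier A" "amult A a b \<in> vcarrier A" using ab by simp_all
    have "vadd A a b \<in> ?C"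
      by (rule inC[OF _ sn.vconverges_add[OF xc yc ab x(3) y(3)]]) (use c x y ops in auto)
    moreover have "amult A a b \<in> ?C"
      by (rule inC[OF _ sn.vconverges_mult[OF xc yc ab x(3) y(3)]]) (use c x y ops in auto)
    ultimately show ?thesis ..
  qed
  have star_scale: "astar A a \<in> ?C \<and> (\<forall>c. vscale A c a \<in> ?C)" if aC: "a \<in> ?C" for a
  proof -
    have a: "a \<in> vcarrier A" using aC by auto
    obtain x where x: "\<forall>n. x n \<in> vcarrier A" "\<forall>n. x n \<in> D" "vconverges A (anorm A) x a"
      using ex[OF aC] by (elim exE conjE)
    have xc: "x n \<in> vcarrier A" for n using x by auto
    have c: "astar A a \<in> vcarrier A" "vscale A c a \<in> vcarrier A" for c using a by simp_all
    have "astar A a \<in> ?C"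
      by (rule inC[OF _ sn.vconverges_star[OF xc a x(3)]]) (use c x ops in auto)
    moreover have "vscale A z a \<in> ?C" for z
      by (rule inC[OF _ sn.vconverges_scale[OF xc a x(3)]]) (use c x ops in auto)
    ultimately show ?thesis by (intro conjI allI)
  qed
  have closed: "l \<in> ?C" if y: "\<forall>n. y n \<in> ?C" and l: "l \<in> vcarrier A" and lim: "vconverges A (anorm A) y l" for y l
  proof -
    have approx: "\<exists>d\<in>D. anorm A (vminus A d l) < \<epsilon>" if e: "\<epsilon> > 0" for \<epsilon>
    proof -
      have e2: "\<epsilon> / 2 > 0" using e by simp
      obtain n where n: "anorm A (vminus A (y n) l) < \<epsilon> / 2"
        using order_tendstoD(2)[OF lim[unfolded vconverges_def] e2] eventually_sequentially by auto
      have yn: "y n \<in> ?C" "y n \<in> vcarrier A" using y by auto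
      obtain x where x: "\<forall>k. x k \<in> vcarrier A" "\<forall>k. x k \<in> D" "vconverges A (anorm A) x (y n)"
        using ex[OF yn(1)] by (elim exE conjE)
      obtain k where k: "anorm A (vminus A (x k) (y n)) < \<epsilon> / 2"
        using order_tendstoD(2)[OF x(3)[unfolded vconverges_def] e2] eventually_sequentially by auto
      have "anorm A (vminus A (x k) l) \<le> anorm A (vminus A (x k) (y n)) + anorm A (vminus A (y n) l)"
        using sn.ns.nrm_minus_trans[of "x k" "y n" l] x(1) yn l by simp
      then have "anorm A (vminus A (x k) l) < \<epsilon>" using n k by simp
      then show ?thesis using x(2) by blast
    qed
    obtain x where "\<forall>n. x n \<in> D" "vconverges A (anorm A) x l"
      using approximating_sequence[OF D(1) l approx] by metis
    then show ?thesis using l by blast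
  qed
  show ?thesis
    unfolding cstar_subalgebra_def
  proof (intro conjI ballI allI impI)
    show "?C \<subseteq> vcarrier A" by blast
    show "vzero A \<in> ?C" by (rule DC[OF D(2)])
    show "vadd A x y \<in> ?C" "amult A x y \<in> ?C" if "x \<in> ?C" "y \<in> ?C" for x y using add_mult[OF that] by simp_all
    show "astar A x \<in> ?C" "vscale A c x \<in> ?C" if "x \<in> ?C" for x c using star_scale[OF that] by simp_all
    show "l \<in> ?C" if "(\<forall>n. x n \<in> ?C) \<and> l \<in> vcarrier A \<and> vconverges A (anorm A) x l" for x l
      using closed that by (elim conjE)
  qed
qed

end

lemma (in ck_universe) aunit_ck_cstar: "aunit ck_cstar = embed (gen One)"
  by (rule C.aunit_eq[OF embed_unit])

text \<open>The universal property speaks of test algebras in the universe only. So the homomorphism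
  is found into a copy \<open>B\<close> of the completed algebra and followed by the inverse of the
  copying map.\<close>

lemma (in ck_universe) universal_hom:
  fixes OA :: "'o nstar_alg"
  assumes univ: "universal_exel_laca TYPE('u) I A OA S"
  shows "\<exists>\<phi>. unital_star_hom OA ck_cstar \<phi> \<and> (\<forall>i\<in>I. \<phi> (S i) = embed (gen (T i)))"
proof -
  obtain g :: "'i ck_gen gen_cstar_elem \<Rightarrow> 'u" where g: "inj_on g (vcarrier ck_cstar)"
    using ck_cstar_embeds by (elim exE)
  obtain B :: "'u nstar_alg" where B: "cstar_algebra B" "star_hom ck_cstar B g" "vcarrier B = g ` vcarrier ck_cstar"
    using transport_cstar_algebra[OF C.cstar_algebra_axioms g] by (elim exE conjE)
  interpret B: cstar_algebra B by (rule B(1))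
  interpret ck: ck_seminorm I N A by (rule N_ck_seminorm)
  note gs = star_homD[OF B(2)]
  have unit: "is_unit B (g (embed (gen One)))"
    unfolding is_unit_def B(3)
  proof (intro conjI ballI)
    have e: "embed (gen One) \<in> vcarrier ck_cstar" using embed_unit by (simp add: is_unit_def)
    then show "g (embed (gen One)) \<in> g ` vcarrier ck_cstar" by (rule imageI)
    fix y assume "y \<in> g ` vcarrier ck_cstar"
    then obtain X where X: "y = g X" "X \<in> vcarrier ck_cstar" by blast
    show "amult B (g (embed (gen One))) y = y" "amult B y (g (embed (gen One))) = y"
      using embed_unit X(2) unfolding X(1) gs(4)[OF e X(2), symmetric] gs(4)[OF X(2) e, symmetric]
      by (simp_all add: is_unit_def)
  qed
  then have aunit: "aunit B = g (embed (gen One))" by (rule B.aunit_eq)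
  have null: "g (embed x) = vzero B" if x: "x \<in> M" "N x = 0" for x
  proof -
    have "embed x = vzero ck_cstar"
      by (rule C.norm_definite) (use x in \<open>simp_all add: embed_norm embed_simps\<close>)
    then show ?thesis
      using star_hom_zero[OF B(2) C.star_algebra_axioms B.star_algebra_axioms] by simp
  qed
  have "EL_family I A B (\<lambda>i. g (embed (gen (T i))))"
    by (rule ck.EL_family_hom[OF star_hom_comp[OF embed_hom B(2)] B.star_algebra_axioms aunit[symmetric] null])
  moreover have "unital_cstar_algebra B" using B(1) unit by (auto simp: unital_cstar_algebra_def)
  ultimately obtain f where f: "unital_star_hom OA B f" "\<forall>i\<in>I. f (S i) = g (embed (gen (T i)))"
    using univ unfolding universal_exel_laca_def by blast
  let ?h = "inv_into (vcarrier ck_cstar) g"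
  have inv: "?h (g (embed x)) = embed x" if "x \<in> M" for x
    using g that by (simp add: embed_simps)
  have "star_hom OA ck_cstar (\<lambda>x. ?h (f x))"
    using star_hom_comp star_hom_inv_into[OF C.star_algebra_axioms B(2) g B(3)] f(1)
    unfolding unital_star_hom_def by blast
  moreover have "?h (f (aunit OA)) = aunit ck_cstar"
    using f(1) by (simp add: unital_star_hom_def aunit inv aunit_ck_cstar)
  moreover have "\<forall>i\<in>I. ?h (f (S i)) = embed (gen (T i))" using f(2) by (simp add: inv)
  ultimately show ?thesis unfolding unital_star_hom_def by blast
qed

locale exel_laca_hom = ck_universe I A emb + O: cstar_algebra OA
  for I :: "'i set" and A and emb :: "(nat \<Rightarrow> 'i ck_gen free_alg) \<Rightarrow> 'u" and OA :: "'o nstar_alg" +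
  fixes e :: 'o and S :: "'i \<Rightarrow> 'o" and \<phi>
  assumes unit_OA: "is_unit OA e" and EL: "EL_family I A OA S"
    and hom: "star_hom OA ck_cstar \<phi>" and hom_S: "i \<in> I \<Longrightarrow> \<phi> (S i) = embed (gen (T i))"
    and hom_unit: "\<phi> e = embed (gen One)"
    and gen_OA: "generates OA (insert e (S ` I))"
begin

definition val :: "'i ck_gen \<Rightarrow> 'o" where
  "val g = (case g of T i \<Rightarrow> if i \<in> I then S i else vzero OA | One \<Rightarrow> e)"

lemma S_closed [simp]: "i \<in> I \<Longrightarrow> S i \<in> vcarrier OA"
  using EL by (simp add: EL_family_def)

sublocale evaluation OA e val
  by unfold_locales (use unit_OA in \<open>auto simp: val_def is_unit_def split: ck_gen.splits\<close>)

abbreviation \<pi> :: "'i ck_gen free_alg \<Rightarrow> 'o" where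
  "\<pi> \<equiv> ev OA e val"

lemma ev_hom: "star_hom (free_star (ck_gens I)) OA \<pi>"
  by (rule star_hom_ev)

lemma \<pi>_gen: "i \<in> I \<Longrightarrow> \<pi> (gen (T i)) = S i" "\<pi> (gen One) = e"
  by (simp_all add: val_def)

lemma \<pi>_proj: "i \<in> I \<Longrightarrow> \<pi> (rproj i) = range_proj OA (S i)" "i \<in> I \<Longrightarrow> \<pi> (iproj i) = init_proj OA (S i)"
  by (simp_all add: rproj_def iproj_def range_proj_def init_proj_def ev_mult ev_star \<pi>_gen del: ev_gen)

text \<open>Two homomorphisms that agree on the generators. Together with contractivity of the given
  homomorphism this makes \<open>N\<close> the smaller of the two seminorms.\<close>

lemma hom_\<pi>: "x \<in> M \<Longrightarrow> \<phi> (\<pi> x) = embed x"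
proof (induction x rule: free_star_induct)
  case zero
  show ?case
    using star_hom_zero[OF hom O.star_algebra_axioms C.star_algebra_axioms]
      star_hom_zero[OF embed_hom free_star_algebra C.star_algebra_axioms] by simp
next
  case (gen g)
  then show ?case by (auto simp: ck_gens_def \<pi>_gen hom_S hom_unit simp del: ev_gen)
qed (simp_all add: ev_add ev_mult ev_scale ev_star star_homD[OF hom] embed_simps)

lemma unit_mult [simp]: "x \<in> vcarrier OA \<Longrightarrow> amult OA x e = x"
  using unit_OA by (auto simp: is_unit_def)

lemma \<pi>_EL_prod:
  assumes "set xs \<subseteq> I" "set ys \<subseteq> I"
  shows "\<pi> (EL_prod xs ys) = foldr (amult OA)
    (map (\<lambda>x. init_proj OA (S x)) xs @ map (\<lambda>y. vminus OA (aunit OA) (init_proj OA (S y))) ys) (aunit OA)"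
proof -
  have "\<pi> (foldr (*) zs (gen One)) = foldr (amult OA) (map \<pi> zs) e" for zs
    by (induction zs) (simp_all add: ev_mult \<pi>_gen del: ev_gen)
  moreover have "map \<pi> (map iproj xs @ map (\<lambda>y. gen One - iproj y) ys)
      = map (\<lambda>x. init_proj OA (S x)) xs @ map (\<lambda>y. vminus OA e (init_proj OA (S y))) ys"
    using assms by (auto simp: ev_minus \<pi>_proj \<pi>_gen simp del: ev_gen)
  ultimately show ?thesis by (simp only: EL_prod_def O.aunit_eq[OF unit_OA])
qed

lemma \<pi>_sum_rproj:
  assumes "set js \<subseteq> I" "distinct js"
  shows "\<pi> (\<Sum>j\<in>set js. fscale (c j) (rproj j))
    = foldr (vadd OA) (map (\<lambda>j. vscale OA (c j) (range_proj OA (S j))) js) (vzero OA)"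
  using assms by (induction js) (simp_all add: ev_add ev_scale \<pi>_proj)

text \<open>(EL2) and (EL3) give the orthogonality layer, (EL1) and (EL4) the remaining relations,
  and contractivity gives domination. Gauge invariance and the nonvanishing of range projections are
  properties of \<open>N\<close>.\<close>

lemma comparison: "el_comparison I (\<lambda>x. anorm OA (\<pi> x)) A N"
proof -
  interpret P: free_seminorm "ck_gens I" "\<lambda>x. anorm OA (\<pi> x)"
    by (rule free_seminorm.intro[OF pullback_cstar_seminormed[OF ev_hom O.sn.cstar_seminormed_axioms]])
  have null: "anorm OA (\<pi> (x - y)) = 0" if "\<pi> x = \<pi> y" for x y
    using that by (simp add: ev_minus)
  note c1 = EL[unfolded EL_family_def]
  note c2 = conjunct2[OF c1] note c3 = conjunct2[OF c2] note c4 = conjunct2[OF c3] note c5 = conjunct2[OF c4]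
  have iso: "amult OA (amult OA (S i) (astar OA (S i))) (S i) = S i" if "i \<in> I" for i
    using conjunct1[OF c1] that by blast
  show ?thesis
  proof unfold_locales
    show "A i j = 0 \<or> A i j = 1" if "i \<in> I" "j \<in> I" for i j using entries that by auto
    show "anorm OA (\<pi> x) \<le> \<eta>" if "(x, \<eta>) \<in> ck_RN I" for x \<eta>
    proof -
      have "\<eta> = 0 \<and> anorm OA (\<pi> x) = 0"
        using that unfolding ck_RN_def eq_rel_def
        by (auto intro!: null simp: ev_mult ev_star \<pi>_gen iso simp del: ev_gen)
      then show ?thesis by simp
    qed
    show "anorm OA (\<pi> (rproj i * rproj j)) = 0" if "i \<in> I" "j \<in> I" "i \<noteq> j" for i j
      using conjunct1[OF c3] that by (simp add: ev_mult \<pi>_proj)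
    show "anorm OA (\<pi> (iproj i * rproj j - fscale (A i j) (rproj j))) = 0" if "i \<in> I" "j \<in> I" for i j
      by (rule null) (use conjunct1[OF c4] that in \<open>simp add: ev_mult ev_scale \<pi>_proj\<close>)
    show "anorm OA (\<pi> (iproj i * iproj j - iproj j * iproj i)) = 0" if "i \<in> I" "j \<in> I" for i j
      by (rule null) (use conjunct1[OF c2] that in \<open>simp add: ev_mult \<pi>_proj\<close>)
    show "anorm OA (\<pi> (EL_prod xs ys - (\<Sum>j\<in>set js. fscale (EL_coeff A (set xs) (set ys) j) (rproj j)))) = 0"
      if w: "set xs \<subseteq> I" "set ys \<subseteq> I" "distinct xs" "distinct ys" "distinct js"
        "set js = {j \<in> I. EL_coeff A (set xs) (set ys) j \<noteq> 0}" for xs ys js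
    proof (rule null)
      have "set js \<subseteq> I" using w(6) by blast
      then show "\<pi> (EL_prod xs ys) = \<pi> (\<Sum>j\<in>set js. fscale (EL_coeff A (set xs) (set ys) j) (rproj j))"
        unfolding \<pi>_sum_rproj[OF \<open>set js \<subseteq> I\<close> w(5)] \<pi>_EL_prod[OF w(1,2)] using c5 w by blast
    qed
    show "N x \<le> anorm OA (\<pi> x)" if "x \<in> M" for x
      using hom_contractive[OF O.cstar_algebra_axioms hom, of "\<pi> x"] that by (simp add: hom_\<pi> embed_norm)
    show "N (rproj j) \<noteq> 0" if "j \<in> I" for j using that by (rule N_rproj)
    show "N (homog d x) \<le> N x" if "x \<in> M" for x d using that by (rule N_homog)
  qed
qed

lemma \<pi>_norm: "x \<in> M \<Longrightarrow> anorm OA (\<pi> x) = N x"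
  using el_comparison.comparison_le[OF comparison] el_comparison.dominated[OF comparison] by (intro antisym)

text \<open>The limits of the image form a C*-subalgebra that contains the generators, so they
  exhaust the algebra.\<close>

lemma \<pi>_dense:
  assumes "a \<in> vcarrier OA"
  obtains x where "\<forall>n. x n \<in> M" "vconverges OA (anorm OA) (\<lambda>n. \<pi> (x n)) a"
proof -
  let ?C = "{a \<in> vcarrier OA. \<exists>x. (\<forall>n. x n \<in> \<pi> ` M) \<and> vconverges OA (anorm OA) x a}"
  have "cstar_subalgebra OA ?C"
  proof (rule O.closure_subalgebra)
    show "\<pi> ` M \<subseteq> vcarrier OA" by auto
    show "vzero OA \<in> \<pi> ` M" by (rule image_eqI[of _ _ 0]) simp_all
    show "vadd OA x y \<in> \<pi> ` M" "amult OA x y \<in> \<pi> ` M" if "x \<in> \<pi> ` M" "y \<in> \<pi> ` M" for x y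
      using that by (auto simp flip: ev_add ev_mult)
    show "astar OA x \<in> \<pi> ` M" "vscale OA c x \<in> \<pi> ` M" if "x \<in> \<pi> ` M" for x c
      using that by (auto simp flip: ev_star ev_scale)
  qed
  moreover have "insert e (S ` I) \<subseteq> ?C"
  proof
    fix s assume "s \<in> insert e (S ` I)"
    then have "\<exists>g. g \<in> ck_gens I \<and> s = \<pi> (gen g)"
    proof
      assume "s = e"
      then show ?thesis using \<pi>_gen(2) by (intro exI[of _ One]) simp
    next
      assume "s \<in> S ` I"
      then obtain i where "i \<in> I" "s = S i" by blast
      then show ?thesis using \<pi>_gen(1)[of i] by (intro exI[of _ "T i"]) simp
    qed
    then obtain g where g: "g \<in> ck_gens I" "s = \<pi> (gen g)" by blast
    then have s: "s \<in> vcarrier OA" "s \<in> \<pi> ` M" by (simp only: ev_closed) (use g in \<open>intro image_eqI[of s \<pi> "gen g"]; simp\<close>)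
    then have "vconverges OA (anorm OA) (\<lambda>n. s) s" by (simp add: vconverges_def)
    then show "s \<in> ?C" using s by (intro CollectI conjI exI[of _ "\<lambda>n. s"]) simp_all
  qed
  ultimately have "?C = vcarrier OA" using gen_OA unfolding generates_def by blast
  then have "a \<in> ?C" using assms by simp
  then obtain y where y: "\<forall>n. y n \<in> \<pi> ` M" "vconverges OA (anorm OA) y a" by blast
  have "\<forall>n. \<exists>x. x \<in> M \<and> y n = \<pi> x" using y(1) by blast
  then obtain x where x: "\<forall>n. x n \<in> M \<and> y n = \<pi> (x n)" by (rule choice[THEN exE])
  then have "y = (\<lambda>n. \<pi> (x n))" by auto
  then show ?thesis using that[of x] x y(2) by simp
qed

lemma hom_vconverges:
  assumes "\<forall>n. x n \<in> vcarrier OA" "a \<in> vcarrier OA" "vconverges OA (anorm OA) x a"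
  shows "vconverges ck_cstar (anorm ck_cstar) (\<lambda>n. \<phi> (x n)) (\<phi> a)"
  unfolding vconverges_def
proof (rule Lim_null_comparison)
  have "norm (anorm ck_cstar (vminus ck_cstar (\<phi> (x n)) (\<phi> a))) \<le> anorm OA (vminus OA (x n) a)" for n
  proof -
    have x: "x n \<in> vcarrier OA" using assms(1) by blast
    have d: "\<phi> (vminus OA (x n) a) = vminus ck_cstar (\<phi> (x n)) (\<phi> a)"
      by (rule star_hom_minus[OF hom O.star_algebra_axioms x assms(2)])
    have "anorm ck_cstar (\<phi> (vminus OA (x n) a)) \<le> anorm OA (vminus OA (x n) a)"
      by (rule hom_contractive[OF O.cstar_algebra_axioms hom]) (use x assms(2) in simp)
    moreover have "0 \<le> anorm ck_cstar (\<phi> (vminus OA (x n) a))"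
      by (rule C.norm_nonneg[OF star_homD(1)[OF hom]]) (use x assms(2) in simp)
    ultimately show ?thesis by (simp add: d)
  qed
  then show "\<forall>\<^sub>F n in sequentially. norm (anorm ck_cstar (vminus ck_cstar (\<phi> (x n)) (\<phi> a))) \<le> anorm OA (vminus OA (x n) a)"
    by simp
qed (use assms(3) in \<open>simp add: vconverges_def\<close>)

lemma hom_norm:
  assumes a: "a \<in> vcarrier OA"
  shows "anorm ck_cstar (\<phi> a) = anorm OA a"
proof -
  obtain x where x: "\<forall>n. x n \<in> M" "vconverges OA (anorm OA) (\<lambda>n. \<pi> (x n)) a"
    using \<pi>_dense[OF a] by metis
  have "(\<lambda>n. anorm OA (\<pi> (x n))) \<longlonglongrightarrow> anorm OA a"
    by (rule O.sn.ns.vconverges_nrm[OF _ a x(2)]) simp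
  moreover have "(\<lambda>n. anorm ck_cstar (\<phi> (\<pi> (x n)))) \<longlonglongrightarrow> anorm ck_cstar (\<phi> a)"
    by (rule C.sn.ns.vconverges_nrm[OF _ _ hom_vconverges[OF _ a x(2)]]) (simp_all add: star_homD(1)[OF hom] a)
  moreover have "anorm ck_cstar (\<phi> (\<pi> (x n))) = anorm OA (\<pi> (x n))" for n
    using x(1) by (simp add: hom_\<pi> embed_norm \<pi>_norm)
  ultimately show ?thesis using LIMSEQ_unique by simp
qed

text \<open>For a sequence in the free *-algebra that approximates \<open>X\<close>, the evaluations
  are Cauchy as well, since both homomorphisms pull the norm back to \<open>N\<close>; their limit
  is mapped to \<open>X\<close>.\<close>

lemma hom_surj:
  assumes X: "X \<in> vcarrier ck_cstar"
  shows "\<exists>a\<in>vcarrier OA. \<phi> a = X"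
proof -
  obtain x where x: "\<And>n. x n \<in> M" "vconverges ck_cstar (anorm ck_cstar) (\<lambda>n. embed (x n)) X"
    using embed_dense_seq[OF X] by metis
  have xc: "embed (x n) \<in> vcarrier ck_cstar" for n by (rule embed_simps(1)[OF x(1)])
  have dist: "anorm OA (vminus OA (\<pi> (x m)) (\<pi> (x n))) = anorm ck_cstar (vminus ck_cstar (embed (x m)) (embed (x n)))" for m n
    using \<pi>_norm[of "x m - x n"] embed_norm[of "x m - x n"] x(1) by (simp add: ev_minus embed_simps)
  have "vcauchy OA (anorm OA) (\<lambda>n. \<pi> (x n))"
    using C.sn.ns.vconverges_vcauchy[OF xc X x(2)] unfolding vcauchy_def dist by simp
  then obtain a where a: "a \<in> vcarrier OA" "vconverges OA (anorm OA) (\<lambda>n. \<pi> (x n)) a"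
    using O.norm_complete unfolding vcomplete_def by blast
  have "vconverges ck_cstar (anorm ck_cstar) (\<lambda>n. embed (x n)) (\<phi> a)"
    using hom_vconverges[OF _ a] x(1) by (simp add: hom_\<pi>)
  from C.limit_unique[OF xc star_homD(1)[OF hom a(1)] X this x(2)] show ?thesis using a(1) by blast
qed

theorem hom_bij: "bij_betw \<phi> (vcarrier OA) (vcarrier ck_cstar)"
proof (rule bij_betwI')
  fix a b assume ab: "a \<in> vcarrier OA" "b \<in> vcarrier OA"
  show "\<phi> a = \<phi> b \<longleftrightarrow> a = b"
  proof
    assume eq: "\<phi> a = \<phi> b"
    have "anorm OA (vminus OA a b) = anorm ck_cstar (vminus ck_cstar (\<phi> a) (\<phi> b))"
      using hom_norm[of "vminus OA a b"] star_hom_minus[OF hom O.star_algebra_axioms ab] ab by simp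
    then have "anorm OA (vminus OA a b) = 0" using star_homD(1)[OF hom ab(2)] by (simp add: eq)
    then show "a = b" using O.norm_definite[of "vminus OA a b"] O.minus_eq_zero_iff[of a b] ab by simp
  qed simp
next
  show "\<phi> a \<in> vcarrier ck_cstar" if "a \<in> vcarrier OA" for a by (rule star_homD(1)[OF hom that])
next
  show "\<exists>a\<in>vcarrier OA. X = \<phi> a" if "X \<in> vcarrier ck_cstar" for X using hom_surj[OF that] by metis
qed

end

lemma (in ck_universe) exel_laca_iso:
  fixes OA :: "'o nstar_alg"
  assumes univ: "universal_exel_laca TYPE('u) I A OA S"
  shows "\<exists>\<phi>. unital_star_iso OA ck_cstar \<phi> \<and> (\<forall>i\<in>I. \<phi> (S i) = embed (gen (T i)))"
proof -
  obtain \<phi> where \<phi>: "unital_star_hom OA ck_cstar \<phi>" "\<forall>i\<in>I. \<phi> (S i) = embed (gen (T i))"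
    using universal_hom[OF univ] by (elim exE conjE)
  have OA: "cstar_algebra OA" "EL_family I A OA S" "generates OA (insert (aunit OA) (S ` I))"
    and ex: "\<exists>e. is_unit OA e"
    using univ by (auto simp: universal_exel_laca_def unital_cstar_algebra_def)
  interpret O: cstar_algebra OA by (rule OA(1))
  have unit: "is_unit OA (aunit OA)" using ex O.aunit_eq by metis
  interpret exel_laca_hom I A emb OA "aunit OA" S \<phi>
    by unfold_locales (use OA unit \<phi> in \<open>auto simp: unital_star_hom_def aunit_ck_cstar\<close>)
  show ?thesis using hom_bij \<phi> by (auto simp: unital_star_iso_def)
qed

theorem mainTheorem4:
  fixes I :: "'i set" and A :: "'i \<Rightarrow> 'i \<Rightarrow> complex"
    and emb :: "(nat \<Rightarrow> 'i ck_gen free_alg) \<Rightarrow> 'u"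
  assumes zero_one: "\<forall>i\<in>I. \<forall>j\<in>I. A i j \<in> {0, 1}"
    and no_zero_row: "\<forall>i\<in>I. \<exists>j\<in>I. A i j \<noteq> 0"
    and large_universe: "inj emb"
  shows "admissible TYPE('a) TYPE('u) (ck_gens I) (ck_RN I) (ck_RS I A) \<and>
    (\<forall>(OA :: 'o nstar_alg) S. universal_exel_laca TYPE('u) I A OA S \<longrightarrow>
      (\<exists>\<phi>. unital_star_iso OA (gen_cstar TYPE('u) (ck_gens I) (ck_RN I) (ck_RS I A)) \<phi> \<and>
        (\<forall>i\<in>I. \<phi> (S i) = gen_embed TYPE('u) (ck_gens I) (ck_RN I) (ck_RS I A) (gen (T i)))))"
proof -
  interpret ck_universe I A emb
    by unfold_locales (use assms in auto)
  show ?thesis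
    using ck_admissible[OF zero_one] exel_laca_iso unfolding ck_cstar_def embed_def by blast
qed

end
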